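(* Let $J\in\mathbb N$, $\mathbf a=(a_1,\dots,a_J)\in\mathbb R^J$ and $r>0$. Assume that the interaction function $V:\Omega\to\mathbb R$ is measurable, $r$-local and bounded by a constant $c$. Assume that the score functions $\xi_1,\dots,\xi_J:\Omega\to\mathbb R$ are measurable, bounded from below by a constant $\tilde c$, $r$-local, increasing and cardinality-bounded by a sequence $\{M_b\}_{b\in\mathbb N}$. Let $A:=\inf\{I(P)+P^o(V):P\in\mathcal P_s,\ P^o(\mathbf 1)=\lambda\}$. Then $$\liminf_{n\to\infty}\frac1{|W_n|}\log P_n\big(\Xi_{j,n}<a_j\ \forall j\le J\big)\ge-\inf\{I(P)+P^o(V):P\in\mathcal P_s,\ P^o(\mathbf 1)=\lambda,\ P^o(\xi_j)<\lambda a_j\ \forall j\le J\}+A.$$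
   Context: Fix an intensity $\lambda>0$ and a dimension $d\ge2$. $W_n=\big[-\tfrac12(n/\lambda)^{1/d},\tfrac12(n/\lambda)^{1/d}\big]^d$, so $|W_n|=n/\lambda$. $b_\varrho$ is the closed ball in $\mathbb R^d$ with center $0$ and radius $\varrho$. $\Omega$ is the space of simple locally finite counting measures on $\mathbb R^d$ (identified with locally finite subsets of $\mathbb R^d$), with the $\sigma$-algebra $\mathcal F$ generated by the maps $\omega\mapsto\omega(B)$, $B$ Borel; $|\omega|$ is the number of points of $\omega$; $\omega-x$ is the translate of $\omega$ by $-x$. The periodization of $\omega$ is $\omega^{(n)}=\sum_{z\in (n/\lambda)^{1/d}\mathbb Z^d}((\omega\cap W_n)+z)$. A measurable $h:\Omega\to\mathbb R$ is: $r$-local if $h(\omega)=h(\omega\cap b_r)$ for all $\omega$; bounded by $c>0$ if $|h|\le c$; increasing if $h(\omega)\le h(\omega\cup\{x\})$ for all $\omega\in\Omega$, $x\in\mathbb R^d$; cardinality-bounded by $\{M_b\}_{b\in\mathbb N}$ (a non-decreasing sequence of positive numbers with $M_b\to\infty$) if $h(\omega)\le M_b$ whenever $|\omega|\le b$, for every $b\in\mathbb N$. $\mathbb B_n$ is the distribution of the binomial point process with $n$ points in $W_n$ ($n$ i.i.d. uniform points). For an interaction function $V$, $H_n(\omega)=\sum_{x\in\omega\cap W_n}V(\omega^{(n)}-x)$, and the binomial Gibbs distribution is $dP_n(\omega)=\tilde Z_n^{-1}e^{-H_n(\omega)}\,d\mathbb B_n(\omega)$ with $\tilde Z_n=\int e^{-H_n}\,d\mathbb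 B_n$. For score functions $\xi_j$, $\Xi_{j,n}(\omega)=\frac1n\sum_{x\in\omega\cap W_n}\xi_j(\omega^{(n)}-x)$. $\mathcal P_s$ is the set of stationary probability measures on $(\Omega,\mathcal F)$ with finite intensity. For $P\in\mathcal P_s$, its Palm measure $P^o$ is the unique finite measure on $(\Omega,\mathcal F)$ with $\int\int f(x,\omega-x)\,d\omega(x)\,dP(\omega)=\int\int f(x,\omega)\,dx\,dP^o(\omega)$ for all measurable $f:\mathbb R^d\times\Omega\to[0,\infty)$; $P^o(g)=\int g\,dP^o$ and $\mathbf 1$ is the constant function $1$. The specific entropy is $I(P)=\lim_{n\to\infty}\frac1{|W_n|}I(P_{W_n};\Pi_n)$, where $P_{W_n}$ is the restriction of $P$ to $W_n$ (law of $\omega\cap W_n$ under $P$), $\Pi_n$ is the distribution of the Poisson point process of intensity $\lambda$ in $W_n$, and $I(\cdot;\cdot)$ is relative entropy. Conventions: $\log0=-\infty$, $\inf\emptyset=+\infty$. *)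

theory Defs
  imports "HOL-Probability.Probability"
begin

text \<open>A simple locally finite counting measure is represented by its support, a locally finite
  set of points; then \<open>\<omega>(B)\<close> is the number of points of \<open>\<omega> \<inter> B\<close>, possibly infinite.\<close>

definition locally_finite_sets :: "(real ^ 'd::finite) set set" where
  "locally_finite_sets = {\<omega>. \<forall>B. bounded B \<longrightarrow> finite (\<omega> \<inter> B)}"

definition num_points :: "(real ^ 'd::finite) set \<Rightarrow> (real ^ 'd) set \<Rightarrow> ennreal" where
  "num_points \<omega> B = emeasure (count_space UNIV) (\<omega> \<inter> B)"

definition conf_space :: "(real ^ 'd::finite) set measure" where
  "conf_space = sigma locally_finite_sets
     {{\<omega> \<in> locally_finite_sets. num_points \<omega> B \<in> U} | B U. B \<in> sets borel \<and> U \<in> sets borel}"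

lemma space_conf_space [simp]: "space conf_space = locally_finite_sets"
  unfolding conf_space_def by (rule space_measure_of) auto

definition translate :: "real ^ 'd::finite \<Rightarrow> (real ^ 'd) set \<Rightarrow> (real ^ 'd) set" where
  "translate x \<omega> = (\<lambda>y. y - x) ` \<omega>"

subsection \<open>Score and interaction functions\<close>

definition local_fun :: "real \<Rightarrow> ((real ^ 'd::finite) set \<Rightarrow> real) \<Rightarrow> bool" where
  "local_fun r h \<longleftrightarrow> (\<forall>\<omega> \<in> locally_finite_sets. h \<omega> = h (\<omega> \<inter> cball 0 r))"

definition bounded_fun :: "real \<Rightarrow> ((real ^ 'd::finite) set \<Rightarrow> real) \<Rightarrow> bool" where
  "bounded_fun c h \<longleftrightarrow> 0 < c \<and> (\<forall>\<omega> \<in> locally_finite_sets. \<bar>h \<omega>\<bar> \<le> c)"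

definition bounded_below_fun :: "real \<Rightarrow> ((real ^ 'd::finite) set \<Rightarrow> real) \<Rightarrow> bool" where
  "bounded_below_fun c h \<longleftrightarrow> (\<forall>\<omega> \<in> locally_finite_sets. c \<le> h \<omega>)"

definition increasing_fun :: "((real ^ 'd::finite) set \<Rightarrow> real) \<Rightarrow> bool" where
  "increasing_fun h \<longleftrightarrow> (\<forall>\<omega> \<in> locally_finite_sets. \<forall>x. h \<omega> \<le> h (insert x \<omega>))"

definition cardinality_bounded_fun :: "(nat \<Rightarrow> real) \<Rightarrow> ((real ^ 'd::finite) set \<Rightarrow> real) \<Rightarrow> bool" where
  "cardinality_bounded_fun M h \<longleftrightarrow>
     incseq M \<and> (\<forall>b. 0 < M b) \<and> filterlim M at_top sequentially \<and>
     (\<forall>b. \<forall>\<omega> \<in> locally_finite_sets. finite \<omega> \<and> card \<omega> \<le> b \<longrightarrow> h \<omega> \<le> M b)"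

subsection \<open>Windows, periodization and the binomial Gibbs distribution\<close>

text \<open>The type argument carries the dimension, which does not occur in the type of the value.\<close>

definition side :: "'d::finite itself \<Rightarrow> real \<Rightarrow> nat \<Rightarrow> real" where
  "side _ lam n = (real n / lam) powr (1 / real CARD('d))"

definition window :: "real \<Rightarrow> nat \<Rightarrow> (real ^ 'd::finite) set" where
  "window lam n =
     cbox (\<chi> i. - (side TYPE('d) lam n / 2)) (\<chi> i. side TYPE('d) lam n / 2)"

definition period_lattice :: "real \<Rightarrow> nat \<Rightarrow> (real ^ 'd::finite) set" where
  "period_lattice lam n = {side TYPE('d) lam n *\<^sub>R z | z. \<forall>i. z $ i \<in> \<int>}"

text \<open>The union differs from the sum of counting measures only if \<open>\<omega>\<close> contains
  boundary points of the window that agree modulo the lattice. This has probability zero for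
  \<open>n \<ge> 1\<close> independent uniform points.\<close>

definition periodize :: "real \<Rightarrow> nat \<Rightarrow> (real ^ 'd::finite) set \<Rightarrow> (real ^ 'd) set" where
  "periodize lam n \<omega> = (\<Union>z \<in> period_lattice lam n. (\<lambda>x. x + z) ` (\<omega> \<inter> window lam n))"

definition iid_points :: "(real ^ 'd::finite) set \<Rightarrow> nat \<Rightarrow> (real ^ 'd) set measure" where
  "iid_points W k =
     distr (PiM {..<k} (\<lambda>_. uniform_measure lborel W)) conf_space (\<lambda>X. X ` {..<k})"

definition binomial_process :: "real \<Rightarrow> nat \<Rightarrow> (real ^ 'd::finite) set measure" where
  "binomial_process lam n = iid_points (window lam n) n"

definition energy ::
  "real \<Rightarrow> ((real ^ 'd::finite) set \<Rightarrow> real) \<Rightarrow> nat \<Rightarrow> (real ^ 'd) set \<Rightarrow> real" where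
  "energy lam V n \<omega> = (\<Sum>x \<in> \<omega> \<inter> window lam n. V (translate x (periodize lam n \<omega>)))"

definition partition_fun :: "real \<Rightarrow> ((real ^ 'd::finite) set \<Rightarrow> real) \<Rightarrow> nat \<Rightarrow> real" where
  "partition_fun lam V n = (\<integral>\<omega>. exp (- energy lam V n \<omega>) \<partial>binomial_process lam n)"

definition binomial_gibbs ::
  "real \<Rightarrow> ((real ^ 'd::finite) set \<Rightarrow> real) \<Rightarrow> nat \<Rightarrow> (real ^ 'd) set measure" where
  "binomial_gibbs lam V n =
     density (binomial_process lam n)
       (\<lambda>\<omega>. ennreal (exp (- energy lam V n \<omega>) / partition_fun lam V n))"

definition mean_score ::
  "real \<Rightarrow> ((real ^ 'd::finite) set \<Rightarrow> real) \<Rightarrow> nat \<Rightarrow> (real ^ 'd) set \<Rightarrow> real" where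
  "mean_score lam \<xi> n \<omega> =
     1 / real n * (\<Sum>x \<in> \<omega> \<inter> window lam n. \<xi> (translate x (periodize lam n \<omega>)))"

definition ext_log :: "real \<Rightarrow> ereal" where
  "ext_log p = (if p = 0 then - \<infinity> else ereal (ln p))"

subsection \<open>Stationary point processes and Palm measures\<close>

text \<open>The intensity of a stationary process is the expected number of points in a unit cube.\<close>

definition stationary_processes :: "(real ^ 'd::finite) set measure set" where
  "stationary_processes =
     {P. sets P = sets conf_space \<and> prob_space P \<and>
         (\<forall>x. distr P conf_space (translate x) = P) \<and>
         (\<integral>\<^sup>+\<omega>. num_points \<omega> (cbox 0 1) \<partial>P) < \<infinity>}"

definition palm_measure :: "(real ^ 'd::finite) set measure \<Rightarrow> (real ^ 'd) set measure" where
  "palm_measure P =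
     (THE Q. sets Q = sets conf_space \<and> finite_measure Q \<and>
        (\<forall>f :: (real ^ 'd) \<times> (real ^ 'd) set \<Rightarrow> ennreal.
           f \<in> borel_measurable (borel \<Otimes>\<^sub>M conf_space) \<longrightarrow>
           (\<integral>\<^sup>+\<omega>. (\<integral>\<^sup>+x. f (x, translate x \<omega>) \<partial>count_space \<omega>) \<partial>P) =
           (\<integral>\<^sup>+\<omega>. (\<integral>\<^sup>+x. f (x, \<omega>) \<partial>lborel) \<partial>Q)))"

text \<open>The Bochner integral would be 0 for functions with infinite integral, such as an unbounded
  score function may have under a Palm measure.\<close>

definition ext_integral :: "'a measure \<Rightarrow> ('a \<Rightarrow> real) \<Rightarrow> ereal" where
  "ext_integral M g =
     enn2ereal (\<integral>\<^sup>+x. ennreal (g x) \<partial>M) - enn2ereal (\<integral>\<^sup>+x. ennreal (- g x) \<partial>M)"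

definition palm_integral ::
  "(real ^ 'd::finite) set measure \<Rightarrow> ((real ^ 'd) set \<Rightarrow> real) \<Rightarrow> ereal" where
  "palm_integral P g = ext_integral (palm_measure P) g"

subsection \<open>Specific entropy\<close>

text \<open>The Poisson process in a window of finite positive volume: a Poisson number of
  independent uniform points.\<close>

definition poisson_process :: "real \<Rightarrow> nat \<Rightarrow> (real ^ 'd::finite) set measure" where
  "poisson_process lam n =
     measure_pmf (poisson_pmf (lam * measure lborel (window lam n :: (real ^ 'd) set)))
       \<bind> iid_points (window lam n)"

text \<open>\<^const>\<open>KL_divergence\<close> takes the reference measure first and is 0 when the density is not
  integrable. The negative part of \<open>log (d\<mu>/d\<nu>)\<close> is always \<open>\<mu>\<close>-integrable for probability
  measures, so non-integrability means infinite relative entropy.\<close>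

definition relative_entropy :: "'a measure \<Rightarrow> 'a measure \<Rightarrow> ereal" where
  "relative_entropy \<mu> \<nu> =
     (if absolutely_continuous \<nu> \<mu> \<and> integrable \<mu> (entropy_density (exp 1) \<nu> \<mu>)
      then ereal (KL_divergence (exp 1) \<nu> \<mu>) else \<infinity>)"

definition specific_entropy :: "real \<Rightarrow> (real ^ 'd::finite) set measure \<Rightarrow> ereal" where
  "specific_entropy lam P =
     lim (\<lambda>n. ereal (1 / measure lborel (window lam n :: (real ^ 'd) set)) *
       relative_entropy (distr P conf_space (\<lambda>\<omega>. \<omega> \<inter> window lam n)) (poisson_process lam n))"

end

theory Submission imports Defs "HOL-Real_Asymp.Real_Asymp"
begin

text \<open>Upper bound for the partition function: space is tiled by independent copies of the binomial
 Gibbs process, and the tiling is shifted uniformly. The resulting stationary process is admissible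
 in the infimum \<open>A\<close>; its specific entropy is at most that of a tile, and its Palm energy differs from
 the energy of a tile by the number of points near the boundary.

 Lower bound for the event: the restriction of an admissible \<open>P\<close> to a large window, conditioned on
 having boundedly many points, is placed independently in blocks that are more than \<open>r\<close> apart. The
 corridors between the blocks stay empty, which cannot increase the scores because they are
 increasing. The law of large numbers controls the scores, the energy and the number of points, and
 by the Donsker--Varadhan bound the cost of this event under the Poisson process is the relative
 entropy of the blocks. A small proportion of the blocks is held in reserve for the points missing
 to \<open>n\<close>; one point per small cell keeps the cardinality-bounded scores bounded there. Having exactly \<open>n\<close>
 points, the configuration can be compared with the binomial process.\<close>

section \<open>Measurability in the configuration space\<close>

text \<open>After one equivalence, relative entropies enter only through inequalities tested on
  bounded functions. Such inequalities survive images, products, mixtures and conditioning, so both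
  halves can work with one-sided estimates. Two obstacles shape the lower bound. The law of large
  numbers is of Chernoff type and wants bounded block scores, hence the conditioning on boundedly
  many points; its price \<open>ln 2\<close> vanishes against the volume of a large block. Further,
  the number of points must be exactly \<open>n\<close>, whereas the law of large numbers fixes it
  only up to a small proportion. The blocks are therefore designed to carry slightly fewer than
  \<open>n\<close> points on average, so that fluctuations never overshoot. Comparing Poisson and
  binomial processes is cheap both ways: a nonnegative function vanishing unless there are
  \<open>n\<close> points has the smaller integral under the Poisson process, and the converse loses
  a weight of at least \<open>1 / (exp 1 * n)\<close>. The infimum \<open>A\<close> comes from the
  normalisation: dividing by the partition function calls for an upper bound on it.\<close>

lemma locally_finite_subset: "om \<in> locally_finite_sets \<Longrightarrow> eta \<subseteq> om \<Longrightarrow> eta \<in> locally_finite_sets"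
 unfolding locally_finite_sets_def by (auto intro: finite_subset[OF Int_mono[OF _ order_refl]])

lemma locally_finite_Int: "om \<in> locally_finite_sets \<Longrightarrow> om \<inter> C \<in> locally_finite_sets"
 by (rule locally_finite_subset) auto

lemma finite_Int_bounded: "om \<in> locally_finite_sets \<Longrightarrow> bounded B \<Longrightarrow> finite (om \<inter> B)"
 unfolding locally_finite_sets_def by auto

lemma finite_locally_finite: "finite om \<Longrightarrow> om \<in> locally_finite_sets"
 unfolding locally_finite_sets_def by auto

lemma locally_finite_Un:
 "om \<in> locally_finite_sets \<Longrightarrow> eta \<in> locally_finite_sets \<Longrightarrow> om \<union> eta \<in> locally_finite_sets"
 unfolding locally_finite_sets_def by (auto simp: Int_Un_distrib2)

lemma bounded_translate_iff: "bounded (translate x B) \<longleftrightarrow> bounded B"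
proof
 assume "bounded (translate x B)"
 then have "bounded ((+) x ` translate x B)" by (rule bounded_translation)
 then show "bounded B" by (simp add: translate_def image_image)
next
 assume "bounded B" then show "bounded (translate x B)"
  unfolding translate_def using bounded_translation[of B "-x"] by simp
qed

lemma mem_translate: "y \<in> translate x om \<longleftrightarrow> y + x \<in> om"
 unfolding translate_def by force

lemma translate_Int: "translate x (A \<inter> B) = translate x A \<inter> translate x B"
 by (auto simp: mem_translate)

lemma translate_translate: "translate x (translate y om) = translate (x + y) om"
 by (auto simp: set_eq_iff mem_translate add.assoc)

lemma translate_0 [simp]: "translate 0 om = om"
 by (auto simp: set_eq_iff mem_translate)

lemma translate_locally_finite: "om \<in> locally_finite_sets \<Longrightarrow> translate x om \<in> locally_finite_sets"
proof -
 assume w: "om \<in> locally_finite_sets"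
 have "finite (translate x om \<inter> B)" if "bounded B" for B
 proof -
  have "translate x om \<inter> B = translate x (om \<inter> translate (-x) B)"
   by (auto simp: set_eq_iff mem_translate)
  moreover have "finite (om \<inter> translate (-x) B)"
   using w that by (intro finite_Int_bounded) (auto simp: bounded_translate_iff)
  ultimately show ?thesis by (simp add: translate_def)
 qed
 then show ?thesis unfolding locally_finite_sets_def by auto
qed

lemma borel_translate: "B \<in> sets borel \<Longrightarrow> translate x B \<in> sets (borel :: (real^'d::finite) measure)"
proof -
 assume [measurable]: "B \<in> sets borel"
 have "translate x B = (\<lambda>y. y + x) -` B \<inter> space borel"
  by (auto simp: mem_translate)
 also have "... \<in> sets borel" by measurable
 finally show ?thesis .
qed

text \<open>Label of the half-open dyadic cube of side \<open>1 / 2 ^ k\<close> containing a point.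
  With labels instead of cubes, the number of occupied cells is the cardinality of an image.\<close>

definition cell :: "nat \<Rightarrow> real ^ 'd::finite \<Rightarrow> 'd \<Rightarrow> int" where
 "cell k x = (\<lambda>i. \<lfloor>2 ^ k * x $ i\<rfloor>)"

lemma borel_cell: "{x :: real^'d::finite. cell k x = z} \<in> sets borel"
proof -
 have "{x :: real^'d. cell k x = z} = {x\<in>space borel. \<forall>i. \<lfloor>2 ^ k * x $ i\<rfloor> = z i}"
  by (auto simp: cell_def fun_eq_iff)
 also have "... \<in> sets borel" by measurable
 finally show ?thesis .
qed

lemma finite_int_box: "finite {v :: 'd::finite \<Rightarrow> int. \<forall>i. \<bar>v i\<bar> \<le> m}"
proof (rule finite_subset)
 show "{v :: 'd::finite \<Rightarrow> int. \<forall>i. \<bar>v i\<bar> \<le> m} \<subseteq> PiE UNIV (\<lambda>_. {-m..m})"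
  by (auto simp: PiE_def abs_le_iff) (metis minus_le_iff)
 show "finite (PiE (UNIV :: 'd set) (\<lambda>_. {-m..m}))"
  by (intro finite_PiE) auto
qed

lemma finite_cell_image: "bounded B \<Longrightarrow> finite (cell k ` B)"
proof -
 assume "bounded B"
 then obtain R where R: "\<forall>x\<in>B. norm x \<le> R" by (auto simp: bounded_iff)
 have "cell k ` B \<subseteq> {v. \<forall>i. \<bar>v i\<bar> \<le> \<lceil>2 ^ k * R\<rceil> + 1}"
 proof safe
  fix x i assume "x \<in> B"
  have "\<bar>x $ i\<bar> \<le> R" using R \<open>x \<in> B\<close> component_le_norm_cart[of x i] by force
  then have "\<bar>2 ^ k * x $ i\<bar> \<le> 2 ^ k * R" by (simp add: abs_mult)
  then show "\<bar>cell k x i\<bar> \<le> \<lceil>2 ^ k * R\<rceil> + 1" unfolding cell_def by linarith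
 qed
 then show ?thesis using finite_int_box finite_subset by blast
qed

text \<open>Distinct points differ in some coordinate, and as soon as \<open>2 ^ k\<close> times
  that difference is at least \<open>1\<close>, the two floors differ. Finitely many pairs share one
  threshold for \<open>k\<close>.\<close>

lemma eventually_inj_cell:
 assumes "finite A" shows "\<forall>\<^sub>F k in sequentially. inj_on (cell k) A"
proof -
 have *: "\<forall>\<^sub>F k in sequentially. x \<noteq> y \<longrightarrow> cell k x \<noteq> cell k y" for x y :: "real^'d"
 proof (cases "x = y")
  case False
  then obtain i where i: "x $ i \<noteq> y $ i" by (auto simp: vec_eq_iff)
  obtain N where N: "1 / \<bar>x $ i - y $ i\<bar> < 2 ^ N" using real_arch_pow[of 2] by auto
  have "1 \<le> 2 ^ k * \<bar>x $ i - y $ i\<bar>" if "N \<le> k" for k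
  proof -
   have "1 \<le> 2 ^ N * \<bar>x $ i - y $ i\<bar>" using N i by (simp add: field_simps)
   also have "... \<le> 2 ^ k * \<bar>x $ i - y $ i\<bar>" using that by (intro mult_right_mono power_increasing) auto
   finally show ?thesis .
  qed
  then have "\<forall>\<^sub>F k in sequentially. 1 \<le> 2 ^ k * \<bar>x $ i - y $ i\<bar>"
   by (auto simp: eventually_sequentially)
  then show ?thesis
  proof eventually_elim
   case (elim k)
   then have "1 \<le> \<bar>2 ^ k * x $ i - 2 ^ k * y $ i\<bar>"
    by (simp add: abs_mult flip: right_diff_distrib)
   then have "\<lfloor>2 ^ k * x $ i\<rfloor> \<noteq> \<lfloor>2 ^ k * y $ i\<rfloor>" by linarith
   then show ?case by (auto simp: cell_def fun_eq_iff)
  qed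
 qed simp
 have "\<forall>\<^sub>F k in sequentially. \<forall>p\<in>A \<times> A. fst p \<noteq> snd p \<longrightarrow> cell k (fst p) \<noteq> cell k (snd p)"
  using assms * by (intro eventually_ball_finite) auto
 then show ?thesis by eventually_elim (auto simp: inj_on_def)
qed

lemma num_points_eq_card: "finite (om \<inter> B) \<Longrightarrow> num_points om B = of_nat (card (om \<inter> B))"
 by (simp add: num_points_def)

lemma measurable_num_points [measurable]:
 "B \<in> sets borel \<Longrightarrow> (\<lambda>om. num_points om B) \<in> borel_measurable conf_space"
proof (rule measurableI)
 fix U assume "B \<in> sets borel" "U \<in> sets (borel :: ennreal measure)"
 then have "{om \<in> locally_finite_sets. num_points om B \<in> U} \<in> sets conf_space"
  unfolding conf_space_def by (subst sets_measure_of) (auto intro!: sigma_sets.Basic)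
 then show "(\<lambda>om. num_points om B) -` U \<inter> space conf_space \<in> sets conf_space"
  by (simp add: vimage_def Int_def conj_commute)
qed auto

text \<open>For configurations without multiple points the void events \<open>{\<omega>. \<omega> \<inter> B = {}}\<close> determine the
 counts: a bounded set is eventually resolved by dyadic cells, each containing at most one point.\<close>

lemma measurable_conf_spaceI:
 fixes f :: "'s \<Rightarrow> (real^'d::finite) set"
 assumes LF: "\<And>s. s \<in> space S \<Longrightarrow> f s \<in> locally_finite_sets"
  and void: "\<And>B. B \<in> sets borel \<Longrightarrow> {s\<in>space S. f s \<inter> B = {}} \<in> sets S"
 shows "f \<in> S \<rightarrow>\<^sub>M conf_space"
proof -
 have bd: "(\<lambda>s. num_points (f s) B) \<in> borel_measurable S" if B: "B \<in> sets borel" "bounded B" for B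
 proof (rule borel_measurable_LIMSEQ_order)
  fix k
  let ?C = "\<lambda>z. B \<inter> {x. cell k x = z}"
  have "(\<lambda>s. \<Sum>z\<in>cell k ` B. if f s \<inter> ?C z = {} then 0 else 1 :: ennreal) \<in> borel_measurable S"
  proof (rule borel_measurable_sum)
   fix z
   have "{s\<in>space S. f s \<inter> ?C z = {}} \<in> sets S" using B borel_cell by (intro void) auto
   then show "(\<lambda>s. if f s \<inter> ?C z = {} then 0 else 1 :: ennreal) \<in> borel_measurable S"
    by (intro measurable_If) auto
  qed
  also have "?this \<longleftrightarrow> (\<lambda>s. of_nat (card (cell k ` (f s \<inter> B))) :: ennreal) \<in> borel_measurable S"
  proof (rule measurable_cong)
   fix s assume s: "s \<in> space S"
   have "(\<Sum>z\<in>cell k ` B. if f s \<inter> ?C z = {} then 0 else 1 :: ennreal)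
     = (\<Sum>z\<in>cell k ` B \<inter> {z. f s \<inter> ?C z \<noteq> {}}. 1)"
    using finite_cell_image[OF B(2)] by (subst sum.inter_restrict) (auto intro!: sum.cong)
   also have "cell k ` B \<inter> {z. f s \<inter> ?C z \<noteq> {}} = cell k ` (f s \<inter> B)"
   proof (intro set_eqI iffI)
    fix z assume "z \<in> cell k ` B \<inter> {z. f s \<inter> ?C z \<noteq> {}}"
    then obtain x where "x \<in> f s \<inter> B" "cell k x = z" by auto
    then show "z \<in> cell k ` (f s \<inter> B)" by (intro image_eqI[of _ _ x]) simp_all
   qed auto
   finally show "(\<Sum>z\<in>cell k ` B. if f s \<inter> ?C z = {} then 0 else 1 :: ennreal)
     = of_nat (card (cell k ` (f s \<inter> B)))" by simp
  qed
  finally show "(\<lambda>s. of_nat (card (cell k ` (f s \<inter> B))) :: ennreal) \<in> borel_measurable S" .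
 next
  fix s assume s: "s \<in> space S"
  then have fin: "finite (f s \<inter> B)" using LF B finite_Int_bounded by blast
  have "\<forall>\<^sub>F k in sequentially. of_nat (card (cell k ` (f s \<inter> B))) = num_points (f s) B"
   using eventually_inj_cell[OF fin] by eventually_elim (simp add: num_points_eq_card fin card_image)
  then show "(\<lambda>k. of_nat (card (cell k ` (f s \<inter> B)))) \<longlonglongrightarrow> num_points (f s) B"
   by (rule tendsto_eventually)
 qed
 have "(\<lambda>s. num_points (f s) B) \<in> borel_measurable S" if B: "B \<in> sets borel" for B
 proof -
  have "(\<lambda>s. SUP n. num_points (f s) (B \<inter> cball 0 (real n))) \<in> borel_measurable S"
   using B by (intro borel_measurable_SUP bd) (auto intro: bounded_subset[OF bounded_cball])
  moreover have "(SUP n. num_points (f s) (B \<inter> cball 0 (real n))) = num_points (f s) B" for s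
  proof -
   have "(\<Union>n. cball 0 (real n)) = (UNIV :: (real^'d) set)"
    using real_arch_simple by auto
   then have "(\<Union>n. f s \<inter> (B \<inter> cball 0 (real n))) = f s \<inter> B" by blast
   moreover have "incseq (\<lambda>n. f s \<inter> (B \<inter> cball 0 (real n)))"
    by (auto simp: incseq_def)
   ultimately show ?thesis
    unfolding num_points_def by (subst SUP_emeasure_incseq) auto
  qed
  ultimately show ?thesis by simp
 qed note * = this
 show ?thesis
  unfolding conf_space_def
 proof (rule measurable_measure_of)
  fix y :: "(real^'d) set set" assume "y \<in> {{om \<in> locally_finite_sets. num_points om B \<in> U} |B U. B \<in> sets borel \<and> U \<in> sets borel}"
  then obtain B U where y: "y = {om \<in> locally_finite_sets. num_points om B \<in> U}"
   and B: "B \<in> sets borel" and U: "U \<in> sets borel" by auto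
  have "f -` y \<inter> space S = (\<lambda>s. num_points (f s) B) -` U \<inter> space S"
   using LF by (auto simp: y)
  then show "f -` y \<inter> space S \<in> sets S" using measurable_sets[OF *[OF B] U] by simp
 qed (use LF in auto)
qed

definition void :: "(real ^ 'd::finite) set \<Rightarrow> (real ^ 'd) set set" where
 "void B = {om \<in> locally_finite_sets. om \<inter> B = {}}"

lemma sets_void [measurable]: "B \<in> sets borel \<Longrightarrow> void B \<in> sets conf_space"
proof -
 assume [measurable]: "B \<in> sets borel"
 have "void B = {om\<in>space conf_space. num_points om B = 0}"
  by (auto simp: void_def num_points_def emeasure_count_space)
 also have "... \<in> sets conf_space" by measurable
 finally show ?thesis .
qed

lemma pred_void [measurable (raw)]:
 assumes "f \<in> S \<rightarrow>\<^sub>M conf_space" "B \<in> sets borel"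
 shows "Measurable.pred S (\<lambda>s. f s \<inter> B = {})"
proof -
 have "{s\<in>space S. f s \<inter> B = {}} = f -` void B \<inter> space S"
  using measurable_space[OF assms(1)] by (auto simp: void_def)
 also have "... \<in> sets S" using assms by measurable
 finally show ?thesis by (simp add: pred_def)
qed

text \<open>The identity from the sigma-algebra generated by the void events to
  \<open>conf_space\<close> satisfies the criterion \<open>measurable_conf_spaceI\<close>, so the
  counting events already lie in the smaller sigma-algebra.\<close>

lemma sets_conf_space_void:
 "sets (conf_space :: (real^'d::finite) set measure) = sigma_sets locally_finite_sets (void ` sets borel)"
proof
 let ?N = "sigma locally_finite_sets (void ` sets borel) :: (real^'d) set measure"
 have sub: "void ` sets borel \<subseteq> Pow (locally_finite_sets :: (real^'d) set set)"
  by (auto simp: void_def)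
 have sp: "space ?N = locally_finite_sets" using sub by (rule space_measure_of)
 have "(\<lambda>om. om) \<in> ?N \<rightarrow>\<^sub>M conf_space"
 proof (rule measurable_conf_spaceI)
  fix B :: "(real^'d) set" assume "B \<in> sets borel"
  then have "void B \<in> sets ?N" using sub by auto
  then show "{s \<in> space ?N. s \<inter> B = {}} \<in> sets ?N" unfolding sp void_def[of B] .
 qed (simp add: sp)
 from measurable_sets[OF this]
 show "sets conf_space \<subseteq> sigma_sets locally_finite_sets (void ` sets (borel :: (real^'d) measure))"
  using sub sets.sets_into_space[of _ "conf_space :: (real^'d) set measure"]
  by (auto simp: sp) (metis (no_types, lifting) inf.absorb1)
 show "sigma_sets locally_finite_sets (void ` sets borel) \<subseteq> sets (conf_space :: (real^'d) set measure)"
  using sets.sigma_sets_subset[of "void ` sets borel" "conf_space :: (real^'d) set measure"]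
  by (auto simp: image_subset_iff)
qed

text \<open>Renyi's uniqueness theorem for simple point processes: void events are stable under
  intersection, because \<open>void A\<close> and \<open>void B\<close> meet in
  \<open>void (A \<union> B)\<close>, and they generate the sigma-algebra. Identities between
  Poisson processes are proved through it.\<close>

lemma conf_measure_eqI:
 fixes M N :: "(real^'d::finite) set measure"
 assumes "sets M = sets conf_space" "sets N = sets conf_space" "finite_measure M"
  and eq: "\<And>B. B \<in> sets borel \<Longrightarrow> emeasure M (void B) = emeasure N (void B)"
 shows "M = N"
proof (rule measure_eqI_generator_eq[where E="void ` sets borel" and \<Omega>=locally_finite_sets and A="\<lambda>_. void {}"])
 interpret finite_measure M by fact
 have "void A \<inter> void B = void (A \<union> B)" for A B :: "(real^'d) set" by (auto simp: void_def)
 then show "Int_stable (void ` sets (borel :: (real^'d) measure))"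
  by (auto simp: Int_stable_def)
 show "emeasure M (void {}) \<noteq> \<infinity>" by simp
 show "\<And>X. X \<in> void ` sets borel \<Longrightarrow> emeasure M X = emeasure N X" using eq by blast
 show "(\<Union>i::nat. void {}) = (locally_finite_sets :: (real^'d) set set)" by (auto simp: void_def)
 show "void ` sets borel \<subseteq> Pow (locally_finite_sets :: (real^'d) set set)" by (auto simp: void_def)
qed (auto simp: assms(1,2) sets_conf_space_void)

subsection \<open>Sums over the points of a configuration\<close>

text \<open>Dividing the counting measure on \<open>\<Phi> s \<inter> K\<close> by the number of
  points plus one gives a subprobability kernel, whose integrals depend measurably on the parameter;
  the factor is then multiplied back. The added one covers the empty configuration.\<close>

lemma measurable_count_kernel_bounded:
 fixes \<Phi> :: "'s \<Rightarrow> (real^'d::finite) set"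
 assumes \<Phi> [measurable]: "\<Phi> \<in> S \<rightarrow>\<^sub>M conf_space" and K [measurable]: "K \<in> sets borel" and bd: "bounded K"
  and f [measurable]: "case_prod f \<in> borel_measurable (S \<Otimes>\<^sub>M borel)"
 shows "(\<lambda>s. \<integral>\<^sup>+x. f s x \<partial>count_space (\<Phi> s \<inter> K)) \<in> borel_measurable S"
proof -
 define L where "L s = scale_measure (ennreal (1 / (real (card (\<Phi> s \<inter> K)) + 1)))
   (distr (count_space (\<Phi> s \<inter> K)) borel (\<lambda>x. x))" for s
 have fin: "finite (\<Phi> s \<inter> K)" if "s \<in> space S" for s
  using measurable_space[OF \<Phi> that] bd by (intro finite_Int_bounded) auto
 have N: "num_points (\<Phi> s) (K \<inter> A) = of_nat (card (\<Phi> s \<inter> K \<inter> A))" if "s \<in> space S" for s A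
  using fin[OF that] by (subst num_points_eq_card) (auto simp: Int_assoc intro: finite_subset[of _ "\<Phi> s \<inter> K"])
 have card: "(\<lambda>s. real (card (\<Phi> s \<inter> K))) \<in> borel_measurable S"
 proof -
  have "(\<lambda>s. enn2real (num_points (\<Phi> s) K)) \<in> borel_measurable S" by measurable
  also have "?this \<longleftrightarrow> ?thesis"
   using N[of _ UNIV] by (intro measurable_cong) (simp add: ennreal_of_nat_eq_real_of_nat)
  finally show ?thesis .
 qed
 have em: "emeasure (L s) A = ennreal (1 / (real (card (\<Phi> s \<inter> K)) + 1)) * of_nat (card (\<Phi> s \<inter> K \<inter> A))"
  if s: "s \<in> space S" and "A \<in> sets borel" for s A
 proof -
  have "emeasure (count_space (\<Phi> s \<inter> K)) (\<Phi> s \<inter> K \<inter> A) = of_nat (card (\<Phi> s \<inter> K \<inter> A))"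
   using fin[OF s] by (subst emeasure_count_space) auto
  then show ?thesis
   using that unfolding L_def by (simp add: emeasure_distr Int_commute Int_left_commute)
 qed
 have L: "L \<in> S \<rightarrow>\<^sub>M subprob_algebra borel"
 proof (rule measurable_subprob_algebra)
  fix s assume s: "s \<in> space S"
  show "sets (L s) = sets borel" by (simp add: L_def)
  show "subprob_space (L s)"
  proof (rule subprob_spaceI)
   have "emeasure (L s) UNIV \<le> 1"
    by (subst em[OF s]) (auto simp: ennreal_of_nat_eq_real_of_nat simp flip: ennreal_mult)
   then show "emeasure (L s) (space (L s)) \<le> 1" by (simp add: L_def space_scale_measure)
   show "space (L s) \<noteq> {}" by (simp add: L_def space_scale_measure)
  qed
 next
  fix A :: "(real^'d) set" assume [measurable]: "A \<in> sets borel"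
  have "(\<lambda>s. ennreal (1 / (real (card (\<Phi> s \<inter> K)) + 1)) * num_points (\<Phi> s) (K \<inter> A)) \<in> borel_measurable S"
   using card by measurable
  then show "(\<lambda>s. emeasure (L s) A) \<in> borel_measurable S"
   by (rule measurable_cong[THEN iffD1, rotated]) (simp add: em N Int_assoc)
 qed
 have "(\<lambda>s. ennreal (real (card (\<Phi> s \<inter> K)) + 1) * (\<integral>\<^sup>+x. f s x \<partial>L s)) \<in> borel_measurable S"
  using card nn_integral_measurable_subprob_algebra2[OF f L] by measurable
 also have "?this \<longleftrightarrow> ?thesis"
 proof (rule measurable_cong)
  fix s assume s: "s \<in> space S"
  have [measurable]: "f s \<in> borel_measurable borel"
   using measurable_compose[OF measurable_Pair1'[OF s] f] by simp
  let ?c = "real (card (\<Phi> s \<inter> K)) + 1"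
  have "(\<integral>\<^sup>+x. f s x \<partial>L s) = ennreal (1 / ?c) * (\<integral>\<^sup>+x. f s x \<partial>count_space (\<Phi> s \<inter> K))"
   unfolding L_def by (subst nn_integral_scale_measure) (auto simp: nn_integral_distr)
  then have "ennreal ?c * (\<integral>\<^sup>+x. f s x \<partial>L s) = (ennreal ?c * ennreal (1 / ?c)) * (\<integral>\<^sup>+x. f s x \<partial>count_space (\<Phi> s \<inter> K))"
   by (simp add: mult.assoc)
  also have "ennreal ?c * ennreal (1 / ?c) = 1"
   by (subst ennreal_mult[symmetric]) auto
  finally show "ennreal ?c * (\<integral>\<^sup>+x. f s x \<partial>L s) = (\<integral>\<^sup>+x. f s x \<partial>count_space (\<Phi> s \<inter> K))" by simp
 qed
 finally show ?thesis .
qed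

lemma measurable_count_kernel [measurable (raw)]:
 fixes \<Phi> :: "'s \<Rightarrow> (real^'d::finite) set" and f :: "'s \<Rightarrow> real^'d \<Rightarrow> ennreal"
 assumes \<Phi> [measurable]: "\<Phi> \<in> S \<rightarrow>\<^sub>M conf_space"
  and f [measurable]: "case_prod f \<in> borel_measurable (S \<Otimes>\<^sub>M borel)"
 shows "(\<lambda>s. \<integral>\<^sup>+x. f s x \<partial>count_space (\<Phi> s)) \<in> borel_measurable S"
proof -
 have "(\<lambda>s. SUP n. \<integral>\<^sup>+x. f s x \<partial>count_space (\<Phi> s \<inter> cball 0 (real n))) \<in> borel_measurable S"
  by (intro borel_measurable_SUP measurable_count_kernel_bounded) auto
 moreover have "(SUP n. \<integral>\<^sup>+x. f s x \<partial>count_space (\<Phi> s \<inter> cball 0 (real n))) = (\<integral>\<^sup>+x. f s x \<partial>count_space (\<Phi> s))" for s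
 proof -
  have "(SUP n. \<integral>\<^sup>+x. f s x \<partial>count_space (\<Phi> s \<inter> cball 0 (real n)))
    = (SUP n. \<integral>\<^sup>+x. f s x * indicator (\<Phi> s \<inter> cball 0 (real n)) x \<partial>count_space UNIV)"
   by (subst nn_integral_count_space_indicator) auto
  also have "... = (\<integral>\<^sup>+x. (SUP n. f s x * indicator (\<Phi> s \<inter> cball 0 (real n)) x) \<partial>count_space UNIV)"
   by (rule nn_integral_monotone_convergence_SUP[symmetric])
    (auto simp: incseq_def le_fun_def intro!: mult_left_mono split: split_indicator)
  also have "... = (\<integral>\<^sup>+x. f s x * indicator (\<Phi> s) x \<partial>count_space UNIV)"
  proof (rule nn_integral_cong)
   fix x :: "real^'d"
   obtain m where m: "norm x \<le> real m" using real_arch_simple by blast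
   show "(SUP n. f s x * indicator (\<Phi> s \<inter> cball 0 (real n)) x) = f s x * indicator (\<Phi> s) x"
   proof (rule antisym)
    show "f s x * indicator (\<Phi> s) x \<le> (SUP n. f s x * indicator (\<Phi> s \<inter> cball 0 (real n)) x)"
     by (rule SUP_upper2[of m]) (auto simp: m split: split_indicator)
   qed (auto intro!: SUP_least split: split_indicator)
  qed
  also have "... = (\<integral>\<^sup>+x. f s x \<partial>count_space (\<Phi> s))"
   by (subst nn_integral_count_space_indicator[of "\<Phi> s"]) auto
  finally show ?thesis .
 qed
 ultimately show ?thesis by simp
qed

text \<open>A signed sum is the difference of the integrals of its positive and negative parts. As
  \<open>K\<close> is bounded, both are finite and \<open>enn2real\<close> loses nothing.\<close>

lemma measurable_sum_points:
 fixes \<Phi> :: "'s \<Rightarrow> (real^'d::finite) set" and f :: "'s \<Rightarrow> real^'d \<Rightarrow> real"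
 assumes \<Phi> [measurable]: "\<Phi> \<in> S \<rightarrow>\<^sub>M conf_space" and K: "K \<in> sets borel" "bounded K"
  and f [measurable]: "case_prod f \<in> borel_measurable (S \<Otimes>\<^sub>M borel)"
 shows "(\<lambda>s. \<Sum>x\<in>\<Phi> s \<inter> K. f s x) \<in> borel_measurable S"
proof -
 have "(\<lambda>s. enn2real (\<integral>\<^sup>+x. ennreal (f s x) \<partial>count_space (\<Phi> s \<inter> K))
      - enn2real (\<integral>\<^sup>+x. ennreal (- f s x) \<partial>count_space (\<Phi> s \<inter> K))) \<in> borel_measurable S"
  by (intro borel_measurable_diff measurable_compose[OF _ borel_measurable_enn2real]
    measurable_count_kernel_bounded K) measurable
 also have "?this \<longleftrightarrow> ?thesis"
 proof (rule measurable_cong)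
  fix s assume "s \<in> space S"
  then have fin: "finite (\<Phi> s \<inter> K)"
   using measurable_space[OF \<Phi>, of s] K by (intro finite_Int_bounded) auto
  have e: "enn2real (\<Sum>x\<in>A. ennreal (g x)) = (\<Sum>x\<in>A. max 0 (g x))" for A :: "(real^'d) set" and g
  proof -
   have "(\<Sum>x\<in>A. ennreal (g x)) = (\<Sum>x\<in>A. ennreal (max 0 (g x)))"
    by (intro sum.cong refl) (auto simp: max_def ennreal_neg)
   also have "... = ennreal (\<Sum>x\<in>A. max 0 (g x))" by (intro sum_ennreal) auto
   finally show ?thesis by (simp add: sum_nonneg)
  qed
  show "enn2real (\<integral>\<^sup>+x. ennreal (f s x) \<partial>count_space (\<Phi> s \<inter> K))
      - enn2real (\<integral>\<^sup>+x. ennreal (- f s x) \<partial>count_space (\<Phi> s \<inter> K)) = (\<Sum>x\<in>\<Phi> s \<inter> K. f s x)"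
   using fin by (auto simp: nn_integral_count_space_finite e simp flip: sum_subtractf intro!: sum.cong)
 qed
 finally show ?thesis .
qed

subsection \<open>Operations on configurations\<close>

text \<open>The translate avoids \<open>B\<close> exactly if a sum over the points of the original
  configuration vanishes, and such sums are jointly measurable in shift and configuration. The shift
  may therefore be random.\<close>

lemma measurable_translate [measurable (raw)]:
 fixes g :: "'s \<Rightarrow> real^'d::finite"
 assumes g [measurable]: "g \<in> S \<rightarrow>\<^sub>M borel" and \<Phi> [measurable]: "\<Phi> \<in> S \<rightarrow>\<^sub>M conf_space"
 shows "(\<lambda>s. translate (g s) (\<Phi> s)) \<in> S \<rightarrow>\<^sub>M conf_space"
proof (rule measurable_conf_spaceI)
 fix B :: "(real^'d) set" assume [measurable]: "B \<in> sets borel"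
 have "{s\<in>space S. translate (g s) (\<Phi> s) \<inter> B = {}}
   = {s\<in>space S. (\<integral>\<^sup>+y. indicator B (y - g s) \<partial>count_space (\<Phi> s)) = 0}"
  by (auto simp: nn_integral_0_iff_AE AE_count_space translate_def indicator_def)
 also have "... \<in> sets S" by measurable
 finally show "{s\<in>space S. translate (g s) (\<Phi> s) \<inter> B = {}} \<in> sets S" .
qed (use measurable_space[OF \<Phi>] in \<open>auto intro: translate_locally_finite\<close>)

lemma measurable_conf_UN:
 fixes f :: "'i \<Rightarrow> 's \<Rightarrow> (real^'d::finite) set"
 assumes "countable I" and [measurable]: "\<And>i. i \<in> I \<Longrightarrow> f i \<in> S \<rightarrow>\<^sub>M conf_space"
  and LF: "\<And>s. s \<in> space S \<Longrightarrow> (\<Union>i\<in>I. f i s) \<in> locally_finite_sets"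
 shows "(\<lambda>s. \<Union>i\<in>I. f i s) \<in> S \<rightarrow>\<^sub>M conf_space"
proof (rule measurable_conf_spaceI)
 fix B :: "(real^'d) set" assume [measurable]: "B \<in> sets borel"
 have "{s\<in>space S. (\<Union>i\<in>I. f i s) \<inter> B = {}} = {s\<in>space S. \<forall>i\<in>I. f i s \<inter> B = {}}"
  by auto
 also have "... \<in> sets S" using \<open>countable I\<close> by measurable
 finally show "{s\<in>space S. (\<Union>i\<in>I. f i s) \<inter> B = {}} \<in> sets S" .
qed (use LF in auto)

lemma measurable_conf_Un [measurable (raw)]:
 assumes f [measurable]: "f \<in> S \<rightarrow>\<^sub>M conf_space" and g [measurable]: "g \<in> S \<rightarrow>\<^sub>M conf_space"
 shows "(\<lambda>s. f s \<union> g s) \<in> S \<rightarrow>\<^sub>M conf_space"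
proof (rule measurable_conf_spaceI)
 fix B :: "(real^'b) set" assume [measurable]: "B \<in> sets borel"
 have "{s\<in>space S. (f s \<union> g s) \<inter> B = {}} = {s\<in>space S. f s \<inter> B = {} \<and> g s \<inter> B = {}}"
  by auto
 also have "... \<in> sets S" by measurable
 finally show "{s\<in>space S. (f s \<union> g s) \<inter> B = {}} \<in> sets S" .
qed (use measurable_space[OF f] measurable_space[OF g] in \<open>auto intro: locally_finite_Un\<close>)

lemma measurable_conf_Int [measurable (raw)]:
 assumes f [measurable]: "f \<in> S \<rightarrow>\<^sub>M conf_space" and [measurable]: "C \<in> sets borel"
 shows "(\<lambda>s. f s \<inter> C) \<in> S \<rightarrow>\<^sub>M conf_space"
proof (rule measurable_conf_spaceI)
 fix B :: "(real^'b) set" assume [measurable]: "B \<in> sets borel"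
 have "{s\<in>space S. (f s \<inter> C) \<inter> B = {}} = {s\<in>space S. f s \<inter> (C \<inter> B) = {}}"
  by auto
 also have "... \<in> sets S" by measurable
 finally show "{s\<in>space S. (f s \<inter> C) \<inter> B = {}} \<in> sets S" .
qed (use measurable_space[OF f] in \<open>auto intro: locally_finite_Int\<close>)

lemma measurable_conf_singleton [measurable (raw)]:
 assumes f [measurable]: "f \<in> S \<rightarrow>\<^sub>M borel"
 shows "(\<lambda>s. {f s}) \<in> S \<rightarrow>\<^sub>M conf_space"
proof (rule measurable_conf_spaceI)
 fix B :: "(real^'b) set" assume [measurable]: "B \<in> sets borel"
 have "{s\<in>space S. {f s} \<inter> B = {}} = {s\<in>space S. f s \<notin> B}" by auto
 also have "... \<in> sets S" by measurable
 finally show "{s\<in>space S. {f s} \<inter> B = {}} \<in> sets S" .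
qed (auto intro: finite_locally_finite)

lemma measurable_image_lessThan [measurable]:
 fixes k :: nat shows
 "(\<lambda>X. X ` {..<k}) \<in> (\<Pi>\<^sub>M i\<in>{..<k}. (borel :: (real^'d::finite) measure)) \<rightarrow>\<^sub>M conf_space"
proof -
 have "(\<lambda>X. \<Union>i\<in>{..<k}. {X i}) \<in> (\<Pi>\<^sub>M i\<in>{..<k}. (borel :: (real^'d::finite) measure)) \<rightarrow>\<^sub>M conf_space"
 proof (rule measurable_conf_UN)
  show "(\<lambda>X. {X i}) \<in> (\<Pi>\<^sub>M i\<in>{..<k}. (borel :: (real^'d::finite) measure)) \<rightarrow>\<^sub>M conf_space" if "i \<in> {..<k}" for i
   using that by (intro measurable_conf_singleton measurable_component_singleton)
 qed (auto intro!: countable_finite finite_locally_finite)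
 also have "(\<lambda>X. \<Union>i\<in>{..<k}. {X i}) = (\<lambda>X. X ` {..<k} :: (real^'d) set)" by auto
 finally show ?thesis .
qed

section \<open>Lattice translates and periodization\<close>

definition latt :: "real \<Rightarrow> ('d \<Rightarrow> int) \<Rightarrow> real ^ 'd::finite" where
 "latt L v = L *\<^sub>R (\<chi> i. real_of_int (v i))"

lemma latt_nth [simp]: "latt L v $ i = L * real_of_int (v i)"
 by (simp add: latt_def)

lemma period_lattice_eq: "period_lattice lam n = range (latt (side TYPE('d) lam n) :: _ \<Rightarrow> real^'d::finite)"
proof -
 have "\<exists>v. z = (\<chi> i. real_of_int (v i))" if "\<forall>i. z $ i \<in> \<int>" for z :: "real^'d"
 proof -
  from that have "\<forall>i. \<exists>k. z $ i = real_of_int k" by (simp add: Ints_def image_iff)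
  then obtain v where "\<forall>i. z $ i = real_of_int (v i)" by metis
  then show ?thesis by (intro exI[of _ v]) (simp add: vec_eq_iff)
 qed
 note * = this
 show ?thesis
 proof
  show "period_lattice lam n \<subseteq> range (latt (side TYPE('d) lam n) :: _ \<Rightarrow> real^'d)"
  proof
   fix p :: "real^'d" assume "p \<in> period_lattice lam n"
   then obtain z where "p = side TYPE('d) lam n *\<^sub>R z" "\<forall>i. z $ i \<in> \<int>" by (auto simp: period_lattice_def)
   with *[of z] show "p \<in> range (latt (side TYPE('d) lam n))" by (auto simp: latt_def)
  qed
  have "latt (side TYPE('d) lam n) v \<in> period_lattice lam n" for v :: "'d \<Rightarrow> int"
   unfolding period_lattice_def latt_def
   by (intro CollectI exI[of _ "\<chi> i. real_of_int (v i)"]) auto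
  then show "range (latt (side TYPE('d) lam n)) \<subseteq> (period_lattice lam n :: (real^'d) set)" by blast
 qed
qed

lemma finite_latt: "0 < L \<Longrightarrow> bounded B \<Longrightarrow> finite {v. latt L v \<in> B}"
proof -
 assume L: "0 < L" and "bounded B"
 then obtain R where R: "\<forall>x\<in>B. norm x \<le> R" by (auto simp: bounded_iff)
 have "{v. latt L v \<in> B} \<subseteq> {v. \<forall>i. \<bar>v i\<bar> \<le> \<lceil>R / L\<rceil>}"
 proof safe
  fix v i assume "latt L v \<in> B"
  then have "\<bar>latt L v $ i\<bar> \<le> R" using R component_le_norm_cart[of "latt L v" i] by force
  then have "\<bar>real_of_int (v i)\<bar> \<le> R / L" using L by (simp add: abs_mult field_simps)
  then show "\<bar>v i\<bar> \<le> \<lceil>R / L\<rceil>" by linarith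
 qed
 then show ?thesis using finite_int_box finite_subset by blast
qed

text \<open>A translate by \<open>latt L v\<close> can reach \<open>B\<close> only if this lattice
  vector is a difference of a point of \<open>B\<close> and a point of \<open>K\<close>. Differences
  of two bounded sets are bounded, so only finitely many \<open>v\<close> matter.\<close>

lemma locally_finite_tiling:
 assumes "0 < L" "\<And>v. D v \<in> locally_finite_sets" "\<And>v. D v \<subseteq> K" "bounded K"
 shows "(\<Union>v. translate (- latt L v) (D v)) \<in> locally_finite_sets"
 unfolding locally_finite_sets_def
proof safe
 fix B :: "(real^'a) set" assume B: "bounded B"
 let ?V = "{v. latt L v \<in> (\<lambda>(x, y). x - y) ` (B \<times> K)}"
 have "bounded ((\<lambda>(x, y). x - y) ` (B \<times> K))"
  using B assms(4) by (rule bounded_minus)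
 then have "finite ?V" by (rule finite_latt[OF assms(1)])
 moreover have "(\<Union>v. translate (- latt L v) (D v)) \<inter> B \<subseteq> (\<Union>v\<in>?V. translate (- latt L v) (D v) \<inter> B)"
 proof safe
  fix v x assume x: "x \<in> translate (- latt L v) (D v)" "x \<in> B"
  then have "x - latt L v \<in> K" using assms(3) by (auto simp: mem_translate)
  then have "v \<in> ?V" using x by (auto intro!: image_eqI[of _ _ "(x, x - latt L v)"])
  then show "x \<in> (\<Union>v\<in>?V. translate (- latt L v) (D v) \<inter> B)" using x by blast
 qed
 moreover have "finite (translate (- latt L v) (D v) \<inter> B)" for v
  using assms(2) B by (intro finite_Int_bounded translate_locally_finite)
 ultimately show "finite ((\<Union>v. translate (- latt L v) (D v)) \<inter> B)"
  by (meson finite_UN_I finite_subset)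
qed

lemma side_pos: "0 < lam \<Longrightarrow> 0 < n \<Longrightarrow> 0 < side TYPE('d::finite) lam n"
 by (simp add: side_def)

lemma periodize_eq:
 "periodize lam n om = (\<Union>v. translate (- latt (side TYPE('d::finite) lam n) v) (om \<inter> window lam n :: (real^'d) set))"
 unfolding periodize_def period_lattice_eq translate_def by auto

lemma bounded_window [simp]: "bounded (window lam n)"
 by (simp add: window_def bounded_cbox)

lemma borel_window [measurable]: "window lam n \<in> sets borel"
 by (simp add: window_def)

lemma periodize_locally_finite:
 "0 < lam \<Longrightarrow> 0 < n \<Longrightarrow> om \<in> locally_finite_sets \<Longrightarrow> periodize lam n om \<in> locally_finite_sets"
 unfolding periodize_eq
 by (intro locally_finite_tiling[where K="window lam n"] locally_finite_Int) (auto intro: side_pos)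

lemma measurable_periodize [measurable (raw)]:
 fixes \<Phi> :: "'s \<Rightarrow> (real^'d::finite) set"
 assumes "0 < lam" "0 < n" and \<Phi> [measurable]: "\<Phi> \<in> S \<rightarrow>\<^sub>M conf_space"
 shows "(\<lambda>s. periodize lam n (\<Phi> s)) \<in> S \<rightarrow>\<^sub>M conf_space"
 unfolding periodize_eq
proof (rule measurable_conf_UN)
 fix s assume "s \<in> space S"
 then have "\<Phi> s \<in> locally_finite_sets" using measurable_space[OF \<Phi>, of s] by simp
 from periodize_locally_finite[OF assms(1,2) this]
 show "(\<Union>v. translate (- latt (side TYPE('d) lam n) v) (\<Phi> s \<inter> window lam n)) \<in> locally_finite_sets"
  by (simp add: periodize_eq)
next
 fix v :: "'d \<Rightarrow> int"
 show "(\<lambda>s. translate (- latt (side TYPE('d) lam n) v) (\<Phi> s \<inter> window lam n)) \<in> S \<rightarrow>\<^sub>M conf_space"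
  by (intro measurable_translate measurable_const measurable_conf_Int \<Phi>) auto
qed simp

lemma measurable_score_sum:
 fixes h :: "(real^'d::finite) set \<Rightarrow> real"
 assumes [measurable]: "h \<in> borel_measurable conf_space" and "0 < lam" "0 < n"
 shows "(\<lambda>om. \<Sum>x\<in>om \<inter> window lam n. h (translate x (periodize lam n om))) \<in> borel_measurable conf_space"
proof (rule measurable_sum_points)
 have "(\<lambda>p. translate (snd p) (periodize lam n (fst p))) \<in> conf_space \<Otimes>\<^sub>M borel \<rightarrow>\<^sub>M (conf_space :: (real^'d) set measure)"
  using assms(2,3) by (intro measurable_translate measurable_periodize) auto
 then show "(\<lambda>(om, x). h (translate x (periodize lam n om))) \<in> borel_measurable (conf_space \<Otimes>\<^sub>M borel)"
  unfolding case_prod_beta by (rule measurable_compose) fact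
qed auto

text \<open>The score of a window with free boundary: the points outside \<open>W\<close> are
  deleted, in contrast to the periodized sums in \<open>energy\<close> and
  \<open>mean_score\<close>. Block contributions take this form because the blocks are surrounded by
  empty corridors.\<close>

definition free_score :: "((real^'d::finite) set \<Rightarrow> real) \<Rightarrow> (real^'d) set \<Rightarrow> (real^'d) set \<Rightarrow> real" where
 "free_score h W om = (\<Sum>x\<in>om \<inter> W. h (translate x (om \<inter> W)))"

lemma measurable_free_score:
 fixes h :: "(real^'d::finite) set \<Rightarrow> real"
 assumes [measurable]: "h \<in> borel_measurable conf_space" "W \<in> sets borel" and "bounded W"
 shows "free_score h W \<in> borel_measurable conf_space"
 unfolding free_score_def[abs_def]
proof (rule measurable_sum_points)
 have "(\<lambda>p. translate (snd p) (fst p \<inter> W)) \<in> conf_space \<Otimes>\<^sub>M borel \<rightarrow>\<^sub>M (conf_space :: (real^'d) set measure)"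
  by (intro measurable_translate measurable_conf_Int) auto
 then show "(\<lambda>(om, x). h (translate x (om \<inter> W))) \<in> borel_measurable (conf_space \<Otimes>\<^sub>M borel)"
  unfolding case_prod_beta by (rule measurable_compose) fact
qed (use assms(3) in auto)

section \<open>The Poisson process\<close>

lemma side_power: "0 < lam \<Longrightarrow> side TYPE('d::finite) lam n ^ CARD('d) = real n / lam"
 by (cases "n = 0") (simp_all add: side_def powr_power)

lemma side_nonneg: "0 \<le> side TYPE('d::finite) lam n"
 by (simp add: side_def)

lemma measure_window:
 assumes "0 < lam"
 shows "measure lborel (window lam n :: (real^'d::finite) set) = real n / lam"
proof -
 let ?s = "side TYPE('d) lam n"
 have "(window lam n :: (real^'d) set) \<noteq> {}"
  using side_nonneg[where 'd='d, of lam n] by (simp add: window_def interval_ne_empty_cart)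
 then have "measure lborel (window lam n :: (real^'d) set) = (\<Prod>i\<in>(UNIV::'d set). ?s)"
  unfolding window_def by (subst content_cbox_cart) auto
 then show ?thesis using side_power[OF assms, where 'd='d] by simp
qed

lemma emeasure_window_finite: "emeasure lborel (window lam n :: (real^'d::finite) set) < \<infinity>"
 using emeasure_lborel_cbox_finite by (auto simp: window_def less_top)

text \<open>The case distinction is needed because
 \<^const>\<open>uniform_measure\<close> is not a probability measure on null sets.\<close>

definition ppp :: "real \<Rightarrow> (real^'d::finite) set \<Rightarrow> (real^'d) set measure" where
 "ppp lam C = (if measure lborel C = 0 then return conf_space {}
   else measure_pmf (poisson_pmf (lam * measure lborel C)) \<bind> iid_points C)"

lemma poisson_process_eq_ppp:
 "0 < lam \<Longrightarrow> 0 < n \<Longrightarrow> poisson_process lam n = ppp lam (window lam n)"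
 by (simp add: poisson_process_def ppp_def measure_window)

lemma sets_iid_points [simp, measurable_cong]: "sets (iid_points C k) = sets conf_space"
 by (simp add: iid_points_def)

lemma empty_in_locally_finite [simp]: "{} \<in> locally_finite_sets"
 by (simp add: finite_locally_finite)

locale positive_volume =
 fixes C :: "(real^'d::finite) set"
 assumes borel_C [measurable]: "C \<in> sets borel"
  and finite_volume: "emeasure lborel C < \<infinity>"
  and positive_volume: "0 < measure lborel C"
begin

lemma emeasure_C: "emeasure lborel C = ennreal (measure lborel C)"
 using finite_volume by (simp add: emeasure_eq_ennreal_measure less_top)

sublocale U: prob_space "uniform_measure lborel C"
 using finite_volume positive_volume
 by (intro prob_space_uniform_measure) (auto simp: emeasure_C)

sublocale PU: product_prob_space "\<lambda>_. uniform_measure lborel C" "{..<k}" for k :: nat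
 by standard

lemma sets_PiM_uniform: "sets (PiM I (\<lambda>_. uniform_measure lborel C)) = sets (PiM I (\<lambda>_. borel))"
 by (intro sets_PiM_cong) auto

lemma measurable_points [measurable]:
 "(\<lambda>X. X ` {..<k}) \<in> PiM {..<k::nat} (\<lambda>_. uniform_measure lborel C) \<rightarrow>\<^sub>M conf_space"
 using measurable_image_lessThan by (simp add: measurable_cong_sets[OF sets_PiM_uniform refl])

lemma prob_space_iid: "prob_space (iid_points C k)"
 unfolding iid_points_def by (intro PU.prob_space_distr measurable_points)

lemma nn_integral_iid:
 assumes "F \<in> borel_measurable conf_space"
 shows "(\<integral>\<^sup>+om. F om \<partial>iid_points C k) = (\<integral>\<^sup>+X. F (X ` {..<k}) \<partial>PiM {..<k} (\<lambda>_. uniform_measure lborel C))"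
 unfolding iid_points_def using assms by (intro nn_integral_distr measurable_points) auto

lemma AE_iid_subset: "AE om in iid_points C k. om \<subseteq> C \<and> finite om \<and> card om \<le> k"
proof -
 have "AE X in PiM {..<k} (\<lambda>_. uniform_measure lborel C). \<forall>i\<in>{..<k}. X i \<in> C"
 proof (intro AE_finite_allI finite_lessThan PU.AE_component)
  show "AE x in uniform_measure lborel C. x \<in> C"
   using positive_volume emeasure_C by (intro AE_uniform_measureI) (auto simp: emeasure_C)
 qed
 then have *: "AE X in PiM {..<k} (\<lambda>_. uniform_measure lborel C). (X ` {..<k}) \<inter> (- C) = {}"
  by eventually_elim auto
 have "AE om in iid_points C k. om \<inter> (- C) = {}"
  unfolding iid_points_def
 proof (subst AE_distr_iff)
  have "{om \<in> space conf_space. om \<inter> - C = {}} = void (- C)" by (auto simp: void_def)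
  then show "{om \<in> space conf_space. om \<inter> - C = {}} \<in> sets conf_space" by simp
 qed (use * in auto)
 moreover have "AE om in iid_points C k. num_points om UNIV \<le> of_nat k"
  unfolding iid_points_def
 proof (subst AE_distr_iff)
  show "AE X in PiM {..<k} (\<lambda>_. uniform_measure lborel C). num_points (X ` {..<k}) UNIV \<le> of_nat k"
   using card_image_le[of "{..<k}"] by (auto simp: num_points_eq_card)
  show "{om \<in> space conf_space. num_points om UNIV \<le> of_nat k} \<in> sets conf_space" by measurable
 qed auto
 ultimately show ?thesis
 proof eventually_elim
  case (elim om)
  then have "num_points om UNIV < \<infinity>"
   by (intro order.strict_trans1[OF elim(2)]) (simp add: of_nat_less_top)
  then have "finite om"
   by (auto simp: num_points_def emeasure_count_space split: if_splits)
  then show ?case using elim by (auto simp: num_points_eq_card)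
 qed
qed

text \<open>Given the earlier points, the next uniform point almost surely avoids this finite set.
  Since a configuration is an image set, coinciding points would lower the count, so this is what
  makes a sample of size \<open>k\<close> have exactly \<open>k\<close> points.\<close>

lemma AE_inj_points: "AE X in PiM {..<k} (\<lambda>_. uniform_measure lborel C). inj_on X {..<k::nat}"
proof (induction k)
 case (Suc k)
 let ?U = "uniform_measure lborel C"
 have meas: "Measurable.pred (PiM {..<m} (\<lambda>_. ?U)) (\<lambda>X. inj_on X {..<m})" for m :: nat
 proof -
  have "Measurable.pred (PiM {..<m} (\<lambda>_. borel :: (real^'d) measure)) (\<lambda>X. \<forall>i\<in>{..<m}. \<forall>j\<in>{..<m}. dist (X i) (X j) = 0 \<longrightarrow> i = j)"
   by measurable
  then have "Measurable.pred (PiM {..<m} (\<lambda>_. borel :: (real^'d) measure)) (\<lambda>X. \<forall>i\<in>{..<m}. \<forall>j\<in>{..<m}. X i = X j \<longrightarrow> i = j)"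
   unfolding dist_eq_0_iff .
  then show ?thesis unfolding inj_on_def by (simp add: measurable_cong_sets[OF sets_PiM_uniform refl])
 qed
 have null: "emeasure ?U (X ` {..<k}) = 0" for X :: "nat \<Rightarrow> real^'d"
 proof -
  have "emeasure lborel (C \<inter> X ` {..<k}) \<le> emeasure lborel (X ` {..<k})"
   by (intro emeasure_mono) (auto intro!: borel_closed finite_imp_closed)
  also have "... = 0" by (intro emeasure_lborel_countable countable_finite) auto
  finally show ?thesis
   by (subst emeasure_uniform_measure) (auto intro!: borel_closed finite_imp_closed)
 qed
 have "(\<integral>\<^sup>+X. indicator {X. \<not> inj_on X {..<Suc k}} X \<partial>PiM (insert k {..<k}) (\<lambda>_. ?U))
   = (\<integral>\<^sup>+X. \<integral>\<^sup>+y. indicator {X. \<not> inj_on X {..<Suc k}} (X(k := y)) \<partial>?U \<partial>PiM {..<k} (\<lambda>_. ?U))"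
 proof (rule PU.product_nn_integral_insert)
  have "Measurable.pred (PiM {..<Suc k} (\<lambda>_. ?U)) (\<lambda>X. \<not> inj_on X {..<Suc k})"
   using meas[of "Suc k"] by measurable
  then show "indicator {X. \<not> inj_on X {..<Suc k}} \<in> borel_measurable (PiM (insert k {..<k}) (\<lambda>_. ?U))"
   by (intro borel_measurable_indicator') (simp_all add: pred_def lessThan_Suc space_PiM)
 qed auto
 also have "... = (\<integral>\<^sup>+X. 0 \<partial>PiM {..<k} (\<lambda>_. ?U))"
 proof (rule nn_integral_cong_AE)
  show "AE X in PiM {..<k} (\<lambda>_. ?U). (\<integral>\<^sup>+y. indicator {X. \<not> inj_on X {..<Suc k}} (X(k := y)) \<partial>?U) = 0"
   using Suc.IH
  proof eventually_elim
   case (elim X)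
   have "(\<integral>\<^sup>+y. indicator {X. \<not> inj_on X {..<Suc k}} (X(k := y)) \<partial>?U) \<le> (\<integral>\<^sup>+y. indicator (X ` {..<k}) y \<partial>?U)"
   proof (rule nn_integral_mono)
    fix y
    have "inj_on (X(k := y)) {..<Suc k}" if "y \<notin> X ` {..<k}"
     using elim that by (auto simp: inj_on_def lessThan_Suc)
    then show "indicator {X. \<not> inj_on X {..<Suc k}} (X(k := y)) \<le> (indicator (X ` {..<k}) y :: ennreal)"
     by (auto split: split_indicator)
   qed
   also have "... = emeasure ?U (X ` {..<k})"
    by (intro nn_integral_indicator) (auto intro!: borel_closed finite_imp_closed)
   finally show ?case by (simp add: null)
  qed
 qed
 finally have "(\<integral>\<^sup>+X. indicator {X. \<not> inj_on X {..<Suc k}} X \<partial>PiM {..<Suc k} (\<lambda>_. ?U)) = 0"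
  by (simp add: lessThan_Suc)
 then show ?case
  using meas[of "Suc k"]
  by (subst (asm) nn_integral_0_iff_AE) (auto simp: indicator_def pred_def elim!: AE_mp intro!: AE_I2)
qed simp

lemma AE_iid_card: "AE om in iid_points C k. num_points om UNIV = of_nat k"
 unfolding iid_points_def
proof (subst AE_distr_iff)
 show "AE X in PiM {..<k} (\<lambda>_. uniform_measure lborel C). num_points (X ` {..<k}) UNIV = of_nat k"
  using AE_inj_points by eventually_elim (simp add: num_points_eq_card card_image)
 show "{om \<in> space conf_space. num_points om UNIV = of_nat k} \<in> sets conf_space" by measurable
qed auto

lemma emeasure_iid_void:
 assumes [measurable]: "B \<in> sets borel"
 shows "emeasure (iid_points C k) (void B) = ennreal ((1 - measure lborel (C \<inter> B) / measure lborel C) ^ k)"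
proof -
 have eq: "(\<lambda>X. X ` {..<k}) -` void B \<inter> space (PiM {..<k} (\<lambda>_. uniform_measure lborel C)) = PiE {..<k} (\<lambda>_. - B)"
  by (auto simp: void_def space_PiM finite_locally_finite PiE_def)
 have "measure lborel (C \<inter> - B) = measure lborel C - measure lborel (C \<inter> B)"
 proof -
  have "emeasure lborel (C \<inter> B) \<le> emeasure lborel C" by (intro emeasure_mono) auto
  then have "emeasure lborel (C \<inter> B) \<noteq> \<infinity>" using finite_volume by (auto simp: less_top top_unique)
  then have "measure lborel ((C \<inter> - B) \<union> (C \<inter> B)) = measure lborel (C \<inter> - B) + measure lborel (C \<inter> B)"
   using finite_volume emeasure_mono[of "C \<inter> - B" C lborel]
   by (intro measure_Union) (auto simp: less_top top_unique)
  moreover have "(C \<inter> - B) \<union> (C \<inter> B) = C" by auto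
  ultimately show ?thesis by simp
 qed
 moreover have "emeasure lborel (C \<inter> - B) = ennreal (measure lborel (C \<inter> - B))"
  using finite_volume emeasure_mono[of "C \<inter> - B" C lborel]
  by (intro emeasure_eq_ennreal_measure) (auto simp: less_top top_unique)
 moreover have le: "measure lborel (C \<inter> B) \<le> measure lborel C"
  using finite_volume by (intro measure_mono_fmeasurable) (auto simp: fmeasurable_def)
 ultimately have "emeasure (uniform_measure lborel C) (- B) = ennreal (1 - measure lborel (C \<inter> B) / measure lborel C)"
  using positive_volume by (subst emeasure_uniform_measure) (auto simp: emeasure_C divide_ennreal le diff_divide_distrib)
 then have "emeasure (PiM {..<k} (\<lambda>_. uniform_measure lborel C)) (PiE {..<k} (\<lambda>_. - B))
   = (\<Prod>i\<in>{..<k}. ennreal (1 - measure lborel (C \<inter> B) / measure lborel C))"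
  by (subst PU.emeasure_PiM) auto
 also have "... = ennreal ((1 - measure lborel (C \<inter> B) / measure lborel C) ^ k)"
 proof -
  have "measure lborel (C \<inter> B) \<le> measure lborel C"
   using finite_volume by (intro measure_mono_fmeasurable) (auto simp: fmeasurable_def)
  then show ?thesis using positive_volume by (simp add: ennreal_power)
 qed
 finally show ?thesis
  unfolding iid_points_def by (subst emeasure_distr) (auto simp: eq)
qed

lemma measurable_iid_points: "iid_points C \<in> measure_pmf p \<rightarrow>\<^sub>M subprob_algebra conf_space"
 using prob_space_iid by (auto simp: space_subprob_algebra prob_space_imp_subprob_space)

lemma ppp_eq: "ppp lam C = measure_pmf (poisson_pmf (lam * measure lborel C)) \<bind> iid_points C"
 using positive_volume by (simp add: ppp_def)

lemma sets_ppp_pos: "sets (ppp lam C) = sets conf_space"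
 unfolding ppp_eq by (rule sets_bind) auto

lemma nn_integral_ppp:
 assumes "F \<in> borel_measurable conf_space"
 shows "(\<integral>\<^sup>+om. F om \<partial>ppp lam C) =
  (\<Sum>k. ennreal (pmf (poisson_pmf (lam * measure lborel C)) k) * (\<integral>\<^sup>+om. F om \<partial>iid_points C k))"
 unfolding ppp_eq using assms
 by (subst nn_integral_bind[OF _ measurable_iid_points])
  (auto simp: nn_integral_measure_pmf nn_integral_count_space_nat)

text \<open>Keeps a single term of the Poisson mixture. For \<open>k\<close> equal to the mean its
  weight decays only polynomially, which is negligible on the exponential scale.\<close>

lemma nn_integral_ppp_ge:
 assumes "F \<in> borel_measurable conf_space"
 shows "ennreal (pmf (poisson_pmf (lam * measure lborel C)) k) * (\<integral>\<^sup>+om. F om \<partial>iid_points C k) \<le> (\<integral>\<^sup>+om. F om \<partial>ppp lam C)"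
 unfolding nn_integral_ppp[OF assms]
 using sum_le_suminf[of "\<lambda>k. ennreal (pmf (poisson_pmf (lam * measure lborel C)) k) * (\<integral>\<^sup>+om. F om \<partial>iid_points C k)" "{k}"]
 by simp

text \<open>A function living on configurations with exactly \<open>k\<close> points sees one
  component of the mixture, whose weight is at most \<open>1\<close>. This carries the Poisson lower
  bound over to the binomial process at no cost.\<close>

lemma nn_integral_ppp_le:
 assumes F: "F \<in> borel_measurable conf_space"
  and "\<And>om. num_points om UNIV \<noteq> of_nat k \<Longrightarrow> F om = 0"
 shows "(\<integral>\<^sup>+om. F om \<partial>ppp lam C) \<le> (\<integral>\<^sup>+om. F om \<partial>iid_points C k)"
proof -
 let ?t = "\<lambda>j. ennreal (pmf (poisson_pmf (lam * measure lborel C)) j) * (\<integral>\<^sup>+om. F om \<partial>iid_points C j)"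
 have "?t j = 0" if "j \<noteq> k" for j
 proof -
  have "AE om in iid_points C j. F om = 0"
   using AE_iid_card by eventually_elim (use that in \<open>auto intro!: assms(2)\<close>)
  then have "(\<integral>\<^sup>+om. F om \<partial>iid_points C j) = (\<integral>\<^sup>+om. 0 \<partial>iid_points C j)" by (rule nn_integral_cong_AE)
  then show ?thesis by simp
 qed
 then have "suminf ?t = ?t k" by (intro suminf_finite[of "{k}", simplified]) auto
 also have "... \<le> 1 * (\<integral>\<^sup>+om. F om \<partial>iid_points C k)"
  by (intro mult_right_mono) (auto simp: pmf_le_1)
 finally show ?thesis unfolding nn_integral_ppp[OF F] by simp
qed

end

section \<open>Void probabilities of the Poisson process\<close>

lemma exp_series_pmf:
 assumes "0 < a"
 shows "(\<lambda>k. pmf (poisson_pmf a) k * q ^ k) sums exp (a * q - a)"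
proof -
 have "(\<lambda>k. exp (- a) * ((a * q) ^ k /\<^sub>R fact k)) sums (exp (- a) * exp (a * q))"
  by (intro sums_mult exp_converges)
 also have "(\<lambda>k. exp (- a) * ((a * q) ^ k /\<^sub>R fact k)) = (\<lambda>k. pmf (poisson_pmf a) k * q ^ k)"
  using assms by (simp add: fun_eq_iff power_mult_distrib field_simps)
 finally show ?thesis by (simp add: exp_add[symmetric])
qed

context
 fixes lam :: real and C :: "(real^'d::finite) set"
 assumes lam: "0 < lam" and C [measurable]: "C \<in> sets borel" and finC: "emeasure lborel C < \<infinity>"
begin

lemma sets_ppp [measurable_cong]: "sets (ppp lam C) = sets conf_space"
proof (cases "measure lborel C = 0")
 case False
 then interpret positive_volume C
  using finC C by unfold_locales (auto simp: zero_less_measure_iff)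
 show ?thesis by (rule sets_ppp_pos)
qed (simp add: ppp_def)

lemma space_ppp: "space (ppp lam C) = locally_finite_sets"
 using sets_eq_imp_space_eq[OF sets_ppp] by simp

text \<open>A sample of size \<open>k\<close> misses \<open>B\<close> with probability
  \<open>q ^ k\<close>, where \<open>q\<close> is the proportion of volume outside \<open>B\<close>;
  summing against the Poisson weights gives the exponential. Together with
  \<open>conf_measure_eqI\<close>, restriction, translation and superposition become statements
  about volumes.\<close>

lemma ppp_void:
 assumes [measurable]: "B \<in> sets borel"
 shows "emeasure (ppp lam C) (void B) = ennreal (exp (- lam * measure lborel (C \<inter> B)))"
proof (cases "measure lborel C = 0")
 case True
 have "measure lborel (C \<inter> B) \<le> measure lborel C"
  using finC by (intro measure_mono_fmeasurable) (auto simp: fmeasurable_def)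
 with True have "measure lborel (C \<inter> B) = 0" using measure_nonneg[of lborel "C \<inter> B"] by linarith
 moreover have "{} \<in> void B" by (simp add: void_def)
 ultimately show ?thesis using True by (simp add: ppp_def)
next
 case False
 then interpret positive_volume C
  using finC C by unfold_locales (auto simp: zero_less_measure_iff)
 let ?m = "measure lborel C" and ?q = "1 - measure lborel (C \<inter> B) / measure lborel C"
 have le: "measure lborel (C \<inter> B) \<le> ?m"
  using finC by (intro measure_mono_fmeasurable) (auto simp: fmeasurable_def)
 have "emeasure (ppp lam C) (void B) = (\<integral>\<^sup>+om. indicator (void B) om \<partial>ppp lam C)"
  by (simp add: sets_ppp)
 also have "... = (\<Sum>k. ennreal (pmf (poisson_pmf (lam * ?m)) k) * emeasure (iid_points C k) (void B))"
  by (subst nn_integral_ppp) auto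
 also have "... = (\<Sum>k. ennreal (pmf (poisson_pmf (lam * ?m)) k * ?q ^ k))"
  using le positive_volume by (simp add: emeasure_iid_void ennreal_mult)
 also have "... = ennreal (exp (lam * ?m * ?q - lam * ?m))"
  using le positive_volume lam
  by (intro suminf_ennreal_eq exp_series_pmf) auto
 also have "lam * ?m * ?q - lam * ?m = - lam * measure lborel (C \<inter> B)"
  using positive_volume by (simp add: field_simps)
 finally show ?thesis .
qed

lemma prob_space_ppp: "prob_space (ppp lam C)"
proof
 have "emeasure (ppp lam C) (void {}) = 1" by (subst ppp_void) auto
 then show "emeasure (ppp lam C) (space (ppp lam C)) = 1"
  by (simp add: space_ppp void_def)
qed

lemma AE_ppp_subset: "AE om in ppp lam C. om \<subseteq> C"
proof -
 interpret prob_space "ppp lam C" by (rule prob_space_ppp)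
 have "emeasure (ppp lam C) (void (- C)) = 1" by (subst ppp_void) auto
 then have "AE om in ppp lam C. om \<in> void (- C)"
  by (intro AE_prob_1) (simp add: emeasure_eq_measure)
 then show ?thesis by eventually_elim (auto simp: void_def)
qed

end

lemma emeasure_Int_finite:
 "C \<in> sets M \<Longrightarrow> emeasure M C < \<infinity> \<Longrightarrow> emeasure M (C \<inter> D) < \<infinity>"
 using emeasure_mono[of "C \<inter> D" C M] by (auto simp: less_top top_unique)

lemma ppp_restrict:
 fixes C D :: "(real^'d::finite) set"
 assumes lam: "0 < lam" and C [measurable]: "C \<in> sets borel" and fin: "emeasure lborel C < \<infinity>"
  and D [measurable]: "D \<in> sets borel"
 shows "distr (ppp lam C) conf_space (\<lambda>om. om \<inter> D) = ppp lam (C \<inter> D)"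
proof (rule conf_measure_eqI)
 note [measurable_cong] = sets_ppp[OF lam C fin]
 have fin': "emeasure lborel (C \<inter> D) < \<infinity>" using fin by (intro emeasure_Int_finite) auto
 show "sets (ppp lam (C \<inter> D)) = sets conf_space" using fin' lam by (intro sets_ppp) auto
 interpret prob_space "ppp lam C" by (intro prob_space_ppp lam C fin)
 show "finite_measure (distr (ppp lam C) conf_space (\<lambda>om. om \<inter> D))"
  by (intro finite_measure_distr) measurable
 fix B :: "(real^'d) set" assume B [measurable]: "B \<in> sets borel"
 have "emeasure (distr (ppp lam C) conf_space (\<lambda>om. om \<inter> D)) (void B)
   = emeasure (ppp lam C) ((\<lambda>om. om \<inter> D) -` void B \<inter> space (ppp lam C))"
  by (rule emeasure_distr) measurable
 also have "(\<lambda>om. om \<inter> D) -` void B \<inter> space (ppp lam C) = void (D \<inter> B)"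
  unfolding space_ppp[OF lam C fin] void_def by (auto intro: locally_finite_Int)
 finally show "emeasure (distr (ppp lam C) conf_space (\<lambda>om. om \<inter> D)) (void B) = emeasure (ppp lam (C \<inter> D)) (void B)"
  using lam fin fin' by (simp add: ppp_void Int_assoc)
qed simp

lemma measure_translate: "measure lborel (translate x C) = measure lborel (C :: (real^'d::finite) set)"
 and emeasure_translate: "emeasure lborel (translate x C) = emeasure lborel C"
 if [measurable]: "C \<in> sets borel"
proof -
 have "emeasure lborel C = emeasure (distr lborel borel ((+) x)) C"
  by (simp add: lborel_distr_plus)
 also have "... = emeasure lborel (translate x C)"
  by (subst emeasure_distr) (auto intro!: arg_cong[of _ _ "emeasure lborel"] simp: mem_translate add.commute)
 finally show "emeasure lborel (translate x C) = emeasure lborel C" ..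
 then show "measure lborel (translate x C) = measure lborel C" by (simp add: measure_def)
qed

lemma ppp_translate:
 fixes C :: "(real^'d::finite) set"
 assumes lam: "0 < lam" and C [measurable]: "C \<in> sets borel" and fin: "emeasure lborel C < \<infinity>"
 shows "distr (ppp lam C) conf_space (translate x) = ppp lam (translate x C)"
proof (rule conf_measure_eqI)
 note [measurable_cong] = sets_ppp[OF lam C fin]
 have [measurable]: "translate x C \<in> sets borel" using C by (rule borel_translate)
 have fin': "emeasure lborel (translate x C) < \<infinity>" using fin by (simp add: emeasure_translate)
 show "sets (ppp lam (translate x C)) = sets conf_space" using fin' lam by (intro sets_ppp) auto
 interpret prob_space "ppp lam C" by (intro prob_space_ppp lam C fin)
 show "finite_measure (distr (ppp lam C) conf_space (translate x))"
  by (intro finite_measure_distr) measurable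
 fix B :: "(real^'d) set" assume B [measurable]: "B \<in> sets borel"
 have B' [measurable]: "translate (- x) B \<in> sets borel" using B by (rule borel_translate)
 have "emeasure (distr (ppp lam C) conf_space (translate x)) (void B)
   = emeasure (ppp lam C) (translate x -` void B \<inter> space (ppp lam C))"
  by (rule emeasure_distr) measurable
 also have "translate x -` void B \<inter> space (ppp lam C) = void (translate (- x) B)"
  unfolding space_ppp[OF lam C fin] void_def
  by (auto simp: translate_locally_finite mem_translate disjoint_iff)
 also have "emeasure (ppp lam C) (void (translate (- x) B)) = emeasure (ppp lam (translate x C)) (void B)"
 proof -
  have "translate x (C \<inter> translate (- x) B) = translate x C \<inter> B"
   by (simp add: translate_Int translate_translate)
  then have "measure lborel (C \<inter> translate (- x) B) = measure lborel (translate x C \<inter> B)"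
   using measure_translate[of "C \<inter> translate (- x) B" x] by simp
  then show ?thesis using lam fin fin' by (simp add: ppp_void)
 qed
 finally show "emeasure (distr (ppp lam C) conf_space (translate x)) (void B) = emeasure (ppp lam (translate x C)) (void B)" .
qed simp

section \<open>Superposition and independence on disjoint regions\<close>

lemma locally_finite_finite_UN:
 "finite I \<Longrightarrow> (\<And>i. i \<in> I \<Longrightarrow> f i \<in> locally_finite_sets) \<Longrightarrow> (\<Union>i\<in>I. f i) \<in> locally_finite_sets"
 by (induction I rule: finite_induct) (auto intro: locally_finite_Un)

text \<open>A union avoids \<open>B\<close> iff each component does. Independence multiplies the
  void probabilities, and disjointness turns the sum in the exponent into the volume of the
  union.\<close>

lemma ppp_superposition:
 fixes C :: "'i \<Rightarrow> (real^'d::finite) set"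
 assumes lam: "0 < lam" and I: "finite I" and C [measurable]: "\<And>i. C i \<in> sets borel"
  and fin: "\<And>i. emeasure lborel (C i) < \<infinity>" and disj: "disjoint_family_on C I"
 shows "(\<lambda>om. \<Union>i\<in>I. om i) \<in> PiM I (\<lambda>i. ppp lam (C i)) \<rightarrow>\<^sub>M conf_space"
  and "distr (PiM I (\<lambda>i. ppp lam (C i))) conf_space (\<lambda>om. \<Union>i\<in>I. om i) = ppp lam (\<Union>i\<in>I. C i)"
proof -
 note [measurable_cong] = sets_ppp[OF lam C fin]
 interpret product_prob_space "\<lambda>i. ppp lam (C i)" I
  by (intro product_prob_spaceI prob_space_ppp lam C fin)
 show m: "(\<lambda>om. \<Union>i\<in>I. om i) \<in> PiM I (\<lambda>i. ppp lam (C i)) \<rightarrow>\<^sub>M conf_space"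
 proof (rule measurable_conf_UN)
  show "(\<lambda>om. om i) \<in> PiM I (\<lambda>i. ppp lam (C i)) \<rightarrow>\<^sub>M conf_space" if "i \<in> I" for i
   using measurable_component_singleton[OF that, of "\<lambda>i. ppp lam (C i)"]
   by (simp add: measurable_cong_sets[OF refl sets_ppp[OF lam C fin]])
 next
  fix s assume "s \<in> space (PiM I (\<lambda>i. ppp lam (C i)))"
  then show "(\<Union>i\<in>I. s i) \<in> locally_finite_sets"
   by (intro locally_finite_finite_UN I) (auto simp: space_PiM space_ppp[OF lam C fin])
 qed (use I in \<open>auto intro: countable_finite\<close>)
 have [measurable]: "(\<Union>i\<in>I. C i) \<in> sets borel" using I by (intro sets.finite_UN) auto
 have fin': "emeasure lborel (\<Union>i\<in>I. C i) < \<infinity>"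
 proof -
  have "emeasure lborel (\<Union>i\<in>I. C i) \<le> (\<Sum>i\<in>I. emeasure lborel (C i))"
   using I by (intro emeasure_subadditive_finite) auto
  also have "... < \<infinity>" using fin I by (simp add: less_top)
  finally show ?thesis .
 qed
 show "distr (PiM I (\<lambda>i. ppp lam (C i))) conf_space (\<lambda>om. \<Union>i\<in>I. om i) = ppp lam (\<Union>i\<in>I. C i)"
 proof (rule conf_measure_eqI)
  show "sets (ppp lam (\<Union>i\<in>I. C i)) = sets conf_space" using fin' lam by (intro sets_ppp) auto
  show "finite_measure (distr (PiM I (\<lambda>i. ppp lam (C i))) conf_space (\<lambda>om. \<Union>i\<in>I. om i))"
   using prob_space_distr[OF m] by (simp add: prob_space_def)
  fix B :: "(real^'d) set" assume B [measurable]: "B \<in> sets borel"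
  have "emeasure (distr (PiM I (\<lambda>i. ppp lam (C i))) conf_space (\<lambda>om. \<Union>i\<in>I. om i)) (void B)
    = emeasure (PiM I (\<lambda>i. ppp lam (C i))) ((\<lambda>om. \<Union>i\<in>I. om i) -` void B \<inter> space (PiM I (\<lambda>i. ppp lam (C i))))"
   by (rule emeasure_distr[OF m]) measurable
  also have "(\<lambda>om. \<Union>i\<in>I. om i) -` void B \<inter> space (PiM I (\<lambda>i. ppp lam (C i))) = PiE I (\<lambda>i. void B)"
   using I by (auto simp: void_def space_PiM space_ppp[OF lam C fin] PiE_def Pi_def intro!: locally_finite_finite_UN)
  also have "emeasure (PiM I (\<lambda>i. ppp lam (C i))) (PiE I (\<lambda>i. void B)) = (\<Prod>i\<in>I. emeasure (ppp lam (C i)) (void B))"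
   by (rule emeasure_PiM) (auto simp: I sets_ppp[OF lam C fin])
  also have "... = (\<Prod>i\<in>I. ennreal (exp (- lam * measure lborel (C i \<inter> B))))"
   by (intro prod.cong refl ppp_void lam fin) auto
  also have "... = ennreal (exp (\<Sum>i\<in>I. - lam * measure lborel (C i \<inter> B)))"
   using I by (simp add: prod_ennreal exp_sum)
  also have "(\<Sum>i\<in>I. - lam * measure lborel (C i \<inter> B)) = - lam * measure lborel (\<Union>i\<in>I. C i \<inter> B)"
  proof (subst measure_finite_Union[OF I])
   show "disjoint_family_on (\<lambda>i. C i \<inter> B) I" using disj by (auto simp: disjoint_family_on_def)
   show "emeasure lborel (C i \<inter> B) \<noteq> \<infinity>" for i
    using emeasure_Int_finite[of "C i" lborel B] fin by (auto simp: less_top)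
  qed (auto simp: sum_distrib_left)
  also have "(\<Union>i\<in>I. C i \<inter> B) = (\<Union>i\<in>I. C i) \<inter> B" by auto
  also have "ennreal (exp (- lam * measure lborel ((\<Union>i\<in>I. C i) \<inter> B))) = emeasure (ppp lam (\<Union>i\<in>I. C i)) (void B)"
   using lam fin' by (simp add: ppp_void)
  finally show "emeasure (distr (PiM I (\<lambda>i. ppp lam (C i))) conf_space (\<lambda>om. \<Union>i\<in>I. om i)) (void B)
    = emeasure (ppp lam (\<Union>i\<in>I. C i)) (void B)" .
 qed simp
qed

lemma ppp_superposition2:
 fixes A B :: "(real^'d::finite) set"
 assumes lam: "0 < lam" and A [measurable]: "A \<in> sets borel" and finA: "emeasure lborel A < \<infinity>"
  and B [measurable]: "B \<in> sets borel" and finB: "emeasure lborel B < \<infinity>" and disj: "A \<inter> B = {}"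
 shows "distr (ppp lam A \<Otimes>\<^sub>M ppp lam B) conf_space (\<lambda>(om, eta). om \<union> eta) = ppp lam (A \<union> B)"
proof (rule conf_measure_eqI)
 note [measurable_cong] = sets_ppp[OF lam A finA] sets_ppp[OF lam B finB]
 interpret A: prob_space "ppp lam A" by (intro prob_space_ppp lam A finA)
 interpret B: prob_space "ppp lam B" by (intro prob_space_ppp lam B finB)
 interpret AB: pair_prob_space "ppp lam A" "ppp lam B" ..
 have fin': "emeasure lborel (A \<union> B) < \<infinity>"
 proof -
  have "emeasure lborel (A \<union> B) \<le> emeasure lborel A + emeasure lborel B"
   by (intro emeasure_subadditive) auto
  also have "... < \<infinity>" using finA finB by simp
  finally show ?thesis .
 qed
 show "sets (ppp lam (A \<union> B)) = sets conf_space" using fin' lam by (intro sets_ppp) auto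
 have m: "(\<lambda>(om, eta). om \<union> eta) \<in> ppp lam A \<Otimes>\<^sub>M ppp lam B \<rightarrow>\<^sub>M (conf_space :: (real^'d) set measure)"
  unfolding case_prod_beta by measurable
 show "finite_measure (distr (ppp lam A \<Otimes>\<^sub>M ppp lam B) conf_space (\<lambda>(om, eta). om \<union> eta))"
  using AB.prob_space_distr[OF m] by (simp add: prob_space_def)
 fix D :: "(real^'d) set" assume D [measurable]: "D \<in> sets borel"
 have "emeasure (distr (ppp lam A \<Otimes>\<^sub>M ppp lam B) conf_space (\<lambda>(om, eta). om \<union> eta)) (void D)
  = emeasure (ppp lam A \<Otimes>\<^sub>M ppp lam B) ((\<lambda>(om, eta). om \<union> eta) -` void D \<inter> space (ppp lam A \<Otimes>\<^sub>M ppp lam B))"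
  by (rule emeasure_distr[OF m]) measurable
 also have "(\<lambda>(om, eta). om \<union> eta) -` void D \<inter> space (ppp lam A \<Otimes>\<^sub>M ppp lam B) = void D \<times> void D"
  by (auto simp: void_def space_pair_measure space_ppp[OF lam A finA] space_ppp[OF lam B finB] intro: locally_finite_Un)
 also have "emeasure (ppp lam A \<Otimes>\<^sub>M ppp lam B) (void D \<times> void D) = emeasure (ppp lam A) (void D) * emeasure (ppp lam B) (void D)"
  by (rule B.emeasure_pair_measure_Times) (auto simp: sets_ppp[OF lam A finA] sets_ppp[OF lam B finB])
 also have "... = ennreal (exp (- lam * (measure lborel (A \<inter> D) + measure lborel (B \<inter> D))))"
  unfolding ppp_void[OF lam A finA D] ppp_void[OF lam B finB D]
  by (simp add: distrib_left ennreal_mult[symmetric] exp_add[symmetric])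
 also have "measure lborel (A \<inter> D) + measure lborel (B \<inter> D) = measure lborel ((A \<inter> D) \<union> (B \<inter> D))"
  using emeasure_Int_finite[of A lborel D] emeasure_Int_finite[of B lborel D] finA finB disj
  by (intro measure_Union[symmetric]) (auto simp: less_top)
 also have "(A \<inter> D) \<union> (B \<inter> D) = (A \<union> B) \<inter> D" by auto
 also have "ennreal (exp (- lam * measure lborel ((A \<union> B) \<inter> D))) = emeasure (ppp lam (A \<union> B)) (void D)"
  using fin' lam by (simp add: ppp_void)
 finally show "emeasure (distr (ppp lam A \<Otimes>\<^sub>M ppp lam B) conf_space (\<lambda>(om, eta). om \<union> eta)) (void D)
   = emeasure (ppp lam (A \<union> B)) (void D)" .
qed simp

text \<open>Only the term of the mixture with one point is kept. It is the factor contributed by one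
  reserve cell.\<close>

lemma (in positive_volume) ppp_singleton:
 assumes "0 < lam"
 shows "ennreal (lam * measure lborel C * exp (- lam * measure lborel C))
  \<le> emeasure (ppp lam C) {om \<in> locally_finite_sets. num_points om UNIV = 1}"
proof -
 let ?E = "{om \<in> locally_finite_sets. num_points om UNIV = 1} :: (real^'d) set set"
 have E [measurable]: "?E \<in> sets conf_space"
  unfolding space_conf_space[symmetric] by measurable
 interpret I: prob_space "iid_points C 1" by (rule prob_space_iid)
 have "AE om in iid_points C 1. om \<in> ?E"
  using AE_iid_card[of 1] AE_space[of "iid_points C 1"]
  by eventually_elim (auto simp: iid_points_def)
 then have "emeasure (iid_points C 1) ?E = 1"
  using I.emeasure_eq_1_AE[of ?E] E by simp
 then have "ennreal (pmf (poisson_pmf (lam * measure lborel C)) 1) \<le> (\<integral>\<^sup>+om. indicator ?E om \<partial>ppp lam C)"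
  using nn_integral_ppp_ge[of "indicator ?E" lam 1] E by simp
 then show ?thesis
  using assms positive_volume E by (simp add: sets_ppp_pos)
qed

section \<open>The Donsker--Varadhan bound\<close>

text \<open>The Donsker--Varadhan form of the statement that the relative entropy of
  \<open>mu\<close> with respect to \<open>nu\<close> is at most \<open>K\<close>. As a family of
  inequalities over bounded \<open>g\<close>, it passes through products and conditioning by
  choosing a test function, without handling densities.\<close>

definition entropy_bound :: "real \<Rightarrow> 'a measure \<Rightarrow> 'a measure \<Rightarrow> bool" where
 "entropy_bound K mu nu \<longleftrightarrow>
  (\<forall>g \<in> borel_measurable nu. (\<exists>b. \<forall>x\<in>space nu. \<bar>g x\<bar> \<le> b) \<longrightarrow> (\<integral>x. g x \<partial>mu) \<le> K + ln (\<integral>x. exp (g x) \<partial>nu))"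

lemma entropy_boundD:
 "entropy_bound K mu nu \<Longrightarrow> g \<in> borel_measurable nu \<Longrightarrow> (\<And>x. x \<in> space nu \<Longrightarrow> \<bar>g x\<bar> \<le> b) \<Longrightarrow>
  (\<integral>x. g x \<partial>mu) \<le> K + ln (\<integral>x. exp (g x) \<partial>nu)"
 unfolding entropy_bound_def by blast

text \<open>Jensen's inequality for the exponential: the tangent at the mean lies below the graph
  and has the right expectation.\<close>

lemma (in prob_space) exp_expectation_le:
 fixes X :: "'a \<Rightarrow> real"
 assumes X: "integrable M X" and eX: "integrable M (\<lambda>x. exp (X x))"
 shows "exp (expectation X) \<le> expectation (\<lambda>x. exp (X x))"
proof -
 let ?m = "expectation X"
 have "exp ?m = expectation (\<lambda>x. exp ?m * (1 + (X x - ?m)))"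
  using X by (simp add: prob_space)
 also have "... \<le> expectation (\<lambda>x. exp (X x))"
 proof (rule integral_mono)
  show "integrable M (\<lambda>x. exp ?m * (1 + (X x - ?m)))" using X by simp
  fix x
  have "exp ?m * (1 + (X x - ?m)) \<le> exp ?m * exp (X x - ?m)"
   by (intro mult_left_mono exp_ge_add_one_self) simp
  then show "exp ?m * (1 + (X x - ?m)) \<le> exp (X x)" by (simp add: exp_diff)
 qed fact
 finally show ?thesis .
qed

lemma (in prob_space) integrable_bounded_fun:
 fixes g :: "'a \<Rightarrow> real"
 assumes "g \<in> borel_measurable M" "\<And>x. x \<in> space M \<Longrightarrow> \<bar>g x\<bar> \<le> b"
 shows "integrable M g" "integrable M (\<lambda>x. exp (g x))"
proof -
 show "integrable M g" using assms by (intro integrable_const_bound[where B=b]) auto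
 have [measurable]: "g \<in> borel_measurable M" by fact
 have "exp (g x) \<le> exp b" if "x \<in> space M" for x using assms(2)[OF that] by (simp add: abs_le_iff)
 then show "integrable M (\<lambda>x. exp (g x))" by (intro integrable_const_bound[where B="exp b"]) auto
qed

lemma (in prob_space) expectation_exp_pos:
 fixes g :: "'a \<Rightarrow> real"
 assumes "integrable M g" "integrable M (\<lambda>x. exp (g x))"
 shows "0 < expectation (\<lambda>x. exp (g x))"
 using exp_expectation_le[OF assms] by (meson exp_gt_zero less_le_trans)

text \<open>Testing with \<open>t\<close> times the indicator of a null set leaves
  \<open>t * mu.prob N \<le> K\<close> for every \<open>t \<ge> 0\<close>, which forces the
  probability to vanish.\<close>

lemma entropy_bound_imp_absolutely_continuous:
 assumes "prob_space mu" "prob_space nu" and sets: "sets mu = sets nu" and "entropy_bound K mu nu"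
 shows "absolutely_continuous nu mu"
 unfolding absolutely_continuous_def
proof
 interpret mu: prob_space mu by fact
 interpret nu: prob_space nu by fact
 fix N assume N: "N \<in> null_sets nu"
 then have [measurable]: "N \<in> sets nu" "N \<in> sets mu" using sets by auto
 have le: "t * mu.prob N \<le> K" if "0 \<le> t" for t
 proof -
  have "(\<integral>x. t * indicator N x \<partial>mu) \<le> K + ln (\<integral>x. exp (t * indicator N x) \<partial>nu)"
   using assms(4) by (rule entropy_boundD[where b=t]) (use that in \<open>auto split: split_indicator\<close>)
  also have "(\<integral>x. exp (t * indicator N x) \<partial>nu) = (\<integral>x. 1 \<partial>nu)"
  proof (rule integral_cong_AE)
   show "AE x in nu. exp (t * indicator N x) = 1"
    using AE_not_in[OF N] by eventually_elim simp
  qed auto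
  finally show ?thesis by (simp add: nu.prob_space)
 qed
 have "mu.prob N = 0"
 proof (rule ccontr)
  assume "mu.prob N \<noteq> 0"
  then have "0 < mu.prob N" by (simp add: zero_less_measure_iff)
  moreover have "((\<bar>K\<bar> + 1) / mu.prob N) * mu.prob N \<le> K" by (rule le) simp
  ultimately show False by simp
 qed
 then show "N \<in> null_sets mu" by (auto simp: mu.emeasure_eq_measure)
qed

text \<open>The bridge between the definition of relative entropy and its variational form. Forward,
  Jensen is applied under \<open>mu\<close> to \<open>g - ln f\<close>, with \<open>f\<close> the
  density. Backward, the optimal test function \<open>ln f\<close> is unbounded on both sides and is
  approximated by truncations.\<close>

lemma relative_entropy_le_iff_entropy_bound:
 assumes "prob_space mu" "prob_space nu" and sets: "sets mu = sets nu"
 shows "relative_entropy mu nu \<le> ereal K \<longleftrightarrow> entropy_bound K mu nu"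
proof
 interpret mu: prob_space mu by fact
 interpret nu: prob_space nu by fact
 have sp: "space mu = space nu" using sets by (rule sets_eq_imp_space_eq)
 note [measurable_cong] = sets
 define f where "f = (\<lambda>x. enn2real (RN_deriv nu mu x))"
 have [measurable]: "f \<in> borel_measurable nu" by (simp add: f_def)
 have [measurable]: "f \<in> borel_measurable mu" using measurable_cong_sets[OF sets refl] \<open>f \<in> borel_measurable nu\<close> by blast
 have f0: "0 \<le> f x" for x by (simp add: f_def)
 have dens: "mu = density nu (\<lambda>x. ennreal (f x))" if ac: "absolutely_continuous nu mu"
 proof -
  have "density nu (RN_deriv nu mu) = mu"
   using ac sets by (intro nu.density_RN_deriv) auto
  moreover have "AE x in nu. RN_deriv nu mu x = ennreal (f x)"
   using nu.RN_deriv_finite[OF mu.sigma_finite_measure_axioms ac sets]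
   unfolding f_def by eventually_elim (simp add: less_top)
  then have "density nu (RN_deriv nu mu) = density nu (\<lambda>x. ennreal (f x))"
   by (intro density_cong) auto
  ultimately show ?thesis by simp
 qed
 have ent: "entropy_density (exp 1) nu mu = (\<lambda>x. ln (f x))"
  by (simp add: entropy_density_def f_def fun_eq_iff log_def)
 have fpos: "AE x in mu. 0 < f x" if ac: "absolutely_continuous nu mu"
  using f0 by (subst dens[OF ac]) (simp add: AE_density)
 \<comment> \<open>Only an inequality, since \<open>nu\<close> may charge the set where
   \<open>f\<close> vanishes, and division by zero contributes nothing there.\<close>
 have pull: "(\<integral>\<^sup>+x. ennreal (h x / f x) \<partial>mu) \<le> (\<integral>\<^sup>+x. ennreal (h x) \<partial>nu)"
  if ac: "absolutely_continuous nu mu" and [measurable]: "h \<in> borel_measurable nu" and "\<And>x. 0 \<le> h x" for h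
 proof -
  have "(\<integral>\<^sup>+x. ennreal (h x / f x) \<partial>mu) = (\<integral>\<^sup>+x. ennreal (f x) * ennreal (h x / f x) \<partial>nu)"
   by (subst dens[OF ac], subst nn_integral_density) auto
  also have "... \<le> (\<integral>\<^sup>+x. ennreal (h x) \<partial>nu)"
  proof (rule nn_integral_mono)
   fix x
   show "ennreal (f x) * ennreal (h x / f x) \<le> ennreal (h x)"
    using f0[of x] that(3)[of x] by (cases "f x = 0") (auto simp flip: ennreal_mult)
  qed
  finally show ?thesis .
 qed
 {
  assume "relative_entropy mu nu \<le> ereal K"
  then have ac: "absolutely_continuous nu mu" and int: "integrable mu (\<lambda>x. ln (f x))"
   and KL: "(\<integral>x. ln (f x) \<partial>mu) \<le> K"
   by (auto simp: relative_entropy_def ent KL_divergence_def split: if_splits)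
  show "entropy_bound K mu nu"
   unfolding entropy_bound_def
  proof safe
   fix g b assume g [measurable]: "g \<in> borel_measurable nu" and b: "\<forall>x\<in>space nu. \<bar>g x\<bar> \<le> (b::real)"
   have ig: "integrable mu g" using b by (intro mu.integrable_bounded_fun(1)) (auto simp: sp)
   have ieg: "integrable nu (\<lambda>x. exp (g x))" using b by (intro nu.integrable_bounded_fun(2)) auto
   have pos: "0 < (\<integral>x. exp (g x) \<partial>nu)" using b by (intro nu.expectation_exp_pos nu.integrable_bounded_fun) auto
   have eq: "AE x in mu. exp (g x - ln (f x)) = exp (g x) / f x"
    using fpos[OF ac] by eventually_elim (simp add: exp_diff)
   have le: "(\<integral>\<^sup>+x. ennreal (exp (g x - ln (f x))) \<partial>mu) \<le> ennreal (\<integral>x. exp (g x) \<partial>nu)"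
   proof -
    have "(\<integral>\<^sup>+x. ennreal (exp (g x - ln (f x))) \<partial>mu) = (\<integral>\<^sup>+x. ennreal (exp (g x) / f x) \<partial>mu)"
     using eq by (intro nn_integral_cong_AE) (auto elim!: eventually_mono)
    also have "... \<le> (\<integral>\<^sup>+x. ennreal (exp (g x)) \<partial>nu)" by (intro pull ac) auto
    finally show ?thesis using ieg by (simp add: nn_integral_eq_integral)
   qed
   have i2: "integrable mu (\<lambda>x. exp (g x - ln (f x)))"
   proof (rule integrableI_nonneg)
    show "(\<integral>\<^sup>+x. ennreal (exp (g x - ln (f x))) \<partial>mu) < \<infinity>"
     by (rule order.strict_trans1[OF le]) simp
   qed auto
   have "exp (\<integral>x. g x - ln (f x) \<partial>mu) \<le> (\<integral>x. exp (g x - ln (f x)) \<partial>mu)"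
    using ig int i2 by (intro mu.exp_expectation_le) auto
   also have "... \<le> (\<integral>x. exp (g x) \<partial>nu)"
    using le i2 pos by (simp add: nn_integral_eq_integral)
   finally have "(\<integral>x. g x - ln (f x) \<partial>mu) \<le> ln (\<integral>x. exp (g x) \<partial>nu)"
    using pos by (simp add: ln_ge_iff)
   then show "(\<integral>x. g x \<partial>mu) \<le> K + ln (\<integral>x. exp (g x) \<partial>nu)" using KL ig int by simp
  qed
 }
 {
  assume eb: "entropy_bound K mu nu"
  then have ac: "absolutely_continuous nu mu"
   using assms by (intro entropy_bound_imp_absolutely_continuous)
  have mf: "integrable nu f" "(\<integral>x. f x \<partial>nu) = 1"
  proof -
   have "(\<integral>\<^sup>+x. ennreal (f x) \<partial>nu) = emeasure mu (space mu)"
    by (subst dens[OF ac], simp add: sp emeasure_density cong: nn_integral_cong)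
   then have *: "(\<integral>\<^sup>+x. ennreal (f x) \<partial>nu) = 1" by (simp add: mu.emeasure_space_1)
   show "integrable nu f" by (intro integrableI_nonneg) (auto simp: f0 *)
   then show "(\<integral>x. f x \<partial>nu) = 1" using * f0 by (simp add: nn_integral_eq_integral)
  qed
  \<comment> \<open>Negative part of the log-density. It is always \<open>mu\<close>-integrable,
    being at most \<open>1 / f\<close>, whose integral is at most the total mass of
    \<open>nu\<close>.\<close>
  define n where "n = (\<lambda>x. max 0 (- ln (f x)))"
  have n0: "0 \<le> n x" for x by (simp add: n_def)
  have [measurable]: "n \<in> borel_measurable nu" "n \<in> borel_measurable mu" unfolding n_def by measurable
  have nle: "AE x in mu. n x \<le> 1 / f x"
   using fpos[OF ac]
  proof eventually_elim
   case (elim x)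
   then have "- ln (f x) = ln (1 / f x)" by (simp add: ln_div)
   also have "... \<le> 1 / f x" using elim by (intro order_trans[OF ln_le_minus_one]) auto
   finally show ?case using elim by (simp add: n_def)
  qed
  have nint: "integrable mu n"
  proof (rule integrableI_nonneg)
   have "(\<integral>\<^sup>+x. ennreal (n x) \<partial>mu) \<le> (\<integral>\<^sup>+x. ennreal (1 / f x) \<partial>mu)"
    using nle by (intro nn_integral_mono_AE) (auto elim!: eventually_mono intro: ennreal_leI)
   also have "... \<le> (\<integral>\<^sup>+x. ennreal 1 \<partial>nu)" by (intro pull ac) auto
   also have "(\<integral>\<^sup>+x. ennreal 1 \<partial>nu) < \<infinity>" by (simp add: nu.emeasure_space_1)
   finally show "(\<integral>\<^sup>+x. ennreal (n x) \<partial>mu) < \<infinity>" .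
  qed (auto simp: n0)
  define p where "p = (\<lambda>k x. max 0 (min (real k) (ln (f x))))"
  \<comment> \<open>Since \<open>ln 0 = 0\<close>, the zeros of \<open>f\<close> must be sent to
    \<open>- real k\<close> by hand. With this choice
    \<open>exp (p k x - q k x) \<le> f x + exp (- real k)\<close> everywhere, so the exponential
    moment under \<open>nu\<close> tends to \<open>1\<close>.\<close>
  define q where "q = (\<lambda>k x. if f x = 0 then real k else min (real k) (n x))"
  have pm [measurable]: "p k \<in> borel_measurable nu" "p k \<in> borel_measurable mu" for k
   unfolding p_def by measurable
  have qm [measurable]: "q k \<in> borel_measurable nu" "q k \<in> borel_measurable mu" for k
   unfolding q_def by measurable
  have pq: "integrable mu (p k)" "integrable mu (q k)" for k
   by (rule mu.integrable_bounded_fun(1)[where b="real k"], simp, force simp: p_def q_def n_def)+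
  have bound: "(\<integral>x. p k x \<partial>mu) \<le> K + ln (1 + exp (- real k)) + (\<integral>x. n x \<partial>mu)" for k
  proof -
   have "(\<integral>x. p k x - q k x \<partial>mu) \<le> K + ln (\<integral>x. exp (p k x - q k x) \<partial>nu)"
    by (rule entropy_boundD[OF eb, where b="real k"]) (auto simp: p_def q_def n_def)
   also have "... \<le> K + ln (1 + exp (- real k))"
   proof -
    have b: "\<bar>p k x - q k x\<bar> \<le> real k" for x by (auto simp: p_def q_def n_def)
    have pos: "0 < (\<integral>x. exp (p k x - q k x) \<partial>nu)"
     using b by (intro nu.expectation_exp_pos nu.integrable_bounded_fun) auto
    have "(\<integral>x. exp (p k x - q k x) \<partial>nu) \<le> (\<integral>x. f x + exp (- real k) \<partial>nu)"
    proof (rule integral_mono_AE)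
     show "integrable nu (\<lambda>x. exp (p k x - q k x))" using b by (intro nu.integrable_bounded_fun) auto
     show "AE x in nu. exp (p k x - q k x) \<le> f x + exp (- real k)"
     proof (rule AE_I2)
      fix x
      show "exp (p k x - q k x) \<le> f x + exp (- real k)"
      proof (cases "f x = 0")
       case True
       then show ?thesis by (simp add: p_def q_def)
      next
       case False
       then have fx: "0 < f x" using f0[of x] by simp
       have "p k x - q k x \<le> max (ln (f x)) (- real k)" by (auto simp: p_def q_def n_def)
       then have "exp (p k x - q k x) \<le> exp (max (ln (f x)) (- real k))" by simp
       also have "... \<le> f x + exp (- real k)" using fx by (auto simp: max_def)
       finally show ?thesis .
      qed
     qed
    qed (use mf in auto)
    also have "... = 1 + exp (- real k)" using mf by (simp add: nu.prob_space)
    finally show ?thesis using pos by (simp add: add_pos_pos)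
   qed
   finally have "(\<integral>x. p k x \<partial>mu) \<le> K + ln (1 + exp (- real k)) + (\<integral>x. q k x \<partial>mu)"
    using pq by simp
   moreover have "(\<integral>x. q k x \<partial>mu) \<le> (\<integral>x. n x \<partial>mu)"
    using pq nint fpos[OF ac] by (intro integral_mono_AE) (auto simp: q_def elim!: eventually_mono)
   ultimately show ?thesis by simp
  qed
  define P where "P = (\<lambda>x. max 0 (ln (f x)))"
  have [measurable]: "P \<in> borel_measurable nu" "P \<in> borel_measurable mu" unfolding P_def by measurable
  have lim: "(\<lambda>k. p k x) \<longlonglongrightarrow> P x" for x
  proof (rule tendsto_eventually)
   obtain m :: nat where "ln (f x) \<le> real m" using real_arch_simple by blast
   then show "\<forall>\<^sub>F k in sequentially. p k x = P x"
    by (auto simp: eventually_sequentially p_def P_def intro!: exI[of _ m])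
  qed
  \<comment> \<open>Fatou's lemma turns the bounds on the truncations, uniform in \<open>k\<close>,
    into integrability of the positive part. Only then does dominated convergence apply to give the
    sharp constant.\<close>
  have Pint: "integrable mu P"
  proof (rule integrableI_nonneg)
   have "(\<integral>\<^sup>+x. ennreal (P x) \<partial>mu) = (\<integral>\<^sup>+x. liminf (\<lambda>k. ennreal (p k x)) \<partial>mu)"
    using lim by (intro nn_integral_cong lim_imp_Liminf[symmetric] tendsto_ennrealI) auto
   also have "... \<le> liminf (\<lambda>k. \<integral>\<^sup>+x. ennreal (p k x) \<partial>mu)"
    by (intro nn_integral_liminf) auto
   also have "... \<le> liminf (\<lambda>k::nat. ennreal (K + ln 2 + (\<integral>x. n x \<partial>mu)))"
   proof (intro Liminf_mono eventuallyI)
    fix k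
    have "(\<integral>\<^sup>+x. ennreal (p k x) \<partial>mu) = ennreal (\<integral>x. p k x \<partial>mu)"
     using pq by (intro nn_integral_eq_integral) (auto simp: p_def)
    also have "ln (1 + exp (- real k)) \<le> ln 2" by (subst ln_le_cancel_iff) (auto simp: add_pos_pos)
    then have "ennreal (\<integral>x. p k x \<partial>mu) \<le> ennreal (K + ln 2 + (\<integral>x. n x \<partial>mu))"
     using bound[of k] by (intro ennreal_leI) linarith
    finally show "(\<integral>\<^sup>+x. ennreal (p k x) \<partial>mu) \<le> ennreal (K + ln 2 + (\<integral>x. n x \<partial>mu))" .
   qed
   also have "... < \<infinity>" by (simp add: Liminf_const)
   finally show "(\<integral>\<^sup>+x. ennreal (P x) \<partial>mu) < \<infinity>" .
  qed (auto simp: P_def)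
  have "(\<lambda>k. \<integral>x. p k x \<partial>mu) \<longlonglongrightarrow> (\<integral>x. P x \<partial>mu)"
   using lim by (intro integral_dominated_convergence[where w=P] Pint AE_I2) (auto simp: p_def P_def)
  moreover have "(\<lambda>k. K + ln (1 + exp (- real k)) + (\<integral>x. n x \<partial>mu)) \<longlonglongrightarrow> K + ln (1 + 0) + (\<integral>x. n x \<partial>mu)"
   by (intro tendsto_intros filterlim_compose[OF exp_at_bot] filterlim_compose[OF filterlim_uminus_at_bot_at_top] filterlim_real_sequentially) auto
  ultimately have Ple: "(\<integral>x. P x \<partial>mu) \<le> K + ln (1 + 0) + (\<integral>x. n x \<partial>mu)"
   by (rule LIMSEQ_le) (use bound in auto)
  have "ln (f x) = P x - n x" for x by (auto simp: P_def n_def)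
  then have "integrable mu (\<lambda>x. ln (f x))" "(\<integral>x. ln (f x) \<partial>mu) \<le> K"
   using Pint nint Ple by auto
  then show "relative_entropy mu nu \<le> ereal K"
   using ac by (simp add: relative_entropy_def ent KL_divergence_def)
 }
qed

lemma entropy_bound_nonneg:
 assumes "prob_space nu" "entropy_bound K mu nu" shows "0 \<le> K"
proof -
 interpret prob_space nu by fact
 show ?thesis using entropy_boundD[OF assms(2), of "\<lambda>_. 0" 0] by (simp add: prob_space)
qed

lemma entropy_bound_mono: "entropy_bound K mu nu \<Longrightarrow> K \<le> K' \<Longrightarrow> entropy_bound K' mu nu"
 unfolding entropy_bound_def by fastforce

lemma entropy_bound_refl:
 assumes "prob_space nu" shows "entropy_bound 0 nu nu"
 unfolding entropy_bound_def
proof safe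
 interpret prob_space nu by fact
 fix g b assume g: "g \<in> borel_measurable nu" and b: "\<forall>x\<in>space nu. \<bar>g x\<bar> \<le> (b::real)"
 have i: "integrable nu g" "integrable nu (\<lambda>x. exp (g x))"
  using g b by (auto intro!: integrable_bounded_fun[where b=b])
 show "(\<integral>x. g x \<partial>nu) \<le> 0 + ln (\<integral>x. exp (g x) \<partial>nu)"
  using exp_expectation_le[OF i] expectation_exp_pos[OF i] by (simp add: ln_ge_iff)
qed

text \<open>Data processing: a bounded test function on the image pulls back to a bounded one on the
  source.\<close>

lemma entropy_bound_distr:
 assumes "entropy_bound K mu nu" and T: "T \<in> nu \<rightarrow>\<^sub>M N" and sets: "sets mu = sets nu"
 shows "entropy_bound K (distr mu N T) (distr nu N T)"
 unfolding entropy_bound_def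
proof safe
 have T': "T \<in> mu \<rightarrow>\<^sub>M N" using T by (simp add: measurable_cong_sets[OF sets refl])
 fix g b assume g: "g \<in> borel_measurable (distr nu N T)" and b: "\<forall>x\<in>space (distr nu N T). \<bar>g x\<bar> \<le> (b::real)"
 then have g' [measurable]: "g \<in> borel_measurable N" by simp
 have "(\<integral>x. g (T x) \<partial>mu) \<le> K + ln (\<integral>x. exp (g (T x)) \<partial>nu)"
  using b measurable_space[OF T] by (intro entropy_boundD[OF assms(1), of _ b] measurable_compose[OF T g']) auto
 then show "(\<integral>x. g x \<partial>distr mu N T) \<le> K + ln (\<integral>x. exp (g x) \<partial>distr nu N T)"
  using T T' by (simp add: integral_distr)
qed

text \<open>For fixed first coordinate the second bound is applied; what remains is the logarithm of
  a partial exponential integral, again a bounded function, and it serves as test function for the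
  first bound.\<close>

lemma entropy_bound_pair:
 assumes "prob_space mu1" "prob_space nu1" and s1: "sets mu1 = sets nu1" and e1: "entropy_bound K1 mu1 nu1"
  and "prob_space mu2" "prob_space nu2" and s2: "sets mu2 = sets nu2" and e2: "entropy_bound K2 mu2 nu2"
 shows "entropy_bound (K1 + K2) (mu1 \<Otimes>\<^sub>M mu2) (nu1 \<Otimes>\<^sub>M nu2)"
 unfolding entropy_bound_def
proof safe
 interpret mu1: prob_space mu1 by fact
 interpret mu2: prob_space mu2 by fact
 interpret nu1: prob_space nu1 by fact
 interpret nu2: prob_space nu2 by fact
 interpret mu: pair_prob_space mu1 mu2 ..
 interpret nu: pair_prob_space nu1 nu2 ..
 note [measurable_cong] = s1 s2
 fix g b assume g [measurable]: "g \<in> borel_measurable (nu1 \<Otimes>\<^sub>M nu2)"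
  and b: "\<forall>z\<in>space (nu1 \<Otimes>\<^sub>M nu2). \<bar>g z\<bar> \<le> (b::real)"
 have sp: "space mu1 = space nu1" "space mu2 = space nu2" using s1 s2 by (auto dest: sets_eq_imp_space_eq)
 have sp12: "space (mu1 \<Otimes>\<^sub>M mu2) = space (nu1 \<Otimes>\<^sub>M nu2)" by (simp add: space_pair_measure sp)
 have b': "\<bar>g (x, y)\<bar> \<le> b" if "x \<in> space nu1" "y \<in> space nu2" for x y
  using b that by (auto simp: space_pair_measure)
 have [measurable]: "g \<in> borel_measurable (mu1 \<Otimes>\<^sub>M mu2)" by measurable
 define h where "h = (\<lambda>x. ln (\<integral>y. exp (g (x, y)) \<partial>nu2))"
 have [measurable]: "h \<in> borel_measurable nu1" unfolding h_def by measurable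
 have ii: "integrable nu2 (\<lambda>y. g (x, y))" "integrable nu2 (\<lambda>y. exp (g (x, y)))" if "x \<in> space nu1" for x
  using b' that by (auto intro!: nu2.integrable_bounded_fun[where b=b])
 have pos: "0 < (\<integral>y. exp (g (x, y)) \<partial>nu2)" if "x \<in> space nu1" for x
  using ii[OF that] by (rule nu2.expectation_exp_pos)
 have hb: "\<bar>h x\<bar> \<le> b" if x: "x \<in> space nu1" for x
 proof -
  have "(\<integral>y. exp (g (x, y)) \<partial>nu2) \<le> (\<integral>y. exp b \<partial>nu2)"
   using ii[OF x] b' x by (intro integral_mono) (auto simp: abs_le_iff)
  moreover have "(\<integral>y. exp (- b) \<partial>nu2) \<le> (\<integral>y. exp (g (x, y)) \<partial>nu2)"
   using ii[OF x] b' x by (intro integral_mono) (auto simp: abs_le_iff minus_le_iff)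
  ultimately have "exp (- b) \<le> (\<integral>y. exp (g (x, y)) \<partial>nu2)" "(\<integral>y. exp (g (x, y)) \<partial>nu2) \<le> exp b"
   by (simp_all add: nu2.prob_space)
  then have "- b \<le> h x" "h x \<le> b" unfolding h_def using pos[OF x]
   by (simp_all add: ln_ge_iff) (metis exp_gt_zero ln_exp ln_le_cancel_iff)
  then show ?thesis by (simp add: abs_le_iff)
 qed
 have ig: "integrable (mu1 \<Otimes>\<^sub>M mu2) g"
  using b by (intro mu.integrable_bounded_fun(1)[where b=b]) (auto simp: sp12)
 have ieg: "integrable (nu1 \<Otimes>\<^sub>M nu2) (\<lambda>z. exp (g z))"
  using b by (intro nu.integrable_bounded_fun(2)[where b=b]) auto
 have "(\<integral>z. g z \<partial>(mu1 \<Otimes>\<^sub>M mu2)) = (\<integral>x. \<integral>y. g (x, y) \<partial>mu2 \<partial>mu1)"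
  using ig by (rule mu.integral_fst'[symmetric])
 also have "... \<le> (\<integral>x. K2 + h x \<partial>mu1)"
 proof (rule integral_mono)
  show "integrable mu1 (\<lambda>x. \<integral>y. g (x, y) \<partial>mu2)" using ig by (rule mu.integrable_fst')
  show "integrable mu1 (\<lambda>x. K2 + h x)"
  proof -
   have "integrable mu1 h" using hb by (intro mu1.integrable_bounded_fun(1)[where b=b]) (auto simp: sp)
   then show ?thesis by simp
  qed
  fix x assume x: "x \<in> space mu1"
  then have [measurable]: "(\<lambda>y. g (x, y)) \<in> borel_measurable nu2" by (simp add: sp)
  show "(\<integral>y. g (x, y) \<partial>mu2) \<le> K2 + h x"
   unfolding h_def using b' x by (intro entropy_boundD[OF e2, of _ b]) (auto simp: sp)
 qed
 also have "... = K2 + (\<integral>x. h x \<partial>mu1)"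
 proof -
  have "integrable mu1 h" using hb by (intro mu1.integrable_bounded_fun(1)[where b=b]) (auto simp: sp)
  then show ?thesis by (simp add: mu1.prob_space)
 qed
 also have "(\<integral>x. h x \<partial>mu1) \<le> K1 + ln (\<integral>x. exp (h x) \<partial>nu1)"
  using hb by (intro entropy_boundD[OF e1, of _ b]) auto
 also have "(\<integral>x. exp (h x) \<partial>nu1) = (\<integral>x. \<integral>y. exp (g (x, y)) \<partial>nu2 \<partial>nu1)"
  using pos by (intro Bochner_Integration.integral_cong) (auto simp: h_def)
 also have "... = (\<integral>z. exp (g z) \<partial>(nu1 \<Otimes>\<^sub>M nu2))"
  using ieg by (rule nu.integral_fst')
 finally show "(\<integral>z. g z \<partial>(mu1 \<Otimes>\<^sub>M mu2)) \<le> K1 + K2 + ln (\<integral>z. exp (g z) \<partial>(nu1 \<Otimes>\<^sub>M nu2))" by simp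
qed

lemma entropy_bound_PiM:
 assumes "finite I" and p: "\<And>i. prob_space (mu i)" "\<And>i. prob_space (nu i)"
  and s: "\<And>i. sets (mu i) = sets (nu i)" and e: "\<And>i. entropy_bound (K i) (mu i) (nu i)"
 shows "entropy_bound (\<Sum>i\<in>I. K i) (PiM I mu) (PiM I nu)"
 using \<open>finite I\<close>
proof (induction I rule: finite_induct)
 case empty
 have "prob_space (PiM {} nu)" by (intro prob_space_PiM) auto
 then show ?case using entropy_bound_refl by (simp add: PiM_empty)
next
 case (insert i I)
 have sP: "sets (PiM J mu) = sets (PiM J nu)" for J by (intro sets_PiM_cong s) auto
 have "entropy_bound (K i + (\<Sum>i\<in>I. K i)) (mu i \<Otimes>\<^sub>M PiM I mu) (nu i \<Otimes>\<^sub>M PiM I nu)"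
  using insert.IH by (intro entropy_bound_pair e s sP p prob_space_PiM)
 then have "entropy_bound (K i + (\<Sum>i\<in>I. K i)) (distr (mu i \<Otimes>\<^sub>M PiM I mu) (PiM (insert i I) nu) (\<lambda>(x, X). X(i := x)))
   (distr (nu i \<Otimes>\<^sub>M PiM I nu) (PiM (insert i I) nu) (\<lambda>(x, X). X(i := x)))"
  by (rule entropy_bound_distr) (auto simp: sets_pair_measure_cong[OF s sP])
 moreover have "distr (mu i \<Otimes>\<^sub>M PiM I mu) (PiM (insert i I) nu) (\<lambda>(x, X). X(i := x)) = PiM (insert i I) mu"
  using distr_pair_PiM_eq_PiM[of I mu i] p by (simp add: distr_cong[OF refl sP[symmetric] refl])
 moreover have "distr (nu i \<Otimes>\<^sub>M PiM I nu) (PiM (insert i I) nu) (\<lambda>(x, X). X(i := x)) = PiM (insert i I) nu"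
  using distr_pair_PiM_eq_PiM[of I nu i] p by simp
 ultimately show ?case using insert.hyps by simp
qed

text \<open>The change of measure behind the large deviation lower bound: an event likely under
  \<open>mu\<close> has \<open>nu\<close>-probability at least about \<open>exp (- K)\<close>. The
  test function is \<open>t\<close> times the indicator of \<open>G\<close>, with \<open>t\<close>
  the logarithmic cost of \<open>G\<close> under \<open>nu\<close>.\<close>

lemma entropy_bound_event:
 assumes "prob_space mu" "prob_space nu" and sets: "sets mu = sets nu" and eb: "entropy_bound K mu nu"
  and G: "G \<in> sets nu" and pos: "0 < measure mu G"
 shows "exp (- (K + ln 2) / measure mu G) \<le> measure nu G"
proof -
 interpret mu: prob_space mu by fact
 interpret nu: prob_space nu by fact
 have [measurable]: "G \<in> sets nu" "G \<in> sets mu" using G sets by auto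
 have a: "0 < nu.prob G"
 proof (rule ccontr)
  assume "\<not> 0 < nu.prob G"
  then have "nu.prob G = 0" using measure_nonneg[of nu G] by linarith
  then have "G \<in> null_sets nu" using G by (auto simp: nu.emeasure_eq_measure)
  then have "G \<in> null_sets mu"
   using entropy_bound_imp_absolutely_continuous[OF assms(1-4)] by (auto simp: absolutely_continuous_def)
  then show False using pos by (auto simp: mu.emeasure_eq_measure)
 qed
 define t where "t = - ln (nu.prob G)"
 have t0: "0 \<le> t" using a by (simp add: t_def)
 have "(\<integral>x. t * indicator G x \<partial>mu) \<le> K + ln (\<integral>x. exp (t * indicator G x) \<partial>nu)"
  using eb by (rule entropy_boundD[where b=t]) (use t0 in \<open>auto split: split_indicator\<close>)
 \<comment> \<open>With \<open>exp t = 1 / nu.prob G\<close> the exponential moment equals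
   \<open>2 - nu.prob G\<close>, which is the origin of \<open>ln 2\<close>.\<close>
 also have "(\<integral>x. exp (t * indicator G x) \<partial>nu) = (\<integral>x. 1 + (exp t - 1) * indicator G x \<partial>nu)"
  by (intro Bochner_Integration.integral_cong) (auto split: split_indicator)
 also have "... = 1 + (exp t - 1) * nu.prob G"
  by (subst Bochner_Integration.integral_add) (auto simp: nu.prob_space nu.emeasure_eq_measure)
 also have "exp t = 1 / nu.prob G" using a by (simp add: t_def exp_minus inverse_eq_divide)
 also have "1 + (1 / nu.prob G - 1) * nu.prob G = 2 - nu.prob G" using a by (simp add: field_simps)
 also have "ln (2 - nu.prob G) \<le> ln 2"
 proof (subst ln_le_cancel_iff)
  show "0 < 2 - nu.prob G" using nu.prob_le_1[of G] by linarith
 qed (use a in auto)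
 finally have "t * mu.prob G \<le> K + ln 2" by simp
 then have "t \<le> (K + ln 2) / mu.prob G" using pos by (simp add: field_simps)
 then have "- (K + ln 2) / mu.prob G \<le> - t" by (simp only: minus_divide_left[symmetric] neg_le_iff_le)
 then have "exp (- (K + ln 2) / mu.prob G) \<le> exp (- t)" by simp
 also have "exp (- t) = nu.prob G" using a by (simp add: t_def)
 finally show ?thesis .
qed

lemma (in prob_space) integral_uniform_measure:
 fixes g :: "'a \<Rightarrow> real"
 assumes S: "S \<in> events" "0 < prob S" and g: "g \<in> borel_measurable M"
 shows "(\<integral>x. g x \<partial>uniform_measure M S) = (\<integral>x. indicator S x * g x \<partial>M) / prob S"
proof -
 have "uniform_measure M S = density M (\<lambda>x. ennreal (indicator S x / prob S))"
  unfolding uniform_measure_def using S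
  by (intro density_cong) (auto simp: emeasure_eq_measure divide_ennreal split: split_indicator simp flip: ennreal_1)
 then have "(\<integral>x. g x \<partial>uniform_measure M S) = (\<integral>x. (indicator S x / prob S) * g x \<partial>M)"
  using S g by (simp add: integral_density)
 then show ?thesis by simp
qed

text \<open>The test function is \<open>g\<close> on \<open>S\<close> and the constant
  \<open>\<kappa>\<close> off \<open>S\<close>, with \<open>\<kappa>\<close> the log-moment of
  \<open>g\<close> itself. Its exponential is at most \<open>exp (g x) + exp \<kappa>\<close>, which
  integrates to \<open>2 * exp \<kappa>\<close>; hence the price \<open>ln 2\<close>. Moving the
  constant part to the right and dividing by the probability of \<open>S\<close> leaves the
  conditioned mean.\<close>

lemma entropy_bound_condition:
 assumes "prob_space mu" "prob_space nu" and sets: "sets mu = sets nu" and eb: "entropy_bound K mu nu"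
  and S: "S \<in> sets nu" and pos: "0 < measure mu S"
 shows "entropy_bound ((K + ln 2) / measure mu S) (uniform_measure mu S) nu"
 unfolding entropy_bound_def
proof safe
 interpret mu: prob_space mu by fact
 interpret nu: prob_space nu by fact
 have [measurable]: "S \<in> sets nu" "S \<in> sets mu" using S sets by auto
 have sp: "space mu = space nu" using sets by (rule sets_eq_imp_space_eq)
 fix g b assume g [measurable]: "g \<in> borel_measurable nu" and b: "\<forall>x\<in>space nu. \<bar>g x\<bar> \<le> (b::real)"
 have [measurable]: "g \<in> borel_measurable mu" using g by (simp add: measurable_cong_sets[OF sets refl])
 let ?p = "mu.prob S"
 have ieg: "integrable nu (\<lambda>x. exp (g x))" using b by (intro nu.integrable_bounded_fun(2)[where b=b]) auto
 have epos: "0 < (\<integral>x. exp (g x) \<partial>nu)" using b by (intro nu.expectation_exp_pos nu.integrable_bounded_fun[where b=b]) auto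
 define \<kappa> where "\<kappa> = ln (\<integral>x. exp (g x) \<partial>nu)"
 have ig: "integrable mu g" using b by (intro mu.integrable_bounded_fun(1)[where b=b]) (auto simp: sp)
 have "(\<integral>x. indicator S x * g x + \<kappa> * indicator (space nu - S) x \<partial>mu)
   \<le> K + ln (\<integral>x. exp (indicator S x * g x + \<kappa> * indicator (space nu - S) x) \<partial>nu)"
  using eb by (rule entropy_boundD[where b="\<bar>b\<bar> + \<bar>\<kappa>\<bar>"]) (use b in \<open>force split: split_indicator\<close>)+
 also have "(\<integral>x. exp (indicator S x * g x + \<kappa> * indicator (space nu - S) x) \<partial>nu) \<le> (\<integral>x. exp (g x) + exp \<kappa> \<partial>nu)"
 proof (rule integral_mono)
  show "integrable nu (\<lambda>x. exp (indicator S x * g x + \<kappa> * indicator (space nu - S) x))"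
   by (rule nu.integrable_bounded_fun(2)[where b="\<bar>b\<bar> + \<bar>\<kappa>\<bar>"]) (use b in \<open>force split: split_indicator\<close>)+
  show "exp (indicator S x * g x + \<kappa> * indicator (space nu - S) x) \<le> exp (g x) + exp \<kappa>" if "x \<in> space nu" for x
   using that by (auto split: split_indicator)
 qed (use ieg in simp)
 then have "ln (\<integral>x. exp (indicator S x * g x + \<kappa> * indicator (space nu - S) x) \<partial>nu) \<le> ln (\<integral>x. exp (g x) + exp \<kappa> \<partial>nu)"
 proof (subst ln_le_cancel_iff)
  show "0 < (\<integral>x. exp (indicator S x * g x + \<kappa> * indicator (space nu - S) x) \<partial>nu)"
   by (rule nu.expectation_exp_pos; rule nu.integrable_bounded_fun[where b="\<bar>b\<bar> + \<bar>\<kappa>\<bar>"]) (use b in \<open>force split: split_indicator\<close>)+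
  show "0 < (\<integral>x. exp (g x) + exp \<kappa> \<partial>nu)" using ieg epos by (simp add: nu.prob_space add_pos_pos)
 qed auto
 also have "(\<integral>x. exp (g x) + exp \<kappa> \<partial>nu) = 2 * exp \<kappa>"
  using ieg epos by (simp add: nu.prob_space \<kappa>_def)
 also have "ln (2 * exp \<kappa>) = ln 2 + \<kappa>" by (simp add: ln_mult)
 also have "(\<integral>x. indicator S x * g x + \<kappa> * indicator (space nu - S) x \<partial>mu) = (\<integral>x. indicator S x * g x \<partial>mu) + \<kappa> * (1 - ?p)"
 proof -
  have "integrable mu (\<lambda>x. indicator S x * g x)"
   using b by (intro mu.integrable_bounded_fun(1)[where b=b]) (force simp: sp split: split_indicator)+
  moreover have "integrable mu (\<lambda>x. \<kappa> * indicator (space mu - S) x)"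
   by (intro integrable_mult_right mu.integrable_bounded_fun(1)[where b=1]) (auto split: split_indicator)
  moreover have "(\<integral>x. \<kappa> * indicator (space mu - S) x \<partial>mu) = \<kappa> * (1 - ?p)"
   by (simp add: mu.prob_compl)
  ultimately show ?thesis by (simp flip: sp)
 qed
 finally have "(\<integral>x. indicator S x * g x \<partial>mu) \<le> K + ln 2 + \<kappa> * ?p" by (simp add: algebra_simps)
 then have "(\<integral>x. indicator S x * g x \<partial>mu) / ?p \<le> (K + ln 2) / ?p + \<kappa>"
  using pos by (simp add: field_simps)
 then show "(\<integral>x. g x \<partial>uniform_measure mu S) \<le> (K + ln 2) / ?p + ln (\<integral>x. exp (g x) \<partial>nu)"
  using pos by (subst mu.integral_uniform_measure) (auto simp: \<kappa>_def)
qed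

section \<open>Palm measures\<close>

lemma countable_locally_finite: "om \<in> locally_finite_sets \<Longrightarrow> countable om"
proof -
 assume w: "om \<in> locally_finite_sets"
 have "om = (\<Union>n. om \<inter> cball 0 (real n))" using real_arch_simple by auto
 moreover have "countable (\<Union>n. om \<inter> cball 0 (real n))"
  by (rule countable_UN) (auto intro: countable_finite finite_Int_bounded[OF w bounded_cball])
 ultimately show ?thesis by metis
qed

lemma nn_integral_count_translate:
 "(\<integral>\<^sup>+x. f x \<partial>count_space (translate u om)) = (\<integral>\<^sup>+x. f (x - u) \<partial>count_space om)"
 unfolding translate_def
 by (rule nn_integral_bij_count_space[symmetric]) (auto simp: bij_betw_def inj_on_def)

lemma nn_integral_lborel_shift:
 fixes f :: "real^'d::finite \<Rightarrow> ennreal"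
 assumes [measurable]: "f \<in> borel_measurable borel"
 shows "(\<integral>\<^sup>+u. f (x + u) \<partial>lborel) = (\<integral>\<^sup>+u. f u \<partial>lborel)"
proof -
 have "(\<integral>\<^sup>+u. f u \<partial>lborel) = (\<integral>\<^sup>+u. f u \<partial>distr lborel borel ((+) x))" by (simp add: lborel_distr_plus)
 also have "... = (\<integral>\<^sup>+u. f (x + u) \<partial>lborel)" by (subst nn_integral_distr) auto
 finally show ?thesis ..
qed

lemma nn_integral_lborel_reflect:
 fixes f :: "real^'d::finite \<Rightarrow> ennreal"
 assumes [measurable]: "f \<in> borel_measurable borel"
 shows "(\<integral>\<^sup>+u. f (x - u) \<partial>lborel) = (\<integral>\<^sup>+u. f u \<partial>lborel)"
proof -
 have "(lborel :: (real^'d) measure) = distr lborel borel uminus"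
  using lborel_affine[of "-1" "0 :: real^'d"] by (simp add: density_1)
 then have "(\<integral>\<^sup>+u. f u \<partial>lborel) = (\<integral>\<^sup>+u. f u \<partial>distr lborel borel uminus)" by simp
 also have "... = (\<integral>\<^sup>+u. f (- u) \<partial>lborel)" by (subst nn_integral_distr) auto
 also have "... = (\<integral>\<^sup>+u. f (- (- x + u)) \<partial>lborel)"
  by (rule nn_integral_lborel_shift[symmetric]) auto
 finally show ?thesis by simp
qed

locale stationary_process =
 fixes P :: "(real^'d::finite) set measure"
 assumes stationary: "P \<in> stationary_processes"
begin

lemma sets_P [measurable_cong]: "sets P = sets conf_space"
 using stationary by (simp add: stationary_processes_def)

lemma space_P: "space P = locally_finite_sets"
 using sets_eq_imp_space_eq[OF sets_P] by simp

sublocale prob_space P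
 using stationary by (simp add: stationary_processes_def)

lemma distr_translate: "distr P conf_space (translate x) = P"
 using stationary by (simp add: stationary_processes_def)

lemma nn_integral_translate:
 assumes [measurable]: "F \<in> borel_measurable conf_space"
 shows "(\<integral>\<^sup>+om. F (translate x om) \<partial>P) = (\<integral>\<^sup>+om. F om \<partial>P)"
proof -
 have "(\<integral>\<^sup>+om. F om \<partial>P) = (\<integral>\<^sup>+om. F om \<partial>distr P conf_space (translate x))" by (simp add: distr_translate)
 also have "... = (\<integral>\<^sup>+om. F (translate x om) \<partial>P)" by (intro nn_integral_distr) auto
 finally show ?thesis ..
qed

text \<open>Mecke's exchange argument. Both sides are read as integrals over a shift
  \<open>u\<close> and the points \<open>x\<close>; stationarity moves the shift from the second
  argument of \<open>f\<close> into the indicator of \<open>C\<close>, whose integral over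
  \<open>u\<close> is the volume of \<open>C\<close>. Counting points in \<open>C\<close> can thus
  replace counting all points.\<close>

lemma campbell_swap:
 assumes f [measurable]: "f \<in> borel_measurable (borel \<Otimes>\<^sub>M conf_space)"
  and C [measurable]: "C \<in> sets borel"
 shows "emeasure lborel C * (\<integral>\<^sup>+om. \<integral>\<^sup>+x. f (x, translate x om) \<partial>count_space om \<partial>P)
  = (\<integral>\<^sup>+om. \<integral>\<^sup>+x. indicator C x * (\<integral>\<^sup>+u. f (u, translate x om) \<partial>lborel) \<partial>count_space om \<partial>P)"
proof -
 interpret PL: pair_sigma_finite P lborel ..
 have meas1: "(\<lambda>(p, x). indicator C x * f (x + snd p, translate x (fst p))) \<in> borel_measurable ((P \<Otimes>\<^sub>M lborel) \<Otimes>\<^sub>M borel)"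
  by measurable
 have meas2: "(\<lambda>(p, x). indicator C (x - snd p) * f (x, translate x (fst p))) \<in> borel_measurable ((P \<Otimes>\<^sub>M lborel) \<Otimes>\<^sub>M borel)"
  by measurable
 have fst: "fst \<in> P \<Otimes>\<^sub>M lborel \<rightarrow>\<^sub>M (conf_space :: (real^'d) set measure)" by measurable
 have slice: "(\<lambda>u. f (u, translate x om)) \<in> borel_measurable borel" if "om \<in> space P" for x om
  using that by (intro measurable_compose[OF _ f] measurable_Pair) (auto simp: space_P translate_locally_finite)
 have "(\<integral>\<^sup>+om. \<integral>\<^sup>+x. indicator C x * (\<integral>\<^sup>+u. f (u, translate x om) \<partial>lborel) \<partial>count_space om \<partial>P)
   = (\<integral>\<^sup>+om. \<integral>\<^sup>+u. \<integral>\<^sup>+x. indicator C x * f (x + u, translate x om) \<partial>count_space om \<partial>lborel \<partial>P)"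
 proof (rule nn_integral_cong)
  fix om assume w: "om \<in> space P"
  have "(\<integral>\<^sup>+x. indicator C x * (\<integral>\<^sup>+u. f (u, translate x om) \<partial>lborel) \<partial>count_space om)
    = (\<integral>\<^sup>+x. (\<integral>\<^sup>+u. indicator C x * f (x + u, translate x om) \<partial>lborel) \<partial>count_space om)"
  proof (rule nn_integral_cong)
   fix x
   have "(\<integral>\<^sup>+u. indicator C x * f (x + u, translate x om) \<partial>lborel) = indicator C x * (\<integral>\<^sup>+u. f (x + u, translate x om) \<partial>lborel)"
    using slice[OF w] by (intro nn_integral_cmult) (auto intro: measurable_compose[of "\<lambda>u. x + u" _ _ "\<lambda>u. f (u, translate x om)"])
   then show "indicator C x * (\<integral>\<^sup>+u. f (u, translate x om) \<partial>lborel) = (\<integral>\<^sup>+u. indicator C x * f (x + u, translate x om) \<partial>lborel)"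
    using nn_integral_lborel_shift[OF slice[OF w], of x] by simp
  qed
  also have "... = (\<integral>\<^sup>+u. \<integral>\<^sup>+x. indicator C x * f (x + u, translate x om) \<partial>count_space om \<partial>lborel)"
  proof (rule nn_integral_count_space_nn_integral[symmetric])
   show "countable om" using w by (simp add: space_P countable_locally_finite)
   show "(\<lambda>u. indicator C x * f (x + u, translate x om)) \<in> borel_measurable lborel" for x
    using measurable_compose[of "\<lambda>u. x + u" lborel borel, OF _ slice[OF w]] by simp
  qed
  finally show "(\<integral>\<^sup>+x. indicator C x * (\<integral>\<^sup>+u. f (u, translate x om) \<partial>lborel) \<partial>count_space om)
    = (\<integral>\<^sup>+u. \<integral>\<^sup>+x. indicator C x * f (x + u, translate x om) \<partial>count_space om \<partial>lborel)" .
 qed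
 also have "... = (\<integral>\<^sup>+u. \<integral>\<^sup>+om. \<integral>\<^sup>+x. indicator C x * f (x + u, translate x om) \<partial>count_space om \<partial>P \<partial>lborel)"
  using measurable_count_kernel[OF fst, of "\<lambda>p x. indicator C x * f (x + snd p, translate x (fst p))"] meas1
  by (intro PL.Fubini'[symmetric]) (simp add: case_prod_beta)
 \<comment> \<open>For fixed \<open>u\<close>, the configuration is replaced by its translate by
   \<open>u\<close>; the argument \<open>translate x om\<close> is unaffected once \<open>x\<close>
   is relabelled.\<close>
 also have "... = (\<integral>\<^sup>+u. \<integral>\<^sup>+om. \<integral>\<^sup>+x. indicator C (x - u) * f (x, translate x om) \<partial>count_space om \<partial>P \<partial>lborel)"
 proof (rule nn_integral_cong)
  fix u :: "real^'d"
  have "(\<lambda>om. \<integral>\<^sup>+x. indicator C x * f (x + u, translate x om) \<partial>count_space om) \<in> borel_measurable conf_space"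
   by measurable
  then have "(\<integral>\<^sup>+om. \<integral>\<^sup>+x. indicator C x * f (x + u, translate x om) \<partial>count_space om \<partial>P)
    = (\<integral>\<^sup>+om. \<integral>\<^sup>+x. indicator C x * f (x + u, translate x (translate u om)) \<partial>count_space (translate u om) \<partial>P)"
   by (rule nn_integral_translate[symmetric])
  then show "(\<integral>\<^sup>+om. \<integral>\<^sup>+x. indicator C x * f (x + u, translate x om) \<partial>count_space om \<partial>P)
    = (\<integral>\<^sup>+om. \<integral>\<^sup>+x. indicator C (x - u) * f (x, translate x om) \<partial>count_space om \<partial>P)"
   by (simp add: nn_integral_count_translate translate_translate)
 qed
 also have "... = (\<integral>\<^sup>+om. \<integral>\<^sup>+u. \<integral>\<^sup>+x. indicator C (x - u) * f (x, translate x om) \<partial>count_space om \<partial>lborel \<partial>P)"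
  using measurable_count_kernel[OF fst, of "\<lambda>p x. indicator C (x - snd p) * f (x, translate x (fst p))"] meas2
  by (intro PL.Fubini') (simp add: case_prod_beta)
 also have "... = (\<integral>\<^sup>+om. \<integral>\<^sup>+x. emeasure lborel C * f (x, translate x om) \<partial>count_space om \<partial>P)"
 proof (rule nn_integral_cong)
  fix om assume w: "om \<in> space P"
  have "(\<integral>\<^sup>+u. \<integral>\<^sup>+x. indicator C (x - u) * f (x, translate x om) \<partial>count_space om \<partial>lborel)
    = (\<integral>\<^sup>+x. (\<integral>\<^sup>+u. indicator C (x - u) * f (x, translate x om) \<partial>lborel) \<partial>count_space om)"
   using w by (intro nn_integral_count_space_nn_integral) (auto simp: space_P countable_locally_finite)
  also have "... = (\<integral>\<^sup>+x. emeasure lborel C * f (x, translate x om) \<partial>count_space om)"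
  proof (rule nn_integral_cong)
   fix x
   have "(\<integral>\<^sup>+u. indicator C (x - u) * f (x, translate x om) \<partial>lborel) = (\<integral>\<^sup>+u. indicator C (x - u) \<partial>lborel) * f (x, translate x om)"
    by (intro nn_integral_multc) measurable
   also have "(\<integral>\<^sup>+u. indicator C (x - u) \<partial>lborel) = emeasure lborel C"
    by (subst nn_integral_lborel_reflect) auto
   finally show "(\<integral>\<^sup>+u. indicator C (x - u) * f (x, translate x om) \<partial>lborel) = emeasure lborel C * f (x, translate x om)" .
  qed
  finally show "(\<integral>\<^sup>+u. \<integral>\<^sup>+x. indicator C (x - u) * f (x, translate x om) \<partial>count_space om \<partial>lborel)
   = (\<integral>\<^sup>+x. emeasure lborel C * f (x, translate x om) \<partial>count_space om)" .
 qed
 also have "... = (\<integral>\<^sup>+om. emeasure lborel C * (\<integral>\<^sup>+x. f (x, translate x om) \<partial>count_space om) \<partial>P)"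
  by (intro nn_integral_cong nn_integral_cmult) auto
 also have "... = emeasure lborel C * (\<integral>\<^sup>+om. \<integral>\<^sup>+x. f (x, translate x om) \<partial>count_space om \<partial>P)"
  by (intro nn_integral_cmult) measurable
 finally show ?thesis ..
qed

text \<open>Mecke's explicit formula for the Palm measure, with the unit cube as reference
  set.\<close>

definition palm_candidate :: "(real^'d) set measure" where
 "palm_candidate = measure_of locally_finite_sets (sets conf_space)
   (\<lambda>F. \<integral>\<^sup>+om. \<integral>\<^sup>+x. indicator (cbox 0 1) x * indicator F (translate x om) \<partial>count_space om \<partial>P)"

lemma sets_palm_candidate [measurable_cong]: "sets palm_candidate = sets conf_space"
 unfolding palm_candidate_def
 using sets.sets_measure_of_eq[of "conf_space :: (real^'d) set measure"] by simp

lemma emeasure_palm_candidate: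
 assumes "F \<in> sets conf_space"
 shows "emeasure palm_candidate F =
  (\<integral>\<^sup>+om. \<integral>\<^sup>+x. indicator (cbox 0 1) x * indicator F (translate x om) \<partial>count_space om \<partial>P)"
proof (rule emeasure_measure_of[OF palm_candidate_def])
 show "sets conf_space \<subseteq> Pow (locally_finite_sets :: (real^'d) set set)"
  using sets.space_closed[of conf_space] by simp
 show "F \<in> sets palm_candidate" using assms by (simp add: sets_palm_candidate)
 let ?mu = "\<lambda>F. \<integral>\<^sup>+om. \<integral>\<^sup>+x. indicator (cbox 0 1) x * indicator F (translate x om) \<partial>count_space om \<partial>P"
 show "positive (sets palm_candidate) ?mu" by (simp add: positive_def)
 show "countably_additive (sets palm_candidate) ?mu"
  unfolding countably_additive_def sets_palm_candidate
 proof safe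
  fix F :: "nat \<Rightarrow> (real^'d) set set"
  assume F: "range F \<subseteq> sets conf_space" and disj: "disjoint_family F"
  have [measurable]: "F i \<in> sets conf_space" for i using F by auto
  have "(\<Sum>i. ?mu (F i)) = (\<integral>\<^sup>+om. (\<Sum>i. \<integral>\<^sup>+x. indicator (cbox 0 1) x * indicator (F i) (translate x om) \<partial>count_space om) \<partial>P)"
   by (intro nn_integral_suminf[symmetric]) measurable
  also have "... = (\<integral>\<^sup>+om. (\<integral>\<^sup>+x. (\<Sum>i. indicator (cbox 0 1) x * indicator (F i) (translate x om)) \<partial>count_space om) \<partial>P)"
   by (intro nn_integral_cong nn_integral_suminf[symmetric]) auto
  also have "... = ?mu (\<Union>i. F i)"
   using disj by (simp add: suminf_indicator)
  finally show "(\<Sum>i. ?mu (F i)) = ?mu (\<Union>i. F i)" .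
 qed
qed

lemma nn_integral_palm_candidate:
 assumes "g \<in> borel_measurable conf_space"
 shows "(\<integral>\<^sup>+om. g om \<partial>palm_candidate) =
  (\<integral>\<^sup>+om. \<integral>\<^sup>+x. indicator (cbox 0 1) x * g (translate x om) \<partial>count_space om \<partial>P)"
 using assms
proof (induction g rule: borel_measurable_induct)
 case (cong f g)
 have "(\<integral>\<^sup>+om. f om \<partial>palm_candidate) = (\<integral>\<^sup>+om. g om \<partial>palm_candidate)"
  using cong(3) sets_eq_imp_space_eq[OF sets_palm_candidate] by (intro nn_integral_cong) auto
 moreover have "(\<integral>\<^sup>+om. \<integral>\<^sup>+x. indicator (cbox 0 1) x * f (translate x om) \<partial>count_space om \<partial>P)
  = (\<integral>\<^sup>+om. \<integral>\<^sup>+x. indicator (cbox 0 1) x * g (translate x om) \<partial>count_space om \<partial>P)"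
  using cong(3) by (intro nn_integral_cong) (auto simp: space_P translate_locally_finite)
 ultimately show ?case using cong.IH by simp
next
 case (set A)
 then show ?case by (simp add: emeasure_palm_candidate sets_palm_candidate)
next
 case (mult u c)
 note [measurable] = mult(2)
 have "(\<integral>\<^sup>+om. \<integral>\<^sup>+x. indicator (cbox 0 1) x * (c * u (translate x om)) \<partial>count_space om \<partial>P)
   = (\<integral>\<^sup>+om. c * (\<integral>\<^sup>+x. indicator (cbox 0 1) x * u (translate x om) \<partial>count_space om) \<partial>P)"
  by (intro nn_integral_cong) (subst nn_integral_cmult[symmetric], auto simp: mult_ac)
 also have "... = c * (\<integral>\<^sup>+om. \<integral>\<^sup>+x. indicator (cbox 0 1) x * u (translate x om) \<partial>count_space om \<partial>P)"
  by (intro nn_integral_cmult) measurable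
 finally show ?case using mult by (simp add: nn_integral_cmult)
next
 case (add u v)
 note [measurable] = add.hyps(1,3)
 have "(\<integral>\<^sup>+om. \<integral>\<^sup>+x. indicator (cbox 0 1) x * (v (translate x om) + u (translate x om)) \<partial>count_space om \<partial>P)
   = (\<integral>\<^sup>+om. (\<integral>\<^sup>+x. indicator (cbox 0 1) x * v (translate x om) \<partial>count_space om)
      + (\<integral>\<^sup>+x. indicator (cbox 0 1) x * u (translate x om) \<partial>count_space om) \<partial>P)"
  by (intro nn_integral_cong) (simp add: distrib_left nn_integral_add)
 also have "... = (\<integral>\<^sup>+om. \<integral>\<^sup>+x. indicator (cbox 0 1) x * v (translate x om) \<partial>count_space om \<partial>P)
      + (\<integral>\<^sup>+om. \<integral>\<^sup>+x. indicator (cbox 0 1) x * u (translate x om) \<partial>count_space om \<partial>P)"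
  by (intro nn_integral_add) measurable
 finally show ?case using add by (simp add: nn_integral_add add.commute)
next
 case (seq U)
 note [measurable] = seq(1)
 have inc: "incseq (\<lambda>i. indicator (cbox 0 1) x * U i (translate x om))" for x and om :: "(real^'d) set"
  using seq(3) by (auto simp: incseq_def le_fun_def intro!: mult_left_mono)
 have "(\<integral>\<^sup>+om. \<integral>\<^sup>+x. indicator (cbox 0 1) x * (SUP i. U i) (translate x om) \<partial>count_space om \<partial>P)
   = (\<integral>\<^sup>+om. (\<integral>\<^sup>+x. (SUP i. indicator (cbox 0 1) x * U i (translate x om)) \<partial>count_space om) \<partial>P)"
  by (simp add: SUP_mult_left_ennreal[symmetric] image_comp)
 also have "... = (\<integral>\<^sup>+om. (SUP i. \<integral>\<^sup>+x. indicator (cbox 0 1) x * U i (translate x om) \<partial>count_space om) \<partial>P)"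
  using inc by (intro nn_integral_cong nn_integral_monotone_convergence_SUP) (auto simp: incseq_def le_fun_def)
 also have "... = (SUP i. \<integral>\<^sup>+om. \<integral>\<^sup>+x. indicator (cbox 0 1) x * U i (translate x om) \<partial>count_space om \<partial>P)"
  using inc by (intro nn_integral_monotone_convergence_SUP) (auto simp: incseq_def le_fun_def intro!: nn_integral_mono)
 also have "... = (SUP i. \<integral>\<^sup>+om. U i om \<partial>palm_candidate)" using seq by simp
 also have "... = (\<integral>\<^sup>+om. (SUP i. U i) om \<partial>palm_candidate)"
  using seq by (simp add: nn_integral_monotone_convergence_SUP image_comp)
 finally show ?case by simp
qed

lemma emeasure_unit_cbox: "emeasure lborel (cbox 0 1 :: (real^'d) set) = 1"
proof -
 have "measure lborel (cbox 0 1 :: (real^'d) set) = (\<Prod>i\<in>(UNIV::'d set). 1)"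
  by (subst content_cbox_cart) (auto simp: interval_ne_empty_cart)
 moreover have "emeasure lborel (cbox 0 1 :: (real^'d) set) = ennreal (measure lborel (cbox 0 1 :: (real^'d) set))"
  using emeasure_lborel_cbox_finite by (intro emeasure_eq_ennreal_measure) (simp add: less_top)
 ultimately show ?thesis by simp
qed

text \<open>The definite description must be resolved before anything is known about
  \<open>palm_measure\<close>. Existence is \<open>campbell_swap\<close> for the unit cube; its
  total mass is the intensity, hence finite. Uniqueness follows by testing with products of the unit
  cube and an event.\<close>

lemma palm_measure_eq: "palm_measure P = palm_candidate"
 unfolding palm_measure_def
proof (rule the_equality, intro conjI allI impI)
 show "sets palm_candidate = sets conf_space" by (rule sets_palm_candidate)
 show "finite_measure palm_candidate"
 proof
  have "emeasure palm_candidate (space palm_candidate) = (\<integral>\<^sup>+om. 1 \<partial>palm_candidate)" by simp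
  also have "... = (\<integral>\<^sup>+om. \<integral>\<^sup>+x. indicator (cbox 0 1) x \<partial>count_space om \<partial>P)"
   by (subst nn_integral_palm_candidate) auto
  also have "... = (\<integral>\<^sup>+om. num_points om (cbox 0 1) \<partial>P)"
  proof (rule nn_integral_cong)
   fix om :: "(real^'d) set"
   have "(\<integral>\<^sup>+x. indicator (cbox 0 1) x \<partial>count_space om) = (\<integral>\<^sup>+x. indicator (om \<inter> cbox 0 1) x \<partial>count_space UNIV)"
    by (subst nn_integral_count_space_indicator; (rule nn_integral_cong)?; auto split: split_indicator)
   then show "(\<integral>\<^sup>+x. indicator (cbox 0 1) x \<partial>count_space om) = num_points om (cbox 0 1)"
    by (simp add: num_points_def)
  qed
  also have "... < \<infinity>" using stationary by (simp add: stationary_processes_def)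
  finally show "emeasure palm_candidate (space palm_candidate) \<noteq> \<infinity>" by simp
 qed
 fix f :: "(real^'d) \<times> (real^'d) set \<Rightarrow> ennreal" assume f [measurable]: "f \<in> borel_measurable (borel \<Otimes>\<^sub>M conf_space)"
 have "(\<integral>\<^sup>+om. \<integral>\<^sup>+x. f (x, translate x om) \<partial>count_space om \<partial>P)
   = (\<integral>\<^sup>+om. \<integral>\<^sup>+x. indicator (cbox 0 1) x * (\<integral>\<^sup>+u. f (u, translate x om) \<partial>lborel) \<partial>count_space om \<partial>P)"
  using campbell_swap[OF f, of "cbox 0 1"] by (simp add: emeasure_unit_cbox)
 also have "... = (\<integral>\<^sup>+om. \<integral>\<^sup>+x. f (x, om) \<partial>lborel \<partial>palm_candidate)"
  by (subst nn_integral_palm_candidate) measurable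
 finally show "(\<integral>\<^sup>+om. \<integral>\<^sup>+x. f (x, translate x om) \<partial>count_space om \<partial>P) = (\<integral>\<^sup>+om. \<integral>\<^sup>+x. f (x, om) \<partial>lborel \<partial>palm_candidate)" .
next
 fix Q :: "(real^'d) set measure"
 assume Q: "sets Q = sets conf_space \<and> finite_measure Q \<and>
  (\<forall>f. f \<in> borel_measurable (borel \<Otimes>\<^sub>M conf_space) \<longrightarrow>
   (\<integral>\<^sup>+om. \<integral>\<^sup>+x. f (x, translate x om) \<partial>count_space om \<partial>P) = (\<integral>\<^sup>+om. \<integral>\<^sup>+x. f (x, om) \<partial>lborel \<partial>Q))"
 then have [measurable_cong]: "sets Q = sets conf_space" by simp
 show "Q = palm_candidate"
 proof (rule measure_eqI)
  show "sets Q = sets palm_candidate" using Q by (simp add: sets_palm_candidate)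
  fix F assume F': "F \<in> sets Q"
  then have F [measurable]: "F \<in> sets conf_space" using Q by simp
  let ?f = "\<lambda>p :: (real^'d) \<times> (real^'d) set. indicator (cbox 0 1) (fst p) * indicator F (snd p) :: ennreal"
  have "?f \<in> borel_measurable (borel \<Otimes>\<^sub>M conf_space)" by measurable
  then have "(\<integral>\<^sup>+om. \<integral>\<^sup>+x. ?f (x, translate x om) \<partial>count_space om \<partial>P) = (\<integral>\<^sup>+om. \<integral>\<^sup>+x. ?f (x, om) \<partial>lborel \<partial>Q)"
   using Q by blast
  then have "emeasure palm_candidate F = (\<integral>\<^sup>+om. \<integral>\<^sup>+x. indicator (cbox 0 1 :: (real^'d) set) x * indicator F om \<partial>lborel \<partial>Q)"
   by (simp add: emeasure_palm_candidate F)
  also have "... = (\<integral>\<^sup>+om. indicator F om \<partial>Q)"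
   by (simp add: nn_integral_multc emeasure_unit_cbox)
  also have "... = emeasure Q F" using F' by simp
  finally show "emeasure Q F = emeasure palm_candidate F" ..
 qed
qed

lemma nn_integral_palm:
 assumes [measurable]: "g \<in> borel_measurable conf_space" and C [measurable]: "C \<in> sets borel"
 shows "emeasure lborel C * (\<integral>\<^sup>+om. g om \<partial>palm_measure P) =
  (\<integral>\<^sup>+om. \<integral>\<^sup>+x. g (translate x om) \<partial>count_space (om \<inter> C) \<partial>P)"
proof -
 let ?f = "\<lambda>p :: (real^'d) \<times> (real^'d) set. indicator C (fst p) * g (snd p) :: ennreal"
 have "(\<integral>\<^sup>+om. \<integral>\<^sup>+x. g (translate x om) \<partial>count_space (om \<inter> C) \<partial>P) = (\<integral>\<^sup>+om. \<integral>\<^sup>+x. ?f (x, translate x om) \<partial>count_space om \<partial>P)"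
 proof (rule nn_integral_cong)
  fix om :: "(real^'d) set"
  show "(\<integral>\<^sup>+x. g (translate x om) \<partial>count_space (om \<inter> C)) = (\<integral>\<^sup>+x. ?f (x, translate x om) \<partial>count_space om)"
   by (subst (1 2) nn_integral_count_space_indicator) (auto intro!: nn_integral_cong split: split_indicator)
 qed
 also have "... = (\<integral>\<^sup>+om. \<integral>\<^sup>+x. indicator (cbox 0 1) x * (\<integral>\<^sup>+u. ?f (u, translate x om) \<partial>lborel) \<partial>count_space om \<partial>P)"
  using campbell_swap[of ?f "cbox 0 1"] by (simp add: emeasure_unit_cbox)
 also have "... = (\<integral>\<^sup>+om. (\<integral>\<^sup>+u. ?f (u, om) \<partial>lborel) \<partial>palm_candidate)"
  by (subst nn_integral_palm_candidate) measurable
 also have "... = (\<integral>\<^sup>+om. emeasure lborel C * g om \<partial>palm_candidate)"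
  by (intro nn_integral_cong) (simp add: nn_integral_multc)
 also have "... = emeasure lborel C * (\<integral>\<^sup>+om. g om \<partial>palm_candidate)"
  by (intro nn_integral_cmult) measurable
 finally show ?thesis by (simp add: palm_measure_eq)
qed

lemma sets_palm_measure [measurable_cong]: "sets (palm_measure P) = sets conf_space"
 by (simp add: palm_measure_eq sets_palm_candidate)

lemma space_palm_measure: "space (palm_measure P) = locally_finite_sets"
 using sets_eq_imp_space_eq[OF sets_palm_measure] by simp

end

text \<open>On a finite measure a lower bound makes the negative part integrable, so the difference
  in \<open>ext_integral\<close> is never indefinite and shifting by \<open>c\<close> is legitimate
  even when the value is infinite. Palm integrals thereby become integrals of nonnegative
  functions.\<close>

lemma ext_integral_shift:
 assumes "finite_measure Q" and h [measurable]: "h \<in> borel_measurable Q" and c: "\<And>x. x \<in> space Q \<Longrightarrow> c \<le> h x"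
 shows "ext_integral Q h = enn2ereal (\<integral>\<^sup>+x. ennreal (h x - c) \<partial>Q) + ereal (c * measure Q (space Q))"
proof -
 interpret finite_measure Q by fact
 have neg: "(\<integral>\<^sup>+x. ennreal (- h x) \<partial>Q) < \<infinity>"
 proof -
  have "(\<integral>\<^sup>+x. ennreal (- h x) \<partial>Q) \<le> (\<integral>\<^sup>+x. ennreal (- c) \<partial>Q)"
   using c by (intro nn_integral_mono ennreal_leI) auto
  also have "... < \<infinity>" by (simp add: emeasure_eq_measure flip: ennreal_mult'')
  finally show ?thesis .
 qed
 show ?thesis
 proof (cases "(\<integral>\<^sup>+x. ennreal (h x - c) \<partial>Q) = \<infinity>")
  case True
  have "(\<integral>\<^sup>+x. ennreal (h x - c) \<partial>Q) \<le> (\<integral>\<^sup>+x. ennreal (h x) + ennreal \<bar>c\<bar> \<partial>Q)"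
   by (intro nn_integral_mono) (auto simp: ennreal_plus_if intro!: ennreal_leI)
  also have "... = (\<integral>\<^sup>+x. ennreal (h x) \<partial>Q) + (\<integral>\<^sup>+x. ennreal \<bar>c\<bar> \<partial>Q)"
   by (intro nn_integral_add) auto
  finally have "(\<integral>\<^sup>+x. ennreal (h x) \<partial>Q) = \<infinity>"
   using True by (auto simp: top_unique ennreal_mult_eq_top_iff)
  then show ?thesis
   using True neg unfolding ext_integral_def
   by (cases "enn2ereal (\<integral>\<^sup>+x. ennreal (- h x) \<partial>Q)") (auto simp: less_top[symmetric] enn2ereal_eq_top_iff)
 next
  case False
  then have i: "integrable Q (\<lambda>x. h x - c)"
   using c by (intro integrableI_nonneg) (auto simp: less_top[symmetric])
  then have ih: "integrable Q h"
   using Bochner_Integration.integrable_add[OF i integrable_const[of c]] by simp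
  have "(\<integral>\<^sup>+x. ennreal (h x - c) \<partial>Q) = ennreal (\<integral>x. h x - c \<partial>Q)"
   using c i by (intro nn_integral_eq_integral) auto
  moreover have "0 \<le> (\<integral>x. h x - c \<partial>Q)" using c by (intro integral_nonneg_AE AE_I2) auto
  moreover have "(\<integral>x. h x - c \<partial>Q) = (\<integral>x. h x \<partial>Q) - c * measure Q (space Q)"
   using ih by simp
  moreover have "ext_integral Q h = ereal (\<integral>x. h x \<partial>Q)"
  proof -
   have i: "integrable Q (\<lambda>x. max 0 (h x))" "integrable Q (\<lambda>x. max 0 (- h x))"
    using ih by auto
   have "(\<integral>\<^sup>+x. ennreal (h x) \<partial>Q) = ennreal (\<integral>x. max 0 (h x) \<partial>Q)"
     "(\<integral>\<^sup>+x. ennreal (- h x) \<partial>Q) = ennreal (\<integral>x. max 0 (- h x) \<partial>Q)"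
    using nn_integral_eq_integral[OF i(1)] nn_integral_eq_integral[OF i(2)] by simp_all
   moreover have "(\<integral>x. h x \<partial>Q) = (\<integral>x. max 0 (h x) \<partial>Q) - (\<integral>x. max 0 (- h x) \<partial>Q)"
    unfolding Bochner_Integration.integral_diff[OF i, symmetric]
    by (intro Bochner_Integration.integral_cong) (auto simp: max_def)
   ultimately show ?thesis
    by (simp add: ext_integral_def enn2ereal_ennreal integral_nonneg_AE)
  qed
  ultimately show ?thesis by (simp add: enn2ereal_ennreal)
 qed
qed

section \<open>Grids of cubes\<close>

definition cube :: "real \<Rightarrow> (real^'d::finite) set" where
 "cube s = {x. \<forall>i. \<bar>x $ i\<bar> \<le> s / 2}"

lemma cube_eq_cbox: "cube s = cbox (\<chi> i. - (s / 2)) (\<chi> i. s / 2)"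
proof -
 have "\<bar>y\<bar> \<le> s / 2 \<longleftrightarrow> - (s / 2) \<le> y \<and> y \<le> s / 2" for y by linarith
 then show ?thesis by (simp add: cube_def mem_box_cart set_eq_iff)
qed

lemma window_eq_cube: "(window lam n :: (real^'d::finite) set) = cube (side TYPE('d) lam n)"
 by (simp add: window_def cube_eq_cbox)

lemma borel_cube [measurable]: "cube s \<in> sets borel"
 by (simp add: cube_eq_cbox)

lemma bounded_cube: "bounded (cube s)"
 by (simp add: cube_eq_cbox bounded_cbox)

lemma emeasure_cube_finite: "emeasure lborel (cube s :: (real^'d::finite) set) < \<infinity>"
 using emeasure_lborel_cbox_finite by (auto simp: cube_eq_cbox less_top)

lemma measure_cube: "0 \<le> s \<Longrightarrow> measure lborel (cube s :: (real^'d::finite) set) = s ^ CARD('d)"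
 unfolding cube_eq_cbox by (subst content_cbox_cart) (auto simp: interval_ne_empty_cart)

definition grid :: "nat \<Rightarrow> ('d::finite \<Rightarrow> nat) set" where
 "grid k = {w. \<forall>i. w i < k}"

lemma grid_eq_PiE: "grid k = PiE UNIV (\<lambda>_. {..<k})"
 by (auto simp: grid_def PiE_def)

lemma finite_grid: "finite (grid k)"
 unfolding grid_eq_PiE by (intro finite_PiE) auto

lemma card_grid: "card (grid k :: ('d::finite \<Rightarrow> nat) set) = k ^ CARD('d)"
 unfolding grid_eq_PiE by (subst card_PiE) auto

text \<open>The centres of the \<open>k\<^sup>d\<close> cells into which a centred cube of side \<open>L\<close> is divided.\<close>

definition center :: "real \<Rightarrow> nat \<Rightarrow> ('d \<Rightarrow> nat) \<Rightarrow> real ^ 'd::finite" where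
 "center L k w = (\<chi> i. (real (w i) + 1 / 2) * (L / real k) - L / 2)"

lemma mem_tile: "x \<in> translate (- t) (cube s) \<longleftrightarrow> (\<forall>i. \<bar>x $ i - t $ i\<bar> \<le> s / 2)"
 by (simp add: mem_translate cube_def)

lemma center_diff: "center L k w $ i - center L k w' $ i = (real (w i) - real (w' i)) * (L / real k)"
 by (simp add: center_def algebra_simps)

text \<open>Different indices differ by at least one in some coordinate, where the centres are at
  least a grid spacing apart; each point deviates from its centre by at most \<open>s / 2\<close>.
  The remainder is the corridor width.\<close>

lemma tile_separation:
 assumes "w \<noteq> w'" "0 \<le> L" "x \<in> translate (- center L k w) (cube s)" "y \<in> translate (- center L k w') (cube s)"
 shows "\<exists>i. L / real k - s \<le> \<bar>x $ i - y $ i\<bar>"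
proof -
 obtain i where i: "w i \<noteq> w' i" using assms(1) by auto
 then have "1 \<le> \<bar>real (w i) - real (w' i)\<bar>" by linarith
 then have "L / real k \<le> \<bar>real (w i) - real (w' i)\<bar> * (L / real k)"
  using assms(2) mult_right_mono[of 1 _ "L / real k"] by fastforce
 also have "... = \<bar>center L k w $ i - center L k w' $ i\<bar>"
  using assms(2) by (simp add: center_diff abs_mult)
 finally show ?thesis
  using assms(3,4)[unfolded mem_tile, THEN spec, of i] by (intro exI[of _ i]) linarith
qed

text \<open>Tiles are centred in their grid cells, so half a corridor width also separates the
  outermost tiles from the boundary of the window.\<close>

lemma tile_inside:
 assumes "w \<in> grid k" "0 \<le> L" "x \<in> translate (- center L k w) (cube s)"
 shows "\<bar>x $ i\<bar> \<le> L / 2 - (L / real k - s) / 2"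
proof -
 have w: "w i < k" using assms(1) by (simp add: grid_def)
 define q where "q = L / real k"
 have 1: "0 \<le> real (w i) * q" using assms(2) by (simp add: q_def)
 have "(real (w i) + 1) * q \<le> real k * q"
  using w assms(2) by (intro mult_right_mono) (auto simp: q_def)
 moreover have "real k * q = L" using w by (simp add: q_def)
 ultimately have 2: "real (w i) * q + q \<le> L" by (simp add: distrib_right)
 have "center L k w $ i = real (w i) * q + q / 2 - L / 2"
 proof -
  have "center L k w $ i = (real (w i) + 1 / 2) * q - L / 2" by (simp add: center_def q_def)
  then show ?thesis by (simp only: distrib_right)
 qed
 then show ?thesis
  using 1 2 assms(3)[unfolded mem_tile, THEN spec, of i]
  unfolding q_def[symmetric] diff_divide_distrib by linarith
qed

lemma tile_subset:
 assumes "w \<in> grid k" "0 \<le> L" "s \<le> L / real k"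
 shows "translate (- center L k w) (cube s) \<subseteq> cube L"
proof
 fix x assume x: "x \<in> translate (- center L k w) (cube s)"
 show "x \<in> cube L"
  unfolding cube_def
 proof safe
  fix i
  have "\<bar>x $ i\<bar> \<le> L / 2 - (L / real k - s) / 2" using tile_inside[OF assms(1,2) x] .
  also have "... \<le> L / 2"
  proof -
   define q where "q = L / real k"
   show ?thesis using assms(3) unfolding q_def[symmetric] by simp
  qed
  finally show "\<bar>x $ i\<bar> \<le> L / 2" .
 qed
qed

lemma tile_disjoint:
 assumes "0 \<le> L" "s < L / real k"
 shows "disjoint_family_on (\<lambda>w. translate (- center L k w) (cube s)) I"
 unfolding disjoint_family_on_def
proof safe
 fix w w' :: "'a \<Rightarrow> nat" and x assume ne: "w \<noteq> w'"
  and x: "x \<in> translate (- center L k w) (cube s)" "x \<in> translate (- center L k w') (cube s)"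
 show "x \<in> {}" using tile_separation[OF ne assms(1) x] assms(2) by auto
qed

section \<open>The specific entropy\<close>

text \<open>Independence of a Poisson process on disjoint translates of one set, in multiplicative
  form: restrict to the union of the translates, write it as a superposition, factorise, and move
  every factor back to \<open>C\<close>.\<close>

lemma nn_integral_ppp_blocks:
 fixes C W :: "(real^'d::finite) set"
 assumes lam: "0 < lam" and I: "finite I" and C [measurable]: "C \<in> sets borel" and finC: "emeasure lborel C < \<infinity>"
  and W [measurable]: "W \<in> sets borel" and finW: "emeasure lborel W < \<infinity>"
  and disj: "disjoint_family_on (\<lambda>i. translate (- t i) C) I" and sub: "\<And>i. i \<in> I \<Longrightarrow> translate (- t i) C \<subseteq> W"
  and g [measurable]: "\<And>i. g i \<in> borel_measurable conf_space"
 shows "(\<integral>\<^sup>+om. (\<Prod>i\<in>I. g i (translate (t i) om \<inter> C)) \<partial>ppp lam W) = (\<Prod>i\<in>I. \<integral>\<^sup>+om. g i om \<partial>ppp lam C)"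
proof -
 let ?T = "\<lambda>i. translate (- t i) C"
 have T [measurable]: "?T i \<in> sets borel" for i using C by (rule borel_translate)
 have finT: "emeasure lborel (?T i) < \<infinity>" for i using finC by (simp add: emeasure_translate)
 note [measurable_cong] = sets_ppp[OF lam C finC] sets_ppp[OF lam W finW]
 have sT [measurable_cong]: "sets (ppp lam (?T i)) = sets conf_space" for i by (intro sets_ppp lam T finT)
 have U [measurable]: "(\<Union>i\<in>I. ?T i) \<in> sets borel" using I by (intro sets.finite_UN) auto
 have WU: "W \<inter> (\<Union>i\<in>I. ?T i) = (\<Union>i\<in>I. ?T i)" using sub by auto
 have loc: "translate (t i) om \<inter> C = translate (t i) (om \<inter> ?T i)" for i and om :: "(real^'d) set"
  by (simp add: translate_Int translate_translate)
 interpret product_prob_space "\<lambda>i. ppp lam (?T i)" I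
  by (intro product_prob_spaceI prob_space_ppp lam T finT)
 have mg: "(\<lambda>om. g i (translate (t i) om \<inter> C)) \<in> borel_measurable conf_space" for i by measurable
 have mG: "(\<lambda>om. \<Prod>i\<in>I. g i (translate (t i) om \<inter> C)) \<in> borel_measurable conf_space"
  by (intro borel_measurable_prod_ennreal mg)
 have "(\<integral>\<^sup>+om. (\<Prod>i\<in>I. g i (translate (t i) om \<inter> C)) \<partial>ppp lam W)
   = (\<integral>\<^sup>+om. (\<Prod>i\<in>I. g i (translate (t i) (om \<inter> (\<Union>i\<in>I. ?T i)) \<inter> C)) \<partial>ppp lam W)"
 proof (intro nn_integral_cong prod.cong refl)
  fix i and om :: "(real^'d) set" assume "i \<in> I"
  then have "om \<inter> (\<Union>i\<in>I. ?T i) \<inter> ?T i = om \<inter> ?T i" by auto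
  then show "g i (translate (t i) om \<inter> C) = g i (translate (t i) (om \<inter> (\<Union>i\<in>I. ?T i)) \<inter> C)"
   by (simp add: loc)
 qed
 also have "... = (\<integral>\<^sup>+om. (\<Prod>i\<in>I. g i (translate (t i) om \<inter> C)) \<partial>distr (ppp lam W) conf_space (\<lambda>om. om \<inter> (\<Union>i\<in>I. ?T i)))"
  using mG by (intro nn_integral_distr[symmetric]) measurable
 also have "distr (ppp lam W) conf_space (\<lambda>om. om \<inter> (\<Union>i\<in>I. ?T i)) = ppp lam (\<Union>i\<in>I. ?T i)"
  using ppp_restrict[OF lam W finW U] by (simp add: WU)
 also have "... = distr (PiM I (\<lambda>i. ppp lam (?T i))) conf_space (\<lambda>om. \<Union>i\<in>I. om i)"
  by (rule ppp_superposition(2)[symmetric]) (use lam I finT disj in auto)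
 also have "(\<integral>\<^sup>+om. (\<Prod>i\<in>I. g i (translate (t i) om \<inter> C)) \<partial>...) =
   (\<integral>\<^sup>+om. (\<Prod>i\<in>I. g i (translate (t i) (\<Union>i\<in>I. om i) \<inter> C)) \<partial>PiM I (\<lambda>i. ppp lam (?T i)))"
  using mG by (intro nn_integral_distr ppp_superposition(1)) (use lam I finT disj in auto)
 also have "... = (\<integral>\<^sup>+om. (\<Prod>i\<in>I. g i (translate (t i) (om i) \<inter> C)) \<partial>PiM I (\<lambda>i. ppp lam (?T i)))"
 proof (rule nn_integral_cong_AE)
  have "AE om in PiM I (\<lambda>i. ppp lam (?T i)). \<forall>i\<in>I. om i \<subseteq> ?T i"
   using I by (intro AE_finite_allI AE_component AE_ppp_subset lam T finT) auto
  then show "AE om in PiM I (\<lambda>i. ppp lam (?T i)). (\<Prod>i\<in>I. g i (translate (t i) (\<Union>i\<in>I. om i) \<inter> C))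
    = (\<Prod>i\<in>I. g i (translate (t i) (om i) \<inter> C))"
  proof eventually_elim
   case (elim om)
   have "(\<Union>j\<in>I. om j) \<inter> ?T i = om i \<inter> ?T i" if "i \<in> I" for i
    using elim that disj by (fastforce simp: disjoint_family_on_def)
   then show ?case by (intro prod.cong refl) (simp add: loc)
  qed
 qed
 also have "... = (\<Prod>i\<in>I. \<integral>\<^sup>+om. g i (translate (t i) om \<inter> C) \<partial>ppp lam (?T i))"
  using mg by (intro product_nn_integral_prod I) (auto simp: measurable_cong_sets[OF sT refl])
 also have "... = (\<Prod>i\<in>I. \<integral>\<^sup>+om. g i om \<partial>ppp lam C)"
 proof (intro prod.cong refl)
  fix i assume "i \<in> I"
  have "ppp lam C = distr (ppp lam (?T i)) conf_space (translate (t i))"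
   using ppp_translate[OF lam T finT, of i "t i"] by (simp add: translate_translate)
  then have "(\<integral>\<^sup>+om. g i (om \<inter> C) \<partial>ppp lam C) = (\<integral>\<^sup>+om. g i (translate (t i) om \<inter> C) \<partial>ppp lam (?T i))"
   by (simp add: nn_integral_distr)
  moreover have "(\<integral>\<^sup>+om. g i (om \<inter> C) \<partial>ppp lam C) = (\<integral>\<^sup>+om. g i om \<partial>ppp lam C)"
   using AE_ppp_subset[OF lam C finC] by (intro nn_integral_cong_AE) (auto elim!: eventually_mono simp: Int_absorb2)
  ultimately show "(\<integral>\<^sup>+om. g i (translate (t i) om \<inter> C) \<partial>ppp lam (?T i)) = (\<integral>\<^sup>+om. g i om \<partial>ppp lam C)" by simp
 qed
 finally show ?thesis .
qed

abbreviation restriction :: "real \<Rightarrow> (real^'d::finite) set measure \<Rightarrow> nat \<Rightarrow> (real^'d) set measure" where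
 "restriction lam P n \<equiv> distr P conf_space (\<lambda>om. om \<inter> window lam n)"

lemma (in stationary_process) prob_space_restriction: "prob_space (restriction lam P n)"
 by (intro prob_space_distr) measurable

lemma prob_space_poisson: "prob_space (poisson_process lam n :: (real^'d::finite) set measure)"
 and sets_poisson: "sets (poisson_process lam n :: (real^'d) set measure) = sets conf_space"
 if "0 < lam" "0 < n"
 unfolding poisson_process_eq_ppp[OF that]
 using that(1) by (intro prob_space_ppp sets_ppp borel_window emeasure_window_finite; assumption)+

text \<open>A test function on the small window is copied to \<open>k ^ CARD('d)\<close> disjoint
  translates inside the large one and summed. Under \<open>P\<close> stationarity makes every copy
  contribute the same mean; under the Poisson process the exponential moment factorises by
  independence. Division by the number of copies gives the bound.\<close>

lemma (in stationary_process) entropy_bound_subwindow: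
 assumes lam: "0 < lam" and m: "0 < m" and n: "0 < n" and k: "0 < k"
  and fits: "real k * side TYPE('d) lam m < side TYPE('d) lam n"
  and eb: "entropy_bound K (restriction lam P n) (poisson_process lam n)"
 shows "entropy_bound (K / real (k ^ CARD('d))) (restriction lam P m) (poisson_process lam m)"
 unfolding entropy_bound_def
proof safe
 let ?L = "side TYPE('d) lam n" and ?s = "side TYPE('d) lam m" and ?N = "real (k ^ CARD('d))"
 let ?t = "center ?L k :: _ \<Rightarrow> real^'d" and ?W = "window lam m :: (real^'d) set"
 interpret R: prob_space "restriction lam P n" by (rule prob_space_restriction)
 interpret Pn: prob_space "poisson_process lam n :: (real^'d) set measure" using lam n by (rule prob_space_poisson)
 interpret Pm: prob_space "poisson_process lam m :: (real^'d) set measure" using lam m by (rule prob_space_poisson)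
 note [measurable_cong] = sets_poisson[OF lam n, where 'd='d] sets_poisson[OF lam m, where 'd='d]
 have sp: "space (poisson_process lam m :: (real^'d) set measure) = locally_finite_sets"
   "space (poisson_process lam n :: (real^'d) set measure) = locally_finite_sets"
  using sets_eq_imp_space_eq[OF sets_poisson[OF lam m, where 'd='d]] sets_eq_imp_space_eq[OF sets_poisson[OF lam n, where 'd='d]] by simp_all
 have sL: "?s < ?L / real k" using fits k by (simp add: field_simps)
 have L0: "0 \<le> ?L" by (rule side_nonneg)
 have N0: "0 < ?N" using k by simp
 fix g b assume "g \<in> borel_measurable (poisson_process lam m :: (real^'d) set measure)"
  and "\<forall>x\<in>space (poisson_process lam m :: (real^'d) set measure). \<bar>g x\<bar> \<le> (b::real)"
 then have g [measurable]: "g \<in> borel_measurable conf_space" and b: "\<And>x. x \<in> locally_finite_sets \<Longrightarrow> \<bar>g x\<bar> \<le> b"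
  by (auto simp: sp measurable_cong_sets[OF sets_poisson[OF lam m, where 'd='d] refl])
 have loc: "translate (?t w) (om \<inter> window lam n) \<inter> ?W = translate (?t w) om \<inter> ?W" if "w \<in> grid k" for w and om :: "(real^'d) set"
 proof -
  have "translate (- ?t w) ?W \<subseteq> window lam n"
   unfolding window_eq_cube using that L0 sL by (intro tile_subset) auto
  then have "x + ?t w \<in> window lam n" if "x \<in> ?W" for x
   using that by (auto simp: mem_translate subset_iff)
  then show ?thesis by (auto simp: mem_translate)
 qed
 define G where "G = (\<lambda>om. \<Sum>w\<in>(grid k :: ('d \<Rightarrow> nat) set). g (translate (?t w) om \<inter> ?W))"
 have mg [measurable]: "(\<lambda>om. g (translate (?t w) om \<inter> ?W)) \<in> borel_measurable conf_space" for w by measurable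
 have mG [measurable]: "G \<in> borel_measurable conf_space" unfolding G_def by measurable
 have gb: "\<bar>g (translate (?t w) om \<inter> ?W)\<bar> \<le> b" if "om \<in> locally_finite_sets" for w om
  using that by (intro b locally_finite_Int translate_locally_finite)
 have Gb: "\<bar>G om\<bar> \<le> ?N * b" if "om \<in> locally_finite_sets" for om
 proof -
  have "\<bar>G om\<bar> \<le> (\<Sum>w\<in>(grid k :: ('d \<Rightarrow> nat) set). b)"
   unfolding G_def using gb[OF that] by (intro order_trans[OF sum_abs] sum_mono)
  then show ?thesis by (simp add: card_grid)
 qed
 have "(\<integral>om. G om \<partial>restriction lam P n) \<le> K + ln (\<integral>om. exp (G om) \<partial>poisson_process lam n)"
  using eb by (rule entropy_boundD) (use Gb in \<open>auto simp: sp\<close>)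
 moreover have "(\<integral>om. G om \<partial>restriction lam P n) = ?N * (\<integral>om. g om \<partial>restriction lam P m)"
 proof -
  have int: "integrable P (\<lambda>om. g (translate (?t w) om \<inter> ?W))" for w
   using gb by (intro integrable_bounded_fun(1)[where b=b]) (auto simp: space_P)
  have "(\<integral>om. G om \<partial>restriction lam P n) = (\<integral>om. G (om \<inter> window lam n) \<partial>P)"
   by (intro integral_distr) auto
  also have "... = (\<integral>om. (\<Sum>w\<in>(grid k :: ('d \<Rightarrow> nat) set). g (translate (?t w) om \<inter> ?W)) \<partial>P)"
   by (simp add: G_def loc)
  also have "... = (\<Sum>w\<in>(grid k :: ('d \<Rightarrow> nat) set). \<integral>om. g (translate (?t w) om \<inter> ?W) \<partial>P)"
   using int by (intro Bochner_Integration.integral_sum)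
  also have "... = (\<Sum>w\<in>(grid k :: ('d \<Rightarrow> nat) set). \<integral>om. g om \<partial>restriction lam P m)"
  proof (intro sum.cong refl)
   fix w
   have "(\<integral>om. g (translate (?t w) om \<inter> ?W) \<partial>P) = (\<integral>om. g (om \<inter> ?W) \<partial>distr P conf_space (translate (?t w)))"
    by (intro integral_distr[symmetric]) auto
   also have "... = (\<integral>om. g om \<partial>restriction lam P m)"
    unfolding distr_translate by (intro integral_distr[symmetric]) auto
   finally show "(\<integral>om. g (translate (?t w) om \<inter> ?W) \<partial>P) = (\<integral>om. g om \<partial>restriction lam P m)" .
  qed
  finally show ?thesis by (simp add: card_grid)
 qed
 moreover have "ln (\<integral>om. exp (G om) \<partial>poisson_process lam n) = ?N * ln (\<integral>om. exp (g om) \<partial>poisson_process lam m)"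
 proof -
  let ?e = "\<integral>om. exp (g om) \<partial>(poisson_process lam m :: (real^'d) set measure)"
  have im: "integrable (poisson_process lam m) g" "integrable (poisson_process lam m) (\<lambda>om. exp (g om))"
   using b by (auto intro!: Pm.integrable_bounded_fun[where b=b] simp: sp)
  have pos: "0 < ?e" using im by (rule Pm.expectation_exp_pos)
  have ni: "integrable (poisson_process lam n) (\<lambda>om. exp (G om))"
   using Gb by (intro Pn.integrable_bounded_fun(2)) (auto simp: sp)
  have "ennreal (\<integral>om. exp (G om) \<partial>poisson_process lam n) = (\<integral>\<^sup>+om. ennreal (exp (G om)) \<partial>poisson_process lam n)"
   using ni by (intro nn_integral_eq_integral[symmetric]) auto
  also have "... = (\<integral>\<^sup>+om. (\<Prod>w\<in>(grid k :: ('d \<Rightarrow> nat) set). ennreal (exp (g (translate (?t w) om \<inter> ?W)))) \<partial>poisson_process lam n)"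
   by (simp add: G_def exp_sum finite_grid prod_ennreal)
  also have "... = (\<Prod>w\<in>(grid k :: ('d \<Rightarrow> nat) set). \<integral>\<^sup>+om. ennreal (exp (g om)) \<partial>poisson_process lam m)"
   unfolding poisson_process_eq_ppp[OF lam n] poisson_process_eq_ppp[OF lam m]
  proof (rule nn_integral_ppp_blocks)
   show "disjoint_family_on (\<lambda>i. translate (- ?t i) ?W) (grid k)"
    unfolding window_eq_cube using L0 sL by (rule tile_disjoint)
   show "translate (- ?t i) ?W \<subseteq> window lam n" if "i \<in> grid k" for i
    unfolding window_eq_cube using that L0 sL by (intro tile_subset) auto
  qed (use lam in \<open>simp_all add: finite_grid emeasure_window_finite[simplified]\<close>)
  also have "... = (\<Prod>w\<in>(grid k :: ('d \<Rightarrow> nat) set). ennreal ?e)"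
   using im by (simp add: nn_integral_eq_integral)
  also have "... = ennreal (?e ^ (k ^ CARD('d)))"
   using pos by (simp add: card_grid ennreal_power)
  finally have "(\<integral>om. exp (G om) \<partial>poisson_process lam n) = ?e ^ (k ^ CARD('d))"
   using pos by (subst (asm) ennreal_inj) (auto intro!: integral_nonneg_AE)
  then show ?thesis using pos by (simp add: ln_realpow)
 qed
 ultimately have "?N * (\<integral>om. g om \<partial>restriction lam P m) \<le> K + ?N * ln (\<integral>om. exp (g om) \<partial>poisson_process lam m)" by simp
 then show "(\<integral>om. g om \<partial>restriction lam P m) \<le> K / ?N + ln (\<integral>om. exp (g om) \<partial>poisson_process lam m)"
  using N0 by (simp add: field_simps)
qed

section \<open>Existence of the specific entropy\<close>

lemma filterlim_side: "0 < lam \<Longrightarrow> filterlim (\<lambda>n. side TYPE('d::finite) lam n) at_top sequentially"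
proof -
 assume lam: "0 < lam"
 have "0 < 1 / real CARD('d)" by simp
 then show ?thesis
  unfolding side_def using lam by real_asymp
qed

definition entropy_density_seq :: "real \<Rightarrow> (real^'d::finite) set measure \<Rightarrow> nat \<Rightarrow> ereal" where
 "entropy_density_seq lam P n = ereal (1 / measure lborel (window lam n :: (real ^ 'd) set)) *
    relative_entropy (restriction lam P n) (poisson_process lam n)"

lemma (in stationary_process) relative_entropy_restriction_iff:
 assumes "0 < lam" "0 < n"
 shows "relative_entropy (restriction lam P n) (poisson_process lam n) \<le> ereal K
  \<longleftrightarrow> entropy_bound K (restriction lam P n) (poisson_process lam n)"
 using assms by (intro relative_entropy_le_iff_entropy_bound prob_space_restriction prob_space_poisson) (simp_all add: sets_poisson)

lemma (in stationary_process) relative_entropy_restriction_nonneg: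
 assumes "0 < lam" "0 < n"
 shows "0 \<le> relative_entropy (restriction lam P n) (poisson_process lam n)"
proof (cases "relative_entropy (restriction lam P n) (poisson_process lam n)")
 case (real K)
 then have "entropy_bound K (restriction lam P n) (poisson_process lam n)"
  using relative_entropy_restriction_iff[OF assms, of K] by simp
 then have "0 \<le> K" using prob_space_poisson[OF assms] by (rule entropy_bound_nonneg[rotated])
 then show ?thesis using real by simp
next
 case MInf
 then show ?thesis by (auto simp: relative_entropy_def split: if_splits)
qed simp

lemma (in stationary_process) relative_entropy_superadditive:
 assumes lam: "0 < lam" and m: "0 < m" and n: "0 < n" and k: "0 < k"
  and fits: "real k * side TYPE('d) lam m < side TYPE('d) lam n"
 shows "ereal (real (k ^ CARD('d))) * relative_entropy (restriction lam P m) (poisson_process lam m)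
  \<le> relative_entropy (restriction lam P n) (poisson_process lam n)"
proof (cases "relative_entropy (restriction lam P n) (poisson_process lam n)")
 case (real K)
 then have "entropy_bound K (restriction lam P n) (poisson_process lam n)"
  using relative_entropy_restriction_iff[OF lam n, of K] by simp
 then have "entropy_bound (K / real (k ^ CARD('d))) (restriction lam P m) (poisson_process lam m)"
  by (rule entropy_bound_subwindow[OF lam m n k fits])
 then have "relative_entropy (restriction lam P m) (poisson_process lam m) \<le> ereal (K / real (k ^ CARD('d)))"
  using relative_entropy_restriction_iff[OF lam m] by blast
 then have "ereal (real (k ^ CARD('d))) * relative_entropy (restriction lam P m) (poisson_process lam m)
   \<le> ereal (real (k ^ CARD('d))) * ereal (K / real (k ^ CARD('d)))"
  by (intro ereal_mult_left_mono) auto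
 then show ?thesis using k real by simp
next
 case MInf
 then show ?thesis using relative_entropy_restriction_nonneg[OF lam n] by simp
qed simp

text \<open>A Fekete argument: packing copies of window \<open>m\<close> into window
  \<open>n\<close> gives that each term is at most the limit inferior, hence the limit superior is
  too. Since \<open>lim\<close> is a description operator, convergence has to be known before
  \<open>specific_entropy\<close> can be used at all.\<close>

lemma (in stationary_process) entropy_density_seq_tendsto:
 assumes lam: "0 < lam"
 shows "entropy_density_seq lam P \<longlonglongrightarrow> specific_entropy lam P"
proof -
 let ?e = "entropy_density_seq lam P" and ?s = "\<lambda>n. side TYPE('d) lam n" and ?d = "CARD('d)"
 let ?R = "\<lambda>n. relative_entropy (restriction lam P n) (poisson_process lam n)"
 have e: "?e n = ereal (1 / ?s n ^ ?d) * ?R n" for n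
  by (simp add: entropy_density_seq_def measure_window[OF lam] side_power[OF lam])
 have e0: "0 \<le> ?e n" if "0 < n" for n
  unfolding e using relative_entropy_restriction_nonneg[OF lam that] side_nonneg[where 'd='d, of lam n] by simp
 have le: "?e m \<le> liminf ?e" if m: "0 < m" for m
 proof -
  have sm: "0 < ?s m" using lam m by (rule side_pos)
  \<comment> \<open>Number of copies per direction: the largest integer strictly below the ratio of
    the sides. Strictness keeps the closed subwindows disjoint.\<close>
  define k where "k = (\<lambda>n. nat \<lceil>?s n / ?s m\<rceil> - 1)"
  have lim1: "filterlim (\<lambda>n. ?s n / ?s m) at_top sequentially"
   using filterlim_side[OF lam, where 'd='d] sm
   by (simp add: divide_inverse filterlim_at_top_mult_tendsto_pos[OF tendsto_const] mult.commute)
  \<comment> \<open>Proportion of the volume of window \<open>n\<close> covered by the copies. It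
    tends to \<open>1\<close>, so the limit below is valid even if the entropy of window
    \<open>m\<close> is infinite.\<close>
  define c where "c = (\<lambda>n. (real (k n) * ?s m / ?s n) ^ ?d)"
  have ev: "\<forall>\<^sub>F n in sequentially. ereal (c n) * ?e m \<le> ?e n"
  proof -
   have "\<forall>\<^sub>F n in sequentially. 1 < ?s n / ?s m" using lim1 by (simp add: filterlim_at_top_dense)
   then show ?thesis
    using eventually_gt_at_top[of "0::nat"]
   proof eventually_elim
    case (elim n)
    have sn: "0 < ?s n" using lam elim(2) by (rule side_pos)
    have k0: "0 < k n" using elim unfolding k_def by linarith
    have "real (k n) < ?s n / ?s m" using elim unfolding k_def by linarith
    then have "real (k n) * ?s m < ?s n" using sm by (simp add: field_simps)
    from relative_entropy_superadditive[OF lam m elim(2) k0 this]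
    have "ereal (1 / ?s n ^ ?d) * (ereal (real (k n ^ ?d)) * ?R m) \<le> ?e n"
     unfolding e using sn by (intro ereal_mult_left_mono) auto
    moreover have "ereal (1 / ?s n ^ ?d) * (ereal (real (k n ^ ?d)) * ?R m) = ereal (c n) * ?e m"
     unfolding e c_def using sm by (simp add: mult.assoc[symmetric] power_divide power_mult_distrib)
    ultimately show ?case by simp
   qed
  qed
  have "(\<lambda>n. real (k n) / (?s n / ?s m)) \<longlonglongrightarrow> 1"
  proof (rule tendsto_sandwich)
   have lim0: "(\<lambda>n. 1 / (?s n / ?s m)) \<longlonglongrightarrow> 0"
    by (rule tendsto_divide_0[OF tendsto_const filterlim_at_top_imp_at_infinity[OF lim1]])
   have "(\<lambda>n. 1 - 1 / (?s n / ?s m)) \<longlonglongrightarrow> 1 - 0" by (intro tendsto_diff tendsto_const lim0)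
   then show "(\<lambda>n. 1 - 1 / (?s n / ?s m)) \<longlonglongrightarrow> 1" by simp
   have ev: "\<forall>\<^sub>F n in sequentially. 1 < ?s n / ?s m" using lim1 by (simp add: filterlim_at_top_dense)
   show "\<forall>\<^sub>F n in sequentially. 1 - 1 / (?s n / ?s m) \<le> real (k n) / (?s n / ?s m)"
    using ev
   proof eventually_elim
    case (elim n)
    have "?s n / ?s m - 1 \<le> real (k n)" using elim unfolding k_def by linarith
    then have "(?s n / ?s m - 1) / (?s n / ?s m) \<le> real (k n) / (?s n / ?s m)"
     using elim by (intro divide_right_mono) auto
    moreover have "(x - 1) / x = 1 - 1 / x" if "1 < x" for x :: real using that by (simp add: field_simps)
    ultimately show ?case using elim by metis
   qed
   show "\<forall>\<^sub>F n in sequentially. real (k n) / (?s n / ?s m) \<le> 1"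
    using ev
   proof eventually_elim
    case (elim n)
    have "real (k n) \<le> ?s n / ?s m" using elim unfolding k_def by linarith
    then show ?case using elim by (subst divide_le_eq_1) auto
   qed
  qed simp
  then have "(\<lambda>n. (real (k n) / (?s n / ?s m)) ^ ?d) \<longlonglongrightarrow> 1 ^ ?d" by (rule tendsto_power)
  then have "c \<longlonglongrightarrow> 1" by (simp add: c_def)
  then have "(\<lambda>n. ereal (c n)) \<longlonglongrightarrow> ereal 1" by simp
  then have "(\<lambda>n. ereal (c n) * ?e m) \<longlonglongrightarrow> ereal 1 * ?e m"
   by (intro tendsto_mult_ereal tendsto_const) auto
  then have "liminf (\<lambda>n. ereal (c n) * ?e m) = ?e m"
   by (simp add: lim_imp_Liminf)
  moreover have "liminf (\<lambda>n. ereal (c n) * ?e m) \<le> liminf ?e" using ev by (rule Liminf_mono)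
  ultimately show ?thesis by simp
 qed
 have "limsup ?e \<le> liminf ?e"
  using le by (intro Limsup_bounded) (auto simp: eventually_sequentially intro!: exI[of _ 1])
 then have "liminf ?e = limsup ?e"
  by (intro antisym Liminf_le_Limsup) auto
 then have "?e \<longlonglongrightarrow> liminf ?e"
  by (intro Liminf_eq_Limsup) (simp_all add: trivial_limit_sequentially)
 moreover have "specific_entropy lam P = lim ?e"
  by (simp add: specific_entropy_def entropy_density_seq_def[abs_def])
 ultimately show ?thesis using limI[of ?e] by simp
qed

section \<open>Stationary tilings\<close>

text \<open>Half-open, so that its lattice translates partition space exactly; the closed windows
  overlap along their faces.\<close>

definition hcube :: "real \<Rightarrow> (real^'d::finite) set" where
 "hcube L = {x. \<forall>i. - (L / 2) \<le> x $ i \<and> x $ i < L / 2}"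

lemma borel_hcube [measurable]: "hcube L \<in> sets borel"
proof -
 have "hcube L = {x \<in> space borel. \<forall>i. - (L / 2) \<le> x $ i \<and> x $ i < L / 2}" by (auto simp: hcube_def)
 also have "... \<in> sets borel" by measurable
 finally show ?thesis .
qed

lemma hcube_subset_cube: "hcube L \<subseteq> cube L"
proof
 fix x :: "real^'b" assume x: "x \<in> hcube L"
 have "\<bar>x $ i\<bar> \<le> L / 2" for i
  using x[unfolded hcube_def, simplified, THEN spec, of i] by linarith
 then show "x \<in> cube L" by (simp add: cube_def)
qed

lemma measure_hcube:
 assumes "0 \<le> L"
 shows "emeasure lborel (hcube L :: (real^'d::finite) set) = ennreal (L ^ CARD('d))"
  and "emeasure lborel (cube L - hcube L :: (real^'d::finite) set) = 0"
proof -
 let ?a = "(\<chi> i. - (L / 2)) :: real^'d" and ?b = "(\<chi> i. L / 2) :: real^'d"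
 have sub: "box ?a ?b \<subseteq> hcube L" by (auto simp: hcube_def mem_box_cart less_imp_le)
 have c: "emeasure lborel (cube L :: (real^'d) set) = ennreal (L ^ CARD('d))"
  using emeasure_cube_finite[where 'd='d, of L] measure_cube[where 'd='d, OF assms]
  by (subst emeasure_eq_ennreal_measure) (auto simp: less_top)
 have "emeasure lborel (box ?a ?b) = emeasure lborel (cbox ?a ?b)"
  by (simp add: emeasure_lborel_box_eq emeasure_lborel_cbox_eq)
 then have b: "emeasure lborel (box ?a ?b) = ennreal (L ^ CARD('d))"
  using c by (simp add: cube_eq_cbox)
 show e: "emeasure lborel (hcube L :: (real^'d) set) = ennreal (L ^ CARD('d))"
 proof (rule antisym)
  have "emeasure lborel (hcube L :: (real^'d) set) \<le> emeasure lborel (cube L :: (real^'d) set)"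
   by (intro emeasure_mono hcube_subset_cube) auto
  then show "emeasure lborel (hcube L :: (real^'d) set) \<le> ennreal (L ^ CARD('d))" using c by simp
  have "emeasure lborel (box ?a ?b) \<le> emeasure lborel (hcube L :: (real^'d) set)"
   by (intro emeasure_mono sub) auto
  then show "ennreal (L ^ CARD('d)) \<le> emeasure lborel (hcube L :: (real^'d) set)" using b by simp
 qed
 show "emeasure lborel (cube L - hcube L :: (real^'d::finite) set) = 0"
  using hcube_subset_cube e c by (subst emeasure_Diff) auto
qed

lemma latt_add: "latt L (\<lambda>i. v i + w i) = latt L v + latt L w"
 and latt_uminus: "latt L (\<lambda>i. - v i) = - latt L v"
 and latt_zero: "latt L (\<lambda>i. 0) = 0"
 by (simp_all add: vec_eq_iff distrib_left)

text \<open>Rounding each coordinate to the lattice. The half-open cube resolves ties, which makes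
  the cell index unique.\<close>

lemma hcube_latt_iff:
 assumes "0 < L" shows "x - latt L v \<in> hcube L \<longleftrightarrow> v = (\<lambda>i. \<lfloor>x $ i / L + 1 / 2\<rfloor>)"
proof -
 have "- (L / 2) \<le> x $ i - L * real_of_int (v i) \<and> x $ i - L * real_of_int (v i) < L / 2
   \<longleftrightarrow> v i = \<lfloor>x $ i / L + 1 / 2\<rfloor>" for i
 proof -
  have "- (L / 2) \<le> x $ i - L * real_of_int (v i) \<longleftrightarrow> real_of_int (v i) \<le> x $ i / L + 1 / 2"
   using assms by (simp add: field_simps)
  moreover have "x $ i - L * real_of_int (v i) < L / 2 \<longleftrightarrow> x $ i / L + 1 / 2 < real_of_int (v i) + 1"
   using assms by (simp add: field_simps)
  ultimately show ?thesis using floor_eq_iff[of "x $ i / L + 1 / 2" "v i"] by auto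
 qed
 then show ?thesis by (simp add: hcube_def fun_eq_iff)
qed

lemma nn_integral_hcube_latt:
 assumes "0 < L"
 shows "(\<integral>\<^sup>+v. indicator (hcube L) (x - latt L v) \<partial>count_space UNIV) = 1"
  and "(\<integral>\<^sup>+v. indicator (hcube L) (x + latt L v) \<partial>count_space UNIV) = 1"
proof -
 show 1: "(\<integral>\<^sup>+v. indicator (hcube L) (x - latt L v) \<partial>count_space UNIV) = 1"
 proof -
  have "(\<integral>\<^sup>+v. indicator (hcube L) (x - latt L v) \<partial>count_space UNIV)
    = (\<integral>\<^sup>+v. indicator {\<lambda>i. \<lfloor>x $ i / L + 1 / 2\<rfloor>} v \<partial>count_space UNIV)"
   by (intro nn_integral_cong) (simp add: indicator_def hcube_latt_iff[OF assms])
  then show ?thesis by simp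
 qed
 have "bij_betw (\<lambda>v i. - v i :: int) UNIV UNIV"
  by (rule bij_betwI[where g="\<lambda>v i. - v i"]) auto
 from nn_integral_bij_count_space[OF this, of "\<lambda>v. indicator (hcube L) (x - latt L v)"]
 show "(\<integral>\<^sup>+v. indicator (hcube L) (x + latt L v) \<partial>count_space UNIV) = 1"
  using 1 by (simp add: latt_uminus)
qed

text \<open>Any shifted cell is a fundamental domain: cut it along the lattice cells, translate the
  pieces back into the central one, and they cover it exactly once.\<close>

lemma nn_integral_periodic:
 fixes g :: "real^'d::finite \<Rightarrow> ennreal"
 assumes L: "0 < L" and g [measurable]: "g \<in> borel_measurable borel" and per: "\<And>u v. g (latt L v + u) = g u"
 shows "(\<integral>\<^sup>+u. indicator (hcube L) (u - x) * g u \<partial>lborel) = (\<integral>\<^sup>+u. indicator (hcube L) u * g u \<partial>lborel)"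
proof -
 have per': "g (u + latt L v) = g u" for u v using per[of v u] by (simp add: add.commute)
 have "(\<integral>\<^sup>+u. indicator (hcube L) (u - x) * g u \<partial>lborel)
   = (\<integral>\<^sup>+u. \<integral>\<^sup>+v. indicator (hcube L) (u - x) * g u * indicator (hcube L) (u - latt L v) \<partial>count_space UNIV \<partial>lborel)"
  by (simp add: nn_integral_cmult nn_integral_hcube_latt[OF L])
 also have "... = (\<integral>\<^sup>+v. \<integral>\<^sup>+u. indicator (hcube L) (u - x) * g u * indicator (hcube L) (u - latt L v) \<partial>lborel \<partial>count_space UNIV)"
  by (intro nn_integral_count_space_nn_integral) auto
 also have "... = (\<integral>\<^sup>+v. \<integral>\<^sup>+u. indicator (hcube L) ((u - x) + latt L v) * g u * indicator (hcube L) u \<partial>lborel \<partial>count_space UNIV)"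
 proof (rule nn_integral_cong)
  fix v
  have "(\<integral>\<^sup>+u. indicator (hcube L) (u - x) * g u * indicator (hcube L) (u - latt L v) \<partial>lborel)
   = (\<integral>\<^sup>+u. indicator (hcube L) ((latt L v + u) - x) * g (latt L v + u) * indicator (hcube L) ((latt L v + u) - latt L v) \<partial>lborel)"
   by (rule nn_integral_lborel_shift[symmetric]) measurable
  then show "(\<integral>\<^sup>+u. indicator (hcube L) (u - x) * g u * indicator (hcube L) (u - latt L v) \<partial>lborel)
   = (\<integral>\<^sup>+u. indicator (hcube L) ((u - x) + latt L v) * g u * indicator (hcube L) u \<partial>lborel)"
   by (simp add: per' add.commute[of "latt L v"] add_diff_eq diff_add_eq mult_ac)
 qed
 also have "... = (\<integral>\<^sup>+u. \<integral>\<^sup>+v. indicator (hcube L) ((u - x) + latt L v) * g u * indicator (hcube L) u \<partial>count_space UNIV \<partial>lborel)"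
  by (intro nn_integral_count_space_nn_integral[symmetric]) auto
 also have "... = (\<integral>\<^sup>+u. indicator (hcube L) u * g u \<partial>lborel)"
  by (simp add: nn_integral_multc nn_integral_hcube_latt[OF L] mult.assoc) (simp add: mult.commute)
 finally show ?thesis .
qed

section \<open>Independent tiles with a uniform random shift\<close>

locale tiling =
 fixes L :: real and mu :: "(real^'d::finite) set measure"
 assumes L: "0 < L" and sets_mu [measurable_cong]: "sets mu = sets conf_space"
  and prob_mu: "prob_space mu"
begin

lemma space_mu: "space mu = locally_finite_sets"
 using sets_eq_imp_space_eq[OF sets_mu] by simp

sublocale mu: prob_space mu by (rule prob_mu)

sublocale PM: product_prob_space "\<lambda>_. mu" "UNIV :: ('d \<Rightarrow> int) set" ..

text \<open>Every tile is cut to the half-open cube before being placed, so neighbouring tiles never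
  share a point.\<close>

definition tile :: "(('d \<Rightarrow> int) \<Rightarrow> (real^'d) set) \<Rightarrow> (real^'d) set" where
 "tile eta = (\<Union>v. translate (- latt L v) (eta v \<inter> hcube L))"

lemma measurable_tile [measurable]: "tile \<in> PiM UNIV (\<lambda>_. mu) \<rightarrow>\<^sub>M conf_space"
 unfolding tile_def[abs_def]
proof (rule measurable_conf_UN)
 fix v :: "'d \<Rightarrow> int"
 have [measurable]: "(\<lambda>eta. eta v) \<in> PiM UNIV (\<lambda>_. mu) \<rightarrow>\<^sub>M conf_space"
  using measurable_component_singleton[of v UNIV "\<lambda>_. mu"] by (simp add: measurable_cong_sets[OF refl sets_mu])
 show "(\<lambda>eta. translate (- latt L v) (eta v \<inter> hcube L)) \<in> PiM UNIV (\<lambda>_. mu) \<rightarrow>\<^sub>M conf_space" by measurable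
next
 fix eta assume "eta \<in> space (PiM (UNIV :: ('d \<Rightarrow> int) set) (\<lambda>_. mu))"
 then have "eta v \<in> locally_finite_sets" for v by (auto simp: space_PiM space_mu)
 then show "(\<Union>v. translate (- latt L v) (eta v \<inter> hcube L)) \<in> locally_finite_sets"
  using bounded_subset[OF bounded_cube hcube_subset_cube]
  by (intro locally_finite_tiling[where K="hcube L"] L locally_finite_Int) auto
qed simp

definition P0 :: "(real^'d) set measure" where
 "P0 = distr (PiM UNIV (\<lambda>_. mu)) conf_space tile"

lemma sets_P0 [measurable_cong]: "sets P0 = sets conf_space" by (simp add: P0_def)

lemma space_P0: "space P0 = locally_finite_sets" by (simp add: P0_def)

sublocale P0: prob_space P0
 unfolding P0_def by (intro PM.prob_space_distr measurable_tile)

lemma tile_Int_hcube: "tile eta \<inter> hcube L = eta (\<lambda>_. 0) \<inter> hcube L"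
proof -
 have "x \<in> tile eta \<longleftrightarrow> x \<in> eta (\<lambda>_. 0)" if x: "x \<in> hcube L" for x
 proof -
  have "x - latt L v \<in> hcube L \<longleftrightarrow> v = (\<lambda>_. 0)" for v
   using hcube_latt_iff[OF L, of x v] hcube_latt_iff[OF L, of x "\<lambda>_. 0"] x by (simp add: latt_zero)
  then show ?thesis using x by (auto simp: tile_def mem_translate latt_zero)
 qed
 then show ?thesis by auto
qed

text \<open>A shift by a lattice vector permutes the independent, identically distributed
  tiles.\<close>

lemma distr_P0_latt: "distr P0 conf_space (translate (latt L u)) = P0"
proof -
 have restr: "(\<lambda>eta :: ('d \<Rightarrow> int) \<Rightarrow> (real^'d) set. \<lambda>n\<in>UNIV. eta (\<lambda>i. n i + u i)) = (\<lambda>eta n. eta (\<lambda>i. n i + u i))"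
  by (simp add: fun_eq_iff)
 have "distr (PiM UNIV (\<lambda>_. mu)) (PiM UNIV (\<lambda>_. mu)) (\<lambda>eta. \<lambda>n\<in>UNIV. eta (\<lambda>i. n i + u i)) = PiM (UNIV :: ('d \<Rightarrow> int) set) (\<lambda>_. mu)"
  by (rule distr_PiM_reindex) (auto simp: inj_on_def fun_eq_iff prob_mu)
 then have r: "distr (PiM UNIV (\<lambda>_. mu)) (PiM UNIV (\<lambda>_. mu)) (\<lambda>eta n. eta (\<lambda>i. n i + u i)) = PiM UNIV (\<lambda>_. mu)"
  by (simp only: restr)
 have m: "(\<lambda>eta n. eta (\<lambda>i. n i + u i)) \<in> PiM UNIV (\<lambda>_. mu) \<rightarrow>\<^sub>M PiM (UNIV :: ('d \<Rightarrow> int) set) (\<lambda>_. mu)"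
  by (intro measurable_PiM_single') (auto simp: space_PiM)
 have eq: "translate (latt L u) (tile eta) = tile (\<lambda>n. eta (\<lambda>i. n i + u i))" for eta
 proof (rule set_eqI)
  fix x
  have "x \<in> translate (latt L u) (tile eta) \<longleftrightarrow> (\<exists>v. x + latt L u - latt L v \<in> eta v \<inter> hcube L)"
   by (simp add: tile_def mem_translate)
  also have "... \<longleftrightarrow> (\<exists>v. x - latt L v \<in> eta (\<lambda>i. v i + u i) \<inter> hcube L)"
  proof
   assume "\<exists>v. x + latt L u - latt L v \<in> eta v \<inter> hcube L"
   then obtain v where v: "x + latt L u - latt L v \<in> eta v \<inter> hcube L" ..
   have "latt L v = latt L (\<lambda>i. v i - u i) + latt L u" by (simp flip: latt_add)
   then show "\<exists>v. x - latt L v \<in> eta (\<lambda>i. v i + u i) \<inter> hcube L"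
    using v by (intro exI[of _ "\<lambda>i. v i - u i"]) (simp add: algebra_simps)
  next
   assume "\<exists>v. x - latt L v \<in> eta (\<lambda>i. v i + u i) \<inter> hcube L"
   then obtain v where v: "x - latt L v \<in> eta (\<lambda>i. v i + u i) \<inter> hcube L" ..
   then show "\<exists>v. x + latt L u - latt L v \<in> eta v \<inter> hcube L"
    by (intro exI[of _ "\<lambda>i. v i + u i"]) (simp add: latt_add algebra_simps)
  qed
  also have "... \<longleftrightarrow> x \<in> tile (\<lambda>n. eta (\<lambda>i. n i + u i))" by (simp add: tile_def mem_translate)
  finally show "x \<in> translate (latt L u) (tile eta) \<longleftrightarrow> x \<in> tile (\<lambda>n. eta (\<lambda>i. n i + u i))" .
 qed
 have "distr P0 conf_space (translate (latt L u)) = distr (PiM UNIV (\<lambda>_. mu)) conf_space (\<lambda>eta. translate (latt L u) (tile eta))"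
  unfolding P0_def by (subst distr_distr) (auto simp: comp_def)
 also have "... = distr (PiM UNIV (\<lambda>_. mu)) conf_space (\<lambda>eta. tile (\<lambda>n. eta (\<lambda>i. n i + u i)))" by (simp add: eq)
 also have "... = distr (distr (PiM UNIV (\<lambda>_. mu)) (PiM UNIV (\<lambda>_. mu)) (\<lambda>eta n. eta (\<lambda>i. n i + u i))) conf_space tile"
  using m by (subst distr_distr) (auto simp: comp_def)
 finally show ?thesis by (simp add: r P0_def)
qed

lemma nn_integral_P0_latt:
 assumes [measurable]: "F \<in> borel_measurable conf_space"
 shows "(\<integral>\<^sup>+om. F (translate (latt L u) om) \<partial>P0) = (\<integral>\<^sup>+om. F om \<partial>P0)"
proof -
 have "(\<integral>\<^sup>+om. F om \<partial>P0) = (\<integral>\<^sup>+om. F om \<partial>distr P0 conf_space (translate (latt L u)))" by (simp add: distr_P0_latt)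
 also have "... = (\<integral>\<^sup>+om. F (translate (latt L u) om) \<partial>P0)" by (intro nn_integral_distr) auto
 finally show ?thesis ..
qed

sublocale H: positive_volume "hcube L :: (real^'d) set"
 using L measure_hcube[where 'd='d, of L] by unfold_locales (auto simp: measure_def)

text \<open>The law \<open>P0\<close> is invariant only under the lattice; averaging the shift over
  one period makes it invariant under all translations.\<close>

definition P :: "(real^'d) set measure" where
 "P = distr (uniform_measure lborel (hcube L) \<Otimes>\<^sub>M P0) conf_space (\<lambda>(u, om). translate u om)"

sublocale HP0: pair_prob_space "uniform_measure lborel (hcube L :: (real^'d) set)" P0 ..

lemma measurable_shift: "(\<lambda>(u, om). translate u om) \<in> uniform_measure lborel (hcube L) \<Otimes>\<^sub>M P0 \<rightarrow>\<^sub>M (conf_space :: (real^'d) set measure)"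
 unfolding case_prod_beta by measurable

lemma nn_integral_P:
 assumes F [measurable]: "F \<in> borel_measurable conf_space"
 shows "ennreal (L ^ CARD('d)) * (\<integral>\<^sup>+om. F om \<partial>P)
   = (\<integral>\<^sup>+u. indicator (hcube L) u * (\<integral>\<^sup>+om. F (translate u om) \<partial>P0) \<partial>lborel)"
proof -
 have meas: "(\<lambda>p. F (translate (fst p) (snd p))) \<in> borel_measurable (uniform_measure lborel (hcube L) \<Otimes>\<^sub>M P0)"
  by measurable
 have meas': "(\<lambda>p. F (translate (fst p) (snd p))) \<in> borel_measurable (lborel \<Otimes>\<^sub>M P0)"
  by measurable
 have [measurable]: "(\<lambda>u. \<integral>\<^sup>+om. F (translate u om) \<partial>P0) \<in> borel_measurable lborel"
  using P0.borel_measurable_nn_integral_fst[OF meas'] by simp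
 have "(\<integral>\<^sup>+om. F om \<partial>P) = (\<integral>\<^sup>+p. F (translate (fst p) (snd p)) \<partial>(uniform_measure lborel (hcube L) \<Otimes>\<^sub>M P0))"
  unfolding P_def using measurable_shift by (subst nn_integral_distr) (auto simp: case_prod_beta)
 also have "... = (\<integral>\<^sup>+u. \<integral>\<^sup>+om. F (translate u om) \<partial>P0 \<partial>uniform_measure lborel (hcube L))"
  using P0.nn_integral_fst[OF meas] by simp
 also have "... = (\<integral>\<^sup>+u. (\<integral>\<^sup>+om. F (translate u om) \<partial>P0) * indicator (hcube L) u \<partial>lborel) / emeasure lborel (hcube L :: (real^'d) set)"
  by (intro nn_integral_uniform_measure) auto
 finally show ?thesis
  using L measure_hcube[where 'd='d, of L]
  by (simp add: ennreal_times_divide mult.commute[of "ennreal (L ^ CARD('d))"] mult_divide_eq_ennreal)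
    (simp add: mult.commute)
qed

text \<open>The expectation under \<open>P0\<close> is periodic as a function of the shift, and the
  mean of a periodic function over a period is unaffected by moving the period.\<close>

lemma nn_integral_P_translate:
 assumes F [measurable]: "F \<in> borel_measurable conf_space"
 shows "(\<integral>\<^sup>+om. F (translate x om) \<partial>P) = (\<integral>\<^sup>+om. F om \<partial>P)"
proof -
 define g where "g = (\<lambda>u. \<integral>\<^sup>+om. F (translate u om) \<partial>P0)"
 have meas': "(\<lambda>p. F (translate (fst p) (snd p))) \<in> borel_measurable (borel \<Otimes>\<^sub>M P0)"
  by measurable
 have [measurable]: "g \<in> borel_measurable borel"
  unfolding g_def using P0.borel_measurable_nn_integral_fst[OF meas'] by simp
 have per: "g (latt L v + u) = g u" for u v
 proof -
  have "g (latt L v + u) = (\<integral>\<^sup>+om. F (translate u (translate (latt L v) om)) \<partial>P0)"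
   by (simp add: g_def translate_translate add.commute)
  also have "... = g u" unfolding g_def by (rule nn_integral_P0_latt) measurable
  finally show ?thesis .
 qed
 have "ennreal (L ^ CARD('d)) * (\<integral>\<^sup>+om. F (translate x om) \<partial>P) = (\<integral>\<^sup>+u. indicator (hcube L) u * g (x + u) \<partial>lborel)"
  by (subst nn_integral_P) (auto simp: g_def translate_translate)
 also have "... = (\<integral>\<^sup>+u. indicator (hcube L) ((x + u) - x) * g (x + u) \<partial>lborel)" by simp
 also have "... = (\<integral>\<^sup>+u. indicator (hcube L) (u - x) * g u \<partial>lborel)"
  by (rule nn_integral_lborel_shift) measurable
 also have "... = (\<integral>\<^sup>+u. indicator (hcube L) u * g u \<partial>lborel)"
  using L per by (intro nn_integral_periodic) auto
 also have "... = ennreal (L ^ CARD('d)) * (\<integral>\<^sup>+om. F om \<partial>P)"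
  by (subst nn_integral_P) (auto simp: g_def)
 finally show ?thesis
  using L by (simp add: ennreal_mult_cancel_left)
qed

text \<open>Unfolding the mean over the shift \<open>u\<close> and over the tiles turns the Palm integral of the randomly
 shifted tiling into a sum over the points of a single tile.\<close>

lemma tiling_campbell:
 assumes g [measurable]: "g \<in> borel_measurable conf_space" and C [measurable]: "C \<in> sets borel"
 shows "ennreal (L ^ CARD('d)) * (\<integral>\<^sup>+om. \<integral>\<^sup>+x. indicator C x * g (translate x om) \<partial>count_space om \<partial>P)
  = emeasure lborel C * (\<integral>\<^sup>+om. \<integral>\<^sup>+x. indicator (hcube L) x * g (translate x om) \<partial>count_space om \<partial>P0)"
proof -
 interpret LP: pair_sigma_finite lborel P0 ..
 \<comment> \<open>\<open>k y\<close> is the volume of those shifts in one cell that bring the point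
   \<open>y\<close> into \<open>C\<close>. Summed over the lattice translates of \<open>y\<close> it
   gives the volume of \<open>C\<close>, which is the identity \<open>*\<close> further
   below.\<close>
 define k where "k = (\<lambda>y. \<integral>\<^sup>+u. indicator (hcube L) u * indicator C (y - u) \<partial>(lborel :: (real^'d) measure))"
 have mk [measurable]: "k \<in> borel_measurable borel"
 proof -
  have "(\<lambda>p. indicator (hcube L) (snd p) * indicator C (fst p - snd p) :: ennreal) \<in> borel_measurable (borel \<Otimes>\<^sub>M (lborel :: (real^'d) measure))"
   by measurable
  from lborel.borel_measurable_nn_integral_fst[OF this] show ?thesis by (simp add: k_def)
 qed
 have cnt: "countable om" if "om \<in> space P0" for om using that by (simp add: space_P0 countable_locally_finite)
 have fst: "(\<lambda>p. snd p) \<in> lborel \<Otimes>\<^sub>M P0 \<rightarrow>\<^sub>M (conf_space :: (real^'d) set measure)" by measurable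
 have m1: "(\<lambda>(p, x). indicator C (x - fst p) * g (translate x (snd p))) \<in> borel_measurable ((lborel \<Otimes>\<^sub>M P0) \<Otimes>\<^sub>M borel)"
  by measurable
 have "ennreal (L ^ CARD('d)) * (\<integral>\<^sup>+om. \<integral>\<^sup>+x. indicator C x * g (translate x om) \<partial>count_space om \<partial>P)
   = (\<integral>\<^sup>+u. indicator (hcube L) u * (\<integral>\<^sup>+om. \<integral>\<^sup>+y. indicator C (y - u) * g (translate y om) \<partial>count_space om \<partial>P0) \<partial>lborel)"
 proof (subst nn_integral_P)
  show "(\<lambda>om. \<integral>\<^sup>+x. indicator C x * g (translate x om) \<partial>count_space om) \<in> borel_measurable conf_space" by measurable
 qed (simp add: nn_integral_count_translate translate_translate)
 also have "... = (\<integral>\<^sup>+u. \<integral>\<^sup>+om. indicator (hcube L) u * (\<integral>\<^sup>+y. indicator C (y - u) * g (translate y om) \<partial>count_space om) \<partial>P0 \<partial>lborel)"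
  by (intro nn_integral_cong nn_integral_cmult[symmetric]) measurable
 also have "... = (\<integral>\<^sup>+om. \<integral>\<^sup>+u. indicator (hcube L) u * (\<integral>\<^sup>+y. indicator C (y - u) * g (translate y om) \<partial>count_space om) \<partial>lborel \<partial>P0)"
 proof (rule LP.Fubini'[symmetric])
  have "(\<lambda>p. \<integral>\<^sup>+y. indicator C (y - fst p) * g (translate y (snd p)) \<partial>count_space (snd p)) \<in> borel_measurable (lborel \<Otimes>\<^sub>M P0)"
   using measurable_count_kernel[OF fst m1] .
  then show "(\<lambda>(u, om). indicator (hcube L) u * (\<integral>\<^sup>+y. indicator C (y - u) * g (translate y om) \<partial>count_space om)) \<in> borel_measurable (lborel \<Otimes>\<^sub>M P0)"
   unfolding case_prod_beta by measurable
 qed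
 also have "... = (\<integral>\<^sup>+om. \<integral>\<^sup>+y. k y * g (translate y om) \<partial>count_space om \<partial>P0)"
 proof (rule nn_integral_cong)
  fix om assume w: "om \<in> space P0"
  have "(\<integral>\<^sup>+u. indicator (hcube L) u * (\<integral>\<^sup>+y. indicator C (y - u) * g (translate y om) \<partial>count_space om) \<partial>lborel)
    = (\<integral>\<^sup>+u. (\<integral>\<^sup>+y. indicator (hcube L) u * (indicator C (y - u) * g (translate y om)) \<partial>count_space om) \<partial>lborel)"
   by (intro nn_integral_cong nn_integral_cmult[symmetric]) auto
  also have "... = (\<integral>\<^sup>+y. (\<integral>\<^sup>+u. indicator (hcube L) u * (indicator C (y - u) * g (translate y om)) \<partial>lborel) \<partial>count_space om)"
   using cnt[OF w] by (intro nn_integral_count_space_nn_integral) auto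
  also have "... = (\<integral>\<^sup>+y. k y * g (translate y om) \<partial>count_space om)"
   unfolding k_def by (intro nn_integral_cong) (subst nn_integral_multc[symmetric], auto simp: mult.assoc)
  finally show "(\<integral>\<^sup>+u. indicator (hcube L) u * (\<integral>\<^sup>+y. indicator C (y - u) * g (translate y om) \<partial>count_space om) \<partial>lborel)
    = (\<integral>\<^sup>+y. k y * g (translate y om) \<partial>count_space om)" .
 qed
 \<comment> \<open>Every point lies in exactly one lattice cell, so the sum over points can be
   sorted by cells; lattice invariance then moves each cell to the origin.\<close>
 also have "... = (\<integral>\<^sup>+om. \<integral>\<^sup>+y. \<integral>\<^sup>+v. indicator (hcube L) (y - latt L v) * (k y * g (translate y om)) \<partial>count_space UNIV \<partial>count_space om \<partial>P0)"
  by (simp add: nn_integral_multc nn_integral_hcube_latt[OF L])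
 also have "... = (\<integral>\<^sup>+om. \<integral>\<^sup>+v. \<integral>\<^sup>+y. indicator (hcube L) (y - latt L v) * (k y * g (translate y om)) \<partial>count_space om \<partial>count_space UNIV \<partial>P0)"
  by (intro nn_integral_cong nn_integral_count_space_nn_integral) auto
 also have "... = (\<integral>\<^sup>+v. \<integral>\<^sup>+om. \<integral>\<^sup>+y. indicator (hcube L) (y - latt L v) * (k y * g (translate y om)) \<partial>count_space om \<partial>P0 \<partial>count_space UNIV)"
  by (rule nn_integral_count_space_nn_integral) measurable
 also have "... = (\<integral>\<^sup>+v. \<integral>\<^sup>+om. \<integral>\<^sup>+y. indicator (hcube L) y * (k (y + latt L v) * g (translate y om)) \<partial>count_space om \<partial>P0 \<partial>count_space UNIV)"
 proof (rule nn_integral_cong)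
  fix v
  let ?G = "\<lambda>om. \<integral>\<^sup>+y. indicator (hcube L) y * (k (y + latt L v) * g (translate y om)) \<partial>count_space om"
  have "?G \<in> borel_measurable conf_space" by measurable
  from nn_integral_P0_latt[OF this, of v]
  show "(\<integral>\<^sup>+om. \<integral>\<^sup>+y. indicator (hcube L) (y - latt L v) * (k y * g (translate y om)) \<partial>count_space om \<partial>P0) = (\<integral>\<^sup>+om. ?G om \<partial>P0)"
   by (simp add: nn_integral_count_translate translate_translate)
 qed
 also have "... = (\<integral>\<^sup>+om. \<integral>\<^sup>+v. \<integral>\<^sup>+y. indicator (hcube L) y * (k (y + latt L v) * g (translate y om)) \<partial>count_space om \<partial>count_space UNIV \<partial>P0)"
  by (rule nn_integral_count_space_nn_integral[symmetric]) measurable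
 also have "... = (\<integral>\<^sup>+om. \<integral>\<^sup>+y. \<integral>\<^sup>+v. indicator (hcube L) y * (k (y + latt L v) * g (translate y om)) \<partial>count_space UNIV \<partial>count_space om \<partial>P0)"
  by (intro nn_integral_cong nn_integral_count_space_nn_integral[symmetric]) auto
 also have "... = (\<integral>\<^sup>+om. \<integral>\<^sup>+y. emeasure lborel C * (indicator (hcube L) y * g (translate y om)) \<partial>count_space om \<partial>P0)"
 proof (intro nn_integral_cong)
  fix om and y :: "real^'d"
  have "(\<integral>\<^sup>+v. k (y + latt L v) \<partial>count_space UNIV)
    = (\<integral>\<^sup>+v. \<integral>\<^sup>+u. indicator (hcube L) ((y - u) + latt L v) * indicator C u \<partial>lborel \<partial>count_space UNIV)"
  proof (rule nn_integral_cong)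
   fix v
   have "(\<integral>\<^sup>+u. indicator (hcube L) ((y + latt L v) - u) * indicator C ((y + latt L v) - ((y + latt L v) - u)) \<partial>lborel) = k (y + latt L v)"
    unfolding k_def by (rule nn_integral_lborel_reflect) measurable
   then show "k (y + latt L v) = (\<integral>\<^sup>+u. indicator (hcube L) ((y - u) + latt L v) * indicator C u \<partial>lborel)"
    by (simp add: algebra_simps)
  qed
  also have "... = (\<integral>\<^sup>+u. \<integral>\<^sup>+v. indicator (hcube L) ((y - u) + latt L v) * indicator C u \<partial>count_space UNIV \<partial>lborel)"
   by (intro nn_integral_count_space_nn_integral[symmetric]) auto
  also have "... = emeasure lborel C"
   by (simp add: nn_integral_multc nn_integral_hcube_latt[OF L])
  finally have *: "(\<integral>\<^sup>+v. k (y + latt L v) \<partial>count_space UNIV) = emeasure lborel C" .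
  have "(\<integral>\<^sup>+v. indicator (hcube L) y * (k (y + latt L v) * g (translate y om)) \<partial>count_space UNIV)
    = (\<integral>\<^sup>+v. k (y + latt L v) * (indicator (hcube L) y * g (translate y om)) \<partial>count_space UNIV)"
   by (simp add: mult_ac)
  also have "... = emeasure lborel C * (indicator (hcube L) y * g (translate y om))"
   by (subst nn_integral_multc) (auto simp: *)
  finally show "(\<integral>\<^sup>+v. indicator (hcube L) y * (k (y + latt L v) * g (translate y om)) \<partial>count_space UNIV)
    = emeasure lborel C * (indicator (hcube L) y * g (translate y om))" .
 qed
 also have "... = (\<integral>\<^sup>+om. emeasure lborel C * (\<integral>\<^sup>+y. indicator (hcube L) y * g (translate y om) \<partial>count_space om) \<partial>P0)"
  by (intro nn_integral_cong nn_integral_cmult) auto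
 also have "... = emeasure lborel C * (\<integral>\<^sup>+om. \<integral>\<^sup>+y. indicator (hcube L) y * g (translate y om) \<partial>count_space om \<partial>P0)"
  by (intro nn_integral_cmult) measurable
 finally show ?thesis .
qed

end

section \<open>Intensity and specific entropy of the shifted tiling\<close>

lemma card_int_box: "0 \<le> q \<Longrightarrow> card {v :: 'd::finite \<Rightarrow> int. \<forall>i. \<bar>v i\<bar> \<le> q} = nat (2 * q + 1) ^ CARD('d)"
proof -
 assume "0 \<le> q"
 have "{v :: 'd \<Rightarrow> int. \<forall>i. \<bar>v i\<bar> \<le> q} = PiE UNIV (\<lambda>_. {- q..q})"
  by (auto simp: PiE_def abs_le_iff minus_le_iff)
 then show ?thesis by (simp add: card_PiE algebra_simps)
qed

lemma abs_floor_le: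
 fixes y s :: real
 assumes "\<bar>y\<bar> \<le> s + 1 / 2" "s + 2 \<le> real_of_int q"
 shows "\<bar>\<lfloor>y + 1 / 2\<rfloor>\<bar> \<le> q"
proof -
 have "\<lfloor>y + 1 / 2\<rfloor> \<le> q" "- q \<le> \<lfloor>y + 1 / 2\<rfloor>" using assms by linarith+
 then show ?thesis by linarith
qed

context tiling
begin

lemma nn_integral_component:
 assumes "F \<in> borel_measurable conf_space"
 shows "(\<integral>\<^sup>+eta. F (eta v) \<partial>PiM UNIV (\<lambda>_. mu)) = (\<integral>\<^sup>+om. F om \<partial>mu)"
proof -
 have "(\<integral>\<^sup>+om. F om \<partial>mu) = (\<integral>\<^sup>+om. F om \<partial>distr (PiM UNIV (\<lambda>_. mu)) mu (\<lambda>eta. eta v))"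
  using distr_PiM_component[of UNIV "\<lambda>_. mu" v] prob_mu by simp
 also have "... = (\<integral>\<^sup>+eta. F (eta v) \<partial>PiM UNIV (\<lambda>_. mu))"
  using assms by (intro nn_integral_distr) (auto simp: measurable_cong_sets[OF sets_mu refl])
 finally show ?thesis ..
qed

text \<open>Only points of the central tile are counted, but \<open>g\<close> at such a point still
  sees the neighbouring tiles. This gap is the boundary error treated later.\<close>

lemma nn_integral_P0_hcube:
 assumes g [measurable]: "g \<in> borel_measurable conf_space"
 shows "(\<integral>\<^sup>+om. \<integral>\<^sup>+x. indicator (hcube L) x * g (translate x om) \<partial>count_space om \<partial>P0)
  = (\<integral>\<^sup>+eta. \<integral>\<^sup>+x. g (translate x (tile eta)) \<partial>count_space (eta (\<lambda>_. 0) \<inter> hcube L) \<partial>PiM UNIV (\<lambda>_. mu))"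
proof -
 have "(\<integral>\<^sup>+om. \<integral>\<^sup>+x. indicator (hcube L) x * g (translate x om) \<partial>count_space om \<partial>P0)
   = (\<integral>\<^sup>+eta. \<integral>\<^sup>+x. indicator (hcube L) x * g (translate x (tile eta)) \<partial>count_space (tile eta) \<partial>PiM UNIV (\<lambda>_. mu))"
  unfolding P0_def by (intro nn_integral_distr) measurable
 also have "... = (\<integral>\<^sup>+eta. \<integral>\<^sup>+x. g (translate x (tile eta)) \<partial>count_space (tile eta \<inter> hcube L) \<partial>PiM UNIV (\<lambda>_. mu))"
 proof (rule nn_integral_cong)
  fix eta :: "('d \<Rightarrow> int) \<Rightarrow> (real^'d) set"
  show "(\<integral>\<^sup>+x. indicator (hcube L) x * g (translate x (tile eta)) \<partial>count_space (tile eta))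
    = (\<integral>\<^sup>+x. g (translate x (tile eta)) \<partial>count_space (tile eta \<inter> hcube L))"
   by (subst (1 2) nn_integral_count_space_indicator; (rule nn_integral_cong)?; auto split: split_indicator)
 qed
 finally show ?thesis by (simp add: tile_Int_hcube)
qed

lemma P0_mean_count:
 "(\<integral>\<^sup>+om. \<integral>\<^sup>+x. indicator (hcube L) x \<partial>count_space om \<partial>P0) = (\<integral>\<^sup>+om. num_points om (hcube L) \<partial>mu)"
proof -
 have "(\<integral>\<^sup>+om. \<integral>\<^sup>+x. indicator (hcube L) x \<partial>count_space om \<partial>P0)
   = (\<integral>\<^sup>+eta. \<integral>\<^sup>+x. 1 \<partial>count_space (eta (\<lambda>_. 0) \<inter> hcube L) \<partial>PiM (UNIV :: ('d \<Rightarrow> int) set) (\<lambda>_. mu))"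
  using nn_integral_P0_hcube[of "\<lambda>_. 1"] by simp
 also have "... = (\<integral>\<^sup>+eta. num_points (eta (\<lambda>_. 0)) (hcube L) \<partial>PiM (UNIV :: ('d \<Rightarrow> int) set) (\<lambda>_. mu))"
 proof (intro nn_integral_cong)
  fix A :: "(real^'d) set"
  show "(\<integral>\<^sup>+x. 1 \<partial>count_space (eta (\<lambda>_. 0) \<inter> hcube L)) = num_points (eta (\<lambda>_. 0)) (hcube L)" for eta :: "('d \<Rightarrow> int) \<Rightarrow> (real^'d) set"
   unfolding num_points_def by (subst nn_integral_count_space_indicator) auto
 qed
 also have "... = (\<integral>\<^sup>+om. num_points om (hcube L) \<partial>mu)" by (rule nn_integral_component) measurable
 finally show ?thesis .
qed

lemma sets_P [measurable_cong]: "sets P = sets conf_space" by (simp add: P_def)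

lemma prob_space_P: "prob_space P"
 unfolding P_def by (intro HP0.prob_space_distr measurable_shift)

lemma stationary_P:
 assumes "(\<integral>\<^sup>+om. num_points om (hcube L) \<partial>mu) < \<infinity>"
 shows "P \<in> stationary_processes"
 unfolding stationary_processes_def
proof (intro CollectI conjI allI)
 interpret P: prob_space P by (rule prob_space_P)
 fix x :: "real^'d"
 show "distr P conf_space (translate x) = P"
 proof (rule measure_eqI)
  show "sets (distr P conf_space (translate x)) = sets P" by (simp add: sets_P)
  fix F assume "F \<in> sets (distr P conf_space (translate x))"
  then have F [measurable]: "F \<in> sets conf_space" by simp
  have "emeasure (distr P conf_space (translate x)) F = (\<integral>\<^sup>+om. indicator F om \<partial>distr P conf_space (translate x))"
   by simp
  also have "... = (\<integral>\<^sup>+om. indicator F (translate x om) \<partial>P)" by (intro nn_integral_distr) measurable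
  also have "... = (\<integral>\<^sup>+om. indicator F om \<partial>P)" by (rule nn_integral_P_translate) measurable
  also have "... = emeasure P F" by (simp add: sets_P)
  finally show "emeasure (distr P conf_space (translate x)) F = emeasure P F" .
 qed
 have num: "(\<integral>\<^sup>+x. indicator (cbox 0 1) x \<partial>count_space om) = num_points om (cbox 0 1)" for om :: "(real^'d) set"
 proof -
  have "(\<integral>\<^sup>+x. indicator (cbox 0 1) x \<partial>count_space om) = (\<integral>\<^sup>+x. indicator (om \<inter> cbox 0 1) x \<partial>count_space UNIV)"
   by (subst nn_integral_count_space_indicator; (rule nn_integral_cong)?; auto split: split_indicator)
  then show ?thesis by (simp add: num_points_def)
 qed
 have "ennreal (L ^ CARD('d)) * (\<integral>\<^sup>+om. num_points om (cbox 0 1) \<partial>P)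
   = emeasure lborel (cbox 0 1 :: (real^'d) set) * (\<integral>\<^sup>+om. num_points om (hcube L) \<partial>mu)"
  using tiling_campbell[of "\<lambda>_. 1" "cbox 0 1"] by (simp add: num P0_mean_count)
 also have "... < \<infinity>"
  using assms emeasure_lborel_cbox_finite[of 0 "1 :: real^'d"] by (simp add: ennreal_mult_less_top less_top)
 finally show "(\<integral>\<^sup>+om. num_points om (cbox 0 1) \<partial>P) < \<infinity>"
  using L by (auto simp: ennreal_mult_less_top)
qed (auto simp: sets_P prob_space_P)

lemma nn_integral_palm_P:
 assumes fin: "(\<integral>\<^sup>+om. num_points om (hcube L) \<partial>mu) < \<infinity>" and g [measurable]: "g \<in> borel_measurable conf_space"
 shows "ennreal (L ^ CARD('d)) * (\<integral>\<^sup>+om. g om \<partial>palm_measure P)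
  = (\<integral>\<^sup>+eta. \<integral>\<^sup>+x. g (translate x (tile eta)) \<partial>count_space (eta (\<lambda>_. 0) \<inter> hcube L) \<partial>PiM UNIV (\<lambda>_. mu))"
proof -
 interpret S: stationary_process P by unfold_locales (rule stationary_P[OF fin])
 have "(\<integral>\<^sup>+om. g om \<partial>palm_measure P) = (\<integral>\<^sup>+om. \<integral>\<^sup>+x. g (translate x om) \<partial>count_space (om \<inter> cbox 0 1) \<partial>P)"
  using S.nn_integral_palm[OF g, of "cbox 0 1"] by (simp add: S.emeasure_unit_cbox)
 also have "... = (\<integral>\<^sup>+om. \<integral>\<^sup>+x. indicator (cbox 0 1) x * g (translate x om) \<partial>count_space om \<partial>P)"
 proof (rule nn_integral_cong)
  fix om :: "(real^'d) set"
  show "(\<integral>\<^sup>+x. g (translate x om) \<partial>count_space (om \<inter> cbox 0 1)) = (\<integral>\<^sup>+x. indicator (cbox 0 1) x * g (translate x om) \<partial>count_space om)"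
   by (subst (1 2) nn_integral_count_space_indicator; (rule nn_integral_cong)?; auto split: split_indicator)
 qed
 finally show ?thesis
  using tiling_campbell[OF g, of "cbox 0 1"] by (simp add: S.emeasure_unit_cbox nn_integral_P0_hcube)
qed

end

text \<open>Cutting independent Poisson processes to cells and reassembling them in a shifted grid
  yields a Poisson process again, by void probabilities. It identifies the reference measure in the
  entropy bound for the tiling.\<close>

lemma distr_shifted_tiles:
 fixes u :: "real^'d::finite"
 assumes lam: "0 < lam" and n: "0 < n" and N: "0 < N" and u: "u \<in> hcube L" and L: "L = side TYPE('d) lam n"
  and q: "side TYPE('d) lam N / (2 * L) + 2 \<le> real_of_int q"
 defines "Z \<equiv> {v :: 'd \<Rightarrow> int. \<forall>i. \<bar>v i\<bar> \<le> q}"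
 defines "T \<equiv> \<lambda>eta. (\<Union>v\<in>Z. translate (u - latt L v) (eta v \<inter> hcube L)) \<inter> window lam N"
 shows "T \<in> PiM Z (\<lambda>_. poisson_process lam n) \<rightarrow>\<^sub>M conf_space"
  and "distr (PiM Z (\<lambda>_. poisson_process lam n)) conf_space T = poisson_process lam N"
proof -
 let ?nu = "poisson_process lam n :: (real^'d) set measure" and ?W = "window lam n :: (real^'d) set"
 have L0: "0 < L" using side_pos[OF lam n] L by simp
 have snu [measurable_cong]: "sets ?nu = sets conf_space" using lam n by (rule sets_poisson)
 have spnu: "space ?nu = locally_finite_sets" using sets_eq_imp_space_eq[OF snu] by simp
 have pnu: "prob_space ?nu" using lam n by (rule prob_space_poisson)
 have Z: "finite Z" unfolding Z_def by (rule finite_int_box)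
 interpret product_prob_space "\<lambda>_. ?nu" Z using pnu by (intro product_prob_spaceI)
 show T: "T \<in> PiM Z (\<lambda>_. ?nu) \<rightarrow>\<^sub>M conf_space"
  unfolding T_def
 proof (intro measurable_conf_Int measurable_conf_UN)
  fix v assume "v \<in> Z"
  then have [measurable]: "(\<lambda>eta. eta v) \<in> PiM Z (\<lambda>_. ?nu) \<rightarrow>\<^sub>M conf_space"
   using measurable_component_singleton[of v Z "\<lambda>_. ?nu"] by (simp add: measurable_cong_sets[OF refl snu])
  show "(\<lambda>eta. translate (u - latt L v) (eta v \<inter> hcube L)) \<in> PiM Z (\<lambda>_. ?nu) \<rightarrow>\<^sub>M conf_space" by measurable
 next
  fix s assume "s \<in> space (PiM Z (\<lambda>_. ?nu))"
  then show "(\<Union>v\<in>Z. translate (u - latt L v) (s v \<inter> hcube L)) \<in> locally_finite_sets"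
   by (intro locally_finite_finite_UN Z translate_locally_finite locally_finite_Int) (auto simp: space_PiM spnu)
 qed (auto intro: countable_finite Z)
 show "distr (PiM Z (\<lambda>_. ?nu)) conf_space T = poisson_process lam N"
 proof (rule conf_measure_eqI)
  show "sets (poisson_process lam N :: (real^'d) set measure) = sets conf_space" using lam N by (rule sets_poisson)
  show "finite_measure (distr (PiM Z (\<lambda>_. ?nu)) conf_space T)"
   using prob_space_distr[OF T] by (simp add: prob_space_def)
  fix B :: "(real^'d) set" assume B [measurable]: "B \<in> sets borel"
  let ?S = "window lam N \<inter> B"
  have trB [measurable]: "translate x ?S \<in> sets borel" "translate x (hcube L) \<in> sets (borel :: (real^'d) measure)" for x
   by (intro borel_translate; simp)+
  have "emeasure (distr (PiM Z (\<lambda>_. ?nu)) conf_space T) (void B) = emeasure (PiM Z (\<lambda>_. ?nu)) (T -` void B \<inter> space (PiM Z (\<lambda>_. ?nu)))"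
   by (rule emeasure_distr[OF T]) measurable
  also have "T -` void B \<inter> space (PiM Z (\<lambda>_. ?nu)) = PiE Z (\<lambda>v. void (hcube L \<inter> translate (latt L v - u) ?S))"
  proof -
   have UN_Int: "(\<Union>v\<in>Z. X v) \<inter> W \<inter> B = {} \<longleftrightarrow> (\<forall>v\<in>Z. X v \<inter> (W \<inter> B) = {})" for X :: "('d \<Rightarrow> int) \<Rightarrow> (real^'d) set" and W
    by auto
   have "translate (u - latt L v) (A \<inter> hcube L) \<inter> ?S = {} \<longleftrightarrow> A \<inter> (hcube L \<inter> translate (latt L v - u) ?S) = {}" for v A
   proof -
    have "translate (u - latt L v) (A \<inter> hcube L) \<inter> ?S = translate (u - latt L v) (A \<inter> (hcube L \<inter> translate (latt L v - u) ?S))"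
     by (simp add: translate_Int translate_translate Int_assoc)
    moreover have "translate (u - latt L v) X = {} \<longleftrightarrow> X = {}" for X :: "(real^'d) set"
     by (simp add: translate_def)
    ultimately show ?thesis by simp
   qed
   note tr = this
   have iff: "T eta \<in> void B \<longleftrightarrow> (\<forall>v\<in>Z. eta v \<inter> (hcube L \<inter> translate (latt L v - u) ?S) = {})"
    if "eta \<in> space (PiM Z (\<lambda>_. ?nu))" for eta
   proof -
    have "T eta \<in> locally_finite_sets" using measurable_space[OF T that] by simp
    then have "T eta \<in> void B \<longleftrightarrow> (\<forall>v\<in>Z. translate (u - latt L v) (eta v \<inter> hcube L) \<inter> ?S = {})"
     by (simp add: T_def void_def UN_Int)
    then show ?thesis by (simp only: tr)
   qed
   have pie: "eta \<in> PiE Z (\<lambda>v. void (hcube L \<inter> translate (latt L v - u) ?S)) \<longleftrightarrow>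
     eta \<in> space (PiM Z (\<lambda>_. ?nu)) \<and> (\<forall>v\<in>Z. eta v \<inter> (hcube L \<inter> translate (latt L v - u) ?S) = {})" for eta
    by (auto simp: space_PiM void_def spnu PiE_iff)
   show ?thesis
   proof (rule set_eqI)
    fix eta
    show "eta \<in> T -` void B \<inter> space (PiM Z (\<lambda>_. ?nu)) \<longleftrightarrow> eta \<in> PiE Z (\<lambda>v. void (hcube L \<inter> translate (latt L v - u) ?S))"
     unfolding pie using iff[of eta] by auto
   qed
  qed
  also have "emeasure (PiM Z (\<lambda>_. ?nu)) (PiE Z (\<lambda>v. void (hcube L \<inter> translate (latt L v - u) ?S)))
    = (\<Prod>v\<in>Z. emeasure ?nu (void (hcube L \<inter> translate (latt L v - u) ?S)))"
   by (rule emeasure_PiM) (auto simp: Z snu)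
  also have "... = (\<Prod>v\<in>Z. ennreal (exp (- lam * measure lborel (translate (u - latt L v) (hcube L) \<inter> ?S))))"
  proof (rule prod.cong)
   fix v
   have "?W \<inter> (hcube L \<inter> translate (latt L v - u) ?S) = hcube L \<inter> translate (latt L v - u) ?S"
    using hcube_subset_cube unfolding window_eq_cube L by blast
   moreover have "measure lborel (hcube L \<inter> translate (latt L v - u) ?S) = measure lborel (translate (u - latt L v) (hcube L) \<inter> ?S)"
   proof -
    have "hcube L \<inter> translate (latt L v - u) ?S \<in> sets borel" by measurable
    from measure_translate[OF this, of "u - latt L v"] show ?thesis
     by (simp add: translate_Int translate_translate)
   qed
   ultimately show "emeasure ?nu (void (hcube L \<inter> translate (latt L v - u) ?S)) = ennreal (exp (- lam * measure lborel (translate (u - latt L v) (hcube L) \<inter> ?S)))"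
    unfolding poisson_process_eq_ppp[OF lam n] by (subst ppp_void[OF lam borel_window emeasure_window_finite]) auto
  qed simp
  also have "... = ennreal (exp (- lam * (\<Sum>v\<in>Z. measure lborel (translate (u - latt L v) (hcube L) \<inter> ?S))))"
   using Z by (simp add: prod_ennreal exp_sum[symmetric] sum_distrib_left sum_negf)
  also have "(\<Sum>v\<in>Z. measure lborel (translate (u - latt L v) (hcube L) \<inter> ?S)) = measure lborel (\<Union>v\<in>Z. translate (u - latt L v) (hcube L) \<inter> ?S)"
  proof (rule measure_finite_Union[symmetric, OF Z])
   show "(\<lambda>v. translate (u - latt L v) (hcube L) \<inter> ?S) ` Z \<subseteq> sets lborel" by auto
   show "disjoint_family_on (\<lambda>v. translate (u - latt L v) (hcube L) \<inter> ?S) Z"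
   proof (unfold disjoint_family_on_def, safe)
    fix v w x assume "v \<noteq> w" "x \<in> translate (u - latt L v) (hcube L)" "x \<in> translate (u - latt L w) (hcube L)"
    then have "(x + u) - latt L v \<in> hcube L" "(x + u) - latt L w \<in> hcube L" by (simp_all add: mem_translate algebra_simps)
    then have "v = w" unfolding hcube_latt_iff[OF L0] by simp
    then show "x \<in> {}" using \<open>v \<noteq> w\<close> by simp
   qed
   have "emeasure lborel (translate (u - latt L v) (hcube L) \<inter> ?S) < \<infinity>" for v
    by (intro emeasure_Int_finite trB) (use measure_hcube(1)[of L, where 'd='d] L0 in \<open>auto simp: emeasure_translate\<close>)
   then show "emeasure lborel (translate (u - latt L v) (hcube L) \<inter> ?S) \<noteq> \<infinity>" for v by (simp add: less_top)
  qed
  also have "(\<Union>v\<in>Z. translate (u - latt L v) (hcube L) \<inter> ?S) = ?S"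
  proof -
   \<comment> \<open>The cells with index in \<open>Z\<close> cover the window: the summand
     \<open>2\<close> in the hypothesis on \<open>q\<close> leaves room for the shift by at most
     half a cell and for rounding.\<close>
   have "\<exists>v\<in>Z. x \<in> translate (u - latt L v) (hcube L)" if x: "x \<in> window lam N" for x
   proof -
    let ?v = "\<lambda>i. \<lfloor>(x + u) $ i / L + 1 / 2\<rfloor>"
    have "x + (u - latt L ?v) \<in> hcube L"
     using hcube_latt_iff[OF L0, of "x + u" ?v] by (simp add: algebra_simps)
    moreover have "\<bar>?v i\<bar> \<le> q" for i
    proof -
     have "\<bar>x $ i\<bar> \<le> side TYPE('d) lam N / 2" using x by (simp add: window_eq_cube cube_def)
     moreover have "\<bar>u $ i\<bar> \<le> L / 2" using u hcube_subset_cube[of L] by (auto simp: cube_def)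
     ultimately have "\<bar>x $ i + u $ i\<bar> \<le> side TYPE('d) lam N / 2 + L / 2" by linarith
     then have "\<bar>x $ i + u $ i\<bar> / L \<le> (side TYPE('d) lam N / 2 + L / 2) / L"
      using L0 by (intro divide_right_mono) auto
     also have "... = side TYPE('d) lam N / (2 * L) + 1 / 2" using L0 by (simp add: add_divide_distrib)
     finally have "\<bar>(x + u) $ i / L\<bar> \<le> side TYPE('d) lam N / (2 * L) + 1 / 2" using L0 by (simp add: abs_divide)
     then show ?thesis using q by (rule abs_floor_le)
    qed
    ultimately show ?thesis by (intro bexI[of _ ?v]) (auto simp: mem_translate Z_def)
   qed
   then show ?thesis by auto
  qed
  also have "ennreal (exp (- lam * measure lborel ?S)) = emeasure (poisson_process lam N) (void B)"
   unfolding poisson_process_eq_ppp[OF lam N] by (subst ppp_void[OF lam borel_window emeasure_window_finite]) auto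
  finally show "emeasure (distr (PiM Z (\<lambda>_. ?nu)) conf_space T) (void B) = emeasure (poisson_process lam N) (void B)" .
 qed simp
qed

context tiling
begin

text \<open>For fixed \<open>u\<close>, the tiling in window \<open>N\<close> is an image of
  finitely many independent tiles, so product and image bounds give the entropy of one tile times
  their number. The image of the Poisson reference is Poisson whatever \<open>u\<close> is, and the
  left side of the bound is affine in \<open>mu\<close>, so averaging over \<open>u\<close>
  preserves it.\<close>

lemma entropy_bound_P:
 assumes lam: "0 < lam" and n: "0 < n" and N: "0 < N" and Ls: "L = side TYPE('d) lam n"
  and q: "side TYPE('d) lam N / (2 * L) + 2 \<le> real_of_int q"
  and eb: "entropy_bound K mu (poisson_process lam n)"
 shows "entropy_bound (real (nat (2 * q + 1) ^ CARD('d)) * K) (restriction lam P N) (poisson_process lam N)"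
 unfolding entropy_bound_def
proof safe
 let ?nu = "poisson_process lam n :: (real^'d) set measure" and ?Q = "poisson_process lam N :: (real^'d) set measure"
 let ?W = "window lam N :: (real^'d) set"
 define Z where "Z = {v :: 'd \<Rightarrow> int. \<forall>i. \<bar>v i\<bar> \<le> q}"
 have Z: "finite Z" unfolding Z_def by (rule finite_int_box)
 have "0 \<le> side TYPE('d) lam N / (2 * L)" using L side_nonneg[where 'd='d, of lam N] by simp
 then have q0: "0 \<le> q" using q by linarith
 have cZ: "card Z = nat (2 * q + 1) ^ CARD('d)" unfolding Z_def by (rule card_int_box[OF q0])
 have sQ: "sets ?Q = sets conf_space" using lam N by (rule sets_poisson)
 have spQ: "space ?Q = locally_finite_sets" using sets_eq_imp_space_eq[OF sQ] by simp
 have snu: "sets ?nu = sets conf_space" using lam n by (rule sets_poisson)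
 interpret Q: prob_space ?Q using lam N by (rule prob_space_poisson)
 interpret nu: prob_space ?nu using lam n by (rule prob_space_poisson)
 interpret P: prob_space P by (rule prob_space_P)
 fix g b assume "g \<in> borel_measurable ?Q" and "\<forall>x\<in>space ?Q. \<bar>g x\<bar> \<le> (b::real)"
 then have g [measurable]: "g \<in> borel_measurable conf_space" and b: "\<And>x. x \<in> locally_finite_sets \<Longrightarrow> \<bar>g x\<bar> \<le> b"
  by (auto simp: spQ measurable_cong_sets[OF sQ refl])
 let ?R = "real (card Z) * K + ln (\<integral>om. exp (g om) \<partial>?Q)"
 have main: "(\<integral>om. g (translate u om \<inter> ?W) \<partial>P0) \<le> ?R" if u: "u \<in> hcube L" for u
 proof -
  define T where "T = (\<lambda>eta. (\<Union>v\<in>Z. translate (u - latt L v) (eta v \<inter> hcube L)) \<inter> ?W)"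
  note T = distr_shifted_tiles[OF lam n N u Ls q, folded Z_def, folded T_def]
  have sPM: "sets (PiM Z (\<lambda>_. mu)) = sets (PiM Z (\<lambda>_. ?nu))" by (intro sets_PiM_cong) (auto simp: sets_mu snu)
  have Tm: "T \<in> PiM Z (\<lambda>_. mu) \<rightarrow>\<^sub>M conf_space" using T(1) by (simp add: measurable_cong_sets[OF sPM refl])
  have "(\<integral>om. g (translate u om \<inter> ?W) \<partial>P0) = (\<integral>eta. g (translate u (tile eta) \<inter> ?W) \<partial>PiM UNIV (\<lambda>_. mu))"
   unfolding P0_def by (intro integral_distr) measurable
  also have "... = (\<integral>eta. g (T (restrict eta Z)) \<partial>PiM UNIV (\<lambda>_. mu))"
  proof -
   have "translate u (tile eta) \<inter> ?W = T (restrict eta Z)" for eta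
   proof (rule set_eqI)
    fix x
    show "x \<in> translate u (tile eta) \<inter> ?W \<longleftrightarrow> x \<in> T (restrict eta Z)"
    proof
     assume x: "x \<in> translate u (tile eta) \<inter> ?W"
     then obtain v where v: "x + u - latt L v \<in> eta v \<inter> hcube L" by (auto simp: tile_def mem_translate)
     then have "v = (\<lambda>i. \<lfloor>(x + u) $ i / L + 1 / 2\<rfloor>)" using hcube_latt_iff[OF L, of "x + u" v] by simp
     moreover have "\<bar>\<lfloor>(x + u) $ i / L + 1 / 2\<rfloor>\<bar> \<le> q" for i
     proof -
      have "\<bar>x $ i\<bar> \<le> side TYPE('d) lam N / 2" using x by (simp add: window_eq_cube cube_def)
      moreover have "\<bar>u $ i\<bar> \<le> L / 2" using u hcube_subset_cube[of L] by (auto simp: cube_def)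
      ultimately have "\<bar>x $ i + u $ i\<bar> \<le> side TYPE('d) lam N / 2 + L / 2" by linarith
      then have "\<bar>x $ i + u $ i\<bar> / L \<le> (side TYPE('d) lam N / 2 + L / 2) / L"
       using L by (intro divide_right_mono) auto
      also have "... = side TYPE('d) lam N / (2 * L) + 1 / 2" using L by (simp add: add_divide_distrib)
      finally have "\<bar>(x + u) $ i / L\<bar> \<le> side TYPE('d) lam N / (2 * L) + 1 / 2" using L by (simp add: abs_divide)
      then show ?thesis using q by (rule abs_floor_le)
     qed
     ultimately have "v \<in> Z" by (simp add: Z_def)
     then show "x \<in> T (restrict eta Z)" using v x by (auto simp: T_def mem_translate algebra_simps intro!: bexI[of _ v])
    next
     assume "x \<in> T (restrict eta Z)"
     then show "x \<in> translate u (tile eta) \<inter> ?W"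
      by (auto simp: T_def tile_def mem_translate algebra_simps)
    qed
   qed
   then show ?thesis by simp
  qed
  also have "... = (\<integral>eta. g (T eta) \<partial>distr (PiM UNIV (\<lambda>_. mu)) (PiM Z (\<lambda>_. mu)) (\<lambda>eta. restrict eta Z))"
   using Tm by (intro integral_distr[symmetric] measurable_restrict_subset measurable_compose[OF _ g]) auto
  also have "distr (PiM UNIV (\<lambda>_. mu)) (PiM Z (\<lambda>_. mu)) (\<lambda>eta. restrict eta Z) = PiM Z (\<lambda>_. mu)"
   by (rule PM.distr_PiM_restrict_finite[OF Z]) simp
  also have "(\<integral>eta. g (T eta) \<partial>PiM Z (\<lambda>_. mu)) \<le> (\<Sum>v\<in>Z. K) + ln (\<integral>eta. exp (g (T eta)) \<partial>PiM Z (\<lambda>_. ?nu))"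
  proof (rule entropy_boundD[where b=b])
   show "entropy_bound (\<Sum>v\<in>Z. K) (PiM Z (\<lambda>_. mu)) (PiM Z (\<lambda>_. ?nu))"
    by (intro entropy_bound_PiM Z prob_mu nu.prob_space_axioms eb) (simp add: sets_mu snu)
   show "(\<lambda>eta. g (T eta)) \<in> borel_measurable (PiM Z (\<lambda>_. ?nu))" using T(1) by measurable
   show "\<bar>g (T eta)\<bar> \<le> b" if "eta \<in> space (PiM Z (\<lambda>_. ?nu))" for eta
    using measurable_space[OF T(1) that] by (intro b) simp
  qed
  also have "(\<integral>eta. exp (g (T eta)) \<partial>PiM Z (\<lambda>_. ?nu)) = (\<integral>om. exp (g om) \<partial>distr (PiM Z (\<lambda>_. ?nu)) conf_space T)"
   using T(1) by (intro integral_distr[symmetric]) auto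
  finally show ?thesis by (simp add: T(2))
 qed
 have bd: "\<bar>g (translate u om \<inter> ?W)\<bar> \<le> b" if "om \<in> locally_finite_sets" for u om
  using that by (intro b locally_finite_Int translate_locally_finite)
 let ?U = "uniform_measure lborel (hcube L) :: (real^'d) measure"
 have mg: "(\<lambda>p. g (translate (fst p) (snd p) \<inter> ?W)) \<in> borel_measurable (?U \<Otimes>\<^sub>M P0)" by measurable
 have int: "integrable (?U \<Otimes>\<^sub>M P0) (\<lambda>p. g (translate (fst p) (snd p) \<inter> ?W))"
  using mg bd by (intro HP0.integrable_bounded_fun(1)[where b=b]) (auto simp: space_pair_measure space_P0)
 have "(\<integral>om. g om \<partial>restriction lam P N) = (\<integral>om. g (om \<inter> ?W) \<partial>P)"
  by (intro integral_distr) auto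
 also have "... = (\<integral>p. g (translate (fst p) (snd p) \<inter> ?W) \<partial>(?U \<Otimes>\<^sub>M P0))"
  unfolding P_def using measurable_shift by (subst integral_distr) (auto simp: case_prod_beta)
 also have "... = (\<integral>u. \<integral>om. g (translate u om \<inter> ?W) \<partial>P0 \<partial>?U)"
  using HP0.integral_fst'[OF int] by simp
 also have "... \<le> (\<integral>u. ?R \<partial>?U)"
 proof (rule integral_mono_AE)
  show "integrable ?U (\<lambda>u. \<integral>om. g (translate u om \<inter> ?W) \<partial>P0)"
   using HP0.integrable_fst'[OF int] by simp
  show "AE u in ?U. (\<integral>om. g (translate u om \<inter> ?W) \<partial>P0) \<le> ?R"
  proof (rule AE_uniform_measureI)
   show "AE x in lborel. x \<in> hcube L \<longrightarrow> (\<integral>om. g (translate x om \<inter> ?W) \<partial>P0) \<le> ?R" using main by simp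
  qed simp
 qed simp
 also have "... = ?R" using H.U.prob_space by simp
 finally show "(\<integral>om. g om \<partial>restriction lam P N) \<le> real (nat (2 * q + 1) ^ CARD('d)) * K + ln (\<integral>om. exp (g om) \<partial>?Q)"
  by (simp add: cZ)
qed

text \<open>The tiles meeting window \<open>N\<close> exceed those needed for its volume only by a
  boundary layer. Their number divided by the volume therefore tends to one over the volume of a
  tile.\<close>

lemma specific_entropy_P:
 assumes lam: "0 < lam" and n: "0 < n" and Ls: "L = side TYPE('d) lam n"
  and fin: "(\<integral>\<^sup>+om. num_points om (hcube L) \<partial>mu) < \<infinity>"
  and eb: "entropy_bound K mu (poisson_process lam n)"
 shows "specific_entropy lam P \<le> ereal (K / (real n / lam))"
proof -
 interpret S: stationary_process P by unfold_locales (rule stationary_P[OF fin])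
 let ?d = "CARD('d)" and ?s = "\<lambda>N. side TYPE('d) lam N"
 have K0: "0 \<le> K" using eb prob_space_poisson[OF lam n] entropy_bound_nonneg by blast
 \<comment> \<open>The \<open>7\<close> stems from \<open>2 * q + 1\<close> with \<open>q\<close> at
   most \<open>?s N / (2 * L) + 3\<close>.\<close>
 define B where "B = (\<lambda>N. (?s N / L + 7) ^ ?d * K / ?s N ^ ?d)"
 have le: "entropy_density_seq lam P N \<le> ereal (B N)" if N: "0 < N" for N
 proof -
  have s: "0 < ?s N" using lam N by (rule side_pos)
  define q where "q = \<lceil>?s N / (2 * L)\<rceil> + 2"
  have q: "?s N / (2 * L) + 2 \<le> real_of_int q" unfolding q_def by linarith
  have "0 \<le> ?s N / (2 * L)" using s L by simp
  then have q0: "0 \<le> q" unfolding q_def by linarith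
  have "real_of_int q \<le> ?s N / (2 * L) + 3" unfolding q_def by linarith
  then have "real (nat (2 * q + 1)) \<le> 2 * (?s N / (2 * L) + 3) + 1" using q0 by simp
  also have "... = ?s N / L + 7" by simp
  finally have cle: "real (nat (2 * q + 1)) ^ ?d \<le> (?s N / L + 7) ^ ?d" by (intro power_mono) auto
  have "relative_entropy (restriction lam P N) (poisson_process lam N) \<le> ereal (real (nat (2 * q + 1) ^ ?d) * K)"
   using entropy_bound_P[OF lam n N Ls q eb] S.relative_entropy_restriction_iff[OF lam N] by blast
  also have "... \<le> ereal ((?s N / L + 7) ^ ?d * K)"
   using cle K0 by (simp add: mult_right_mono)
  finally have "entropy_density_seq lam P N \<le> ereal (1 / ?s N ^ ?d) * ereal ((?s N / L + 7) ^ ?d * K)"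
   using s unfolding entropy_density_seq_def measure_window[OF lam] side_power[OF lam, symmetric, where 'd='d]
   by (intro ereal_mult_left_mono) auto
  then show ?thesis by (simp add: B_def)
 qed
 have "B \<longlonglongrightarrow> (1 / L) ^ ?d * K"
 proof -
  have "(\<lambda>N. 7 / ?s N) \<longlonglongrightarrow> 0"
   by (rule tendsto_divide_0[OF tendsto_const filterlim_at_top_imp_at_infinity[OF filterlim_side[OF lam]]])
  then have "(\<lambda>N. (1 / L + 7 / ?s N) ^ ?d * K) \<longlonglongrightarrow> (1 / L + 0) ^ ?d * K"
   by (intro tendsto_intros)
  moreover have "\<forall>\<^sub>F N in sequentially. (1 / L + 7 / ?s N) ^ ?d * K = B N"
   using eventually_gt_at_top[of "0::nat"]
  proof eventually_elim
   case (elim N)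
   then have s: "0 < ?s N" using lam by (intro side_pos)
   have "1 / L + 7 / ?s N = (?s N / L + 7) / ?s N" using s by (simp add: field_simps)
   then show ?case by (simp add: B_def power_divide)
  qed
  ultimately show ?thesis by (simp add: Lim_transform_eventually)
 qed
 then have lim: "(\<lambda>N. ereal (B N)) \<longlonglongrightarrow> ereal ((1 / L) ^ ?d * K)" by simp
 have "specific_entropy lam P \<le> ereal ((1 / L) ^ ?d * K)"
  by (rule tendsto_le[OF _ lim S.entropy_density_seq_tendsto[OF lam]])
   (use le in \<open>auto simp: eventually_sequentially intro!: exI[of _ 1]\<close>)
 also have "(1 / L) ^ ?d * K = K / (real n / lam)"
  using side_power[OF lam, where 'd='d, of n] by (simp add: Ls power_divide)
 finally show ?thesis .
qed

end

section \<open>The upper bound for the partition function\<close>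

lemma positive_volume_window: "0 < lam \<Longrightarrow> 0 < n \<Longrightarrow> positive_volume (window lam n :: (real^'d::finite) set)"
 by unfold_locales (simp_all add: emeasure_window_finite[simplified] measure_window)

locale gibbs =
 fixes lam c :: real and n :: nat and V :: "(real^'d::finite) set \<Rightarrow> real"
 assumes lam: "0 < lam" and n: "0 < n" and V [measurable]: "V \<in> borel_measurable conf_space"
  and V_bound: "\<And>om. om \<in> locally_finite_sets \<Longrightarrow> \<bar>V om\<bar> \<le> c"
begin

abbreviation "W \<equiv> window lam n :: (real^'d) set"
abbreviation "\<beta> \<equiv> binomial_process lam n :: (real^'d) set measure"
abbreviation "H \<equiv> energy lam V n"
abbreviation "Z \<equiv> partition_fun lam V n"
abbreviation "G \<equiv> binomial_gibbs lam V n"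
abbreviation "Poi \<equiv> poisson_process lam n :: (real^'d) set measure"

sublocale W: positive_volume W by (rule positive_volume_window[OF lam n])

sublocale \<beta>: prob_space \<beta> unfolding binomial_process_def by (rule W.prob_space_iid)

sublocale Poi: prob_space Poi by (rule prob_space_poisson[OF lam n])

lemma sets_\<beta> [measurable_cong]: "sets \<beta> = sets conf_space" by (simp add: binomial_process_def)

lemma space_\<beta>: "space \<beta> = locally_finite_sets" using sets_eq_imp_space_eq[OF sets_\<beta>] by simp

lemma sets_Poi [measurable_cong]: "sets Poi = sets conf_space" by (rule sets_poisson[OF lam n])

lemma c0: "0 \<le> c" using V_bound[of "{}"] by simp

lemma H_measurable [measurable]: "H \<in> borel_measurable conf_space"
 unfolding energy_def[abs_def] using V lam n by (rule measurable_score_sum)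

text \<open>The faces of the window are null sets, so closed window and half-open tile almost surely
  hold the same \<open>n\<close> points.\<close>

lemma AE_\<beta>: "AE om in \<beta>. om \<in> locally_finite_sets \<and> om \<subseteq> hcube (side TYPE('d) lam n) \<and> finite om \<and> card om = n"
proof -
 let ?L = "side TYPE('d) lam n"
 have "measure lborel (W \<inter> - hcube ?L) = 0"
  using measure_hcube(2)[where 'd='d, of ?L] side_nonneg[where 'd='d, of lam n]
  by (simp add: window_eq_cube Diff_eq measure_def)
 then have "emeasure \<beta> (void (- hcube ?L)) = 1"
  unfolding binomial_process_def by (subst W.emeasure_iid_void) auto
 then have "AE om in \<beta>. om \<in> void (- hcube ?L)"
  by (intro \<beta>.AE_prob_1) (simp add: \<beta>.emeasure_eq_measure)
 moreover have "AE om in \<beta>. num_points om UNIV = of_nat n"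
  unfolding binomial_process_def by (rule W.AE_iid_card)
 moreover have "AE om in \<beta>. om \<subseteq> W \<and> finite om \<and> card om \<le> n"
  unfolding binomial_process_def by (rule W.AE_iid_subset)
 ultimately show ?thesis
 proof eventually_elim
  case (elim om)
  then show ?case by (auto simp: void_def num_points_eq_card)
 qed
qed

lemma H_bound:
 assumes "om \<in> locally_finite_sets" "finite om" "card om = n"
 shows "\<bar>H om\<bar> \<le> c * real n"
proof -
 have "\<bar>H om\<bar> \<le> (\<Sum>x\<in>om \<inter> W. c)"
  unfolding energy_def
  using V_bound[OF translate_locally_finite[OF periodize_locally_finite[OF lam n assms(1)]]]
  by (intro order_trans[OF sum_abs] sum_mono) auto
 also have "... \<le> real n * c"
  using card_mono[OF assms(2), of "om \<inter> W"] assms c0 by (simp add: mult_right_mono)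
 finally show ?thesis by (simp add: mult.commute)
qed

lemma AE_H: "AE om in \<beta>. \<bar>H om\<bar> \<le> c * real n"
 using AE_\<beta> by eventually_elim (use H_bound in auto)

lemma integrable_exp_H: "integrable \<beta> (\<lambda>om. exp (- H om))"
proof (rule \<beta>.integrable_const_bound[where B="exp (c * real n)"])
 show "AE om in \<beta>. norm (exp (- H om)) \<le> exp (c * real n)"
  using AE_H by eventually_elim (auto simp: abs_le_iff)
qed measurable

lemma Z_bounds: "exp (- c * real n) \<le> Z"
proof -
 have "(\<integral>om. exp (- c * real n) \<partial>\<beta>) \<le> Z"
  unfolding partition_fun_def
 proof (rule integral_mono_AE)
  show "AE om in \<beta>. exp (- c * real n) \<le> exp (- H om)"
   using AE_H by eventually_elim (auto simp: abs_le_iff)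
 qed (use integrable_exp_H in auto)
 then show ?thesis by (simp add: \<beta>.prob_space)
qed

lemma Z_pos: "0 < Z" using Z_bounds exp_gt_zero less_le_trans by blast

lemma sets_G [measurable_cong]: "sets G = sets conf_space"
 by (simp add: binomial_gibbs_def sets_\<beta>)

lemma space_G: "space G = locally_finite_sets" using sets_eq_imp_space_eq[OF sets_G] by simp

lemma nn_integral_G:
 assumes [measurable]: "F \<in> borel_measurable conf_space"
 shows "(\<integral>\<^sup>+om. F om \<partial>G) = (\<integral>\<^sup>+om. ennreal (exp (- H om) / Z) * F om \<partial>\<beta>)"
 unfolding binomial_gibbs_def by (intro nn_integral_density) measurable

lemma integral_G:
 fixes F :: "(real^'d) set \<Rightarrow> real"
 assumes [measurable]: "F \<in> borel_measurable conf_space"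
 shows "(\<integral>om. F om \<partial>G) = (\<integral>om. exp (- H om) * F om \<partial>\<beta>) / Z"
proof -
 have "(\<integral>om. F om \<partial>G) = (\<integral>om. (exp (- H om) / Z) * F om \<partial>\<beta>)"
  unfolding binomial_gibbs_def using Z_pos by (intro integral_real_density) (auto simp: less_imp_le)
 then show ?thesis by simp
qed

sublocale G: prob_space G
proof
 have "emeasure G (space G) = (\<integral>\<^sup>+om. 1 \<partial>G)" by simp
 also have "... = (\<integral>\<^sup>+om. ennreal (exp (- H om) / Z) \<partial>\<beta>)" by (subst nn_integral_G) auto
 also have "... = ennreal (\<integral>om. exp (- H om) / Z \<partial>\<beta>)"
  using integrable_exp_H Z_pos by (intro nn_integral_eq_integral) (auto simp: less_imp_le)
 also have "(\<integral>om. exp (- H om) / Z \<partial>\<beta>) = 1" using Z_pos by (simp add: partition_fun_def)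
 finally show "emeasure G (space G) = 1" by simp
qed

lemma AE_G: "AE om in \<beta>. Q om \<Longrightarrow> AE om in G. Q om"
 unfolding binomial_gibbs_def by (subst AE_density) (auto elim: eventually_mono)

lemma integrable_H: "integrable G H"
proof (rule G.integrable_const_bound[where B="c * real n"])
 show "AE om in G. norm (H om) \<le> c * real n" using AE_G[OF AE_H] by simp
qed measurable

text \<open>Weight of \<open>n\<close> in the Poisson law of the point number; the mean
  \<open>lam\<close> times the volume of the window equals \<open>n\<close>.\<close>

definition p where "p = pmf (poisson_pmf (real n)) n"

lemma p_pos: "0 < p" using n by (simp add: p_def)

text \<open>By Jensen, \<open>\<Pi>(e\<^sup>g) \<ge> p \<beta>(e\<^sup>g) = p Z G(e\<^bsup>g + H\<^esup>) \<ge> p Z e\<^bsup>G(g) + G(H)\<^esup>\<close>, so no densities with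
 respect to the Poisson process are needed.\<close>

lemma entropy_bound_gibbs: "entropy_bound (- ln p - ln Z - (\<integral>om. H om \<partial>G)) G Poi"
 unfolding entropy_bound_def
proof safe
 fix g b assume "g \<in> borel_measurable Poi" and "\<forall>x\<in>space Poi. \<bar>g x\<bar> \<le> (b::real)"
 then have g [measurable]: "g \<in> borel_measurable conf_space" and b: "\<And>x. x \<in> locally_finite_sets \<Longrightarrow> \<bar>g x\<bar> \<le> b"
  using sets_eq_imp_space_eq[OF sets_Poi] by (auto simp: measurable_cong_sets[OF sets_Poi refl])
 have spPoi: "space Poi = locally_finite_sets" using sets_eq_imp_space_eq[OF sets_Poi] by simp
 have iPoi: "integrable Poi (\<lambda>om. exp (g om))" using b by (intro Poi.integrable_bounded_fun(2)[where b=b]) (auto simp: spPoi)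
 have i\<beta>: "integrable \<beta> (\<lambda>om. exp (g om))" using b by (intro \<beta>.integrable_bounded_fun(2)[where b=b]) (auto simp: space_\<beta>)
 have iG: "integrable G g" using b by (intro G.integrable_bounded_fun(1)[where b=b]) (auto simp: space_G)
 have e\<beta>: "(\<integral>om. exp (g om) \<partial>\<beta>) = Z * (\<integral>om. exp (g om + H om) \<partial>G)"
  using Z_pos by (subst integral_G) (auto simp: exp_add exp_minus field_simps)
 have "ennreal p * (\<integral>\<^sup>+om. ennreal (exp (g om)) \<partial>\<beta>) \<le> (\<integral>\<^sup>+om. ennreal (exp (g om)) \<partial>Poi)"
  unfolding poisson_process_eq_ppp[OF lam n] binomial_process_def p_def
  using W.nn_integral_ppp_ge[of "\<lambda>om. ennreal (exp (g om))" lam n] lam by (simp add: measure_window)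
 then have "ennreal (p * (\<integral>om. exp (g om) \<partial>\<beta>)) \<le> ennreal (\<integral>om. exp (g om) \<partial>Poi)"
  using iPoi i\<beta> p_pos by (simp add: nn_integral_eq_integral ennreal_mult)
 then have 1: "p * (\<integral>om. exp (g om) \<partial>\<beta>) \<le> (\<integral>om. exp (g om) \<partial>Poi)"
  by (subst (asm) ennreal_le_iff) (auto intro!: integral_nonneg_AE)
 have "exp (\<integral>om. g om + H om \<partial>G) \<le> (\<integral>om. exp (g om + H om) \<partial>G)"
 proof (rule G.exp_expectation_le)
  show "integrable G (\<lambda>om. g om + H om)" using iG integrable_H by simp
  show "integrable G (\<lambda>om. exp (g om + H om))"
  proof (rule G.integrable_const_bound[where B="exp (b + c * real n)"])
   show "AE om in G. norm (exp (g om + H om)) \<le> exp (b + c * real n)"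
    using AE_G[OF AE_H] AE_space
   proof eventually_elim
    case (elim om)
    then show ?case using b[of om] by (auto simp: space_G abs_le_iff intro!: add_mono)
   qed
  qed measurable
 qed
 then have 2: "p * (Z * exp (\<integral>om. g om + H om \<partial>G)) \<le> p * (\<integral>om. exp (g om) \<partial>\<beta>)"
  unfolding e\<beta> using p_pos Z_pos by (intro mult_left_mono) auto
 have "p * (Z * exp (\<integral>om. g om + H om \<partial>G)) \<le> (\<integral>om. exp (g om) \<partial>Poi)" using 1 2 by linarith
 then have "ln (p * (Z * exp (\<integral>om. g om + H om \<partial>G))) \<le> ln (\<integral>om. exp (g om) \<partial>Poi)"
  using p_pos Z_pos by (intro ln_mono) auto
 then have "ln p + ln Z + (\<integral>om. g om + H om \<partial>G) \<le> ln (\<integral>om. exp (g om) \<partial>Poi)"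
  using p_pos Z_pos by (simp add: ln_mult)
 then show "(\<integral>om. g om \<partial>G) \<le> - ln p - ln Z - (\<integral>om. H om \<partial>G) + ln (\<integral>om. exp (g om) \<partial>Poi)"
  using iG integrable_H by simp
qed

text \<open>Jensen bounds \<open>t\<close> times the mean by a log-moment. The Gibbs density with
  respect to the binomial process is at most \<open>exp (2 * c * real n)\<close>, and there the
  moment is that of \<open>n\<close> independent trials. Such a density could concentrate the mass
  on configurations crowded near the boundary, so a bound on the binomial mean would not suffice; a
  large \<open>t\<close> absorbs the factor.\<close>

lemma mean_count_bound:
 assumes D [measurable]: "D \<in> sets borel" and t: "0 < t"
 defines "m \<equiv> \<lambda>om. \<Sum>x\<in>om \<inter> W. indicator D x :: real"
 shows "m \<in> borel_measurable conf_space" and "integrable G m"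
  and "(\<integral>om. m om \<partial>G) \<le> real n * (2 * c + ln (1 + measure lborel (W \<inter> D) / (real n / lam) * (exp t - 1))) / t"
proof -
 show mm [measurable]: "m \<in> borel_measurable conf_space"
  unfolding m_def by (intro measurable_sum_points) auto
 have m0: "0 \<le> m om" for om unfolding m_def by (intro sum_nonneg) auto
 have mAE: "AE om in \<beta>. m om \<le> real n"
  using AE_\<beta>
 proof eventually_elim
  case (elim om)
  have "m om \<le> (\<Sum>x\<in>om \<inter> W. 1)" unfolding m_def by (intro sum_mono) (auto split: split_indicator)
  also have "... \<le> real n" using elim card_mono[of om "om \<inter> W"] by simp
  finally show ?case .
 qed
 show im: "integrable G m"
  using AE_G[OF mAE] m0 by (intro G.integrable_const_bound[where B="real n"]) auto
 let ?U = "uniform_measure lborel W"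
 let ?p = "measure lborel (W \<inter> D) / (real n / lam)"
 have p0: "0 \<le> ?p" using lam n by simp
 have X0: "0 \<le> ?p * (exp t - 1)" using p0 t by (intro mult_nonneg_nonneg) auto
 have one: "(\<integral>\<^sup>+x. ennreal (exp (t * indicator D x)) \<partial>?U) = ennreal (1 + ?p * (exp t - 1))"
 proof -
  have "(\<integral>\<^sup>+x. ennreal (exp (t * indicator D x)) \<partial>?U) = (\<integral>\<^sup>+x. 1 + ennreal (exp t - 1) * indicator D x \<partial>?U)"
  proof (rule nn_integral_cong)
   have "ennreal (exp t) = 1 + ennreal (exp t - 1)"
    using t by (subst ennreal_1[symmetric], subst ennreal_plus[symmetric]) auto
   then show "ennreal (exp (t * indicator D x)) = 1 + ennreal (exp t - 1) * indicator D x" for x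
    by (auto split: split_indicator)
  qed
  also have "... = 1 + ennreal (exp t - 1) * emeasure ?U D"
   using W.U.emeasure_space_1 by (simp add: nn_integral_add nn_integral_cmult)
  also have "emeasure ?U D = ennreal ?p"
  proof -
   have "emeasure lborel (W \<inter> D) = ennreal (measure lborel (W \<inter> D))"
    using emeasure_Int_finite[of W lborel D] emeasure_window_finite[of lam n, where 'd='d]
    by (intro emeasure_eq_ennreal_measure) (auto simp: less_top)
   then show ?thesis using lam n
    by (simp add: W.emeasure_C measure_window divide_ennreal)
  qed
  also have "1 + ennreal (exp t - 1) * ennreal ?p = ennreal (1 + ?p * (exp t - 1))"
   using t p0 X0 by (simp add: ennreal_mult[symmetric] ennreal_plus[symmetric] mult.commute del: ennreal_plus flip: ennreal_1)
  finally show ?thesis .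
 qed
 have "(\<integral>\<^sup>+om. ennreal (exp (t * m om)) \<partial>\<beta>) = (\<integral>\<^sup>+X. ennreal (exp (t * m (X ` {..<n}))) \<partial>PiM {..<n} (\<lambda>_. ?U))"
  unfolding binomial_process_def by (rule W.nn_integral_iid) measurable
 also have "... \<le> (\<integral>\<^sup>+X. (\<Prod>i\<in>{..<n}. ennreal (exp (t * indicator D (X i)))) \<partial>PiM {..<n} (\<lambda>_. ?U))"
 proof (rule nn_integral_mono)
  fix X :: "nat \<Rightarrow> real^'d"
  have "m (X ` {..<n}) \<le> (\<Sum>x\<in>X ` {..<n}. indicator D x)"
   unfolding m_def by (intro sum_mono2) auto
  also have "... \<le> (\<Sum>i\<in>{..<n}. indicator D (X i))"
   using sum_image_le[of "{..<n}" "indicator D :: _ \<Rightarrow> real" X] by (simp add: comp_def)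
  finally have "t * m (X ` {..<n}) \<le> t * (\<Sum>i\<in>{..<n}. indicator D (X i))"
   using t by (intro mult_left_mono) auto
  then have "exp (t * m (X ` {..<n})) \<le> exp (\<Sum>i\<in>{..<n}. t * indicator D (X i))"
   by (simp only: sum_distrib_left exp_le_cancel_iff)
  also have "... = (\<Prod>i\<in>{..<n}. exp (t * indicator D (X i)))" by (rule exp_sum) simp
  finally show "ennreal (exp (t * m (X ` {..<n}))) \<le> (\<Prod>i\<in>{..<n}. ennreal (exp (t * indicator D (X i))))"
   by (simp add: prod_ennreal ennreal_leI)
 qed
 also have "... = (\<Prod>i\<in>{..<n}. ennreal (1 + ?p * (exp t - 1)))"
  by (subst W.PU.product_nn_integral_prod) (auto simp: one)
 also have "... = ennreal ((1 + ?p * (exp t - 1)) ^ n)"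
  using X0 by (subst prod_ennreal) auto
 finally have \<beta>le: "(\<integral>\<^sup>+om. ennreal (exp (t * m om)) \<partial>\<beta>) \<le> ennreal ((1 + ?p * (exp t - 1)) ^ n)" .
 have "(\<integral>\<^sup>+om. ennreal (exp (t * m om)) \<partial>G) = (\<integral>\<^sup>+om. ennreal (exp (- H om) / Z) * ennreal (exp (t * m om)) \<partial>\<beta>)"
  by (rule nn_integral_G) measurable
 also have "... \<le> (\<integral>\<^sup>+om. ennreal (exp (2 * c * real n)) * ennreal (exp (t * m om)) \<partial>\<beta>)"
 proof (rule nn_integral_mono_AE)
  show "AE om in \<beta>. ennreal (exp (- H om) / Z) * ennreal (exp (t * m om)) \<le> ennreal (exp (2 * c * real n)) * ennreal (exp (t * m om))"
   using AE_H
  proof eventually_elim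
   case (elim om)
   have "exp (- H om) / Z \<le> exp (c * real n) / exp (- c * real n)"
    using elim Z_bounds Z_pos by (intro frac_le) (auto simp: abs_le_iff)
   also have "... = exp (2 * c * real n)" by (simp flip: exp_diff)
   finally show ?case by (intro mult_right_mono ennreal_leI) auto
  qed
 qed
 also have "... = ennreal (exp (2 * c * real n)) * (\<integral>\<^sup>+om. ennreal (exp (t * m om)) \<partial>\<beta>)"
  by (intro nn_integral_cmult) measurable
 also have "... \<le> ennreal (exp (2 * c * real n)) * ennreal ((1 + ?p * (exp t - 1)) ^ n)"
  using \<beta>le by (intro mult_left_mono) auto
 also have "... = ennreal (exp (2 * c * real n) * (1 + ?p * (exp t - 1)) ^ n)"
  using X0 by (simp add: ennreal_mult)
 finally have Gle: "(\<integral>\<^sup>+om. ennreal (exp (t * m om)) \<partial>G) \<le> ennreal (exp (2 * c * real n) * (1 + ?p * (exp t - 1)) ^ n)" .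
 have ie: "integrable G (\<lambda>om. exp (t * m om))"
 proof (rule integrableI_nonneg)
  show "(\<integral>\<^sup>+om. ennreal (exp (t * m om)) \<partial>G) < \<infinity>" by (rule order.strict_trans1[OF Gle]) simp
 qed auto
 have "exp (\<integral>om. t * m om \<partial>G) \<le> (\<integral>om. exp (t * m om) \<partial>G)"
  using im ie by (intro G.exp_expectation_le) auto
 also have "... \<le> exp (2 * c * real n) * (1 + ?p * (exp t - 1)) ^ n"
  using Gle ie X0 by (simp add: nn_integral_eq_integral)
 also have "... = exp (real n * (2 * c + ln (1 + ?p * (exp t - 1))))"
 proof -
  have "0 < 1 + ?p * (exp t - 1)" using X0 by linarith
  then have "(1 + ?p * (exp t - 1)) ^ n = exp (real n * ln (1 + ?p * (exp t - 1)))"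
   by (simp add: exp_of_nat_mult)
  then show ?thesis by (simp add: exp_add[symmetric] algebra_simps)
 qed
 finally have "t * (\<integral>om. m om \<partial>G) \<le> real n * (2 * c + ln (1 + ?p * (exp t - 1)))" by simp
 then show "(\<integral>om. m om \<partial>G) \<le> real n * (2 * c + ln (1 + ?p * (exp t - 1))) / t"
  using t by (simp add: field_simps)
qed

end

section \<open>Palm energy of the tiling against the periodized energy\<close>

lemma periodize_interior:
 fixes z :: "real^'d::finite"
 assumes lam: "0 < lam" and n: "0 < n" and z: "\<And>i. \<bar>z $ i\<bar> < side TYPE('d) lam n / 2"
 shows "z \<in> periodize lam n om \<longleftrightarrow> z \<in> om"
proof -
 let ?L = "side TYPE('d) lam n"
 have L: "0 < ?L" using lam n by (rule side_pos)
 have zW: "z \<in> window lam n" using z by (simp add: window_eq_cube cube_def less_imp_le)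
 have "v = (\<lambda>_. 0)" if "z - latt ?L v \<in> window lam n" for v
 proof
  fix i
  show "v i = 0"
  proof (rule ccontr)
   assume "v i \<noteq> 0"
   then have "1 \<le> \<bar>real_of_int (v i)\<bar>" by linarith
   then have "?L \<le> \<bar>?L * real_of_int (v i)\<bar>"
    using L mult_left_mono[of 1 "\<bar>real_of_int (v i)\<bar>" ?L] by (simp add: abs_mult)
   moreover have "\<bar>z $ i - ?L * real_of_int (v i)\<bar> \<le> ?L / 2"
    using that by (simp add: window_eq_cube cube_def)
   ultimately show False using z[of i] by linarith
  qed
 qed
 moreover have "z \<in> periodize lam n om \<longleftrightarrow> (\<exists>v. z - latt ?L v \<in> om \<and> z - latt ?L v \<in> window lam n)"
  by (simp add: periodize_eq mem_translate)
 ultimately show ?thesis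
  using zW by (metis latt_zero diff_zero)
qed

lemma ennreal_le_divide:
 assumes w: "0 < w" and le: "ennreal w * X \<le> ennreal e"
 shows "X \<le> ennreal (e / w)"
proof -
 have "ennreal (1 / w) * (ennreal w * X) \<le> ennreal (1 / w) * ennreal e"
  using le by (rule mult_left_mono) simp
 moreover have "ennreal (1 / w) * ennreal w = 1"
  using w by (subst ennreal_mult[symmetric]) auto
 moreover have "ennreal (1 / w) * ennreal e = ennreal (e / w)"
  using w by (subst ennreal_mult'[symmetric]) auto
 ultimately show ?thesis by (simp only: mult.assoc[symmetric]) simp
qed

locale local_gibbs = gibbs lam c n V
 for lam c :: real and n :: nat and V :: "(real^'d::finite) set \<Rightarrow> real" +
 fixes r :: real
 assumes r: "0 < r" and V_local: "\<And>om. om \<in> locally_finite_sets \<Longrightarrow> V om = V (om \<inter> cball 0 r)"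
begin

text \<open>The layer in which a point may interact across the faces, hence with a neighbouring tile
  in the tiling but with a periodic image in \<open>periodize\<close>.\<close>

definition near_boundary :: "(real^'d) set" where
 "near_boundary = {x. \<exists>i. side TYPE('d) lam n / 2 - r \<le> \<bar>x $ i\<bar>}"

lemma borel_near_boundary [measurable]: "near_boundary \<in> sets borel"
proof -
 have "near_boundary = {x \<in> space borel. \<exists>i. side TYPE('d) lam n / 2 - r \<le> \<bar>x $ i\<bar>}" by (auto simp: near_boundary_def)
 also have "... \<in> sets borel" by measurable
 finally show ?thesis .
qed

lemma L_pos: "0 < side TYPE('d) lam n" using lam n by (rule side_pos)

sublocale T: tiling "side TYPE('d) lam n" G
 by unfold_locales (auto simp: L_pos sets_G)

text \<open>The ball of radius \<open>r\<close> around such a point stays inside the tile, where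
  tiling and periodization show the same configuration.\<close>

lemma V_tile_eq:
 assumes eta: "eta \<in> space (PiM (UNIV :: ('d \<Rightarrow> int) set) (\<lambda>_. G))" and x: "x \<notin> near_boundary"
 shows "V (translate x (T.tile eta)) = V (translate x (periodize lam n (eta (\<lambda>_. 0))))"
proof -
 have LF: "T.tile eta \<in> locally_finite_sets" "eta (\<lambda>_. 0) \<in> locally_finite_sets"
  using measurable_space[OF T.measurable_tile eta] eta by (auto simp: space_PiM space_G)
 have "translate x (T.tile eta) \<inter> cball 0 r = translate x (periodize lam n (eta (\<lambda>_. 0))) \<inter> cball 0 r"
 proof (rule set_eqI)
  fix y
  show "y \<in> translate x (T.tile eta) \<inter> cball 0 r \<longleftrightarrow> y \<in> translate x (periodize lam n (eta (\<lambda>_. 0))) \<inter> cball 0 r"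
  proof (cases "norm y \<le> r")
   case True
   have z: "\<bar>(y + x) $ i\<bar> < side TYPE('d) lam n / 2" for i
   proof -
    have "\<bar>y $ i\<bar> \<le> r" using True component_le_norm_cart[of y i] by linarith
    moreover have "\<bar>x $ i\<bar> < side TYPE('d) lam n / 2 - r" using x by (simp add: near_boundary_def not_le)
    ultimately show ?thesis unfolding vector_add_component by linarith
   qed
   have "- (side TYPE('d) lam n / 2) \<le> (y + x) $ i \<and> (y + x) $ i < side TYPE('d) lam n / 2" for i
   proof
    show "- (side TYPE('d) lam n / 2) \<le> (y + x) $ i" "(y + x) $ i < side TYPE('d) lam n / 2" using z[of i] by linarith+
   qed
   then have "y + x \<in> hcube (side TYPE('d) lam n)" unfolding hcube_def by blast
   then have "y + x \<in> T.tile eta \<longleftrightarrow> y + x \<in> eta (\<lambda>_. 0)"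
    using T.tile_Int_hcube[of eta] by blast
   then show ?thesis using periodize_interior[OF lam n z, of "eta (\<lambda>_. 0)"] by (simp add: mem_translate)
  qed simp
 qed
 then show ?thesis
  using V_local[OF translate_locally_finite[OF LF(1), of x]]
   V_local[OF translate_locally_finite[OF periodize_locally_finite[OF lam n LF(2)], of x]] by simp
qed

definition boundary_count :: "(real^'d) set \<Rightarrow> real" where
 "boundary_count om = (\<Sum>x\<in>om \<inter> W. indicator near_boundary x)"

lemma boundary_count_measurable [measurable]: "boundary_count \<in> borel_measurable conf_space"
 and integrable_boundary_count: "integrable G boundary_count"
 using mean_count_bound(1,2)[OF borel_near_boundary zero_less_one]
 by (simp_all add: boundary_count_def[abs_def])

lemma AE_PiM_G:
 assumes "AE om in G. Q om" shows "AE eta in PiM (UNIV :: ('d \<Rightarrow> int) set) (\<lambda>_. G). Q (eta (\<lambda>_. 0))"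
 using assms G.prob_space_axioms by (intro AE_PiM_component) auto

text \<open>Away from the boundary layer the interactions agree; at a point of the layer two values
  of \<open>V\<close> differ by at most \<open>2 * c\<close>. Adding \<open>c\<close> keeps the
  integrand nonnegative, and since the tile has \<open>n\<close> points this adds
  \<open>c * real n\<close> to the energy.\<close>

lemma palm_energy_bound:
 "(\<integral>\<^sup>+eta. \<integral>\<^sup>+x. ennreal (V (translate x (T.tile eta)) + c) \<partial>count_space (eta (\<lambda>_. 0) \<inter> hcube (side TYPE('d) lam n)) \<partial>PiM (UNIV :: ('d \<Rightarrow> int) set) (\<lambda>_. G))
  \<le> ennreal ((\<integral>om. H om \<partial>G) + c * real n + 2 * c * (\<integral>om. boundary_count om \<partial>G))"
proof -
 define F where "F = (\<lambda>om. H om + c * real n + 2 * c * boundary_count om)"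
 have [measurable]: "F \<in> borel_measurable conf_space" unfolding F_def by measurable
 have "(\<integral>\<^sup>+eta. \<integral>\<^sup>+x. ennreal (V (translate x (T.tile eta)) + c) \<partial>count_space (eta (\<lambda>_. 0) \<inter> hcube (side TYPE('d) lam n)) \<partial>PiM (UNIV :: ('d \<Rightarrow> int) set) (\<lambda>_. G))
   \<le> (\<integral>\<^sup>+eta. ennreal (F (eta (\<lambda>_. 0))) \<partial>PiM (UNIV :: ('d \<Rightarrow> int) set) (\<lambda>_. G))"
 proof (rule nn_integral_mono_AE)
  show "AE eta in PiM (UNIV :: ('d \<Rightarrow> int) set) (\<lambda>_. G). (\<integral>\<^sup>+x. ennreal (V (translate x (T.tile eta)) + c) \<partial>count_space (eta (\<lambda>_. 0) \<inter> hcube (side TYPE('d) lam n))) \<le> ennreal (F (eta (\<lambda>_. 0)))"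
   using AE_PiM_G[OF AE_G[OF AE_\<beta>]] AE_space
  proof eventually_elim
   case (elim eta)
   let ?om = "eta (\<lambda>_. 0)"
   have "hcube (side TYPE('d) lam n) \<subseteq> W" unfolding window_eq_cube by (rule hcube_subset_cube)
   then have sub: "?om \<inter> hcube (side TYPE('d) lam n) = ?om" "?om \<inter> W = ?om"
    using elim by auto
   have LF: "T.tile eta \<in> locally_finite_sets" using measurable_space[OF T.measurable_tile elim(2)] by simp
   have LFp: "periodize lam n ?om \<in> locally_finite_sets"
    using elim(1) by (intro periodize_locally_finite[OF lam n]) simp
   have nn: "0 \<le> V (translate x (T.tile eta)) + c" for x
    using V_bound[OF translate_locally_finite[OF LF], of x] by simp
   have le: "V (translate x (T.tile eta)) + c \<le> V (translate x (periodize lam n ?om)) + c + 2 * c * indicator near_boundary x" for x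
   proof (cases "x \<in> near_boundary")
    case True
    then show ?thesis
     using V_bound[OF translate_locally_finite[OF LF], of x] V_bound[OF translate_locally_finite[OF LFp], of x] by simp
   next
    case False
    then show ?thesis using V_tile_eq[OF elim(2) False] by simp
   qed
   have "(\<integral>\<^sup>+x. ennreal (V (translate x (T.tile eta)) + c) \<partial>count_space (?om \<inter> hcube (side TYPE('d) lam n))) = (\<Sum>x\<in>?om. ennreal (V (translate x (T.tile eta)) + c))"
    using elim by (simp add: sub nn_integral_count_space_finite)
   also have "... = ennreal (\<Sum>x\<in>?om. V (translate x (T.tile eta)) + c)"
    using nn by (intro sum_ennreal) auto
   also have "... \<le> ennreal (\<Sum>x\<in>?om. V (translate x (periodize lam n ?om)) + c + 2 * c * indicator near_boundary x)"
    using le by (intro ennreal_leI sum_mono) auto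
   also have "(\<Sum>x\<in>?om. V (translate x (periodize lam n ?om)) + c + 2 * c * indicator near_boundary x) = F ?om"
    using elim by (simp add: F_def energy_def boundary_count_def sub sum.distrib sum_distrib_left)
   finally show ?case .
  qed
 qed
 also have "... = (\<integral>\<^sup>+om. ennreal (F om) \<partial>G)" by (rule T.nn_integral_component) measurable
 also have "... = ennreal (\<integral>om. F om \<partial>G)"
 proof (rule nn_integral_eq_integral)
  show "integrable G F" unfolding F_def using integrable_H integrable_boundary_count by simp
  show "AE om in G. 0 \<le> F om"
   using AE_G[OF AE_H]
  proof eventually_elim
   case (elim om)
   have "0 \<le> boundary_count om" unfolding boundary_count_def by (intro sum_nonneg) auto
   then have "0 \<le> 2 * c * boundary_count om" using c0 by simp
   then show ?case using elim by (simp add: F_def)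
  qed
 qed
 also have "(\<integral>om. F om \<partial>G) = (\<integral>om. H om \<partial>G) + c * real n + 2 * c * (\<integral>om. boundary_count om \<partial>G)"
  unfolding F_def using integrable_H integrable_boundary_count by (simp add: G.prob_space)
 finally show ?thesis .
qed

lemma tile_intensity: "(\<integral>\<^sup>+om. num_points om (hcube (side TYPE('d) lam n)) \<partial>G) = ennreal (real n)"
proof -
 have "(\<integral>\<^sup>+om. num_points om (hcube (side TYPE('d) lam n)) \<partial>G) = (\<integral>\<^sup>+om. ennreal (real n) \<partial>G)"
 proof (rule nn_integral_cong_AE)
  show "AE om in G. num_points om (hcube (side TYPE('d) lam n)) = ennreal (real n)"
   using AE_G[OF AE_\<beta>]
  proof eventually_elim
   case (elim om)
   then have "om \<inter> hcube (side TYPE('d) lam n) = om" by auto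
   then show ?case using elim by (simp add: num_points_eq_card ennreal_of_nat_eq_real_of_nat)
  qed
 qed
 then show ?thesis by (simp add: G.emeasure_space_1)
qed

lemma stationary_tiling: "T.P \<in> stationary_processes"
 by (rule T.stationary_P) (simp add: tile_intensity)

text \<open>The mean energy under the Gibbs measure enters the entropy bound with a minus sign and
  the Palm energy with a plus sign, and cancels. Apart from the Poisson weight and the boundary, the
  partition function remains.\<close>

lemma free_energy_tiling:
 shows "palm_integral T.P (\<lambda>_. 1) = ereal lam"
  and "specific_entropy lam T.P + palm_integral T.P V
   \<le> ereal ((- ln p - ln Z + 2 * c * (\<integral>om. boundary_count om \<partial>G)) / (real n / lam))"
proof -
 interpret S: stationary_process T.P by unfold_locales (rule stationary_tiling)
 let ?Q = "palm_measure T.P" and ?w = "real n / lam"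
 have w: "0 < ?w" "side TYPE('d) lam n ^ CARD('d) = ?w" using lam n side_power[OF lam, where 'd='d, of n] by auto
 have fin: "(\<integral>\<^sup>+om. num_points om (hcube (side TYPE('d) lam n)) \<partial>G) < \<infinity>" by (simp add: tile_intensity)
 have "ennreal ?w * (\<integral>\<^sup>+om. 1 \<partial>?Q) = (\<integral>\<^sup>+eta. \<integral>\<^sup>+x. 1 \<partial>count_space (eta (\<lambda>_. 0) \<inter> hcube (side TYPE('d) lam n)) \<partial>PiM (UNIV :: ('d \<Rightarrow> int) set) (\<lambda>_. G))"
  using T.nn_integral_palm_P[OF fin, of "\<lambda>_. 1"] by (simp add: w)
 also have "... = ennreal (real n)"
  using T.nn_integral_P0_hcube[of "\<lambda>_. 1"] T.P0_mean_count tile_intensity by simp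
 finally have mass: "emeasure ?Q (space ?Q) = ennreal lam"
 proof -
  assume "ennreal ?w * (\<integral>\<^sup>+om. 1 \<partial>?Q) = ennreal (real n)"
  then have "ennreal ?w * emeasure ?Q (space ?Q) = ennreal ?w * ennreal lam"
   using lam w by (simp add: ennreal_mult[symmetric])
  then show ?thesis using w by (subst (asm) ennreal_mult_cancel_left) auto
 qed
 then have finQ: "finite_measure ?Q" by (intro finite_measureI) simp
 have mass': "measure ?Q (space ?Q) = lam" using mass lam by (simp add: measure_def)
 show "palm_integral T.P (\<lambda>_. 1) = ereal lam"
  using mass lam by (simp add: palm_integral_def ext_integral_def ennreal_neg enn2ereal_ennreal zero_ennreal.rep_eq)
 have Vm [measurable]: "V \<in> borel_measurable ?Q" using V by (simp add: measurable_cong_sets[OF S.sets_palm_measure refl])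
 let ?e = "(\<integral>om. H om \<partial>G) + c * real n + 2 * c * (\<integral>om. boundary_count om \<partial>G)"
 have "ennreal ?w * (\<integral>\<^sup>+om. ennreal (V om + c) \<partial>?Q) \<le> ennreal ?e"
  using T.nn_integral_palm_P[OF fin, of "\<lambda>om. ennreal (V om + c)"] palm_energy_bound by (simp add: w)
 then have le: "(\<integral>\<^sup>+om. ennreal (V om + c) \<partial>?Q) \<le> ennreal (?e / ?w)"
  using w(1) by (intro ennreal_le_divide)
 have e0: "0 \<le> ?e"
 proof -
  have "(\<integral>om. - (c * real n) \<partial>G) \<le> (\<integral>om. H om \<partial>G)"
  proof (rule integral_mono_AE)
   show "AE om in G. - (c * real n) \<le> H om" using AE_G[OF AE_H] by eventually_elim (simp add: abs_le_iff)
  qed (use integrable_H in auto)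
  moreover have "0 \<le> (\<integral>om. boundary_count om \<partial>G)"
   by (intro integral_nonneg_AE AE_I2) (auto simp: boundary_count_def intro: sum_nonneg)
  then have "0 \<le> 2 * c * (\<integral>om. boundary_count om \<partial>G)" using c0 by simp
  ultimately show ?thesis by (simp add: G.prob_space)
 qed
 have "ext_integral ?Q V = enn2ereal (\<integral>\<^sup>+om. ennreal (V om - (- c)) \<partial>?Q) + ereal (- c * measure ?Q (space ?Q))"
 proof (rule ext_integral_shift[OF finQ Vm])
  fix om assume "om \<in> space ?Q"
  then show "- c \<le> V om" using V_bound[of om] by (simp add: S.space_palm_measure)
 qed
 then have "palm_integral T.P V = enn2ereal (\<integral>\<^sup>+om. ennreal (V om - (- c)) \<partial>?Q) + ereal (- c * lam)"
  by (simp only: palm_integral_def mass')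
 also have "... \<le> enn2ereal (ennreal (?e / ?w)) + ereal (- c * lam)"
  using le by (intro add_right_mono) (simp add: less_eq_ennreal.rep_eq[symmetric])
 also have "... = ereal (((\<integral>om. H om \<partial>G) + 2 * c * (\<integral>om. boundary_count om \<partial>G)) / ?w)"
 proof -
  have "enn2ereal (ennreal (?e / ?w)) = ereal (?e / ?w)"
   by (intro enn2ereal_ennreal divide_nonneg_pos e0 w(1))
  moreover have "?e / ?w + - c * lam = ((\<integral>om. H om \<partial>G) + 2 * c * (\<integral>om. boundary_count om \<partial>G)) / ?w"
   using lam n by (simp add: field_simps)
  ultimately show ?thesis by (simp only: plus_ereal.simps)
 qed
 finally have 1: "palm_integral T.P V \<le> ereal (((\<integral>om. H om \<partial>G) + 2 * c * (\<integral>om. boundary_count om \<partial>G)) / ?w)" .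
 have 2: "specific_entropy lam T.P \<le> ereal ((- ln p - ln Z - (\<integral>om. H om \<partial>G)) / ?w)"
  by (rule T.specific_entropy_P[OF lam n refl fin entropy_bound_gibbs])
 have "specific_entropy lam T.P + palm_integral T.P V
   \<le> ereal ((- ln p - ln Z - (\<integral>om. H om \<partial>G)) / ?w) + ereal (((\<integral>om. H om \<partial>G) + 2 * c * (\<integral>om. boundary_count om \<partial>G)) / ?w)"
  using 1 2 by (rule add_mono[rotated])
 also have "... = ereal ((- ln p - ln Z + 2 * c * (\<integral>om. boundary_count om \<partial>G)) / ?w)"
  by (simp add: add_divide_distrib[symmetric] algebra_simps)
 finally show "specific_entropy lam T.P + palm_integral T.P V
   \<le> ereal ((- ln p - ln Z + 2 * c * (\<integral>om. boundary_count om \<partial>G)) / ?w)" .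
qed

lemma volume_near_boundary:
 assumes "2 * r < side TYPE('d) lam n"
 shows "measure lborel (W \<inter> near_boundary) / (real n / lam) = 1 - (1 - 2 * r / side TYPE('d) lam n) ^ CARD('d)"
proof -
 let ?a = "(\<chi> i. - (side TYPE('d) lam n / 2 - r)) :: real^'d" and ?b = "(\<chi> i. side TYPE('d) lam n / 2 - r) :: real^'d"
 have eq: "W \<inter> near_boundary = W - box ?a ?b"
  by (auto simp: near_boundary_def mem_box_cart) (smt (verit))+
 have sub: "box ?a ?b \<subseteq> W"
 proof
  fix x assume x: "x \<in> box ?a ?b"
  have "\<bar>x $ i\<bar> \<le> side TYPE('d) lam n / 2" for i
  proof -
   have "- (side TYPE('d) lam n / 2 - r) < x $ i" "x $ i < side TYPE('d) lam n / 2 - r"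
    using x[unfolded mem_box_cart, THEN spec, of i] by auto
   then show ?thesis using r by linarith
  qed
  then show "x \<in> W" by (simp add: window_eq_cube cube_def)
 qed
 have "measure lborel (box ?a ?b) = measure lborel (cbox ?a ?b)"
  by (simp add: measure_def emeasure_lborel_box_eq emeasure_lborel_cbox_eq)
 also have "... = (side TYPE('d) lam n - 2 * r) ^ CARD('d)"
  using assms by (subst content_cbox_cart) (auto simp: interval_ne_empty_cart)
 finally have "measure lborel (box ?a ?b) = (side TYPE('d) lam n - 2 * r) ^ CARD('d)" .
 then have "measure lborel (W \<inter> near_boundary) = side TYPE('d) lam n ^ CARD('d) - (side TYPE('d) lam n - 2 * r) ^ CARD('d)"
  unfolding eq using sub emeasure_window_finite[of lam n, where 'd='d]
  by (subst measure_Diff) (auto simp: less_top measure_window[OF lam] side_power[OF lam])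
 moreover have "(1 - 2 * r / side TYPE('d) lam n) ^ CARD('d) = (side TYPE('d) lam n - 2 * r) ^ CARD('d) / side TYPE('d) lam n ^ CARD('d)"
  using L_pos by (simp add: power_divide[symmetric] diff_divide_distrib)
 ultimately show ?thesis
  using L_pos unfolding side_power[OF lam, symmetric, where 'd='d] by (simp add: diff_divide_distrib)
qed

end

text \<open>A Stirling bound by induction, whose step amounts to
  \<open>1 / (n + 1) \<le> ln (n + 1) - ln n\<close>. It shows that \<open>- ln p\<close> grows only
  logarithmically.\<close>

lemma ln_fact_le: "0 < n \<Longrightarrow> ln (fact n) \<le> 1 + ln (real n) + real n * ln (real n) - real n"
proof (induction n rule: nat_induct_non_zero)
 case (Suc n)
 have "1 \<le> (real n + 1) * (ln (real n + 1) - ln (real n))"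
 proof -
  have "ln (real n / (real n + 1)) \<le> real n / (real n + 1) - 1"
   using Suc.hyps by (intro ln_le_minus_one) auto
  also have "... = - (1 / (real n + 1))" using Suc.hyps by (simp add: field_simps)
  finally have "1 / (real n + 1) \<le> ln (real n + 1) - ln (real n)"
   using Suc.hyps by (simp add: ln_div)
  then show ?thesis by (simp add: field_simps)
 qed
 moreover have "ln (fact (Suc n)) = ln (real n + 1) + ln (fact n)"
  by (simp add: ln_mult add.commute)
 ultimately show ?case using Suc.IH by (simp add: algebra_simps)
qed simp

text \<open>Order of choices: first \<open>t\<close> so large that the density factor
  \<open>2 * c\<close> is harmless after division by \<open>t\<close>, then \<open>n\<close> so
  large that the relative volume of the boundary layer beats \<open>exp t\<close>.\<close>

lemma partition_fun_upper:
 fixes V :: "(real^'d::finite) set \<Rightarrow> real"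
 assumes lam: "0 < lam" and r: "0 < r" and V: "V \<in> borel_measurable conf_space"
  and loc: "local_fun r V" and bdd: "bounded_fun c V" and \<delta>: "0 < \<delta>"
 defines "A \<equiv> Inf {specific_entropy lam P + palm_integral P V | P.
   P \<in> stationary_processes \<and> palm_integral P (\<lambda>_. 1) = ereal lam}"
 shows "\<forall>\<^sub>F n in sequentially. A \<le> ereal (- ln (partition_fun lam V n) / (real n / lam) + \<delta>)"
proof -
 let ?L = "\<lambda>n. side TYPE('d) lam n"
 have c: "0 < c" using bdd by (simp add: bounded_fun_def)
 \<comment> \<open>Solves \<open>2 * c * (2 * c + 1) * lam / t = \<delta> / 2\<close>, the
   contribution of the boundary points per unit volume. The other \<open>\<delta> / 2\<close> pays
   for \<open>- ln p\<close>.\<close>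
 define t where "t = 4 * c * (2 * c + 1) * lam / \<delta>"
 have t: "0 < t" using c lam \<delta> by (simp add: t_def)
 define pr where "pr = (\<lambda>n. 1 - (1 - 2 * r / ?L n) ^ CARD('d))"
 have invL: "(\<lambda>n. 2 * r / ?L n) \<longlonglongrightarrow> 0"
  by (rule tendsto_divide_0[OF tendsto_const filterlim_at_top_imp_at_infinity[OF filterlim_side[OF lam]]])
 have "(\<lambda>n. 1 + pr n * (exp t - 1)) \<longlonglongrightarrow> 1 + (1 - (1 - 0) ^ CARD('d)) * (exp t - 1)"
  unfolding pr_def by (intro tendsto_intros invL)
 then have "\<forall>\<^sub>F n in sequentially. 1 + pr n * (exp t - 1) < exp 1"
  by (rule order_tendstoD(2)) simp
 moreover have "(\<lambda>n. (1 + ln (real n)) / (real n / lam)) \<longlonglongrightarrow> 0"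
  using lam by real_asymp
 then have "\<forall>\<^sub>F n in sequentially. (1 + ln (real n)) / (real n / lam) < \<delta> / 2"
  by (rule order_tendstoD(2)) (use \<delta> in simp)
 moreover have "\<forall>\<^sub>F n in sequentially. 2 * r < ?L n"
  using filterlim_side[OF lam, where 'd='d] by (simp add: filterlim_at_top_dense)
 ultimately show ?thesis
  using eventually_gt_at_top[of "0::nat"]
 proof eventually_elim
  case (elim n)
  interpret local_gibbs lam c n V r
   using lam r V loc bdd elim by unfold_locales (auto simp: local_fun_def bounded_fun_def)
  have w: "0 < real n / lam" using lam elim by simp
  have pr0: "0 \<le> pr n"
  proof -
   have "(1 - 2 * r / ?L n) ^ CARD('d) \<le> 1" using elim r L_pos by (intro power_le_one) auto
   then show ?thesis by (simp add: pr_def)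
  qed
  have "A \<le> specific_entropy lam T.P + palm_integral T.P V"
   unfolding A_def using stationary_tiling free_energy_tiling(1) by (intro Inf_lower) blast
  also have "... \<le> ereal ((- ln p - ln Z + 2 * c * (\<integral>om. boundary_count om \<partial>G)) / (real n / lam))"
   by (rule free_energy_tiling(2))
  also have "... \<le> ereal (- ln Z / (real n / lam) + \<delta>)"
  proof -
   have "- ln p \<le> 1 + ln (real n)"
   proof -
    have "ln p = real n * ln (real n) - ln (fact n) - real n"
     using elim by (simp add: p_def ln_mult ln_div ln_realpow)
    then show ?thesis using ln_fact_le[OF n] by simp
   qed
   then have 1: "- ln p / (real n / lam) \<le> (1 + ln (real n)) / (real n / lam)"
    using w by (intro divide_right_mono) auto
   have X0: "0 \<le> pr n * (exp t - 1)" using pr0 t by simp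
   have "(\<integral>om. boundary_count om \<partial>G) \<le> real n * (2 * c + ln (1 + pr n * (exp t - 1))) / t"
    using mean_count_bound(3)[OF borel_near_boundary t, unfolded volume_near_boundary[OF elim(3)]]
    by (simp add: boundary_count_def pr_def)
   also have "ln (1 + pr n * (exp t - 1)) \<le> ln (exp 1)"
    using elim X0 by (intro ln_mono) auto
   then have "real n * (2 * c + ln (1 + pr n * (exp t - 1))) / t \<le> real n * (2 * c + 1) / t"
    using t by (intro divide_right_mono mult_left_mono) auto
   finally have "2 * c * (\<integral>om. boundary_count om \<partial>G) \<le> 2 * c * (real n * (2 * c + 1) / t)"
    using c by (intro mult_left_mono) auto
   then have "2 * c * (\<integral>om. boundary_count om \<partial>G) / (real n / lam) \<le> 2 * c * (real n * (2 * c + 1) / t) / (real n / lam)"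
    using w by (intro divide_right_mono) auto
   also have "... = \<delta> / 2"
   proof -
    define X where "X = 2 * c * (2 * c + 1) * lam"
    have "X \<noteq> 0" using c lam by (simp add: X_def)
    have "2 * c * (real n * (2 * c + 1) / t) / (real n / lam) = X / t" using elim by (simp add: X_def)
    moreover have "t = 2 * X / \<delta>" by (simp add: t_def X_def)
    ultimately show ?thesis using \<open>X \<noteq> 0\<close> \<delta> by simp
   qed
   finally have 2: "2 * c * (\<integral>om. boundary_count om \<partial>G) / (real n / lam) \<le> \<delta> / 2" .
   have "(- ln p - ln Z + 2 * c * (\<integral>om. boundary_count om \<partial>G)) / (real n / lam)
    = - ln p / (real n / lam) + - ln Z / (real n / lam) + 2 * c * (\<integral>om. boundary_count om \<partial>G) / (real n / lam)"
    by (simp only: add_divide_distrib diff_conv_add_uminus)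
   moreover have "(1 + ln (real n)) / (real n / lam) < \<delta> / 2" by (rule elim(2))
   ultimately have "(- ln p - ln Z + 2 * c * (\<integral>om. boundary_count om \<partial>G)) / (real n / lam)
    \<le> - ln Z / (real n / lam) + \<delta>"
    using 1 2 by linarith
   then show ?thesis by simp
  qed
  finally show ?case .
 qed
qed

section \<open>Block configurations\<close>

lemma exp_le_quadratic: "\<bar>y\<bar> \<le> 1 \<Longrightarrow> exp y \<le> 1 + y + y\<^sup>2" for y :: real
proof (cases "0 \<le> y")
 case False
 assume "\<bar>y\<bar> \<le> 1"
 then have "0 < 1 - y" "exp (- y) \<ge> 1 + - y" using False exp_ge_add_one_self[of "- y"] by auto
 then have "exp y \<le> 1 / (1 - y)" by (simp add: exp_minus field_simps)
 also have "1 / (1 - y) \<le> 1 + y + y\<^sup>2"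
 proof -
  have "(1 + y + y\<^sup>2) * (1 - y) = 1 - y ^ 3" by (simp add: power2_eq_square power3_eq_cube algebra_simps)
  moreover have "y ^ 3 \<le> 0" using False by (simp add: power_le_zero_eq)
  ultimately have "1 \<le> (1 + y + y\<^sup>2) * (1 - y)" by simp
  then show ?thesis using False by (simp add: divide_le_eq)
 qed
 finally show ?thesis .
qed (use exp_bound in auto)

text \<open>Chernoff's bound: \<open>h\<close> has mean \<open>- eps\<close>, so for small
  \<open>t\<close> its exponential moment \<open>q\<close> is below \<open>1\<close>, and the
  deviation has probability at most \<open>q ^ card I\<close>. This depends on \<open>I\<close> only
  through its size, as needed for the varying sets of blocks.\<close>

lemma PiM_lln:
 fixes g :: "'a \<Rightarrow> real"
 assumes "prob_space mu" and g [measurable]: "g \<in> borel_measurable mu" and gb: "\<And>x. x \<in> space mu \<Longrightarrow> \<bar>g x\<bar> \<le> b"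
  and eps: "0 < eps" and \<delta>: "0 < \<delta>"
 obtains N0 :: nat where "\<And>I :: 'i set. finite I \<Longrightarrow> N0 \<le> card I \<Longrightarrow>
  measure (PiM I (\<lambda>_. mu)) {om \<in> space (PiM I (\<lambda>_. mu)). real (card I) * ((\<integral>x. g x \<partial>mu) + eps) \<le> (\<Sum>i\<in>I. g (om i))} \<le> \<delta>"
proof -
 interpret prob_space mu by fact
 define e where "e = (\<integral>x. g x \<partial>mu)"
 define B where "B = \<bar>b\<bar> + \<bar>e\<bar> + eps + 1"
 define h where "h = (\<lambda>x. g x - e - eps)"
 have B1: "1 \<le> B" "0 < B" using eps by (auto simp: B_def)
 have hb: "\<bar>h x\<bar> \<le> B" if "x \<in> space mu" for x using gb[OF that] eps unfolding h_def B_def by linarith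
 have ig: "integrable mu g" using gb by (intro integrable_bounded_fun(1)[where b=b]) auto
 \<comment> \<open>Small enough that the quadratic bound for \<open>exp\<close> applies to
   \<open>t * h x\<close> and that its second-order term is at most half of the first-order gain
   \<open>t * eps\<close>.\<close>
 define t where "t = min (1 / B) (eps / (2 * B\<^sup>2))"
 have t0: "0 < t" using B1 eps by (simp add: t_def)
 have tB: "t * B \<le> 1" using B1 unfolding t_def by (simp add: min_def field_simps)
 have teps: "t * B\<^sup>2 \<le> eps / 2"
 proof -
  have "t * B\<^sup>2 \<le> (eps / (2 * B\<^sup>2)) * B\<^sup>2" by (intro mult_right_mono) (auto simp: t_def)
  then show ?thesis using B1 by simp
 qed
 have [measurable]: "h \<in> borel_measurable mu" unfolding h_def by measurable
 define q where "q = (\<integral>x. exp (t * h x) \<partial>mu)"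
 have thb: "\<bar>t * h x\<bar> \<le> 1" if "x \<in> space mu" for x
 proof -
  have "t * \<bar>h x\<bar> \<le> t * B" using hb[OF that] t0 by (intro mult_left_mono) auto
  moreover have "\<bar>t * h x\<bar> = t * \<bar>h x\<bar>" using t0 by (simp add: abs_mult)
  ultimately show ?thesis using tB by linarith
 qed
 have iexp: "integrable mu (\<lambda>x. exp (t * h x))" by (rule integrable_bounded_fun(2)[where b=1]) (use thb in auto)
 have ih: "integrable mu h" unfolding h_def using ig by simp
 have q0: "0 < q" unfolding q_def using ih iexp by (intro expectation_exp_pos) auto
 have "q \<le> (\<integral>x. 1 + t * h x + t * (eps / 2) \<partial>mu)"
  unfolding q_def
 proof (rule integral_mono[OF iexp])
  show "integrable mu (\<lambda>x. 1 + t * h x + t * (eps / 2))" using ih by simp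
  fix x assume x: "x \<in> space mu"
  have "exp (t * h x) \<le> 1 + t * h x + (t * h x)\<^sup>2" by (rule exp_le_quadratic[OF thb[OF x]])
  also have "(t * h x)\<^sup>2 \<le> (t * B)\<^sup>2" using hb[OF x] t0 B1 by (intro power2_le_iff_abs_le[THEN iffD2]) (auto simp: abs_mult mult_left_mono)
  also have "(t * B)\<^sup>2 = t * (t * B\<^sup>2)" by (simp add: power2_eq_square)
  also have "... \<le> t * (eps / 2)" using teps t0 by (intro mult_left_mono) auto
  finally show "exp (t * h x) \<le> 1 + t * h x + t * (eps / 2)" by simp
 qed
 also have "... = 1 - t * (eps / 2)" using ih ig by (simp add: prob_space h_def e_def[symmetric] algebra_simps)
 finally have q1: "q < 1" using t0 eps by (smt (verit) mult_pos_pos half_gt_zero)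
 have "(\<lambda>N. q ^ N) \<longlonglongrightarrow> 0" using q0 q1 by (intro LIMSEQ_power_zero) auto
 then have "\<forall>\<^sub>F N in sequentially. q ^ N < \<delta>" using \<delta> by (rule order_tendstoD(2))
 then obtain N0 where N0: "\<And>N. N0 \<le> N \<Longrightarrow> q ^ N < \<delta>" by (auto simp: eventually_sequentially)
 show ?thesis
 proof (rule that[of N0])
  fix I :: "'i set" assume I: "finite I" "N0 \<le> card I"
  interpret P: product_prob_space "\<lambda>_::'i. mu" I by (intro product_prob_spaceI) (rule prob_space_axioms)
  let ?M = "PiM I (\<lambda>_. mu)"
  let ?E = "{om \<in> space ?M. real (card I) * (e + eps) \<le> (\<Sum>i\<in>I. g (om i))}"
  have [measurable]: "(\<lambda>om. om i) \<in> ?M \<rightarrow>\<^sub>M mu" if "i \<in> I" for i using that by measurable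
  have E [measurable]: "?E \<in> sets ?M" by measurable
  have "emeasure ?M ?E = (\<integral>\<^sup>+om. indicator ?E om \<partial>?M)" by simp
  also have "... \<le> (\<integral>\<^sup>+om. (\<Prod>i\<in>I. ennreal (exp (t * h (om i)))) \<partial>?M)"
  proof (rule nn_integral_mono)
   fix om
   have "1 \<le> (\<Prod>i\<in>I. exp (t * h (om i)))" if "om \<in> ?E"
   proof -
    have "0 \<le> t * (\<Sum>i\<in>I. h (om i))"
     using that t0 by (intro mult_nonneg_nonneg) (auto simp: h_def sum_subtractf algebra_simps)
    then have "1 \<le> exp (\<Sum>i\<in>I. t * h (om i))" by (simp add: sum_distrib_left)
    then show ?thesis by (simp add: exp_sum I(1))
   qed
   then show "indicator ?E om \<le> (\<Prod>i\<in>I. ennreal (exp (t * h (om i))))"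
    by (cases "om \<in> ?E") (auto simp: prod_ennreal ennreal_1[symmetric] simp del: ennreal_1 intro!: ennreal_leI)
  qed
  also have "... = (\<Prod>i\<in>I. \<integral>\<^sup>+x. ennreal (exp (t * h x)) \<partial>mu)"
   by (rule P.product_nn_integral_prod[OF I(1)]) auto
  also have "... = ennreal (q ^ card I)"
   using iexp q0 by (simp add: nn_integral_eq_integral q_def[symmetric] ennreal_power)
  also have "... \<le> ennreal \<delta>" using N0[OF I(2)] by (intro ennreal_leI) simp
  finally show "P.prob {om \<in> space ?M. real (card I) * ((\<integral>x. g x \<partial>mu) + eps) \<le> (\<Sum>i\<in>I. g (om i))} \<le> \<delta>"
   using \<delta> by (simp add: P.emeasure_eq_measure e_def[symmetric])
 qed
qed

text \<open>Within distance \<open>r\<close> a point sees only its own group: other groups are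
  farther away, and so are the periodic images, because all groups stay more than \<open>r\<close>
  inside the window.\<close>

lemma local_sum_separated:
 fixes D :: "'i \<Rightarrow> (real^'d::finite) set"
 assumes lam: "0 < lam" and n: "0 < n" and r: "0 < r" and loc: "local_fun r h"
  and I: "finite I" and fin: "\<And>i. i \<in> I \<Longrightarrow> finite (D i)"
  and inside: "\<And>i x j. i \<in> I \<Longrightarrow> x \<in> D i \<Longrightarrow> \<bar>x $ j\<bar> < side TYPE('d) lam n / 2 - r"
  and sep: "\<And>i j x y. i \<in> I \<Longrightarrow> j \<in> I \<Longrightarrow> i \<noteq> j \<Longrightarrow> x \<in> D i \<Longrightarrow> y \<in> D j \<Longrightarrow> r < norm (x - y)"
 defines "om \<equiv> \<Union>i\<in>I. D i"
 shows "(\<Sum>x\<in>om \<inter> window lam n. h (translate x (periodize lam n om))) = (\<Sum>i\<in>I. \<Sum>x\<in>D i. h (translate x (D i)))"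
proof -
 let ?L = "side TYPE('d) lam n"
 have finom: "finite om" unfolding om_def using I fin by auto
 have sub: "om \<subseteq> window lam n"
 proof
  fix x assume "x \<in> om"
  then obtain i where "i \<in> I" "x \<in> D i" by (auto simp: om_def)
  then have "\<bar>x $ j\<bar> \<le> ?L / 2" for j using inside[of i x j] r by linarith
  then show "x \<in> window lam n" by (simp add: window_eq_cube cube_def)
 qed
 have eq: "h (translate x (periodize lam n om)) = h (translate x (D i))" if i: "i \<in> I" and x: "x \<in> D i" for i x
 proof -
  have "translate x (periodize lam n om) \<inter> cball 0 r = translate x (D i) \<inter> cball 0 r"
  proof (rule set_eqI)
   fix y
   show "y \<in> translate x (periodize lam n om) \<inter> cball 0 r \<longleftrightarrow> y \<in> translate x (D i) \<inter> cball 0 r"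
   proof (cases "norm y \<le> r")
    case True
    have "\<bar>(y + x) $ j\<bar> < ?L / 2" for j
    proof -
     have "\<bar>y $ j\<bar> \<le> r" using True component_le_norm_cart[of y j] by linarith
     then show ?thesis using inside[OF i x, of j] unfolding vector_add_component by linarith
    qed
    then have "y + x \<in> periodize lam n om \<longleftrightarrow> y + x \<in> om" by (rule periodize_interior[OF lam n])
    also have "... \<longleftrightarrow> y + x \<in> D i"
    proof
     assume "y + x \<in> om"
     then obtain j where j: "j \<in> I" "y + x \<in> D j" by (auto simp: om_def)
     have "j = i"
     proof (rule ccontr)
      assume "j \<noteq> i"
      from sep[OF j(1) i this j(2) x] True show False by simp
     qed
     then show "y + x \<in> D i" using j by simp
    qed (use i in \<open>auto simp: om_def\<close>)
    finally show ?thesis by (simp add: mem_translate)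
   qed simp
  qed
  moreover have "translate x (periodize lam n om) \<in> locally_finite_sets"
   using lam n finom by (intro translate_locally_finite periodize_locally_finite finite_locally_finite)
  moreover have "translate x (D i) \<in> locally_finite_sets"
   using fin[OF i] by (intro translate_locally_finite finite_locally_finite)
  ultimately show ?thesis using loc unfolding local_fun_def by metis
 qed
 have disj: "D i \<inter> D j = {}" if "i \<in> I" "j \<in> I" "i \<noteq> j" for i j
 proof (rule ccontr)
  assume "D i \<inter> D j \<noteq> {}"
  then obtain x where "x \<in> D i" "x \<in> D j" by auto
  from sep[OF that this] r show False by simp
 qed
 have "(\<Sum>x\<in>om \<inter> window lam n. h (translate x (periodize lam n om))) = (\<Sum>x\<in>om. h (translate x (periodize lam n om)))"
  using sub by (simp add: Int_absorb2)
 also have "... = (\<Sum>i\<in>I. \<Sum>x\<in>D i. h (translate x (periodize lam n om)))"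
  unfolding om_def using I fin disj by (subst sum.UNION_disjoint) auto
 also have "... = (\<Sum>i\<in>I. \<Sum>x\<in>D i. h (translate x (D i)))"
  using eq by (intro sum.cong refl) auto
 finally show ?thesis .
qed

text \<open>Monotonicity is stated for adding one point, so induction yields finite differences
  only; locality later reduces infinite ones to these.\<close>

lemma increasing_fun_subset:
 assumes "increasing_fun h" and "finite (B - A)" and "A \<in> locally_finite_sets" "A \<subseteq> B"
 shows "h A \<le> h B"
proof -
 have "h A \<le> h (A \<union> F)" if "finite F" for F
  using that
 proof (induction F rule: finite_induct)
  case (insert x F)
  have "A \<union> F \<in> locally_finite_sets" using insert.hyps by (intro locally_finite_Un[OF assms(3)] finite_locally_finite)
  then have "h (A \<union> F) \<le> h (insert x (A \<union> F))" using assms(1) by (auto simp: increasing_fun_def)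
  then show ?case using insert.IH by simp
 qed simp
 from this[OF assms(2)] show ?thesis using assms(4) by (simp add: Un_absorb1)
qed

text \<open>This is where monotonicity of the scores enters: emptying the surroundings of a block cannot
 increase the scores of its points.\<close>

lemma increasing_local_mono:
 assumes "increasing_fun h" "local_fun r h" "A \<subseteq> B" "B \<in> locally_finite_sets"
 shows "h A \<le> h B"
proof -
 have A: "A \<in> locally_finite_sets" using assms(3,4) by (rule locally_finite_subset[rotated])
 have "h (A \<inter> cball 0 r) \<le> h (B \<inter> cball 0 r)"
 proof (rule increasing_fun_subset[OF assms(1)])
  show "finite (B \<inter> cball 0 r - A \<inter> cball 0 r)" using finite_Int_bounded[OF assms(4) bounded_cball] by simp
 qed (use assms(3) A in \<open>auto intro: locally_finite_Int\<close>)
 then show ?thesis using assms(2,4) A unfolding local_fun_def by metis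
qed

section \<open>Block laws: stationary windows conditioned on few points\<close>

lemma free_score_one: "free_score (\<lambda>_. 1) W om = real (card (om \<inter> W))"
 by (simp add: free_score_def)

lemma free_score_Int: "free_score h W (om \<inter> W) = free_score h W om"
 by (simp add: free_score_def Int_assoc)

definition few_points :: "(real^'d::finite) set \<Rightarrow> nat \<Rightarrow> (real^'d) set set" where
 "few_points W b = {om \<in> locally_finite_sets. free_score (\<lambda>_. 1) W om \<le> real b}"

context stationary_process
begin

context
 fixes lam :: real and m :: nat
 assumes lam: "0 < lam" and m: "0 < m" and mass: "palm_integral P (\<lambda>_. 1) = ereal lam"
begin

abbreviation "B \<equiv> window lam m :: (real^'d) set"
abbreviation "cnt \<equiv> free_score (\<lambda>_. 1) B"

abbreviation "few \<equiv> few_points B"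

lemma cnt_measurable [measurable]: "cnt \<in> borel_measurable conf_space"
 by (intro measurable_free_score) auto

lemma few_measurable [measurable]: "few b \<in> sets conf_space"
 unfolding few_points_def space_conf_space[symmetric] by measurable

lemma emeasure_palm: "emeasure (palm_measure P) (space (palm_measure P)) = ennreal lam"
proof -
 have "enn2ereal (emeasure (palm_measure P) (space (palm_measure P))) = ereal lam"
  using mass by (simp add: palm_integral_def ext_integral_def ennreal_neg zero_ennreal.rep_eq)
 also have "... = enn2ereal (ennreal lam)" using lam by (simp add: enn2ereal_ennreal)
 finally show ?thesis by (simp add: enn2ereal_inject)
qed

lemma finite_palm: "finite_measure (palm_measure P)"
 by (intro finite_measureI) (simp add: emeasure_palm)

lemma measure_palm: "measure (palm_measure P) (space (palm_measure P)) = lam"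
 using lam by (simp add: measure_def emeasure_palm)

lemma emeasure_B: "emeasure lborel B = ennreal (real m / lam)"
 using emeasure_window_finite[of lam m, where 'd='d] measure_window[OF lam, of m, where 'd='d]
 by (subst emeasure_eq_ennreal_measure) (auto simp: less_top)

lemma nn_integral_count_points:
 assumes [measurable]: "D \<in> sets borel"
 shows "(\<integral>\<^sup>+om. \<integral>\<^sup>+x. 1 \<partial>count_space (om \<inter> D) \<partial>P) = emeasure lborel D * ennreal lam"
 using nn_integral_palm[of "\<lambda>_. 1" D] by (simp add: emeasure_palm)

lemma nn_integral_cnt: "(\<integral>\<^sup>+om. ennreal (cnt om) \<partial>P) = ennreal (real m)"
proof -
 have "(\<integral>\<^sup>+om. ennreal (cnt om) \<partial>P) = (\<integral>\<^sup>+om. \<integral>\<^sup>+x. 1 \<partial>count_space (om \<inter> B) \<partial>P)"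
 proof (rule nn_integral_cong)
  fix om assume "om \<in> space P"
  then have "finite (om \<inter> B)" by (simp add: space_P finite_Int_bounded)
  then show "ennreal (cnt om) = (\<integral>\<^sup>+x. 1 \<partial>count_space (om \<inter> B))"
   by (simp add: nn_integral_count_space_finite free_score_one ennreal_of_nat_eq_real_of_nat)
 qed
 also have "... = ennreal (real m / lam) * ennreal lam" by (subst nn_integral_count_points) (auto simp: emeasure_B)
 also have "... = ennreal (real m)" using lam by (subst ennreal_mult[symmetric]) auto
 finally show ?thesis .
qed

lemma cnt_nonneg: "0 \<le> cnt om" by (simp add: free_score_one)

lemma integrable_cnt: "integrable P cnt" and integral_cnt: "(\<integral>om. cnt om \<partial>P) = real m"
proof -
 show i: "integrable P cnt"
  by (intro integrableI_nonneg) (auto simp: nn_integral_cnt cnt_nonneg)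
 have "ennreal (\<integral>om. cnt om \<partial>P) = ennreal (real m)"
  using nn_integral_cnt i by (simp add: nn_integral_eq_integral cnt_nonneg)
 then show "(\<integral>om. cnt om \<partial>P) = real m" by (simp add: integral_nonneg_AE cnt_nonneg)
qed

lemma few_tendsto: "(\<lambda>b. prob (few b)) \<longlonglongrightarrow> 1"
proof -
 have "(\<lambda>b. prob (few b)) \<longlonglongrightarrow> prob (\<Union>b. few b)"
 proof (rule finite_Lim_measure_incseq)
  show "range few \<subseteq> events" by (auto simp: sets_P)
  show "incseq few" by (auto simp: incseq_def few_points_def)
 qed
 moreover have "(\<Union>b. few b) = space P"
  using real_arch_simple by (auto simp: few_points_def space_P)
 ultimately show ?thesis by (simp add: prob_space)
qed

lemma few_cnt_tendsto: "(\<lambda>b. \<integral>om. indicator (few b) om * cnt om \<partial>P) \<longlonglongrightarrow> real m"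
 unfolding integral_cnt[symmetric]
proof (rule integral_dominated_convergence[where w=cnt])
 have [measurable]: "few b \<in> sets P" for b by (simp add: sets_P)
 show "(\<lambda>om. indicator (few b) om * cnt om) \<in> borel_measurable P" for b by measurable
 show "AE om in P. (\<lambda>b. indicator (few b) om * cnt om) \<longlonglongrightarrow> cnt om"
 proof (rule AE_I2)
  fix om assume w: "om \<in> space P"
  obtain k :: nat where k: "cnt om \<le> real k" using real_arch_simple by blast
  have "\<forall>\<^sub>F b in sequentially. indicator (few b) om * cnt om = cnt om"
   using eventually_ge_at_top[of k]
   by eventually_elim (use k w in \<open>auto simp: few_points_def space_P indicator_def\<close>)
  then show "(\<lambda>b. indicator (few b) om * cnt om) \<longlonglongrightarrow> cnt om" by (rule tendsto_eventually)
 qed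
qed (auto simp: integrable_cnt cnt_nonneg split: split_indicator)

lemma few_free_score_bound:
 assumes lb: "\<And>om. om \<in> locally_finite_sets \<Longrightarrow> c0 \<le> h om"
  and ub: "\<And>om. finite om \<Longrightarrow> card om \<le> b \<Longrightarrow> h om \<le> K" and w: "om \<in> few b"
 shows "\<bar>free_score h B om\<bar> \<le> real b * (\<bar>c0\<bar> + \<bar>K\<bar>)"
proof -
 have fin: "finite (om \<inter> B)" using w by (simp add: few_points_def finite_Int_bounded)
 have card: "card (om \<inter> B) \<le> b" using w by (simp add: few_points_def free_score_one)
 have "\<bar>h (translate x (om \<inter> B))\<bar> \<le> \<bar>c0\<bar> + \<bar>K\<bar>" for x
 proof -
  have f: "finite (translate x (om \<inter> B))" "card (translate x (om \<inter> B)) \<le> b"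
   using fin card card_image_le[OF fin, of "\<lambda>y. y - x"] by (auto simp: translate_def)
  then show ?thesis using lb[of "translate x (om \<inter> B)"] ub[OF f] finite_locally_finite[OF f(1)] by linarith
 qed
 then have "\<bar>free_score h B om\<bar> \<le> (\<Sum>x\<in>om \<inter> B. \<bar>c0\<bar> + \<bar>K\<bar>)"
  unfolding free_score_def by (intro order_trans[OF sum_abs] sum_mono)
 also have "... \<le> real b * (\<bar>c0\<bar> + \<bar>K\<bar>)" using card by (simp add: mult_right_mono)
 finally show ?thesis .
qed

text \<open>Campbell's formula bounds the mean free score by the volume of the window times the Palm
  integral, up to an error at points of \<open>D\<close>. The hypothesis on \<open>a\<close> and
  \<open>D\<close> serves both applications: the interaction errs by \<open>2 * c\<close> near the
  boundary, while increasing scores take \<open>a = 0\<close>.\<close>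

lemma few_free_score_limit:
 assumes h [measurable]: "h \<in> borel_measurable conf_space" and lb: "\<And>om. om \<in> locally_finite_sets \<Longrightarrow> c0 \<le> h om"
  and ub: "\<And>b om. finite om \<Longrightarrow> card om \<le> b \<Longrightarrow> h om \<le> M b"
  and y: "palm_integral P h = ereal y" and a: "0 \<le> a" and D [measurable]: "D \<in> sets borel"
  and le: "\<And>om x. om \<in> locally_finite_sets \<Longrightarrow> x \<in> om \<inter> B \<Longrightarrow> h (translate x (om \<inter> B)) \<le> h (translate x om) + a * indicator D x"
  and \<kappa>: "0 < \<kappa>"
 shows "\<forall>\<^sub>F b in sequentially. (\<integral>om. indicator (few b) om * free_score h B om \<partial>P) / prob (few b)
   \<le> real m / lam * y + a * lam * measure lborel (B \<inter> D) + \<kappa>"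
proof -
 have [measurable]: "few b \<in> sets P" for b by (simp add: sets_P)
 have fsm: "free_score h B \<in> borel_measurable conf_space" by (intro measurable_free_score) auto
 then have [measurable]: "free_score h B \<in> borel_measurable P" by (simp add: measurable_cong_sets[OF sets_P refl])
 let ?m = "measure lborel (B \<inter> D)"
 have emD: "emeasure lborel (B \<inter> D) = ennreal ?m"
  using emeasure_Int_finite[of B lborel D] emeasure_window_finite[of lam m, where 'd='d]
  by (intro emeasure_eq_ennreal_measure) (auto simp: less_top)
 have hm: "h \<in> borel_measurable (palm_measure P)" using h by (simp add: measurable_cong_sets[OF sets_palm_measure refl])
 have "ereal y = enn2ereal (\<integral>\<^sup>+om. ennreal (h om - c0) \<partial>palm_measure P) + ereal (c0 * lam)"
  using ext_integral_shift[OF finite_palm hm, of c0] lb y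
  by (simp add: palm_integral_def measure_palm[unfolded space_palm_measure] space_palm_measure)
 then have en: "enn2ereal (\<integral>\<^sup>+om. ennreal (h om - c0) \<partial>palm_measure P) = ereal (y - c0 * lam)"
  by (cases "enn2ereal (\<integral>\<^sup>+om. ennreal (h om - c0) \<partial>palm_measure P)") auto
 have y0: "0 \<le> y - c0 * lam"
  using enn2ereal_nonneg[of "\<integral>\<^sup>+om. ennreal (h om - c0) \<partial>palm_measure P"] unfolding en by simp
 have palm: "(\<integral>\<^sup>+om. ennreal (h om - c0) \<partial>palm_measure P) = ennreal (y - c0 * lam)"
  using en y0 by (metis enn2ereal_ennreal enn2ereal_inject)
 define R where "R = real m / lam * (y - c0 * lam) + a * lam * ?m"
 have R0: "0 \<le> R" unfolding R_def using y0 a lam by (intro add_nonneg_nonneg mult_nonneg_nonneg) auto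
 \<comment> \<open>The truncation to \<open>few b\<close> cannot be dropped from a signed sum. After
   subtracting \<open>c0\<close> per point all summands are nonnegative and it can; the correction
   is \<open>c0\<close> times the truncated mean count, which converges to
   \<open>c0 * real m\<close>.\<close>
 have main: "(\<integral>om. indicator (few b) om * free_score h B om \<partial>P) \<le> R + c0 * (\<integral>om. indicator (few b) om * cnt om \<partial>P)" for b
 proof -
  have i1: "integrable P (\<lambda>om. indicator (few b) om * free_score h B om)"
   using few_free_score_bound[OF lb ub]
   by (intro integrable_bounded_fun(1)[where b="real b * (\<bar>c0\<bar> + \<bar>M b\<bar>)"]) (auto split: split_indicator)
  have i2: "integrable P (\<lambda>om. indicator (few b) om * cnt om)"
  proof (rule integrable_bounded_fun(1)[where b="real b"])
   show "(\<lambda>om. indicator (few b) om * cnt om) \<in> borel_measurable P" by measurable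
  qed (auto simp: few_points_def cnt_nonneg split: split_indicator)
  have "(\<integral>\<^sup>+om. ennreal (indicator (few b) om * free_score h B om - c0 * (indicator (few b) om * cnt om)) \<partial>P)
    \<le> (\<integral>\<^sup>+om. (\<integral>\<^sup>+x. ennreal (h (translate x om) - c0) \<partial>count_space (om \<inter> B)) + ennreal a * (\<integral>\<^sup>+x. 1 \<partial>count_space (om \<inter> (B \<inter> D))) \<partial>P)"
  proof (rule nn_integral_mono)
   fix om assume "om \<in> space P"
   then have w: "om \<in> locally_finite_sets" by (simp add: space_P)
   have fin: "finite (om \<inter> B)" using w by (simp add: finite_Int_bounded)
   have "indicator (few b) om * free_score h B om - c0 * (indicator (few b) om * cnt om)
     = indicator (few b) om * (\<Sum>x\<in>om \<inter> B. h (translate x (om \<inter> B)) - c0)"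
    by (simp add: free_score_one free_score_def sum_subtractf algebra_simps)
   also have "... \<le> (\<Sum>x\<in>om \<inter> B. h (translate x (om \<inter> B)) - c0)"
    using lb[OF translate_locally_finite[OF locally_finite_Int[OF w]]]
    by (auto split: split_indicator intro!: sum_nonneg)
   also have "... \<le> (\<Sum>x\<in>om \<inter> B. (h (translate x om) - c0) + a * indicator D x)"
    using le[OF w] by (intro sum_mono) (auto simp: algebra_simps)
   finally have "ennreal (indicator (few b) om * free_score h B om - c0 * (indicator (few b) om * cnt om))
     \<le> ennreal (\<Sum>x\<in>om \<inter> B. (h (translate x om) - c0) + a * indicator D x)" by (rule ennreal_leI)
   also have "... = (\<Sum>x\<in>om \<inter> B. ennreal (h (translate x om) - c0) + ennreal a * indicator D x)"
   proof -
    have n: "0 \<le> h (translate x om) - c0" for x using lb[OF translate_locally_finite[OF w]] by simp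
    have "(\<Sum>x\<in>om \<inter> B. ennreal (h (translate x om) - c0) + ennreal a * indicator D x)
      = (\<Sum>x\<in>om \<inter> B. ennreal ((h (translate x om) - c0) + a * indicator D x))"
     using n a by (intro sum.cong refl) (auto simp: ennreal_plus split: split_indicator)
    also have "... = ennreal (\<Sum>x\<in>om \<inter> B. (h (translate x om) - c0) + a * indicator D x)"
     using n a by (intro sum_ennreal add_nonneg_nonneg) auto
    finally show ?thesis ..
   qed
   also have "... = (\<Sum>x\<in>om \<inter> B. ennreal (h (translate x om) - c0)) + ennreal a * (\<Sum>x\<in>om \<inter> B. indicator D x)"
    by (simp add: sum.distrib sum_distrib_left)
   also have "(\<Sum>x\<in>om \<inter> B. indicator D x :: ennreal) = (\<integral>\<^sup>+x. 1 \<partial>count_space (om \<inter> (B \<inter> D)))"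
   proof -
    have "(\<Sum>x\<in>om \<inter> B. indicator D x :: ennreal) = (\<Sum>x\<in>(om \<inter> B) \<inter> D. 1)"
     using fin by (simp add: indicator_def sum.inter_restrict if_distrib cong: if_cong)
    moreover have "finite (om \<inter> (B \<inter> D))" by (rule finite_subset[OF _ fin]) auto
    ultimately show ?thesis by (simp add: Int_assoc emeasure_count_space_finite)
   qed
   also have "(\<Sum>x\<in>om \<inter> B. ennreal (h (translate x om) - c0)) = (\<integral>\<^sup>+x. ennreal (h (translate x om) - c0) \<partial>count_space (om \<inter> B))"
    using fin by (simp add: nn_integral_count_space_finite)
   finally show "ennreal (indicator (few b) om * free_score h B om - c0 * (indicator (few b) om * cnt om))
    \<le> (\<integral>\<^sup>+x. ennreal (h (translate x om) - c0) \<partial>count_space (om \<inter> B)) + ennreal a * (\<integral>\<^sup>+x. 1 \<partial>count_space (om \<inter> (B \<inter> D)))" .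
  qed
  also have "... = (\<integral>\<^sup>+om. \<integral>\<^sup>+x. ennreal (h (translate x om) - c0) \<partial>count_space (om \<inter> B) \<partial>P)
    + (\<integral>\<^sup>+om. ennreal a * (\<integral>\<^sup>+x. 1 \<partial>count_space (om \<inter> (B \<inter> D))) \<partial>P)"
   by (rule nn_integral_add) measurable
  also have "(\<integral>\<^sup>+om. ennreal a * (\<integral>\<^sup>+x. 1 \<partial>count_space (om \<inter> (B \<inter> D))) \<partial>P) = ennreal a * (\<integral>\<^sup>+om. \<integral>\<^sup>+x. 1 \<partial>count_space (om \<inter> (B \<inter> D)) \<partial>P)"
   by (rule nn_integral_cmult) measurable
  also have "(\<integral>\<^sup>+om. \<integral>\<^sup>+x. 1 \<partial>count_space (om \<inter> (B \<inter> D)) \<partial>P) = ennreal (?m * lam)"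
   by (subst nn_integral_count_points) (auto simp: emD ennreal_mult lam less_imp_le)
  also have "(\<integral>\<^sup>+om. \<integral>\<^sup>+x. ennreal (h (translate x om) - c0) \<partial>count_space (om \<inter> B) \<partial>P) = ennreal (real m / lam * (y - c0 * lam))"
   using nn_integral_palm[of "\<lambda>om. ennreal (h om - c0)" B] lam y0
   by (simp only: palm emeasure_B) (simp add: ennreal_mult del: times_divide_eq_left)
  also have "ennreal (real m / lam * (y - c0 * lam)) + ennreal a * ennreal (?m * lam) = ennreal R"
  proof -
   have "ennreal a * ennreal (?m * lam) = ennreal (a * lam * ?m)"
    using a lam by (subst ennreal_mult[symmetric]) (auto simp: mult_ac)
   moreover have "0 \<le> real m / lam * (y - c0 * lam)" "0 \<le> a * lam * ?m"
    using a lam y0 by (auto intro!: mult_nonneg_nonneg divide_nonneg_pos)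
   ultimately show ?thesis unfolding R_def by (subst ennreal_plus) auto
  qed
  finally have nn: "(\<integral>\<^sup>+om. ennreal (indicator (few b) om * free_score h B om - c0 * (indicator (few b) om * cnt om)) \<partial>P) \<le> ennreal R" .
  have "ennreal (\<integral>om. indicator (few b) om * free_score h B om - c0 * (indicator (few b) om * cnt om) \<partial>P) \<le> ennreal R"
  proof -
   have "0 \<le> indicator (few b) om * free_score h B om - c0 * (indicator (few b) om * cnt om)" if "om \<in> space P" for om
   proof -
    have w: "om \<in> locally_finite_sets" using that by (simp add: space_P)
    have "indicator (few b) om * free_score h B om - c0 * (indicator (few b) om * cnt om)
     = indicator (few b) om * (\<Sum>x\<in>om \<inter> B. h (translate x (om \<inter> B)) - c0)"
     by (simp add: free_score_one free_score_def sum_subtractf algebra_simps)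
    also have "0 \<le> ..."
     using lb[OF translate_locally_finite[OF locally_finite_Int[OF w]]]
     by (intro mult_nonneg_nonneg sum_nonneg) auto
    finally show ?thesis .
   qed
   then show ?thesis using nn i1 i2 by (subst (asm) nn_integral_eq_integral) auto
  qed
  then have "(\<integral>om. indicator (few b) om * free_score h B om - c0 * (indicator (few b) om * cnt om) \<partial>P) \<le> R"
   using R0 by simp
  then show ?thesis using i1 i2 by simp
 qed
 have "(\<lambda>b. (R + c0 * (\<integral>om. indicator (few b) om * cnt om \<partial>P)) / prob (few b)) \<longlonglongrightarrow> (R + c0 * real m) / 1"
  by (intro tendsto_intros few_cnt_tendsto few_tendsto) simp
 moreover have "(R + c0 * real m) / 1 < real m / lam * y + a * lam * ?m + \<kappa>"
  unfolding R_def using lam \<kappa> by (simp add: right_diff_distrib)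
 ultimately have "\<forall>\<^sub>F b in sequentially. (R + c0 * (\<integral>om. indicator (few b) om * cnt om \<partial>P)) / prob (few b) < real m / lam * y + a * lam * ?m + \<kappa>"
  by (rule order_tendstoD(2))
 then show ?thesis
 proof eventually_elim
  case (elim b)
  have "(\<integral>om. indicator (few b) om * free_score h B om \<partial>P) / prob (few b) \<le> (R + c0 * (\<integral>om. indicator (few b) om * cnt om \<partial>P)) / prob (few b)"
   using main by (intro divide_right_mono) auto
  then show ?case using elim by linarith
 qed
qed

end

lemma relative_entropy_le_of_density:
 assumes lam: "0 < lam" and m: "0 < m" and le: "entropy_density_seq lam P m \<le> ereal z"
 shows "entropy_bound (real m / lam * z) (restriction lam P m) (poisson_process lam m)"
proof -
 let ?R = "relative_entropy (restriction lam P m) (poisson_process lam m)"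
 have w: "0 < real m / lam" using lam m by simp
 have "ereal (real m / lam) * entropy_density_seq lam P m \<le> ereal (real m / lam) * ereal z"
  using le w by (intro ereal_mult_left_mono) auto
 moreover have "ereal (real m / lam) * entropy_density_seq lam P m = ?R"
 proof -
  have "ereal (real m / lam) * ereal (1 / (real m / lam)) = 1" using lam m by simp
  then show ?thesis
   unfolding entropy_density_seq_def measure_window[OF lam] mult.assoc[symmetric] by simp
 qed
 ultimately have "?R \<le> ereal (real m / lam * z)" by simp
 then show ?thesis using relative_entropy_restriction_iff[OF lam m] by blast
qed

end

text \<open>One admissible process with finite entropy, energy and Palm scores. The thresholds are
  left out: they enter later as strict inequalities, whose slack absorbs all errors.\<close>

locale score_model = stationary_process P for P :: "(real^'d::finite) set measure" +
 fixes lam r c c' i v :: real and M :: "nat \<Rightarrow> real" and J :: "'j set" and x :: "'j \<Rightarrow> real"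
  and V :: "(real^'d) set \<Rightarrow> real" and \<xi> :: "'j \<Rightarrow> (real^'d) set \<Rightarrow> real"
 assumes lam: "0 < lam" and r: "0 < r" and mass: "palm_integral P (\<lambda>_. 1) = ereal lam"
  and ent: "specific_entropy lam P = ereal i"
  and V: "V \<in> borel_measurable conf_space" "local_fun r V" "bounded_fun c V" "palm_integral P V = ereal v"
  and J: "finite J"
  and \<xi>: "\<And>j. j \<in> J \<Longrightarrow> \<xi> j \<in> borel_measurable conf_space" "\<And>j. j \<in> J \<Longrightarrow> bounded_below_fun c' (\<xi> j)"
   "\<And>j. j \<in> J \<Longrightarrow> local_fun r (\<xi> j)" "\<And>j. j \<in> J \<Longrightarrow> increasing_fun (\<xi> j)"
   "\<And>j. j \<in> J \<Longrightarrow> cardinality_bounded_fun M (\<xi> j)" "\<And>j. j \<in> J \<Longrightarrow> palm_integral P (\<xi> j) = ereal (x j)"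

text \<open>The block law is the restriction of \<open>P\<close> to a large window, conditioned on having at most \<open>b\<close>
 points, which makes all scores bounded.\<close>

lemma (in score_model) block_law:
 assumes eps: "0 < eps"
 shows "\<forall>\<^sub>F m in sequentially. 0 < m \<and> (\<exists>mu b. prob_space mu \<and> sets mu = sets conf_space \<and>
  entropy_bound (real m / lam * (i + eps)) mu (poisson_process lam m) \<and>
  (AE om in mu. om \<in> few_points (window lam m) b) \<and>
  \<bar>(\<integral>om. indicator (few_points (window lam m) b) om * free_score (\<lambda>_. 1) (window lam m) om \<partial>mu) - real m\<bar> \<le> real m / lam * eps \<and>
  (\<integral>om. indicator (few_points (window lam m) b) om * free_score V (window lam m) om \<partial>mu) \<le> real m / lam * (v + eps) \<and>
  (\<forall>j\<in>J. (\<integral>om. indicator (few_points (window lam m) b) om * free_score (\<xi> j) (window lam m) om \<partial>mu) \<le> real m / lam * (x j + eps)))"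
proof -
 have c: "0 < c" and Vb: "\<And>om. om \<in> locally_finite_sets \<Longrightarrow> \<bar>V om\<bar> \<le> c" using V(3) by (auto simp: bounded_fun_def)
 let ?L = "\<lambda>m. side TYPE('d) lam m"
 have "entropy_density_seq lam P \<longlonglongrightarrow> ereal i" using entropy_density_seq_tendsto[OF lam] ent by simp
 then have "\<forall>\<^sub>F m in sequentially. entropy_density_seq lam P m < ereal (i + eps / 4)"
  by (rule order_tendstoD(2)) (use eps in simp)
 moreover have "filterlim (\<lambda>m. real m / lam * (eps / 4)) at_top sequentially" using lam eps by real_asymp
 then have "\<forall>\<^sub>F m in sequentially. ln 2 \<le> real m / lam * (eps / 4)" by (simp add: filterlim_at_top)
 \<comment> \<open>Makes a quarter of \<open>eps\<close> per unit volume exceed the price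
   \<open>ln 2\<close> of conditioning. With the previous quarter, half of \<open>eps\<close>
   remains for dividing by the probability of the condition, which is near \<open>1\<close>.\<close>
 moreover have invL: "(\<lambda>m. 2 * r / ?L m) \<longlonglongrightarrow> 0"
  by (rule tendsto_divide_0[OF tendsto_const filterlim_at_top_imp_at_infinity[OF filterlim_side[OF lam]]])
 have "(\<lambda>m. 2 * c * lam * (1 - (1 - 2 * r / ?L m) ^ CARD('d))) \<longlonglongrightarrow> 2 * c * lam * (1 - (1 - 0) ^ CARD('d))"
  by (intro tendsto_intros invL)
 then have "\<forall>\<^sub>F m in sequentially. 2 * c * lam * (1 - (1 - 2 * r / ?L m) ^ CARD('d)) < eps / 2"
  by (rule order_tendstoD(2)) (use eps in simp)
 moreover have "\<forall>\<^sub>F m in sequentially. 2 * r < ?L m"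
  using filterlim_side[OF lam, where 'd='d] by (simp add: filterlim_at_top_dense)
 ultimately show ?thesis
  using eventually_gt_at_top[of "0::nat"]
 proof eventually_elim
  case (elim m)
  interpret LG: local_gibbs lam c m V r
   using lam r V elim Vb by unfold_locales (auto simp: local_fun_def)
  define w where "w = real m / lam"
  have w: "0 < w" using lam elim by (simp add: w_def)
  let ?B = "window lam m :: (real^'d) set" and ?R = "restriction lam P m" and ?Q = "poisson_process lam m :: (real^'d) set measure"
  let ?few = "few_points ?B"
  interpret R: prob_space ?R by (rule prob_space_restriction)
  have spR: "space ?R = locally_finite_sets" by simp
  have few_m [measurable]: "?few b \<in> sets conf_space" for b by (rule few_measurable[OF lam elim(5) mass])
  have few_P: "?few b \<in> events" for b using few_m by (simp add: sets_P)
  have few_Int: "om \<inter> ?B \<in> ?few b \<longleftrightarrow> om \<in> ?few b" if "om \<in> locally_finite_sets" for om b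
   using that by (simp add: few_points_def free_score_Int locally_finite_Int)
  have Rfew: "R.prob (?few b) = prob (?few b)" for b
  proof -
   have "R.prob (?few b) = prob ((\<lambda>om. om \<inter> ?B) -` ?few b \<inter> space P)"
    by (rule measure_distr) measurable
   also have "(\<lambda>om. om \<inter> ?B) -` ?few b \<inter> space P = ?few b"
    using few_Int by (auto simp: space_P few_points_def)
   finally show ?thesis .
  qed
  have eb0: "entropy_bound (w * (i + eps / 4)) ?R ?Q"
   unfolding w_def using elim by (intro relative_entropy_le_of_density lam) auto
  have tp: "(\<lambda>b. prob (?few b)) \<longlonglongrightarrow> 1" by (rule few_tendsto[OF lam elim(5) mass])
  have "\<forall>\<^sub>F b in sequentially. 0 < prob (?few b)" using tp by (rule order_tendstoD(1)) simp
  moreover have "(\<lambda>b. (w * (i + eps / 4) + ln 2) / prob (?few b)) \<longlonglongrightarrow> (w * (i + eps / 4) + ln 2) / 1"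
   by (intro tendsto_intros tp) simp
  then have "\<forall>\<^sub>F b in sequentially. (w * (i + eps / 4) + ln 2) / prob (?few b) < w * (i + eps)"
  proof (rule order_tendstoD(2))
   have "ln 2 \<le> w * (eps / 4)" using elim by (simp add: w_def)
   moreover have "0 < w * (eps / 2)" using w eps by simp
   ultimately show "(w * (i + eps / 4) + ln 2) / 1 < w * (i + eps)" by (simp add: algebra_simps)
  qed
  moreover have tc: "(\<lambda>b. (\<integral>om. indicator (?few b) om * free_score (\<lambda>_. 1) ?B om \<partial>P) / prob (?few b)) \<longlonglongrightarrow> real m / 1"
   by (intro tendsto_intros tp few_cnt_tendsto[OF lam elim(5) mass]) simp
  have "\<forall>\<^sub>F b in sequentially. dist ((\<integral>om. indicator (?few b) om * free_score (\<lambda>_. 1) ?B om \<partial>P) / prob (?few b)) (real m / 1) < w * eps"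
   by (rule tendstoD[OF tc]) (use w eps in simp)
  \<comment> \<open>The error \<open>2 * c\<close> per boundary point: its mean total is
    \<open>2 * c * lam\<close> times the volume of the layer, at most half of \<open>eps\<close> per
    unit volume for the chosen \<open>m\<close>.\<close>
  moreover have "\<forall>\<^sub>F b in sequentially. (\<integral>om. indicator (?few b) om * free_score V ?B om \<partial>P) / prob (?few b)
    \<le> real m / lam * v + 2 * c * lam * measure lborel (?B \<inter> LG.near_boundary) + w * eps / 2"
  proof (rule few_free_score_limit[OF lam elim(5) mass V(1)])
   show "- c \<le> V om" if "om \<in> locally_finite_sets" for om using Vb[OF that] by simp
   show "V om \<le> c" if "finite om" for om using Vb[OF finite_locally_finite[OF that]] by simp
   fix om y assume om: "om \<in> locally_finite_sets" and y: "y \<in> om \<inter> ?B"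
   show "V (translate y (om \<inter> ?B)) \<le> V (translate y om) + 2 * c * indicator LG.near_boundary y"
   proof (cases "y \<in> LG.near_boundary")
    case True
    then show ?thesis
     using Vb[OF translate_locally_finite[OF locally_finite_Int[OF om, of ?B]], of y] Vb[OF translate_locally_finite[OF om], of y] by simp
   next
    case False
    have "translate y (om \<inter> ?B) \<inter> cball 0 r = translate y om \<inter> cball 0 r"
    proof (rule set_eqI)
     fix z
     have "z + y \<in> ?B" if "norm z \<le> r"
     proof -
      have "\<bar>(z + y) $ j\<bar> \<le> ?L m / 2" for j
      proof -
       have "\<bar>z $ j\<bar> \<le> r" using that component_le_norm_cart[of z j] by linarith
       moreover have "\<bar>y $ j\<bar> < ?L m / 2 - r" using False by (simp add: LG.near_boundary_def not_le)
       ultimately show ?thesis unfolding vector_add_component by linarith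
      qed
      then show ?thesis by (simp add: window_eq_cube cube_def)
     qed
     then show "z \<in> translate y (om \<inter> ?B) \<inter> cball 0 r \<longleftrightarrow> z \<in> translate y om \<inter> cball 0 r"
      by (auto simp: mem_translate)
    qed
    then have "V (translate y (om \<inter> ?B)) = V (translate y om)"
     using V(2) translate_locally_finite[OF locally_finite_Int[OF om, of ?B], of y] translate_locally_finite[OF om, of y]
     unfolding local_fun_def by metis
    then show ?thesis using False by simp
   qed
  qed (use V c w eps in auto)
  \<comment> \<open>No boundary error: deleting the points outside the window only lowers an
    increasing score.\<close>
  moreover have "\<forall>\<^sub>F b in sequentially. \<forall>j\<in>J. (\<integral>om. indicator (?few b) om * free_score (\<xi> j) ?B om \<partial>P) / prob (?few b)
    \<le> real m / lam * x j + 0 * lam * measure lborel (?B \<inter> {}) + w * eps"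
  proof (rule eventually_ball_finite[OF J], rule ballI)
   fix j assume j: "j \<in> J"
   show "\<forall>\<^sub>F b in sequentially. (\<integral>om. indicator (?few b) om * free_score (\<xi> j) ?B om \<partial>P) / prob (?few b)
    \<le> real m / lam * x j + 0 * lam * measure lborel (?B \<inter> {}) + w * eps"
   proof (rule few_free_score_limit[OF lam elim(5) mass \<xi>(1)[OF j]])
    show "c' \<le> \<xi> j om" if "om \<in> locally_finite_sets" for om using \<xi>(2)[OF j] that by (auto simp: bounded_below_fun_def)
    show "\<xi> j om \<le> M b" if "finite om" "card om \<le> b" for om b
     using \<xi>(5)[OF j] that finite_locally_finite[OF that(1)] by (auto simp: cardinality_bounded_fun_def)
    show "palm_integral P (\<xi> j) = ereal (x j)" using \<xi>(6)[OF j] .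
    show "\<xi> j (translate y (om \<inter> ?B)) \<le> \<xi> j (translate y om) + 0 * indicator {} y" if "om \<in> locally_finite_sets" for om y
    proof -
     have "\<xi> j (translate y (om \<inter> ?B)) \<le> \<xi> j (translate y om)"
      by (rule increasing_local_mono[OF \<xi>(4)[OF j] \<xi>(3)[OF j]])
       (auto simp: translate_Int intro: translate_locally_finite that)
     then show ?thesis by simp
    qed
   qed (use w eps in auto)
  qed
  ultimately have "\<forall>\<^sub>F b in sequentially. prob_space (uniform_measure ?R (?few b)) \<and> sets (uniform_measure ?R (?few b)) = sets conf_space \<and>
   entropy_bound (w * (i + eps)) (uniform_measure ?R (?few b)) ?Q \<and>
   (AE om in uniform_measure ?R (?few b). om \<in> ?few b) \<and>
   \<bar>(\<integral>om. indicator (?few b) om * free_score (\<lambda>_. 1) ?B om \<partial>uniform_measure ?R (?few b)) - real m\<bar> \<le> w * eps \<and>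
   (\<integral>om. indicator (?few b) om * free_score V ?B om \<partial>uniform_measure ?R (?few b)) \<le> w * (v + eps) \<and>
   (\<forall>j\<in>J. (\<integral>om. indicator (?few b) om * free_score (\<xi> j) ?B om \<partial>uniform_measure ?R (?few b)) \<le> w * (x j + eps))"
  proof eventually_elim
   case (elim b)
   let ?mu = "uniform_measure ?R (?few b)"
   have pos: "0 < R.prob (?few b)" using elim by (simp add: Rfew)
   have ps: "prob_space ?mu"
    using pos by (intro prob_space_uniform_measure) (auto simp: R.emeasure_eq_measure)
   have int: "(\<integral>om. indicator (?few b) om * free_score h ?B om \<partial>?mu) = (\<integral>om. indicator (?few b) om * free_score h ?B om \<partial>P) / prob (?few b)"
    if h: "h \<in> borel_measurable conf_space" for h
   proof -
    have [measurable]: "free_score h ?B \<in> borel_measurable conf_space" using h by (intro measurable_free_score) auto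
    have "(\<integral>om. indicator (?few b) om * free_score h ?B om \<partial>?mu)
      = (\<integral>om. indicator (?few b) om * (indicator (?few b) om * free_score h ?B om) \<partial>?R) / R.prob (?few b)"
     using pos by (intro R.integral_uniform_measure) auto
    also have "(\<integral>om. indicator (?few b) om * (indicator (?few b) om * free_score h ?B om) \<partial>?R)
      = (\<integral>om. indicator (?few b) (om \<inter> ?B) * (indicator (?few b) (om \<inter> ?B) * free_score h ?B (om \<inter> ?B)) \<partial>P)"
     by (intro integral_distr) auto
    also have "... = (\<integral>om. indicator (?few b) om * free_score h ?B om \<partial>P)"
     by (intro Bochner_Integration.integral_cong) (auto simp: few_Int space_P free_score_Int indicator_def)
    finally show ?thesis by (simp add: Rfew)
   qed
   have "entropy_bound ((w * (i + eps / 4) + ln 2) / R.prob (?few b)) ?mu ?Q"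
    using lam \<open>0 < m\<close> pos
    by (intro entropy_bound_condition R.prob_space_axioms prob_space_poisson eb0) (auto simp: sets_poisson)
   then have eb: "entropy_bound (w * (i + eps)) ?mu ?Q"
    by (rule entropy_bound_mono) (use elim(2) in \<open>simp add: Rfew\<close>)
   have AEf: "AE om in ?mu. om \<in> ?few b"
    using pos by (intro AE_uniform_measureI) (auto simp: R.emeasure_eq_measure)
   have cn: "\<bar>(\<integral>om. indicator (?few b) om * free_score (\<lambda>_. 1) ?B om \<partial>?mu) - real m\<bar> \<le> w * eps"
    using elim(3) by (subst int) (auto simp: dist_real_def)
   have nb: "2 * c * lam * measure lborel (?B \<inter> LG.near_boundary) \<le> w * (eps / 2)"
   proof -
    have "measure lborel (?B \<inter> LG.near_boundary) = w * (1 - (1 - 2 * r / ?L m) ^ CARD('d))"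
     using LG.volume_near_boundary[OF \<open>2 * r < ?L m\<close>] w unfolding w_def[symmetric] by (simp add: field_simps)
    then have "2 * c * lam * measure lborel (?B \<inter> LG.near_boundary) = w * (2 * c * lam * (1 - (1 - 2 * r / ?L m) ^ CARD('d)))"
     by (simp add: mult_ac)
    also have "... \<le> w * (eps / 2)"
     using w \<open>2 * c * lam * (1 - (1 - 2 * r / ?L m) ^ CARD('d)) < eps / 2\<close> by (intro mult_left_mono) auto
    finally show ?thesis .
   qed
   have "(\<integral>om. indicator (?few b) om * free_score V ?B om \<partial>?mu) \<le> w * v + 2 * c * lam * measure lborel (?B \<inter> LG.near_boundary) + w * eps / 2"
    using elim(4) unfolding int[OF V(1)] w_def .
   also have "... \<le> w * v + w * (eps / 2) + w * eps / 2" using nb by linarith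
   also have "... = w * (v + eps)" by (simp add: algebra_simps)
   finally have Vle: "(\<integral>om. indicator (?few b) om * free_score V ?B om \<partial>?mu) \<le> w * (v + eps)" .
   have \<xi>le: "\<forall>j\<in>J. (\<integral>om. indicator (?few b) om * free_score (\<xi> j) ?B om \<partial>?mu) \<le> w * (x j + eps)"
   proof
    fix j assume j: "j \<in> J"
    have "(\<integral>om. indicator (?few b) om * free_score (\<xi> j) ?B om \<partial>P) / prob (?few b) \<le> w * x j + w * eps"
     using elim(5) j unfolding w_def by simp
    then show "(\<integral>om. indicator (?few b) om * free_score (\<xi> j) ?B om \<partial>?mu) \<le> w * (x j + eps)"
     unfolding int[OF \<xi>(1)[OF j]] by (simp only: distrib_left)
   qed
   show ?case using ps eb AEf cn Vle \<xi>le by simp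
  qed
  then obtain b where "prob_space (uniform_measure ?R (?few b)) \<and> sets (uniform_measure ?R (?few b)) = sets conf_space \<and>
   entropy_bound (w * (i + eps)) (uniform_measure ?R (?few b)) ?Q \<and>
   (AE om in uniform_measure ?R (?few b). om \<in> ?few b) \<and>
   \<bar>(\<integral>om. indicator (?few b) om * free_score (\<lambda>_. 1) ?B om \<partial>uniform_measure ?R (?few b)) - real m\<bar> \<le> w * eps \<and>
   (\<integral>om. indicator (?few b) om * free_score V ?B om \<partial>uniform_measure ?R (?few b)) \<le> w * (v + eps) \<and>
   (\<forall>j\<in>J. (\<integral>om. indicator (?few b) om * free_score (\<xi> j) ?B om \<partial>uniform_measure ?R (?few b)) \<le> w * (x j + eps))"
   by (auto simp: eventually_sequentially)
  then show ?case using \<open>0 < m\<close> unfolding w_def by blast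
 qed
qed

section \<open>The lower bound\<close>

lemma distr_translated_blocks:
 fixes C :: "(real^'d::finite) set" and t :: "'i \<Rightarrow> real^'d"
 assumes lam: "0 < lam" and I: "finite I" and C [measurable]: "C \<in> sets borel" and finC: "emeasure lborel C < \<infinity>"
  and disj: "disjoint_family_on (\<lambda>i. translate (- t i) C) I"
 defines "T \<equiv> \<lambda>\<zeta>. \<Union>i\<in>I. translate (- t i) (\<zeta> i \<inter> C)"
 shows "T \<in> PiM I (\<lambda>_. ppp lam C) \<rightarrow>\<^sub>M conf_space"
  and "distr (PiM I (\<lambda>_. ppp lam C)) conf_space T = ppp lam (\<Union>i\<in>I. translate (- t i) C)"
proof -
 let ?nu = "ppp lam C"
 have snu [measurable_cong]: "sets ?nu = sets conf_space" by (rule sets_ppp[OF lam C finC])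
 have spnu: "space ?nu = locally_finite_sets" by (rule space_ppp[OF lam C finC])
 interpret product_prob_space "\<lambda>_. ?nu" I by (intro product_prob_spaceI prob_space_ppp lam C finC)
 have Tb [measurable]: "translate (- t i) C \<in> sets borel" for i using C by (rule borel_translate)
 have Tf: "emeasure lborel (translate (- t i) C) < \<infinity>" for i using finC by (simp add: emeasure_translate)
 have U: "(\<Union>i\<in>I. translate (- t i) C) \<in> sets borel" using I by (intro sets.finite_UN) auto
 have Uf: "emeasure lborel (\<Union>i\<in>I. translate (- t i) C) < \<infinity>"
 proof -
  have "emeasure lborel (\<Union>i\<in>I. translate (- t i) C) \<le> (\<Sum>i\<in>I. emeasure lborel (translate (- t i) C))"
   using I by (intro emeasure_subadditive_finite) auto
  also have "... < \<infinity>" using Tf I by (simp add: less_top)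
  finally show ?thesis .
 qed
 show T: "T \<in> PiM I (\<lambda>_. ?nu) \<rightarrow>\<^sub>M conf_space"
  unfolding T_def
 proof (rule measurable_conf_UN)
  fix i assume "i \<in> I"
  then have [measurable]: "(\<lambda>\<zeta>. \<zeta> i) \<in> PiM I (\<lambda>_. ?nu) \<rightarrow>\<^sub>M conf_space"
   using measurable_component_singleton[of i I "\<lambda>_. ?nu"] by (simp add: measurable_cong_sets[OF refl snu])
  show "(\<lambda>\<zeta>. translate (- t i) (\<zeta> i \<inter> C)) \<in> PiM I (\<lambda>_. ?nu) \<rightarrow>\<^sub>M conf_space" by measurable
 next
  fix \<zeta> assume "\<zeta> \<in> space (PiM I (\<lambda>_. ?nu))"
  then show "(\<Union>i\<in>I. translate (- t i) (\<zeta> i \<inter> C)) \<in> locally_finite_sets"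
   by (intro locally_finite_finite_UN I translate_locally_finite locally_finite_Int) (auto simp: space_PiM spnu)
 qed (use I in \<open>auto intro: countable_finite\<close>)
 show "distr (PiM I (\<lambda>_. ?nu)) conf_space T = ppp lam (\<Union>i\<in>I. translate (- t i) C)"
 proof (rule conf_measure_eqI)
  show "sets (ppp lam (\<Union>i\<in>I. translate (- t i) C)) = sets conf_space" by (rule sets_ppp[OF lam U Uf])
  show "finite_measure (distr (PiM I (\<lambda>_. ?nu)) conf_space T)"
   using prob_space_distr[OF T] by (simp add: prob_space_def)
  fix B :: "(real^'d) set" assume B [measurable]: "B \<in> sets borel"
  have trB [measurable]: "translate x B \<in> sets borel" for x using B by (rule borel_translate)
  have "emeasure (distr (PiM I (\<lambda>_. ?nu)) conf_space T) (void B) = emeasure (PiM I (\<lambda>_. ?nu)) (T -` void B \<inter> space (PiM I (\<lambda>_. ?nu)))"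
   by (rule emeasure_distr[OF T]) measurable
  also have "T -` void B \<inter> space (PiM I (\<lambda>_. ?nu)) = PiE I (\<lambda>i. void (C \<inter> translate (t i) B))"
  proof (rule set_eqI)
   fix \<zeta>
   have tr: "translate (- t i) (A \<inter> C) \<inter> B = {} \<longleftrightarrow> A \<inter> (C \<inter> translate (t i) B) = {}" for A i
   proof -
    have "translate (- t i) (A \<inter> C) \<inter> B = translate (- t i) (A \<inter> (C \<inter> translate (t i) B))"
     by (simp add: translate_Int translate_translate Int_assoc)
    then show ?thesis by (simp add: translate_def)
   qed
   have "\<zeta> \<in> T -` void B \<inter> space (PiM I (\<lambda>_. ?nu)) \<longleftrightarrow> \<zeta> \<in> space (PiM I (\<lambda>_. ?nu)) \<and> T \<zeta> \<inter> B = {}"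
    using measurable_space[OF T, of \<zeta>] by (auto simp: void_def)
   also have "T \<zeta> \<inter> B = {} \<longleftrightarrow> (\<forall>i\<in>I. translate (- t i) (\<zeta> i \<inter> C) \<inter> B = {})"
    unfolding T_def by auto
   also have "\<zeta> \<in> space (PiM I (\<lambda>_. ?nu)) \<and> ... \<longleftrightarrow> \<zeta> \<in> PiE I (\<lambda>i. void (C \<inter> translate (t i) B))"
    unfolding tr by (auto simp: space_PiM void_def spnu PiE_iff)
   finally show "\<zeta> \<in> T -` void B \<inter> space (PiM I (\<lambda>_. ?nu)) \<longleftrightarrow> \<zeta> \<in> PiE I (\<lambda>i. void (C \<inter> translate (t i) B))" .
  qed
  also have "emeasure (PiM I (\<lambda>_. ?nu)) (PiE I (\<lambda>i. void (C \<inter> translate (t i) B))) = (\<Prod>i\<in>I. emeasure ?nu (void (C \<inter> translate (t i) B)))"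
   by (rule emeasure_PiM) (auto simp: I snu)
  also have "... = (\<Prod>i\<in>I. ennreal (exp (- lam * measure lborel (translate (- t i) C \<inter> B))))"
  proof (rule prod.cong)
   fix i
   have "C \<inter> translate (t i) B \<in> sets borel" by measurable
   from measure_translate[OF this, of "- t i"]
   have "measure lborel (C \<inter> translate (t i) B) = measure lborel (translate (- t i) C \<inter> B)"
    by (simp add: translate_Int translate_translate)
   then show "emeasure ?nu (void (C \<inter> translate (t i) B)) = ennreal (exp (- lam * measure lborel (translate (- t i) C \<inter> B)))"
    by (subst ppp_void[OF lam C finC]) (auto simp: Int_assoc[symmetric])
  qed simp
  also have "... = ennreal (exp (- lam * (\<Sum>i\<in>I. measure lborel (translate (- t i) C \<inter> B))))"
   using I by (simp add: prod_ennreal exp_sum[symmetric] sum_distrib_left sum_negf)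
  also have "(\<Sum>i\<in>I. measure lborel (translate (- t i) C \<inter> B)) = measure lborel (\<Union>i\<in>I. translate (- t i) C \<inter> B)"
  proof (rule measure_finite_Union[symmetric, OF I])
   show "disjoint_family_on (\<lambda>i. translate (- t i) C \<inter> B) I" using disj by (auto simp: disjoint_family_on_def)
   show "emeasure lborel (translate (- t i) C \<inter> B) \<noteq> \<infinity>" for i
    using emeasure_Int_finite[of "translate (- t i) C" lborel B] Tf[of i] by (auto simp: less_top)
  qed auto
  also have "(\<Union>i\<in>I. translate (- t i) C \<inter> B) = (\<Union>i\<in>I. translate (- t i) C) \<inter> B" by auto
  also have "ennreal (exp (- lam * measure lborel ((\<Union>i\<in>I. translate (- t i) C) \<inter> B))) = emeasure (ppp lam (\<Union>i\<in>I. translate (- t i) C)) (void B)"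
   by (rule ppp_void[OF lam U Uf, symmetric]) simp
  finally show "emeasure (distr (PiM I (\<lambda>_. ?nu)) conf_space T) (void B) = emeasure (ppp lam (\<Union>i\<in>I. translate (- t i) C)) (void B)" .
 qed simp
qed

lemma nn_integral_ppp_split:
 fixes A B :: "(real^'d::finite) set"
 assumes lam: "0 < lam" and A [measurable]: "A \<in> sets borel" and finA: "emeasure lborel A < \<infinity>"
  and B [measurable]: "B \<in> sets borel" and finB: "emeasure lborel B < \<infinity>" and disj: "A \<inter> B = {}"
  and F [measurable]: "F \<in> borel_measurable conf_space"
 shows "(\<integral>\<^sup>+om. F om \<partial>ppp lam (A \<union> B)) = (\<integral>\<^sup>+om. \<integral>\<^sup>+eta. F (om \<union> eta) \<partial>ppp lam B \<partial>ppp lam A)"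
proof -
 note [measurable_cong] = sets_ppp[OF lam A finA] sets_ppp[OF lam B finB]
 interpret B: prob_space "ppp lam B" by (intro prob_space_ppp lam B finB)
 have "(\<integral>\<^sup>+om. F om \<partial>ppp lam (A \<union> B)) = (\<integral>\<^sup>+p. F (fst p \<union> snd p) \<partial>(ppp lam A \<Otimes>\<^sub>M ppp lam B))"
  unfolding ppp_superposition2[OF lam A finA B finB disj, symmetric]
  by (subst nn_integral_distr) (auto simp: case_prod_beta)
 also have "... = (\<integral>\<^sup>+om. \<integral>\<^sup>+eta. F (om \<union> eta) \<partial>ppp lam B \<partial>ppp lam A)"
  by (subst B.nn_integral_fst[symmetric]) auto
 finally show ?thesis .
qed

definition one_each :: "('f \<Rightarrow> (real^'d::finite) set) \<Rightarrow> 'f set \<Rightarrow> (real^'d) set set" where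
 "one_each D F = {eta \<in> locally_finite_sets. eta \<subseteq> (\<Union>f\<in>F. D f) \<and> (\<forall>f\<in>F. num_points eta (D f) = 1)}"

lemma one_each_measurable:
 fixes D :: "'f \<Rightarrow> (real^'d::finite) set"
 assumes F: "finite F" and [measurable]: "\<And>f. D f \<in> sets borel"
 shows "one_each D F \<in> sets conf_space"
proof -
 have "(\<Union>f\<in>F. D f) \<in> sets borel" using F by (intro sets.finite_UN) auto
 then have compl: "- (\<Union>f\<in>F. D f) \<in> sets borel" by measurable
 have "one_each D F = void (- (\<Union>f\<in>F. D f)) \<inter> {eta \<in> space conf_space. \<forall>f\<in>F. num_points eta (D f) = 1}"
  by (auto simp: one_each_def void_def)
 also have "{eta \<in> space conf_space. \<forall>f\<in>F. num_points eta (D f) = 1} \<in> sets conf_space" using F by measurable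
 then have "void (- (\<Union>f\<in>F. D f)) \<inter> {eta \<in> space conf_space. \<forall>f\<in>F. num_points eta (D f) = 1} \<in> sets conf_space"
  by (intro sets.Int sets_void compl)
 finally show ?thesis .
qed

text \<open>One point in each cell and none elsewhere: a cell contributes
  \<open>lam * \<sigma> * exp (- lam * \<sigma>)\<close>, the rest of \<open>E\<close> its void
  probability, and the exponentials combine to that of the whole volume of \<open>E\<close>.\<close>

lemma ppp_one_each:
 fixes D :: "'f \<Rightarrow> (real^'d::finite) set"
 assumes lam: "0 < lam" and F: "finite F" and D [measurable]: "\<And>f. D f \<in> sets borel"
  and vol: "\<And>f. emeasure lborel (D f) = ennreal \<sigma>" and \<sigma>: "0 < \<sigma>"
  and disj: "disjoint_family_on D F"
  and E [measurable]: "E \<in> sets borel" and finE: "emeasure lborel E < \<infinity>" and sub: "\<And>f. f \<in> F \<Longrightarrow> D f \<subseteq> E"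
 shows "ennreal ((lam * \<sigma>) ^ card F * exp (- lam * measure lborel E)) \<le> emeasure (ppp lam E) (one_each D F)"
proof -
 define U where "U = (\<Union>f\<in>F. D f)"
 have U [measurable]: "U \<in> sets borel" unfolding U_def using F by (intro sets.finite_UN) auto
 have UE: "U \<subseteq> E" using sub by (auto simp: U_def)
 have finD: "emeasure lborel (D f) < \<infinity>" for f by (simp add: vol)
 have finU: "emeasure lborel U < \<infinity>" using emeasure_mono[OF UE, of lborel] finE by (auto simp: less_top top_unique)
 have finR: "emeasure lborel (E - U) < \<infinity>" using emeasure_mono[of "E - U" E lborel] finE by (auto simp: less_top top_unique)
 have A [measurable]: "one_each D F \<in> sets conf_space" by (rule one_each_measurable[OF F D])
 have sE: "sets (ppp lam E) = sets conf_space" by (rule sets_ppp[OF lam E finE])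
 have sU [measurable_cong]: "sets (ppp lam U) = sets conf_space" by (rule sets_ppp[OF lam U finU])
 have R [measurable]: "E - U \<in> sets borel" by measurable
 have sR [measurable_cong]: "sets (ppp lam (E - U)) = sets conf_space" by (rule sets_ppp[OF lam R finR])
 have sD [measurable_cong]: "sets (ppp lam (D f)) = sets conf_space" for f by (rule sets_ppp[OF lam D finD])
 interpret product_prob_space "\<lambda>f. ppp lam (D f)" F by (intro product_prob_spaceI prob_space_ppp lam D finD)
 have mD: "measure lborel (D f) = \<sigma>" for f using vol[of f] \<sigma> by (simp add: measure_def)
 have pv: "positive_volume (D f)" for f by unfold_locales (auto simp: finD[simplified] mD \<sigma>)
 let ?one = "{om \<in> locally_finite_sets. num_points om UNIV = 1} :: (real^'d) set set"
 have one [measurable]: "?one \<in> sets conf_space" unfolding space_conf_space[symmetric] by measurable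
 have "emeasure (ppp lam E) (one_each D F) = (\<integral>\<^sup>+om. indicator (one_each D F) om \<partial>ppp lam (U \<union> (E - U)))"
  using UE by (simp add: Un_absorb1 sE)
 also have "... = (\<integral>\<^sup>+om. \<integral>\<^sup>+eta. indicator (one_each D F) (om \<union> eta) \<partial>ppp lam (E - U) \<partial>ppp lam U)"
  by (rule nn_integral_ppp_split[OF lam U finU R finR]) auto
 \<comment> \<open>The lower bound comes from keeping only the event that the part outside the cells
   is empty; the part on \<open>U\<close> then has to be in \<open>one_each\<close> by
   itself.\<close>
 also have "... \<ge> (\<integral>\<^sup>+om. \<integral>\<^sup>+eta. indicator (one_each D F) om * indicator (void UNIV) eta \<partial>ppp lam (E - U) \<partial>ppp lam U)"
  by (intro nn_integral_mono) (auto simp: void_def split: split_indicator)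
 also have "(\<integral>\<^sup>+om. \<integral>\<^sup>+eta. indicator (one_each D F) om * indicator (void UNIV) eta \<partial>ppp lam (E - U) \<partial>ppp lam U)
   = (\<integral>\<^sup>+om. indicator (one_each D F) om * ennreal (exp (- lam * measure lborel (E - U))) \<partial>ppp lam U)"
  by (simp add: nn_integral_cmult sR ppp_void[OF lam R finR])
 also have "... = emeasure (ppp lam U) (one_each D F) * ennreal (exp (- lam * measure lborel (E - U)))"
  by (simp add: nn_integral_multc sU)
 finally have 1: "emeasure (ppp lam U) (one_each D F) * ennreal (exp (- lam * measure lborel (E - U))) \<le> emeasure (ppp lam E) (one_each D F)" .
 note sup = ppp_superposition[OF lam F D finD disj]
 have "(\<Prod>f\<in>F. ennreal (lam * \<sigma> * exp (- lam * \<sigma>))) \<le> (\<Prod>f\<in>F. emeasure (ppp lam (D f)) ?one)"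
 proof (rule prod_mono_ennreal)
  fix f
  interpret Df: positive_volume "D f" by (rule pv)
  show "ennreal (lam * \<sigma> * exp (- lam * \<sigma>)) \<le> emeasure (ppp lam (D f)) ?one"
   using Df.ppp_singleton[OF lam] by (simp add: mD)
 qed
 also have "... = (\<Prod>f\<in>F. \<integral>\<^sup>+om. indicator ?one om \<partial>ppp lam (D f))" by (simp add: sD)
 also have "... = (\<integral>\<^sup>+\<zeta>. (\<Prod>f\<in>F. indicator ?one (\<zeta> f)) \<partial>PiM F (\<lambda>f. ppp lam (D f)))"
  by (rule product_nn_integral_prod[symmetric, OF F]) measurable
 also have "... \<le> (\<integral>\<^sup>+\<zeta>. indicator (one_each D F) (\<Union>f\<in>F. \<zeta> f) \<partial>PiM F (\<lambda>f. ppp lam (D f)))"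
 proof (rule nn_integral_mono_AE)
  have "AE \<zeta> in PiM F (\<lambda>f. ppp lam (D f)). \<forall>f\<in>F. \<zeta> f \<subseteq> D f"
   using F by (intro AE_finite_allI AE_component AE_ppp_subset lam D finD) auto
  then show "AE \<zeta> in PiM F (\<lambda>f. ppp lam (D f)). (\<Prod>f\<in>F. indicator ?one (\<zeta> f)) \<le> (indicator (one_each D F) (\<Union>f\<in>F. \<zeta> f) :: ennreal)"
  proof eventually_elim
   case (elim \<zeta>)
   show ?case
   proof (cases "\<forall>f\<in>F. \<zeta> f \<in> ?one")
    case True
    have "(\<Union>g\<in>F. \<zeta> g) \<inter> D f = \<zeta> f" if "f \<in> F" for f
     using elim that disj by (fastforce simp: disjoint_family_on_def)
    then have "num_points (\<Union>g\<in>F. \<zeta> g) (D f) = 1" if "f \<in> F" for f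
     using True that by (simp add: num_points_def)
    moreover have "(\<Union>g\<in>F. \<zeta> g) \<in> locally_finite_sets" using True by (intro locally_finite_finite_UN F) auto
    ultimately have "(\<Union>g\<in>F. \<zeta> g) \<in> one_each D F" using elim by (auto simp: one_each_def)
    then show ?thesis using True by simp
   next
    case False
    then obtain f where "f \<in> F" "\<zeta> f \<notin> ?one" by blast
    then have "indicator ?one (\<zeta> f) = (0 :: ennreal)" by (simp only: indicator_def) simp
    then have zero: "(\<Prod>f\<in>F. indicator ?one (\<zeta> f)) = (0 :: ennreal)"
     using \<open>f \<in> F\<close> by (intro prod_zero F bexI)
    show ?thesis unfolding zero by simp
   qed
  qed
 qed
 also have "... = (\<integral>\<^sup>+om. indicator (one_each D F) om \<partial>distr (PiM F (\<lambda>f. ppp lam (D f))) conf_space (\<lambda>\<zeta>. \<Union>f\<in>F. \<zeta> f))"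
  by (rule nn_integral_distr[symmetric, OF sup(1)]) measurable
 also have "... = emeasure (ppp lam U) (one_each D F)"
  unfolding sup(2) U_def[symmetric] by (simp add: sU)
 finally have 2: "ennreal ((lam * \<sigma> * exp (- lam * \<sigma>)) ^ card F) \<le> emeasure (ppp lam U) (one_each D F)"
  using lam \<sigma> by (simp add: ennreal_power)
 have mU: "measure lborel U = real (card F) * \<sigma>"
  unfolding U_def using F disj finD by (subst measure_finite_Union) (auto simp: mD less_top)
 have mR: "measure lborel (E - U) = measure lborel E - real (card F) * \<sigma>"
  using UE finE by (subst measure_Diff) (auto simp: mU less_top)
 have "ennreal ((lam * \<sigma>) ^ card F * exp (- lam * measure lborel E))
   = ennreal ((lam * \<sigma> * exp (- lam * \<sigma>)) ^ card F) * ennreal (exp (- lam * measure lborel (E - U)))"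
 proof -
  have "(lam * \<sigma> * exp (- lam * \<sigma>)) ^ card F * exp (- lam * measure lborel (E - U)) = (lam * \<sigma>) ^ card F * exp (- lam * measure lborel E)"
  proof -
   have "exp (- lam * \<sigma>) ^ card F * exp (- lam * measure lborel (E - U)) = exp (real (card F) * (- lam * \<sigma>) + - lam * measure lborel (E - U))"
    by (simp only: exp_of_nat_mult exp_add)
   also have "real (card F) * (- lam * \<sigma>) + - lam * measure lborel (E - U) = - lam * measure lborel E"
    unfolding mR by (simp add: algebra_simps)
   finally have *: "exp (- lam * \<sigma>) ^ card F * exp (- lam * measure lborel (E - U)) = exp (- lam * measure lborel E)" .
   show ?thesis unfolding power_mult_distrib[of "lam * \<sigma>" "exp (- lam * \<sigma>)"] *[symmetric] by (rule mult.assoc)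
  qed
  then show ?thesis using lam \<sigma> by (subst ennreal_mult[symmetric]) auto
 qed
 also have "... \<le> emeasure (ppp lam U) (one_each D F) * ennreal (exp (- lam * measure lborel (E - U)))"
  using 2 by (rule mult_right_mono) simp
 finally show ?thesis using 1 by (rule order_trans)
qed

lemma free_score_translate:
 "(\<Sum>x\<in>translate (- t) A. h (translate x (translate (- t) A))) = (\<Sum>x\<in>A. h (translate x A))"
 unfolding translate_def[of "- t" A] by (subst sum.reindex) (auto simp: inj_on_def translate_def image_image algebra_simps)

text \<open>A single point per small cell keeps the number of reserve points in any ball bounded,
 uniformly in the size of the blocks.\<close>

lemma card_near_points:
 fixes L s r :: real and k q A :: nat and x :: "real^'d::finite"
 assumes r: "0 < r" and s: "0 < s" and q: "0 < q" and L: "0 \<le> L" and gap: "s + 2 * r < L / real k"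
  and A: "r * real q / s + 1 / 2 \<le> real A"
  and eta: "eta \<in> one_each (\<lambda>p. translate (- (center L k (fst p) + center s q (snd p))) (cube (s / (2 * real q)))) F"
  and F: "F \<subseteq> UNIV \<times> grid q" and x: "x \<in> eta"
 shows "finite (eta \<inter> cball x r)" and "card (eta \<inter> cball x r) \<le> (2 * A + 1) ^ CARD('d)"
proof -
 let ?D = "\<lambda>p. translate (- (center L k (fst p) + center s q (snd p))) (cube (s / (2 * real q))) :: (real^'d) set"
 let ?Y = "eta \<inter> cball x r"
 have LF: "eta \<in> locally_finite_sets" and sub: "eta \<subseteq> (\<Union>f\<in>F. ?D f)" and one: "\<And>f. f \<in> F \<Longrightarrow> num_points eta (?D f) = 1"
  using eta by (auto simp: one_each_def)
 show fin: "finite ?Y" by (rule finite_Int_bounded[OF LF bounded_cball])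
 \<comment> \<open>Assign to each reserve point a cell containing it. As every cell holds one point,
   the assignment is injective, and counting points becomes counting cell indices.\<close>
 have "\<forall>y\<in>eta. \<exists>f. f \<in> F \<and> y \<in> ?D f" using sub by blast
 then obtain c where c: "\<And>y. y \<in> eta \<Longrightarrow> c y \<in> F" "\<And>y. y \<in> eta \<Longrightarrow> y \<in> ?D (c y)" by metis
 have inj: "y = z" if "y \<in> eta" "z \<in> eta" "c y = c z" for y z
 proof -
  have "num_points eta (?D (c y)) = 1" using one c that by blast
  then have "finite (eta \<inter> ?D (c y)) \<and> card (eta \<inter> ?D (c y)) = 1"
   by (auto simp: num_points_def emeasure_count_space split: if_splits)
  then obtain a where "eta \<inter> ?D (c y) = {a}" by (auto simp: card_1_singleton_iff)
  moreover have "y \<in> eta \<inter> ?D (c y)" "z \<in> eta \<inter> ?D (c y)" using that c(2)[of y] c(2)[of z] by auto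
  ultimately show ?thesis by auto
 qed
 have inT: "?D p \<subseteq> translate (- center L k (fst p)) (cube s)" if "snd p \<in> grid q" for p
 proof
  fix y assume "y \<in> ?D p"
  then have "y - center L k (fst p) \<in> translate (- center s q (snd p)) (cube (s / (2 * real q)))"
   by (simp add: mem_translate algebra_simps)
  moreover have "translate (- center s q (snd p)) (cube (s / (2 * real q))) \<subseteq> (cube s :: (real^'d) set)"
   using that s q by (intro tile_subset) (auto simp: field_simps)
  ultimately show "y \<in> translate (- center L k (fst p)) (cube s)" by (auto simp: mem_translate)
 qed
 have cF: "snd (c y) \<in> grid q" if "y \<in> eta" for y using c(1)[OF that] F by auto
 \<comment> \<open>Corridors are wider than \<open>r\<close>, so close points share a tile; inside
   it, the bound on the distance becomes the bound \<open>A\<close> on the difference of cell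
   indices.\<close>
 have near: "fst (c y) = fst (c x) \<and> (\<forall>i. \<bar>int (snd (c y) i) - int (snd (c x) i)\<bar> \<le> int A)" if y: "y \<in> ?Y" for y
 proof
  have ye: "y \<in> eta" and yr: "norm (y - x) \<le> r" using y by (auto simp: dist_norm norm_minus_commute)
  have comp: "\<bar>y $ i - x $ i\<bar> \<le> r" for i using yr component_le_norm_cart[of "y - x" i] by simp
  show eq: "fst (c y) = fst (c x)"
  proof (rule ccontr)
   assume "fst (c y) \<noteq> fst (c x)"
   from tile_separation[OF this L, of y k s x] obtain i where "L / real k - s \<le> \<bar>y $ i - x $ i\<bar>"
    using inT[OF cF[OF ye]] inT[OF cF[OF x]] c(2)[OF ye] c(2)[OF x] by blast
   then show False using comp[of i] gap r by linarith
  qed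
  show "\<forall>i. \<bar>int (snd (c y) i) - int (snd (c x) i)\<bar> \<le> int A"
  proof
   fix i
   let ?a = "center L k (fst (c x)) $ i" and ?cy = "center s q (snd (c y)) $ i" and ?cx = "center s q (snd (c x)) $ i"
   define e where "e = s / (2 * real q)"
   have "\<bar>y $ i - (?a + ?cy)\<bar> \<le> e / 2" "\<bar>x $ i - (?a + ?cx)\<bar> \<le> e / 2"
    using c(2)[OF ye, unfolded mem_tile, THEN spec, of i] c(2)[OF x, unfolded mem_tile, THEN spec, of i] eq
    by (simp_all add: e_def)
   then have "\<bar>?cy - ?cx\<bar> \<le> r + e" using comp[of i] by linarith
   then have "\<bar>?cy - ?cx\<bar> \<le> r + s / (2 * real q)" unfolding e_def .
   then have "\<bar>real (snd (c y) i) - real (snd (c x) i)\<bar> * (s / real q) \<le> r + s / (2 * real q)"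
    using s by (simp add: center_diff abs_mult)
   then have "\<bar>real (snd (c y) i) - real (snd (c x) i)\<bar> \<le> (r + s / (2 * real q)) / (s / real q)"
    using s q by (subst pos_le_divide_eq) auto
   also have "... = r * real q / s + 1 / 2" using s q by (simp add: field_simps)
   finally have "\<bar>real (snd (c y) i) - real (snd (c x) i)\<bar> \<le> real A" using A by linarith
   then show "\<bar>int (snd (c y) i) - int (snd (c x) i)\<bar> \<le> int A" by linarith
  qed
 qed
 \<comment> \<open>Index differences relative to the cell of \<open>x\<close> embed the close points
   into an integer box whose size involves \<open>A\<close> alone.\<close>
 let ?\<Phi> = "\<lambda>y i. int (snd (c y) i) - int (snd (c x) i)"
 have "inj_on ?\<Phi> ?Y"
 proof (rule inj_onI)
  fix y z assume yz: "y \<in> ?Y" "z \<in> ?Y" "?\<Phi> y = ?\<Phi> z"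
  have "snd (c y) = snd (c z)"
  proof
   fix i show "snd (c y) i = snd (c z) i" using fun_cong[OF yz(3), of i] by simp
  qed
  then have "c y = c z" using near[OF yz(1)] near[OF yz(2)] by (simp add: prod_eq_iff)
  then show "y = z" using yz by (intro inj) auto
 qed
 then have "card ?Y = card (?\<Phi> ` ?Y)" by (simp add: card_image)
 also have "... \<le> card {v :: 'd \<Rightarrow> int. \<forall>i. \<bar>v i\<bar> \<le> int A}"
  using near by (intro card_mono finite_int_box) blast
 also have "... = (2 * A + 1) ^ CARD('d)"
  by (subst card_int_box) (auto simp: nat_add_distrib nat_mult_distrib)
 finally show "card ?Y \<le> (2 * A + 1) ^ CARD('d)" .
qed

lemma card_one_each:
 assumes F: "finite F" and disj: "disjoint_family_on D F" and eta: "eta \<in> one_each D F"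
 shows "finite eta" and "card eta = card F"
proof -
 have sub: "eta = (\<Union>f\<in>F. eta \<inter> D f)" using eta by (auto simp: one_each_def)
 have one: "finite (eta \<inter> D f) \<and> card (eta \<inter> D f) = 1" if "f \<in> F" for f
 proof -
  have "num_points eta (D f) = 1" using eta that by (simp add: one_each_def)
  then show ?thesis by (auto simp: num_points_def emeasure_count_space split: if_splits)
 qed
 have "finite (\<Union>f\<in>F. eta \<inter> D f)" using one F by (intro finite_UN_I) auto
 then show "finite eta" by (subst sub)
 have "card (\<Union>f\<in>F. eta \<inter> D f) = (\<Sum>f\<in>F. card (eta \<inter> D f))"
  using F one disj by (intro card_UN_disjoint) (auto simp: disjoint_family_on_def)
 also have "... = card F" using one by simp
 finally show "card eta = card F" using sub by simp
qed

section \<open>Configurations made of filled tiles, empty corridors and reserve cells\<close>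

locale block_layout =
 fixes lam r L s :: real and n m k q :: nat and Ib Ir :: "('d::finite \<Rightarrow> nat) set"
 assumes lam: "0 < lam" and r: "0 < r" and n: "0 < n" and m: "0 < m" and k: "0 < k" and q: "0 < q"
  and L: "L = side TYPE('d) lam n" and s: "s = side TYPE('d) lam m"
  and gap: "s + 2 * r < L / real k"
  and Ib: "Ib \<subseteq> grid k" and Ir: "Ir \<subseteq> grid k" and disj: "Ib \<inter> Ir = {}"
begin

lemma L_pos: "0 < L" and s_pos: "0 < s"
 using side_pos[OF lam n] side_pos[OF lam m] by (simp_all add: L s)

lemma finite_Ib: "finite Ib" and finite_Ir: "finite Ir"
 using Ib Ir finite_grid finite_subset by blast+

abbreviation "W \<equiv> window lam n :: (real^'d) set"
abbreviation "B \<equiv> window lam m :: (real^'d) set"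
abbreviation "Poi \<equiv> poisson_process lam m :: (real^'d) set measure"

abbreviation T :: "('d \<Rightarrow> nat) \<Rightarrow> (real^'d) set" where
 "T w \<equiv> translate (- center L k w) B"

text \<open>Reserve cell \<open>snd p\<close> of tile \<open>fst p\<close>. Its side is half the
  spacing of the cells, so distinct closed cells are disjoint.\<close>

definition small :: "('d \<Rightarrow> nat) \<times> ('d \<Rightarrow> nat) \<Rightarrow> (real^'d) set" where
 "small p = translate (- (center L k (fst p) + center s q (snd p))) (cube (s / (2 * real q)))"

lemma mem_small: "y \<in> small p \<longleftrightarrow> y - center L k (fst p) \<in> translate (- center s q (snd p)) (cube (s / (2 * real q)))"
 by (simp add: small_def mem_translate algebra_simps)

lemma borel_small [measurable]: "small p \<in> sets borel"
 unfolding small_def by (intro borel_translate) auto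

lemma B_eq: "B = cube s" by (simp add: window_eq_cube s)

lemma W_eq: "W = cube L" by (simp add: window_eq_cube L)

lemma T_sub: "w \<in> grid k \<Longrightarrow> T w \<subseteq> W"
 unfolding B_eq W_eq using L_pos gap r by (intro tile_subset) auto

text \<open>The reason for \<open>2 * r\<close> in \<open>gap\<close>: at the window boundary only
  half a corridor is available, and it must still be wider than \<open>r\<close> to screen the
  periodic images.\<close>

lemma T_inside: "w \<in> grid k \<Longrightarrow> x \<in> T w \<Longrightarrow> \<bar>x $ j\<bar> < L / 2 - r"
proof -
 assume "w \<in> grid k" "x \<in> T w"
 then have "\<bar>x $ j\<bar> \<le> L / 2 - (L / real k - s) / 2"
  unfolding B_eq using L_pos by (intro tile_inside) auto
 moreover define g where "g = L / real k"
 ultimately have "\<bar>x $ j\<bar> \<le> L / 2 - (g - s) / 2" "s + 2 * r < g" using gap by simp_all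
 then show ?thesis unfolding diff_divide_distrib by linarith
qed

lemma T_separated:
 assumes "w \<noteq> w'" "x \<in> T w" "y \<in> T w'"
 shows "r < norm (x - y)"
proof -
 obtain i where "L / real k - s \<le> \<bar>x $ i - y $ i\<bar>"
  using tile_separation[OF assms(1)] assms(2,3) L_pos unfolding B_eq by (metis less_imp_le)
 then show ?thesis using gap r component_le_norm_cart[of "x - y" i] by simp
qed

lemma small_sub: "snd p \<in> grid q \<Longrightarrow> small p \<subseteq> T (fst p)"
proof
 fix y assume p: "snd p \<in> grid q" and "y \<in> small p"
 then have "y - center L k (fst p) \<in> translate (- center s q (snd p)) (cube (s / (2 * real q)))"
  by (simp add: mem_small)
 moreover have "translate (- center s q (snd p)) (cube (s / (2 * real q))) \<subseteq> (cube s :: (real^'d) set)"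
  using p s_pos q by (intro tile_subset) (auto simp: field_simps)
 ultimately show "y \<in> T (fst p)" unfolding B_eq by (auto simp: mem_translate)
qed

lemma T_disjoint: "disjoint_family_on T I"
 unfolding B_eq using L_pos gap r by (intro tile_disjoint) auto

lemma small_disjoint: "F \<subseteq> UNIV \<times> grid q \<Longrightarrow> disjoint_family_on small F"
 unfolding disjoint_family_on_def
proof (intro ballI impI equals0I)
 fix p p' x assume F: "F \<subseteq> UNIV \<times> grid q" and p: "p \<in> F" "p' \<in> F" "p \<noteq> p'" and x: "x \<in> small p \<inter> small p'"
 have "p \<in> UNIV \<times> grid q" "p' \<in> UNIV \<times> grid q" using F p by blast+
 then have "snd p \<in> grid q" "snd p' \<in> grid q" by (simp_all add: mem_Times_iff)
 then have "x \<in> T (fst p)" "x \<in> T (fst p')" using small_sub[of p] small_sub[of p'] x by blast+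
 then have f: "fst p = fst p'" using T_separated[of "fst p" "fst p'" x x] r by force
 then have "snd p \<noteq> snd p'" using p by (simp add: prod_eq_iff)
 moreover have "x - center L k (fst p) \<in> translate (- center s q (snd p)) (cube (s / (2 * real q)))"
   "x - center L k (fst p) \<in> translate (- center s q (snd p')) (cube (s / (2 * real q)))"
  using x f by (auto simp: mem_small)
 ultimately obtain i :: 'd where "s / real q - s / (2 * real q) \<le> 0"
  using tile_separation[of "snd p" "snd p'" s "x - center L k (fst p)" q "s / (2 * real q)" "x - center L k (fst p)"] s_pos by auto
 then show False using s_pos q by (simp add: field_simps)
qed

definition config :: "(('d \<Rightarrow> nat) \<Rightarrow> (real^'d) set) \<Rightarrow> (real^'d) set \<Rightarrow> (real^'d) set" where
 "config \<zeta> eta = (\<Union>w\<in>Ib. translate (- center L k w) (\<zeta> w \<inter> B)) \<union> eta"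

text \<open>The sum decouples by \<open>local_sum_separated\<close>, with one group per filled tile
  and a single group for all reserve points, since those of one tile may lie within \<open>r\<close>
  of each other.\<close>

lemma sum_config:
 assumes h: "local_fun r h" and \<zeta>: "\<And>w. w \<in> Ib \<Longrightarrow> \<zeta> w \<in> locally_finite_sets"
  and F: "finite F" "F \<subseteq> Ir \<times> grid q" and eta: "eta \<in> one_each small F"
 shows "(\<Sum>x\<in>config \<zeta> eta \<inter> W. h (translate x (periodize lam n (config \<zeta> eta))))
  = (\<Sum>w\<in>Ib. free_score h B (\<zeta> w)) + (\<Sum>x\<in>eta. h (translate x eta))"
proof -
 \<comment> \<open>The index \<open>None\<close> stands for the reserve points,
   \<open>Some w\<close> for the filled tile \<open>w\<close>.\<close>
 define D where "D = (\<lambda>i. case i of Some w \<Rightarrow> translate (- center L k w) (\<zeta> w \<inter> B) | None \<Rightarrow> eta)"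
 define I where "I = insert None (Some ` Ib)"
 have D_simps: "D None = eta" "D (Some w) = translate (- center L k w) (\<zeta> w \<inter> B)" for w by (simp_all add: D_def)
 have c: "config \<zeta> eta = (\<Union>i\<in>I. D i)" by (auto simp: config_def I_def D_simps)
 have DT: "D (Some w) \<subseteq> T w" for w by (simp add: D_simps translate_Int)
 have etaT: "\<exists>w\<in>Ir. x \<in> T w" if "x \<in> eta" for x
 proof -
  have "x \<in> (\<Union>f\<in>F. small f)" using eta that unfolding one_each_def by blast
  then obtain p where p: "p \<in> F" "x \<in> small p" by (rule UN_E)
  then have "p \<in> Ir \<times> grid q" using F by blast
  then have "fst p \<in> Ir" "snd p \<in> grid q" by (simp_all add: mem_Times_iff)
  then show ?thesis using small_sub[of p] p by blast
 qed
 have "(\<Sum>x\<in>config \<zeta> eta \<inter> W. h (translate x (periodize lam n (config \<zeta> eta)))) = (\<Sum>i\<in>I. \<Sum>x\<in>D i. h (translate x (D i)))"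
  unfolding c
 proof (rule local_sum_separated[OF lam n r h])
  show "finite I" by (simp add: I_def finite_Ib)
  show "finite (D i)" if "i \<in> I" for i
  proof (cases i)
   case None
   have "finite eta" using card_one_each(1)[OF F(1) small_disjoint eta] F by auto
   then show ?thesis using None by (simp add: D_simps)
  next
   case (Some w)
   then have "finite (\<zeta> w \<inter> B)" using that \<zeta> by (intro finite_Int_bounded) (auto simp: I_def)
   then show ?thesis using Some by (simp add: D_simps translate_def)
  qed
  show "\<bar>x $ j\<bar> < side TYPE('d) lam n / 2 - r" if i: "i \<in> I" and x: "x \<in> D i" for i x j
  proof (cases i)
   case None
   then obtain w where "w \<in> Ir" "x \<in> T w" using etaT x by (auto simp: D_simps)
   then show ?thesis using T_inside[of w x j] Ir by (auto simp: L)
  next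
   case (Some w)
   then have "w \<in> Ib" "x \<in> T w" using i x DT by (auto simp: I_def)
   then show ?thesis using T_inside[of w x j] Ib by (auto simp: L)
  qed
  show "r < norm (x - y)" if i: "i \<in> I" and j: "j \<in> I" and ij: "i \<noteq> j" and x: "x \<in> D i" and y: "y \<in> D j" for i j x y
  proof -
   have *: "\<exists>w. x \<in> T w \<and> (case i of Some v \<Rightarrow> w = v | None \<Rightarrow> w \<in> Ir)" if "x \<in> D i" for x i
   proof (cases i)
    case None
    then show ?thesis using etaT that by (auto simp: D_simps)
   next
    case (Some v)
    then show ?thesis using DT[of v] that by auto
   qed
   obtain w where w: "x \<in> T w" "case i of Some v \<Rightarrow> w = v | None \<Rightarrow> w \<in> Ir" using *[OF x] by blast
   obtain w' where w': "y \<in> T w'" "case j of Some v \<Rightarrow> w' = v | None \<Rightarrow> w' \<in> Ir" using *[OF y] by blast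
   have "w \<noteq> w'" using w(2) w'(2) i j ij disj by (auto simp: I_def)
   then show ?thesis using w(1) w'(1) by (rule T_separated)
  qed
 qed
 also have "... = (\<Sum>x\<in>eta. h (translate x eta)) + (\<Sum>w\<in>Ib. \<Sum>x\<in>D (Some w). h (translate x (D (Some w))))"
  unfolding I_def using finite_Ib by (simp add: sum.reindex D_simps)
 also have "(\<Sum>w\<in>Ib. \<Sum>x\<in>D (Some w). h (translate x (D (Some w)))) = (\<Sum>w\<in>Ib. free_score h B (\<zeta> w))"
  unfolding D_simps free_score_translate free_score_def ..
 finally show ?thesis by simp
qed

lemma config_sub:
 assumes F: "F \<subseteq> Ir \<times> grid q" and eta: "eta \<in> one_each small F"
 shows "config \<zeta> eta \<subseteq> W"
proof
 fix x assume "x \<in> config \<zeta> eta"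
 then consider w where "w \<in> Ib" "x \<in> translate (- center L k w) (\<zeta> w \<inter> B)" | "x \<in> eta" by (auto simp: config_def)
 then show "x \<in> W"
 proof cases
  case 1
  then have "x \<in> T w" by (simp add: translate_Int)
  then show ?thesis using T_sub 1 Ib by blast
 next
  case 2
  then have "x \<in> (\<Union>f\<in>F. small f)" using eta unfolding one_each_def by blast
  then obtain p where p: "p \<in> F" "x \<in> small p" by (rule UN_E)
  then have "p \<in> Ir \<times> grid q" using F by blast
  then have "fst p \<in> Ir" "snd p \<in> grid q" by (simp_all add: mem_Times_iff)
  then show ?thesis using small_sub[of p] T_sub[of "fst p"] p Ir by blast
 qed
qed

text \<open>The constant score \<open>1\<close> is local, so the additivity of scores already counts
  the points.\<close>

lemma num_points_config:
 assumes \<zeta>: "\<And>w. w \<in> Ib \<Longrightarrow> \<zeta> w \<in> locally_finite_sets"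
  and F: "finite F" "F \<subseteq> Ir \<times> grid q" and eta: "eta \<in> one_each small F"
 shows "num_points (config \<zeta> eta) UNIV = of_nat ((\<Sum>w\<in>Ib. card (\<zeta> w \<inter> B)) + card F)"
proof -
 have ceta: "finite eta" "card eta = card F" using card_one_each[OF F(1) small_disjoint eta] F by auto
 have "finite (config \<zeta> eta)"
  unfolding config_def using finite_Ib ceta \<zeta> by (auto simp: translate_def finite_Int_bounded)
 moreover have "config \<zeta> eta \<inter> W = config \<zeta> eta" using config_sub[OF F(2) eta] by auto
 moreover have "real (card (config \<zeta> eta \<inter> W)) = (\<Sum>w\<in>Ib. real (card (\<zeta> w \<inter> B))) + real (card F)"
  using sum_config[of "\<lambda>_. 1", OF _ \<zeta> F eta] ceta by (simp add: local_fun_def free_score_one)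
 then have "card (config \<zeta> eta \<inter> W) = (\<Sum>w\<in>Ib. card (\<zeta> w \<inter> B)) + card F"
  by (simp flip: of_nat_sum of_nat_add)
 ultimately show ?thesis by (simp add: num_points_eq_card)
qed

abbreviation "U \<equiv> \<Union>w\<in>Ib. T w"

lemma borel_U: "U \<in> sets borel"
 using finite_Ib by (intro sets.finite_UN borel_translate) auto

lemma U_sub: "U \<subseteq> W" using T_sub Ib by blast

lemma finite_volumes: "emeasure lborel W < \<infinity>" "emeasure lborel U < \<infinity>" "emeasure lborel (W - U) < \<infinity>"
proof -
 show W: "emeasure lborel W < \<infinity>" by (rule emeasure_window_finite)
 show "emeasure lborel U < \<infinity>" using emeasure_mono[OF U_sub, of lborel] W by (auto simp: less_top top_unique)
 show "emeasure lborel (W - U) < \<infinity>" using emeasure_mono[of "W - U" W lborel] W by (auto simp: less_top top_unique)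
qed

lemma measure_U: "measure lborel U = real (card Ib) * (real m / lam)"
proof -
 have "measure lborel U = (\<Sum>w\<in>Ib. measure lborel (T w))"
 proof (rule measure_finite_Union[OF finite_Ib])
  show "T ` Ib \<subseteq> sets lborel" by (auto intro!: borel_translate)
  show "disjoint_family_on T Ib" by (rule T_disjoint)
  show "emeasure lborel (T w) \<noteq> \<infinity>" for w
   using emeasure_window_finite[of lam m, where 'd='d] by (simp add: emeasure_translate less_top)
 qed
 then show ?thesis by (simp add: measure_translate measure_window[OF lam])
qed

lemma measure_W_minus_U: "measure lborel (W - U) = real n / lam - real (card Ib) * (real m / lam)"
 using finite_volumes U_sub borel_U by (subst measure_Diff) (auto simp: less_top measure_U measure_window[OF lam])

text \<open>The process on the filled tiles is independent of the rest and, tile by tile, a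
  translate of the Poisson process in the window of index \<open>m\<close>. The block law can thus
  be compared with its reference on a product space.\<close>

lemma nn_integral_config:
 assumes \<Phi> [measurable]: "\<Phi> \<in> borel_measurable conf_space"
 shows "(\<integral>\<^sup>+om. \<Phi> om \<partial>ppp lam W) = (\<integral>\<^sup>+\<zeta>. \<integral>\<^sup>+eta. \<Phi> (config \<zeta> eta) \<partial>ppp lam (W - U) \<partial>PiM Ib (\<lambda>_. Poi))"
proof -
 have WU [measurable]: "W - U \<in> sets borel" using borel_U by measurable
 have s2 [measurable_cong]: "sets (ppp lam (W - U)) = sets conf_space" by (rule sets_ppp[OF lam WU finite_volumes(3)])
 interpret R: prob_space "ppp lam (W - U)" by (rule prob_space_ppp[OF lam WU finite_volumes(3)])
 note db = distr_translated_blocks[OF lam finite_Ib borel_window emeasure_window_finite T_disjoint]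
 have "(\<lambda>p. \<Phi> (fst p \<union> snd p)) \<in> borel_measurable (conf_space \<Otimes>\<^sub>M ppp lam (W - U))" by measurable
 then have inner: "(\<lambda>om. \<integral>\<^sup>+eta. \<Phi> (om \<union> eta) \<partial>ppp lam (W - U)) \<in> borel_measurable conf_space"
  using R.borel_measurable_nn_integral_fst by fastforce
 have "(\<integral>\<^sup>+om. \<Phi> om \<partial>ppp lam W) = (\<integral>\<^sup>+om. \<Phi> om \<partial>ppp lam (U \<union> (W - U)))"
  using U_sub by (simp add: Un_absorb1)
 also have "... = (\<integral>\<^sup>+om. \<integral>\<^sup>+eta. \<Phi> (om \<union> eta) \<partial>ppp lam (W - U) \<partial>ppp lam U)"
  by (rule nn_integral_ppp_split[OF lam borel_U finite_volumes(2) WU finite_volumes(3)]) auto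
 also have "... = (\<integral>\<^sup>+\<zeta>. \<integral>\<^sup>+eta. \<Phi> (config \<zeta> eta) \<partial>ppp lam (W - U) \<partial>PiM Ib (\<lambda>_. ppp lam B))"
  unfolding db(2)[symmetric] config_def using inner by (intro nn_integral_distr db(1)) auto
 finally show ?thesis unfolding poisson_process_eq_ppp[OF lam m] .
qed

lemma small_volume: "emeasure lborel (small p) = ennreal ((s / (2 * real q)) ^ CARD('d))"
proof -
 have "0 \<le> s / (2 * real q)" using s_pos by simp
 then have "emeasure lborel (cube (s / (2 * real q)) :: (real^'d) set) = ennreal ((s / (2 * real q)) ^ CARD('d))"
  using emeasure_cube_finite[of "s / (2 * real q)", where 'd='d]
  by (subst emeasure_eq_ennreal_measure) (auto simp: less_top measure_cube)
 then show ?thesis by (simp add: small_def emeasure_translate)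
qed

text \<open>If the blocks behave well (event \<open>G\<close>), the \<open>Kf\<close> missing points can be put into distinct small
 cells of the reserved tiles while the rest of the window stays empty.\<close>

lemma poisson_lower:
 assumes \<Phi> [measurable]: "\<Phi> \<in> borel_measurable conf_space" and G: "G \<in> sets (PiM Ib (\<lambda>_. Poi))"
  and \<phi>: "0 \<le> \<phi>"
  and Kf: "\<And>\<zeta>. \<zeta> \<in> G \<Longrightarrow> Kf \<zeta> \<le> card (Ir \<times> (grid q :: ('d \<Rightarrow> nat) set)) \<and> Kf \<zeta> \<le> K"
  and \<sigma>: "lam * (s / (2 * real q)) ^ CARD('d) \<le> 1"
  and le: "\<And>\<zeta> F eta. \<zeta> \<in> G \<Longrightarrow> F \<subseteq> Ir \<times> grid q \<Longrightarrow> card F = Kf \<zeta> \<Longrightarrow> eta \<in> one_each small F \<Longrightarrow> ennreal \<phi> \<le> \<Phi> (config \<zeta> eta)"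
 shows "ennreal (\<phi> * ((lam * (s / (2 * real q)) ^ CARD('d)) ^ K * exp (- lam * measure lborel (W - U))) * measure (PiM Ib (\<lambda>_. Poi)) G)
  \<le> (\<integral>\<^sup>+om. \<Phi> om \<partial>ppp lam W)"
proof -
 let ?\<sigma> = "(s / (2 * real q)) ^ CARD('d)"
 have \<sigma>0: "0 < ?\<sigma>" using s_pos q by simp
 define \<kappa> where "\<kappa> = (lam * ?\<sigma>) ^ K * exp (- lam * measure lborel (W - U))"
 have \<kappa>0: "0 \<le> \<kappa>" using lam \<sigma>0 by (simp add: \<kappa>_def)
 have WU: "W - U \<in> sets borel" using borel_U by measurable
 have sR: "sets (ppp lam (W - U)) = sets conf_space" by (rule sets_ppp[OF lam WU finite_volumes(3)])
 have finS: "finite (Ir \<times> (grid q :: ('d \<Rightarrow> nat) set))"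
  by (intro finite_cartesian_product finite_Ir finite_grid)
 interpret Poi: prob_space Poi by (rule prob_space_poisson[OF lam m])
 interpret PM: product_prob_space "\<lambda>_. Poi" Ib ..
 have inner: "ennreal (\<phi> * \<kappa>) \<le> (\<integral>\<^sup>+eta. \<Phi> (config \<zeta> eta) \<partial>ppp lam (W - U))" if \<zeta>: "\<zeta> \<in> G" for \<zeta>
 proof -
  \<comment> \<open>As many reserve cells as there are missing points; which ones is irrelevant for
    the bound.\<close>
  obtain F where F: "F \<subseteq> Ir \<times> (grid q :: ('d \<Rightarrow> nat) set)" "card F = Kf \<zeta>"
   using Kf[OF \<zeta>] obtain_subset_with_card_n by metis
  have finF: "finite F" using F finS finite_subset by blast
  \<comment> \<open>Since \<open>lam * (s / (2 * real q)) ^ CARD('d)\<close> is at most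
    \<open>1\<close>, raising it to the larger power \<open>K\<close> only decreases it. This
    removes the dependence on \<open>\<zeta>\<close>.\<close>
  have "ennreal \<kappa> \<le> ennreal ((lam * ?\<sigma>) ^ card F * exp (- lam * measure lborel (W - U)))"
   unfolding \<kappa>_def using Kf[OF \<zeta>] F lam \<sigma> \<sigma>0 by (intro ennreal_leI mult_right_mono power_decreasing) auto
  also have "... \<le> emeasure (ppp lam (W - U)) (one_each small F)"
  proof (rule ppp_one_each[OF lam finF _ small_volume \<sigma>0 _ WU finite_volumes(3)])
   show "small f \<in> sets borel" for f by simp
   show "disjoint_family_on small F" using F by (intro small_disjoint) auto
   show "small f \<subseteq> W - U" if "f \<in> F" for f
   proof
    fix x assume "x \<in> small f"
    moreover have f: "snd f \<in> grid q" "fst f \<in> Ir" using F that by auto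
    ultimately have x: "x \<in> T (fst f)" using small_sub by blast
    have "x \<notin> T w" if "w \<in> Ib" for w
    proof
     assume "x \<in> T w"
     moreover have "w \<noteq> fst f" using that f disj by auto
     ultimately show False using T_separated[of w "fst f" x x] x r by simp
    qed
    then show "x \<in> W - U" using x T_sub f Ir by auto
   qed
  qed
  finally have "ennreal \<phi> * ennreal \<kappa> \<le> ennreal \<phi> * emeasure (ppp lam (W - U)) (one_each small F)"
   by (rule mult_left_mono) simp
  also have "... = (\<integral>\<^sup>+eta. ennreal \<phi> * indicator (one_each small F) eta \<partial>ppp lam (W - U))"
  proof -
   have "one_each small F \<in> sets (ppp lam (W - U))"
    unfolding sR by (intro one_each_measurable finF borel_small)
   then show ?thesis by (simp add: nn_integral_cmult)
  qed
  also have "... \<le> (\<integral>\<^sup>+eta. \<Phi> (config \<zeta> eta) \<partial>ppp lam (W - U))"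
   using le[OF \<zeta> F] by (intro nn_integral_mono) (auto split: split_indicator)
  finally show ?thesis using \<phi> \<kappa>0 by (simp add: ennreal_mult)
 qed
 have "ennreal (\<phi> * \<kappa> * PM.prob G) = ennreal (\<phi> * \<kappa>) * emeasure (PiM Ib (\<lambda>_. Poi)) G"
  using \<phi> \<kappa>0 by (simp add: PM.emeasure_eq_measure ennreal_mult)
 also have "... = (\<integral>\<^sup>+\<zeta>. ennreal (\<phi> * \<kappa>) * indicator G \<zeta> \<partial>PiM Ib (\<lambda>_. Poi))"
  using G by (simp add: nn_integral_cmult)
 also have "... \<le> (\<integral>\<^sup>+\<zeta>. \<integral>\<^sup>+eta. \<Phi> (config \<zeta> eta) \<partial>ppp lam (W - U) \<partial>PiM Ib (\<lambda>_. Poi))"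
  using inner by (intro nn_integral_mono) (auto split: split_indicator)
 also have "... = (\<integral>\<^sup>+om. \<Phi> om \<partial>ppp lam W)" by (rule nn_integral_config[symmetric]) measurable
 finally show ?thesis unfolding \<kappa>_def .
qed

end

text \<open>A union bound over the finitely many functions, each with failure probability at most
  \<open>\<delta> / (card K + 1)\<close>.\<close>

lemma PiM_lln_family:
 fixes K :: "('a \<Rightarrow> real) set"
 assumes mu: "prob_space mu" and K: "finite K" and g: "\<And>g. g \<in> K \<Longrightarrow> g \<in> borel_measurable mu"
  and gb: "\<And>g. g \<in> K \<Longrightarrow> \<exists>b. \<forall>x\<in>space mu. \<bar>g x\<bar> \<le> b" and eps: "0 < eps" and \<delta>: "0 < \<delta>"
 shows "\<exists>N0. \<forall>I :: 'i set. finite I \<longrightarrow> N0 \<le> card I \<longrightarrow> 1 - \<delta> \<le>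
  measure (PiM I (\<lambda>_. mu)) {om \<in> space (PiM I (\<lambda>_. mu)). \<forall>g\<in>K. (\<Sum>i\<in>I. g (om i)) < real (card I) * ((\<integral>x. g x \<partial>mu) + eps)}"
proof -
 interpret prob_space mu by fact
 define \<delta>' where "\<delta>' = \<delta> / (real (card K) + 1)"
 have \<delta>': "0 < \<delta>'" using \<delta> by (simp add: \<delta>'_def add_nonneg_pos)
 have "\<forall>g\<in>K. \<exists>N. \<forall>I :: 'i set. finite I \<longrightarrow> N \<le> card I \<longrightarrow>
  measure (PiM I (\<lambda>_. mu)) {om \<in> space (PiM I (\<lambda>_. mu)). real (card I) * ((\<integral>x. g x \<partial>mu) + eps) \<le> (\<Sum>i\<in>I. g (om i))} \<le> \<delta>'"
 proof
  fix h assume h: "h \<in> K"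
  obtain b where b: "\<And>x. x \<in> space mu \<Longrightarrow> \<bar>h x\<bar> \<le> b" using gb[OF h] by blast
  obtain N where "\<And>I :: 'i set. finite I \<Longrightarrow> N \<le> card I \<Longrightarrow>
   measure (PiM I (\<lambda>_. mu)) {om \<in> space (PiM I (\<lambda>_. mu)). real (card I) * ((\<integral>x. h x \<partial>mu) + eps) \<le> (\<Sum>i\<in>I. h (om i))} \<le> \<delta>'"
   using PiM_lln[OF mu g[OF h] b eps \<delta>', where 'i='i] by blast
  then show "\<exists>N. \<forall>I :: 'i set. finite I \<longrightarrow> N \<le> card I \<longrightarrow>
   measure (PiM I (\<lambda>_. mu)) {om \<in> space (PiM I (\<lambda>_. mu)). real (card I) * ((\<integral>x. h x \<partial>mu) + eps) \<le> (\<Sum>i\<in>I. h (om i))} \<le> \<delta>'" by blast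
 qed
 from bchoice[OF this] obtain N where N: "\<And>g I. g \<in> K \<Longrightarrow> finite (I :: 'i set) \<Longrightarrow> N g \<le> card I \<Longrightarrow>
  measure (PiM I (\<lambda>_. mu)) {om \<in> space (PiM I (\<lambda>_. mu)). real (card I) * ((\<integral>x. g x \<partial>mu) + eps) \<le> (\<Sum>i\<in>I. g (om i))} \<le> \<delta>'"
  by blast
 show ?thesis
 proof (intro exI allI impI)
  fix I :: "'i set" assume I: "finite I" "(\<Sum>g\<in>K. N g) \<le> card I"
  interpret P: product_prob_space "\<lambda>_::'i. mu" I ..
  let ?M = "PiM I (\<lambda>_. mu)"
  let ?bad = "\<lambda>g. {om \<in> space ?M. real (card I) * ((\<integral>x. g x \<partial>mu) + eps) \<le> (\<Sum>i\<in>I. g (om i))}"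
  have meas: "(\<lambda>om. \<Sum>i\<in>I. g (om i)) \<in> borel_measurable ?M" if "g \<in> K" for g
   using measurable_component_singleton by (intro borel_measurable_sum measurable_compose[OF _ g[OF that]]) auto
  have bad: "?bad g \<in> sets ?M" if "g \<in> K" for g using meas[OF that] by measurable
  have NK: "N g \<le> card I" if "g \<in> K" for g
   using member_le_sum[OF that, of N] K I(2) by simp
  have "P.prob (\<Union>g\<in>K. ?bad g) \<le> (\<Sum>g\<in>K. P.prob (?bad g))"
   using bad K by (intro P.finite_measure_subadditive_finite) auto
  also have "... \<le> (\<Sum>g\<in>K. \<delta>')" using N[OF _ I(1) NK] by (intro sum_mono) auto
  also have "... \<le> \<delta>"
  proof -
   have "real (card K) * \<delta>' \<le> (real (card K) + 1) * \<delta>'" using \<delta>' by (intro mult_right_mono) auto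
   also have "... = \<delta>" by (simp add: \<delta>'_def add_nonneg_eq_0_iff)
   finally show ?thesis by simp
  qed
  finally have "1 - \<delta> \<le> 1 - P.prob (\<Union>g\<in>K. ?bad g)" by simp
  also have "... = P.prob (space ?M - (\<Union>g\<in>K. ?bad g))"
   using bad K by (intro P.prob_compl[symmetric] sets.finite_UN) auto
  also have "space ?M - (\<Union>g\<in>K. ?bad g) = {om \<in> space ?M. \<forall>g\<in>K. (\<Sum>i\<in>I. g (om i)) < real (card I) * ((\<integral>x. g x \<partial>mu) + eps)}"
   by (auto simp: not_le)
  finally show "1 - \<delta> \<le> P.prob {om \<in> space ?M. \<forall>g\<in>K. (\<Sum>i\<in>I. g (om i)) < real (card I) * ((\<integral>x. g x \<partial>mu) + eps)}" .
 qed
qed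

section \<open>The lower bound for the weighted event\<close>

lemma measurable_gibbs_event:
 fixes \<xi> :: "'j \<Rightarrow> (real^'d::finite) set \<Rightarrow> real"
 assumes "finite J" "\<And>j. j \<in> J \<Longrightarrow> \<xi> j \<in> borel_measurable conf_space" "0 < lam" "0 < n"
 shows "{om \<in> space conf_space. \<forall>j\<in>J. mean_score lam (\<xi> j) n om < a j} \<in> sets conf_space"
proof -
 have "mean_score lam (\<xi> j) n \<in> borel_measurable conf_space" if "j \<in> J" for j
  unfolding mean_score_def[abs_def]
  using measurable_score_sum[OF assms(2)[OF that] assms(3,4)] by measurable
 then show ?thesis using assms(1) by measurable
qed

context block_layout
begin

lemma one_each_near:
 assumes A: "r * real q / s + 1 / 2 \<le> real A" and F: "F \<subseteq> Ir \<times> grid q" and eta: "eta \<in> one_each small F" and x: "x \<in> eta"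
 shows "finite (translate x eta \<inter> cball 0 r)" and "card (translate x eta \<inter> cball 0 r) \<le> (2 * A + 1) ^ CARD('d)"
proof -
 have s: "small = (\<lambda>p. translate (- (center L k (fst p) + center s q (snd p))) (cube (s / (2 * real q))))"
  by (rule ext) (simp add: small_def)
 have "F \<subseteq> UNIV \<times> grid q" using F by auto
 note near = card_near_points[OF r s_pos q less_imp_le[OF L_pos] gap A eta[unfolded s] this x]
 have eq: "translate x eta \<inter> cball 0 r = (\<lambda>y. y - x) ` (eta \<inter> cball x r)"
  by (auto simp: translate_def dist_norm norm_minus_commute)
 show "finite (translate x eta \<inter> cball 0 r)" using near(1) unfolding eq by simp
 show "card (translate x eta \<inter> cball 0 r) \<le> (2 * A + 1) ^ CARD('d)"
  using near unfolding eq by (meson card_image_le order_trans)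
qed

text \<open>Reserve points are few, so the crude bound \<open>c\<close> for each of them is
  affordable.\<close>

lemma config_energy:
 assumes V: "local_fun r V" "\<And>om. om \<in> locally_finite_sets \<Longrightarrow> \<bar>V om\<bar> \<le> c" and \<zeta>: "\<And>w. w \<in> Ib \<Longrightarrow> \<zeta> w \<in> locally_finite_sets"
  and F: "finite F" "F \<subseteq> Ir \<times> grid q" and eta: "eta \<in> one_each small F"
 shows "energy lam V n (config \<zeta> eta) \<le> (\<Sum>w\<in>Ib. free_score V B (\<zeta> w)) + real (card F) * c"
proof -
 have ceta: "finite eta" "card eta = card F" using card_one_each[OF F(1) small_disjoint eta] F by auto
 have "V (translate x eta) \<le> c" for x
  using V(2)[OF finite_locally_finite, of "translate x eta"] ceta by (simp add: translate_def)
 then have "(\<Sum>x\<in>eta. V (translate x eta)) \<le> real (card F) * c"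
  using sum_bounded_above[of eta "\<lambda>x. V (translate x eta)" c] ceta(2) by simp
 moreover have "energy lam V n (config \<zeta> eta) = (\<Sum>w\<in>Ib. free_score V B (\<zeta> w)) + (\<Sum>x\<in>eta. V (translate x eta))"
  unfolding energy_def by (rule sum_config[OF V(1) _ F eta]) (rule \<zeta>)
 ultimately show ?thesis by simp
qed

text \<open>Scores have no uniform upper bound. By locality a reserve point sees at most
  \<open>(2 * A + 1) ^ CARD('d)\<close> points, so cardinality-boundedness supplies a constant, and
  this constant does not grow with the block size.\<close>

lemma config_mean_score:
 assumes h: "local_fun r h" "cardinality_bounded_fun M h" and \<zeta>: "\<And>w. w \<in> Ib \<Longrightarrow> \<zeta> w \<in> locally_finite_sets"
  and F: "finite F" "F \<subseteq> Ir \<times> grid q" and eta: "eta \<in> one_each small F"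
  and A: "r * real q / s + 1 / 2 \<le> real A"
 shows "mean_score lam h n (config \<zeta> eta) \<le>
  ((\<Sum>w\<in>Ib. free_score h B (\<zeta> w)) + real (card F) * M ((2 * A + 1) ^ CARD('d))) / real n"
proof -
 have ceta: "finite eta" "card eta = card F" using card_one_each[OF F(1) small_disjoint eta] F by auto
 have "h (translate x eta) \<le> M ((2 * A + 1) ^ CARD('d))" if x: "x \<in> eta" for x
 proof -
  have "translate x eta \<in> locally_finite_sets" using ceta by (intro finite_locally_finite) (simp add: translate_def)
  then have "h (translate x eta) = h (translate x eta \<inter> cball 0 r)" using h(1) by (simp add: local_fun_def)
  also have "... \<le> M ((2 * A + 1) ^ CARD('d))"
   using h(2) one_each_near[OF A F(2) eta x] finite_locally_finite by (auto simp: cardinality_bounded_fun_def)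
  finally show ?thesis .
 qed
 then have "(\<Sum>x\<in>eta. h (translate x eta)) \<le> real (card F) * M ((2 * A + 1) ^ CARD('d))"
  using sum_bounded_above[of eta "\<lambda>x. h (translate x eta)" "M ((2 * A + 1) ^ CARD('d))"] ceta(2) by simp
 moreover have "(\<Sum>x\<in>config \<zeta> eta \<inter> W. h (translate x (periodize lam n (config \<zeta> eta))))
  = (\<Sum>w\<in>Ib. free_score h B (\<zeta> w)) + (\<Sum>x\<in>eta. h (translate x eta))"
  by (rule sum_config[OF h(1) _ F eta]) (rule \<zeta>)
 ultimately show ?thesis unfolding mean_score_def by (simp add: divide_right_mono)
qed

end

text \<open>Order of choices: first the cell scale \<open>s0\<close>, so that the bound on reserve
  scores is a fixed constant; then the error proportion \<open>\<rho>\<close>; then the block index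
  \<open>m\<close>; finally \<open>n\<close> tends to infinity.\<close>

lemma (in score_model) gibbs_event_lower:
 assumes a: "\<And>j. j \<in> J \<Longrightarrow> x j < lam * a j"
  and \<delta>: "0 < \<delta>"
 shows "\<forall>\<^sub>F n in sequentially. ennreal (exp (- (real n / lam) * (i + v + \<delta>))) \<le>
  (\<integral>\<^sup>+om. indicator {om \<in> space conf_space. \<forall>j\<in>J. mean_score lam (\<xi> j) n om < a j} om * ennreal (exp (- energy lam V n om))
   \<partial>binomial_process lam n)"
proof -
 let ?d = "CARD('d)" and ?side = "\<lambda>n. side TYPE('d) lam n"
 have c: "0 < c" and Vb: "\<And>om. om \<in> locally_finite_sets \<Longrightarrow> \<bar>V om\<bar> \<le> c" using V(3) by (auto simp: bounded_fun_def)
 \<comment> \<open>Upper limit for the spacing of reserve cells, chosen so that a tile of mean point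
   number \<open>m\<close> has at least \<open>10 * m\<close> of them. The factor ten gives the
   reserve enough capacity.\<close>
 define s0 where "s0 = (1 / (10 * lam)) powr (1 / real ?d)"
 have s0: "0 < s0" "s0 ^ ?d = 1 / (10 * lam)"
  using lam by (simp_all add: s0_def powr_power)
 \<comment> \<open>The spacing will be at least \<open>s0 / 2\<close>, so cells of points within
   \<open>r\<close> differ in index by at most \<open>A\<close>. The value depends on neither
   \<open>m\<close> nor \<open>\<rho>\<close>.\<close>
 define A where "A = nat \<lceil>2 * r / s0 + 1 / 2\<rceil>"
 have A: "2 * r / s0 + 1 / 2 \<le> real A" unfolding A_def using r s0 by linarith
 define Mb where "Mb = \<bar>M ((2 * A + 1) ^ ?d)\<bar>"
 have Mb: "0 \<le> Mb" by (simp add: Mb_def)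
 \<comment> \<open>Logarithmic cost of one reserve point: \<open>lam * \<sigma>\<close> will be at
   least \<open>1 / (10 * 4 ^ ?d)\<close>.\<close>
 define C1 where "C1 = ln (10 * 4 ^ ?d :: real)"
 have C1: "0 \<le> C1" unfolding C1_def by (intro ln_ge_zero) (simp add: mult_ge1_I)
 \<comment> \<open>Collects the errors in the exponent per unit volume and unit of
   \<open>\<rho>\<close>: energy and its reserve points, cost of the reserve points, emptiness
   outside the filled tiles, and entropy of the blocks.\<close>
 define Ctot where "Ctot = 4 * \<bar>v\<bar> + lam + 5 * c * lam + 5 * lam * C1 + 4 * lam + lam + 1 + 2 * (\<bar>i\<bar> + lam + 1)"
 \<comment> \<open>The analogous total error for score \<open>j\<close>.\<close>
 define Y where "Y j = 4 * \<bar>x j\<bar> + lam + 5 * lam * Mb" for j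
 have "\<forall>\<^sub>F \<rho> in at_right (0::real). \<rho> * Ctot < \<delta>"
  by (rule order_tendstoD(2)[where y=0]) (auto intro!: tendsto_eq_intros simp: \<delta>)
 moreover have "\<forall>\<^sub>F \<rho> in at_right (0::real). \<forall>j\<in>J. \<rho> * Y j < lam * a j - x j"
 proof (rule eventually_ball_finite[OF J], rule ballI)
  fix j assume "j \<in> J"
  then show "\<forall>\<^sub>F \<rho> in at_right 0. \<rho> * Y j < lam * a j - x j"
   by (intro order_tendstoD(2)[where y=0]) (auto intro!: tendsto_eq_intros simp: a)
 qed
 moreover have "\<forall>\<^sub>F \<rho> in at_right (0::real). \<rho> < 1 / 8"
  by (rule order_tendstoD(2)[where y=0]) (auto intro!: tendsto_eq_intros)
 moreover have "\<forall>\<^sub>F \<rho> in at_right (0::real). 0 < \<rho>" by (rule eventually_at_right_less)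
 ultimately have "\<forall>\<^sub>F \<rho> in at_right (0::real). 0 < \<rho> \<and> \<rho> < 1 / 8 \<and> \<rho> * Ctot < \<delta> \<and> (\<forall>j\<in>J. \<rho> * Y j < lam * a j - x j)"
  by eventually_elim auto
 then obtain \<rho> where \<rho>: "0 < \<rho>" "\<rho> < 1 / 8" and \<rho>C: "\<rho> * Ctot < \<delta>" and \<rho>Y: "\<And>j. j \<in> J \<Longrightarrow> \<rho> * Y j < lam * a j - x j"
  using eventually_happens'[OF trivial_limit_at_right_real] by blast
 \<comment> \<open>Used twice, in the block law and in the law of large numbers. Together this moves
   the mean number of points per block by \<open>\<rho> * real m\<close>, see
   \<open>weps\<close>.\<close>
 define eps where "eps = \<rho> * lam / 2"
 have eps: "0 < eps" using \<rho> lam by (simp add: eps_def)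
 have sinf: "filterlim ?side at_top sequentially" by (rule filterlim_side[OF lam])
 have ev_s: "\<forall>\<^sub>F m in sequentially. s0 \<le> ?side m" using sinf by (simp add: filterlim_at_top)
 \<comment> \<open>The asymptotic proportion of volume covered by tiles once corridors of width
   about \<open>2 * r\<close> are cut out; large blocks make the corridors negligible.\<close>
 have ev_\<theta>: "\<forall>\<^sub>F m in sequentially. 1 - \<rho> < (1 / (1 + 2 * r / ?side m)) ^ ?d"
 proof (rule order_tendstoD(1))
  have "(\<lambda>m. 2 * r / ?side m) \<longlonglongrightarrow> 0"
   by (rule tendsto_divide_0[OF tendsto_const filterlim_at_top_imp_at_infinity[OF sinf]])
  then show "(\<lambda>m. (1 / (1 + 2 * r / ?side m)) ^ ?d) \<longlonglongrightarrow> (1 / (1 + 0)) ^ ?d"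
   by (intro tendsto_intros) auto
 qed (use \<rho> in simp)
 from eventually_happens[OF eventually_conj[OF block_law[OF eps] eventually_conj[OF ev_s ev_\<theta>]]]
 obtain m mu b where m: "0 < m" and mu: "prob_space mu" and sets_mu: "sets mu = sets conf_space"
  and eb: "entropy_bound (real m / lam * (i + eps)) mu (poisson_process lam m)"
  and few: "AE om in mu. om \<in> few_points (window lam m) b"
  and cntE: "\<bar>(\<integral>om. indicator (few_points (window lam m) b) om * free_score (\<lambda>_. 1) (window lam m) om \<partial>mu) - real m\<bar> \<le> real m / lam * eps"
  and VE: "(\<integral>om. indicator (few_points (window lam m) b) om * free_score V (window lam m) om \<partial>mu) \<le> real m / lam * (v + eps)"
  and \<xi>E: "\<And>j. j \<in> J \<Longrightarrow> (\<integral>om. indicator (few_points (window lam m) b) om * free_score (\<xi> j) (window lam m) om \<partial>mu) \<le> real m / lam * (x j + eps)"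
  and s_ge: "s0 \<le> ?side m" and \<theta>m: "1 - \<rho> < (1 / (1 + 2 * r / ?side m)) ^ ?d"
  by (auto simp: trivial_limit_sequentially)
 define s where "s = ?side m"
 have s: "0 < s" unfolding s_def using lam m by (rule side_pos)
 define w where "w = real m / lam"
 have w: "0 < w" using lam m by (simp add: w_def)
 have sd: "s ^ ?d = w" unfolding s_def w_def by (rule side_power[OF lam])
 have weps: "w * eps = \<rho> * real m / 2" using lam by (simp add: w_def eps_def)
 \<comment> \<open>Rounding up makes the spacing \<open>s / q\<close> at most \<open>s0\<close>; as
   \<open>s \<ge> s0\<close>, it stays at least \<open>s0 / 2\<close>.\<close>
 define q where "q = nat \<lceil>s / s0\<rceil>"
 have ss0: "1 \<le> s / s0" using s_ge s0 by (simp add: s_def)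
 have q: "0 < q" "s / s0 \<le> real q" "real q \<le> 2 * (s / s0)" unfolding q_def using ss0 by linarith+
 have qd: "10 * real m \<le> real q ^ ?d"
 proof -
  have "(s / s0) ^ ?d \<le> real q ^ ?d" using q ss0 by (intro power_mono) auto
  moreover have "(s / s0) ^ ?d = 10 * real m" using lam by (simp add: power_divide sd s0 w_def)
  ultimately show ?thesis by simp
 qed
 define \<sigma> where "\<sigma> = (s / (2 * real q)) ^ ?d"
 have \<sigma>: "lam * \<sigma> \<le> 1" "1 / (10 * 4 ^ ?d) \<le> lam * \<sigma>"
 proof -
  have "s / (2 * real q) \<le> s0 / 2" using q s0 by (simp add: field_simps)
  then have "s / (2 * real q) \<le> s0" using s0 by linarith
  then have "\<sigma> \<le> s0 ^ ?d" unfolding \<sigma>_def using s by (intro power_mono) auto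
  then have "lam * \<sigma> \<le> lam * (1 / (10 * lam))" unfolding s0(2) using lam by (intro mult_left_mono) auto
  then show "lam * \<sigma> \<le> 1" using lam by simp
  have "s0 / 4 \<le> s / (2 * real q)" using q s0 by (simp add: field_simps)
  then have "(s0 / 4) ^ ?d \<le> \<sigma>" unfolding \<sigma>_def using s0 by (intro power_mono) auto
  then have "lam * ((s0 / 4) ^ ?d) \<le> lam * \<sigma>" using lam by (intro mult_left_mono) auto
  moreover have "lam * ((s0 / 4) ^ ?d) = 1 / (10 * 4 ^ ?d)" using lam by (simp add: power_divide s0)
  ultimately show "1 / (10 * 4 ^ ?d) \<le> lam * \<sigma>" by simp
 qed
 have Aq: "r * real q / s + 1 / 2 \<le> real A"
 proof -
  have "r * real q / s \<le> r * (2 * (s / s0)) / s" using q r s by (intro divide_right_mono mult_left_mono) auto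
  also have "... = 2 * r / s0" using s by simp
  finally show ?thesis using A by linarith
 qed
 let ?B = "window lam m :: (real^'d) set" and ?Poi = "poisson_process lam m :: (real^'d) set measure"
 let ?few = "few_points ?B b"
 interpret mu: prob_space mu by fact
 interpret Poi: prob_space ?Poi using lam m by (rule prob_space_poisson)
 have sets_Poi: "sets ?Poi = sets conf_space" using lam m by (rule sets_poisson)
 have space_mu: "space mu = locally_finite_sets" using sets_eq_imp_space_eq[OF sets_mu] by simp
 have few_m: "?few \<in> sets conf_space" by (rule few_measurable[OF lam m mass])
 have wi: "0 \<le> i + eps"
 proof -
  have "0 \<le> real m / lam * (i + eps)" using eb Poi.prob_space_axioms by (rule entropy_bound_nonneg[rotated])
  then show ?thesis using w by (simp add: w_def[symmetric] zero_le_mult_iff)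
 qed
 \<comment> \<open>Truncation to \<open>?few\<close> makes the function bounded on the whole space,
   as the law of large numbers demands; on the event \<open>G\<close> it agrees with the free
   score.\<close>
 define f where "f h = (\<lambda>om. indicator ?few om * free_score h ?B om)" for h :: "(real^'d) set \<Rightarrow> real"
 have f_meas: "f h \<in> borel_measurable mu" if h: "h \<in> borel_measurable conf_space" for h
 proof -
  have "free_score h ?B \<in> borel_measurable conf_space" using h by (intro measurable_free_score) auto
  then have "f h \<in> borel_measurable conf_space" unfolding f_def using few_m by measurable
  then show ?thesis by (simp add: measurable_cong_sets[OF sets_mu refl])
 qed
 have f_bd: "\<exists>K. \<forall>om\<in>space mu. \<bar>f h om\<bar> \<le> K"
  if lb: "\<And>om. om \<in> locally_finite_sets \<Longrightarrow> c0 \<le> h om" and ub: "\<And>om. finite om \<Longrightarrow> card om \<le> b \<Longrightarrow> h om \<le> K0" for h c0 K0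
 proof (intro exI ballI)
  fix om
  show "\<bar>f h om\<bar> \<le> real b * (\<bar>c0\<bar> + \<bar>K0\<bar>)"
   unfolding f_def using few_free_score_bound[OF lam m mass lb ub] by (auto split: split_indicator)
 qed
 \<comment> \<open>The point count appears with both signs, since it has to be controlled from above
   and from below; energy and scores only from above.\<close>
 define K where "K = {f (\<lambda>_. 1), (\<lambda>om. - f (\<lambda>_. 1) om), f V} \<union> (\<lambda>j. f (\<xi> j)) ` J"
 have "\<exists>N0. \<forall>I :: ('d \<Rightarrow> nat) set. finite I \<longrightarrow> N0 \<le> card I \<longrightarrow> 1 - \<rho> \<le>
  measure (PiM I (\<lambda>_. mu)) {om \<in> space (PiM I (\<lambda>_. mu)). \<forall>g\<in>K. (\<Sum>i\<in>I. g (om i)) < real (card I) * ((\<integral>x. g x \<partial>mu) + w * eps)}"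
 proof (rule PiM_lln_family[OF mu])
  show "finite K" using J by (simp add: K_def)
  show "g \<in> borel_measurable mu" if "g \<in> K" for g
   using that f_meas[OF V(1)] f_meas[OF \<xi>(1)] f_meas[of "\<lambda>_. 1"] by (auto simp: K_def)
  show "\<exists>b. \<forall>x\<in>space mu. \<bar>g x\<bar> \<le> b" if "g \<in> K" for g
  proof -
   have 1: "\<exists>b. \<forall>x\<in>space mu. \<bar>f (\<lambda>_. 1) x\<bar> \<le> b" by (rule f_bd[of 1 _ 1]) auto
   have 2: "\<exists>b. \<forall>x\<in>space mu. \<bar>f V x\<bar> \<le> b"
   proof (rule f_bd[of "- c" _ c])
    show "- c \<le> V om" if "om \<in> locally_finite_sets" for om using Vb[OF that] by simp
    show "V om \<le> c" if "finite om" for om using Vb[OF finite_locally_finite[OF that]] by simp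
   qed
   have 3: "\<exists>b. \<forall>x\<in>space mu. \<bar>f (\<xi> j) x\<bar> \<le> b" if j: "j \<in> J" for j
   proof (rule f_bd[of c' _ "M b"])
    show "c' \<le> \<xi> j om" if "om \<in> locally_finite_sets" for om using \<xi>(2)[OF j] that by (auto simp: bounded_below_fun_def)
    show "\<xi> j om \<le> M b" if "finite om" "card om \<le> b" for om
     using \<xi>(5)[OF j] that finite_locally_finite[OF that(1)] by (auto simp: cardinality_bounded_fun_def)
   qed
   have 4: "\<exists>b. \<forall>x\<in>space mu. \<bar>- f (\<lambda>_. 1) x\<bar> \<le> b" using 1 by simp
   from that show ?thesis unfolding K_def using 1 2 3 4 by blast
  qed
 qed (use w eps \<rho> in auto)
 then obtain N0 where N0: "\<And>I :: ('d \<Rightarrow> nat) set. finite I \<Longrightarrow> N0 \<le> card I \<Longrightarrow> 1 - \<rho> \<le>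
  measure (PiM I (\<lambda>_. mu)) {om \<in> space (PiM I (\<lambda>_. mu)). \<forall>g\<in>K. (\<Sum>i\<in>I. g (om i)) < real (card I) * ((\<integral>x. g x \<partial>mu) + w * eps)}"
  by blast
 \<comment> \<open>The largest number of tiles per direction whose grid spacing strictly exceeds
   \<open>s + 2 * r\<close>.\<close>
 define k where "k n = nat \<lceil>?side n / (s + 2 * r)\<rceil> - 1" for n
 have lim1: "filterlim (\<lambda>n. ?side n / (s + 2 * r)) at_top sequentially"
  using sinf s r by (simp add: divide_inverse filterlim_at_top_mult_tendsto_pos[OF tendsto_const] mult.commute)
 \<comment> \<open>The term \<open>1 / \<rho>\<close> makes rounding of the reserve harmless,
   \<open>real N0 * 4\<close> secures enough blocks for the law of large numbers, and
   \<open>2\<close> leaves room for at least one spacing in the window.\<close>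
 have ev1: "\<forall>\<^sub>F n in sequentially. max 2 (real N0 * 4 + 1 / \<rho> + 1) + 1 < ?side n / (s + 2 * r)"
  using lim1 unfolding filterlim_at_top_dense by blast
 have ev2: "\<forall>\<^sub>F n in sequentially. 1 - 2 * \<rho> < (s / (s + 2 * r) - s / ?side n) ^ ?d"
 proof (rule order_tendstoD(1))
  have "(\<lambda>n. s / ?side n) \<longlonglongrightarrow> 0"
   by (rule tendsto_divide_0[OF tendsto_const filterlim_at_top_imp_at_infinity[OF sinf]])
  then show "(\<lambda>n. (s / (s + 2 * r) - s / ?side n) ^ ?d) \<longlonglongrightarrow> (s / (s + 2 * r) - 0) ^ ?d"
   by (intro tendsto_intros)
  have "1 / (1 + 2 * r / s) = s / (s + 2 * r)" using s r by (simp add: field_simps)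
  then show "1 - 2 * \<rho> < (s / (s + 2 * r) - 0) ^ ?d" using \<theta>m \<rho> by (simp add: s_def[symmetric])
 qed
 have "filterlim (\<lambda>n. real n / lam * \<rho>) at_top sequentially" using lam \<rho> by real_asymp
 then have ev3: "\<forall>\<^sub>F n in sequentially. ln 2 \<le> real n / lam * \<rho>" by (simp add: filterlim_at_top)
 show ?thesis
  using ev1 ev2 ev3 eventually_gt_at_top[of "0::nat"]
 proof eventually_elim
  case (elim n)
  then have n: "0 < n" by simp
  define L where "L = ?side n"
  have L: "0 < L" unfolding L_def using lam n by (rule side_pos)
  have Ld: "L ^ ?d = real n / lam" unfolding L_def by (rule side_power[OF lam])
  let ?k = "k n"
  have kr: "real ?k < L / (s + 2 * r)" "L / (s + 2 * r) - 1 \<le> real ?k" and kbig: "real N0 * 4 + 1 / \<rho> + 1 \<le> real ?k" "2 \<le> real ?k"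
   using elim(1) unfolding k_def L_def by linarith+
  have k: "0 < ?k" using kbig by simp
  have gap: "s + 2 * r < L / real ?k" using kr(1) k s r by (simp add: field_simps)
  \<comment> \<open>Proportion of the window volume covered by all tiles, written through point
    numbers.\<close>
  define \<theta> where "\<theta> = real ?k ^ ?d * real m / real n"
  have \<theta>1: "\<theta> \<le> 1"
  proof -
   have "real ?k * s \<le> L" using gap k r s by (simp add: field_simps) (smt (verit) mult_nonneg_nonneg of_nat_0_le_iff)
   then have "(real ?k * s) ^ ?d \<le> L ^ ?d" using s by (intro power_mono) auto
   then have "real ?k ^ ?d * w \<le> real n / lam" by (simp add: power_mult_distrib sd Ld)
   then have "real ?k ^ ?d * real m \<le> real n" using lam by (simp add: w_def field_simps)
   then show ?thesis using n by (simp add: \<theta>_def)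
  qed
  have \<theta>2: "1 - 2 * \<rho> \<le> \<theta>"
  proof -
   have "s / (s + 2 * r) - s / L \<le> real ?k * s / L"
   proof -
    have "(L / (s + 2 * r) - 1) * (s / L) \<le> real ?k * (s / L)" using kr(2) s L by (intro mult_right_mono) auto
    moreover have "(L / (s + 2 * r) - 1) * (s / L) = s / (s + 2 * r) - s / L" using L s r by (simp add: field_simps)
    ultimately show ?thesis by simp
   qed
   moreover have "0 \<le> s / (s + 2 * r) - s / L"
   proof -
    have "s + 2 * r \<le> L"
    proof -
     have "2 < L / (s + 2 * r)" using kr(1) kbig(2) by linarith
     then have "2 * (s + 2 * r) < L" using s r by (simp add: pos_less_divide_eq)
     moreover have "0 < s + 2 * r" using s r by simp
     ultimately show ?thesis by argo
    qed
    then show ?thesis using s r L by (simp add: frac_le)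
   qed
   ultimately have "(s / (s + 2 * r) - s / L) ^ ?d \<le> (real ?k * s / L) ^ ?d" by (intro power_mono)
   also have "... = real ?k ^ ?d * w / (real n / lam)" by (simp add: power_mult_distrib power_divide sd Ld)
   also have "... = \<theta>" using lam n by (simp add: \<theta>_def w_def)
   finally show ?thesis using elim(2) by (simp add: L_def)
  qed
  \<comment> \<open>Size of the reserve, between \<open>\<rho>\<close> and \<open>2 * \<rho>\<close>
    of all tiles.\<close>
  define R where "R = nat \<lceil>\<rho> * real (?k ^ ?d)\<rceil>"
  have kd: "1 / \<rho> + real N0 * 4 \<le> real (?k ^ ?d)"
  proof -
   have "real ?k ^ 1 \<le> real ?k ^ ?d" using kbig by (intro power_increasing) (auto simp: Suc_le_eq)
   then show ?thesis unfolding of_nat_power power_one_right using kbig(1) by linarith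
  qed
  have \<rho>k: "1 \<le> \<rho> * real (?k ^ ?d)"
  proof -
   have "1 / \<rho> \<le> real (?k ^ ?d)" using kd by linarith
   then show ?thesis using \<rho> by (simp add: field_simps)
  qed
  have R: "\<rho> * real (?k ^ ?d) \<le> real R" "real R \<le> 2 * \<rho> * real (?k ^ ?d)"
   unfolding R_def using \<rho>k by linarith+
  have "2 * \<rho> * real (?k ^ ?d) \<le> 1 * real (?k ^ ?d)" using \<rho> by (intro mult_right_mono) auto
  then have RK: "R \<le> ?k ^ ?d" using R by linarith
  then obtain Ir where Ir: "Ir \<subseteq> (grid ?k :: ('d \<Rightarrow> nat) set)" "card Ir = R"
   using obtain_subset_with_card_n[of R "grid ?k :: ('d \<Rightarrow> nat) set"] by (auto simp: card_grid)
  define Ib where "Ib = grid ?k - Ir"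
  have finIr: "finite Ir" using Ir finite_grid finite_subset by blast
  have cIb: "card Ib = ?k ^ ?d - R" unfolding Ib_def using Ir finIr by (simp add: card_Diff_subset card_grid)
  define NB where "NB = real (card Ib)"
  have NB: "NB = real (?k ^ ?d) - real R" using cIb RK by (simp add: NB_def of_nat_diff)
  \<comment> \<open>Proportion of the window volume in the filled tiles. The upper bound
    \<open>1 - \<rho>\<close> keeps the blocks from exceeding \<open>n\<close> points, the lower
    bound \<open>1 - 4 * \<rho>\<close> keeps the number of missing points small.\<close>
  define \<beta> where "\<beta> = NB * real m / real n"
  have \<beta>n: "NB * real m = \<beta> * real n" using n by (simp add: \<beta>_def)
  have \<beta>: "\<beta> \<le> 1 - \<rho>" "1 - 4 * \<rho> \<le> \<beta>"
  proof -
   have \<theta>k: "real (?k ^ ?d) * real m = \<theta> * real n" using n by (simp add: \<theta>_def)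
   have \<theta>0: "0 \<le> \<theta>" using \<theta>2 \<rho> by linarith
   have "NB \<le> (1 - \<rho>) * real (?k ^ ?d)" using R NB by (simp add: algebra_simps)
   then have "NB * real m \<le> (1 - \<rho>) * real (?k ^ ?d) * real m" by (intro mult_right_mono) auto
   then have "\<beta> * real n \<le> (1 - \<rho>) * \<theta> * real n" unfolding \<beta>n using \<theta>k by (simp add: mult.assoc)
   then have "\<beta> \<le> (1 - \<rho>) * \<theta>" using n by simp
   also have "... \<le> (1 - \<rho>) * 1" using \<theta>1 \<rho> by (intro mult_left_mono) auto
   finally show "\<beta> \<le> 1 - \<rho>" by simp
   have "(1 - 2 * \<rho>) * real (?k ^ ?d) \<le> NB" using R NB by (simp add: algebra_simps)
   then have "(1 - 2 * \<rho>) * real (?k ^ ?d) * real m \<le> NB * real m" by (intro mult_right_mono) auto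
   then have "(1 - 2 * \<rho>) * \<theta> * real n \<le> \<beta> * real n" unfolding \<beta>n using \<theta>k by (simp add: mult.assoc)
   then have "(1 - 2 * \<rho>) * \<theta> \<le> \<beta>" using n by simp
   moreover have "(1 - 2 * \<rho>) * (1 - 2 * \<rho>) \<le> (1 - 2 * \<rho>) * \<theta>" using \<theta>2 \<rho> by (intro mult_left_mono) auto
   moreover have "(1 - 2 * \<rho>) * (1 - 2 * \<rho>) = 1 - 4 * \<rho> + 4 * (\<rho> * \<rho>)" by (simp add: algebra_simps)
   ultimately show "1 - 4 * \<rho> \<le> \<beta>" using \<rho> by (smt (verit) mult_pos_pos)
  qed
  have \<beta>0: "0 \<le> \<beta>" using \<beta> \<rho> by linarith
  have NBw: "NB * w = \<beta> * (real n / lam)" using \<beta>n by (simp add: w_def)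
  have NBN0: "N0 \<le> card Ib"
  proof -
   have "real R \<le> real (?k ^ ?d) / 2" using R(2) \<rho> mult_right_mono[of "2 * \<rho>" "1 / 2" "real (?k ^ ?d)"] by simp
   then have "real (?k ^ ?d) / 2 \<le> NB" using NB by simp
   moreover have "real N0 * 4 \<le> real (?k ^ ?d)" using kd \<rho> by (smt (verit) divide_pos_pos)
   ultimately have "real N0 \<le> NB" by linarith
   then show ?thesis by (simp add: NB_def)
  qed
  interpret BL: block_layout lam r L s n m ?k q Ib Ir
   using lam r n m k q(1) gap Ir by unfold_locales (auto simp: L_def s_def Ib_def)
  let ?M = "PiM Ib (\<lambda>_. mu)" and ?N = "PiM Ib (\<lambda>_. ?Poi)"
  interpret PM: product_prob_space "\<lambda>_::'d \<Rightarrow> nat. mu" Ib ..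
  interpret PN: product_prob_space "\<lambda>_::'d \<Rightarrow> nat. ?Poi" Ib ..
  have sMN: "sets ?M = sets ?N" by (intro sets_PiM_cong) (auto simp: sets_mu sets_Poi)
  define G1 where "G1 = {\<zeta> \<in> space ?M. \<forall>g\<in>K. (\<Sum>w\<in>Ib. g (\<zeta> w)) < real (card Ib) * ((\<integral>x. g x \<partial>mu) + w * eps)}"
  \<comment> \<open>The condition on \<open>?few\<close> holds almost surely under the block law,
    but must be imposed explicitly: \<open>G\<close> will be measured under the Poisson
    blocks.\<close>
  define G where "G = {\<zeta> \<in> space ?M. (\<forall>w\<in>Ib. \<zeta> w \<in> ?few) \<and> (\<forall>g\<in>K. (\<Sum>w\<in>Ib. g (\<zeta> w)) < real (card Ib) * ((\<integral>x. g x \<partial>mu) + w * eps))}"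
  have fewmu: "?few \<in> sets mu" using few_m sets_mu by simp
  have Kf: "finite K" using J by (simp add: K_def)
  have Km: "g \<in> borel_measurable mu" if "g \<in> K" for g
   using that f_meas[OF V(1)] f_meas[OF \<xi>(1)] f_meas[of "\<lambda>_. 1"] by (auto simp: K_def)
  have sums: "(\<lambda>\<zeta>. \<Sum>w\<in>Ib. g (\<zeta> w)) \<in> borel_measurable ?M" if "g \<in> K" for g
   using measurable_component_singleton by (intro borel_measurable_sum measurable_compose[OF _ Km[OF that]]) auto
  have G1s: "G1 \<in> sets ?M" unfolding G1_def using sums Kf by measurable
  have Gs: "G \<in> sets ?M"
  proof -
   have "{\<zeta> \<in> space ?M. \<forall>w\<in>Ib. \<zeta> w \<in> ?few} \<in> sets ?M"
   proof (intro sets.sets_Collect_finite_All BL.finite_Ib)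
    fix w assume "w \<in> Ib"
    then have "(\<lambda>\<zeta>. \<zeta> w) \<in> measurable ?M mu" by (rule measurable_component_singleton)
    from measurable_sets[OF this fewmu] show "{\<zeta> \<in> space ?M. \<zeta> w \<in> ?few} \<in> sets ?M"
     by (simp add: vimage_def Int_def conj_commute)
   qed
   moreover have "G = {\<zeta> \<in> space ?M. \<forall>w\<in>Ib. \<zeta> w \<in> ?few} \<inter> G1" by (auto simp: G_def G1_def)
   ultimately show ?thesis using G1s by auto
  qed
  have QG: "1 - \<rho> \<le> PM.prob G"
  proof -
   have "AE \<zeta> in ?M. \<forall>w\<in>Ib. \<zeta> w \<in> ?few"
    using few by (intro AE_finite_allI BL.finite_Ib PM.AE_component)
   then have "AE \<zeta> in ?M. \<zeta> \<in> G1 \<longleftrightarrow> \<zeta> \<in> G" by eventually_elim (auto simp: G_def G1_def)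
   then have "PM.prob G1 = PM.prob G" using G1s Gs by (intro PM.finite_measure_eq_AE)
   then show ?thesis using N0[OF BL.finite_Ib NBN0] by (simp add: G1_def)
  qed
  have ebN: "entropy_bound (NB * (w * (i + eps))) ?M ?N"
   using entropy_bound_PiM[OF BL.finite_Ib, of "\<lambda>_. mu" "\<lambda>_. ?Poi" "\<lambda>_. w * (i + eps)"] mu Poi.prob_space_axioms eb
   by (simp add: sets_mu sets_Poi w_def NB_def)
  have nuG: "exp (- (NB * (w * (i + eps)) + ln 2) / PM.prob G) \<le> measure ?N G"
   using QG \<rho> Gs sMN by (intro entropy_bound_event ebN PM.prob_space_axioms PN.prob_space_axioms sMN) auto
  define C where "C \<zeta> = (\<Sum>w\<in>Ib. card (\<zeta> w \<inter> ?B))" for \<zeta> :: "('d \<Rightarrow> nat) \<Rightarrow> (real^'d) set"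
  define K' where "K' = nat \<lfloor>5 * \<rho> * real n\<rfloor>"
  have lf: "\<zeta> w \<in> locally_finite_sets" if "\<zeta> \<in> G" "w \<in> Ib" for \<zeta> w
   using that by (auto simp: G_def few_points_def)
  have sumK: "(\<Sum>w\<in>Ib. free_score h ?B (\<zeta> w)) < NB * ((\<integral>om. f h om \<partial>mu) + w * eps)" if "\<zeta> \<in> G" "f h \<in> K" for \<zeta> h
  proof -
   have "(\<Sum>w\<in>Ib. free_score h ?B (\<zeta> w)) = (\<Sum>w\<in>Ib. f h (\<zeta> w))"
    using that(1) by (intro sum.cong) (auto simp: f_def G_def)
   also have "... < NB * ((\<integral>om. f h om \<partial>mu) + w * eps)" unfolding NB_def using that by (auto simp: G_def)
   finally show ?thesis .
  qed
  have NB0: "0 \<le> NB" by (simp add: NB_def)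
  \<comment> \<open>On \<open>G\<close> the count lies between
    \<open>\<beta> * (1 - \<rho>) * n\<close> and \<open>\<beta> * (1 + \<rho>) * n\<close>; the
    latter is at most \<open>(1 - \<rho>) * (1 + \<rho>) * n\<close>, hence below
    \<open>n\<close>.\<close>
  have cnt: "C \<zeta> \<le> n" "real (n - C \<zeta>) \<le> 5 * \<rho> * real n" if \<zeta>: "\<zeta> \<in> G" for \<zeta>
  proof -
   have Cr: "real (C \<zeta>) = (\<Sum>w\<in>Ib. free_score (\<lambda>_. 1) ?B (\<zeta> w))" by (simp add: C_def free_score_one)
   have int1: "(\<integral>om. f (\<lambda>_. 1) om \<partial>mu) \<le> real m + w * eps" "real m - w * eps \<le> (\<integral>om. f (\<lambda>_. 1) om \<partial>mu)"
    using cntE by (simp_all add: f_def w_def abs_le_iff)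
   have "real (C \<zeta>) < NB * ((\<integral>om. f (\<lambda>_. 1) om \<partial>mu) + w * eps)" unfolding Cr by (rule sumK[OF \<zeta>]) (simp add: K_def)
   also have "... \<le> NB * (real m * (1 + \<rho>))" using int1 weps NB0 by (intro mult_left_mono) (auto simp: algebra_simps)
   also have "... = \<beta> * (1 + \<rho>) * real n" using \<beta>n by (simp add: mult.assoc[symmetric])
   also have "... \<le> 1 * real n"
   proof (intro mult_right_mono)
    have "\<beta> * (1 + \<rho>) \<le> (1 - \<rho>) * (1 + \<rho>)" using \<beta> \<rho> by (intro mult_right_mono) auto
    also have "... \<le> 1" by (simp add: algebra_simps)
    finally show "\<beta> * (1 + \<rho>) \<le> 1" .
   qed simp
   finally show Cn: "C \<zeta> \<le> n" by simp
   have "(\<Sum>w\<in>Ib. - f (\<lambda>_. 1) (\<zeta> w)) < NB * ((\<integral>om. - f (\<lambda>_. 1) om \<partial>mu) + w * eps)"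
    unfolding NB_def using \<zeta> by (auto simp: G_def K_def)
   moreover have "(\<Sum>w\<in>Ib. - f (\<lambda>_. 1) (\<zeta> w)) = - real (C \<zeta>)"
    unfolding Cr sum_negf using \<zeta> by (intro arg_cong[where f=uminus] sum.cong) (auto simp: f_def G_def)
   ultimately have "NB * ((\<integral>om. f (\<lambda>_. 1) om \<partial>mu) - w * eps) < real (C \<zeta>)" by (simp add: algebra_simps)
   moreover have "NB * (real m * (1 - \<rho>)) \<le> NB * ((\<integral>om. f (\<lambda>_. 1) om \<partial>mu) - w * eps)"
    using int1 weps NB0 by (intro mult_left_mono) (auto simp: algebra_simps)
   moreover have "NB * (real m * (1 - \<rho>)) = \<beta> * (1 - \<rho>) * real n" using \<beta>n by (simp add: mult.assoc[symmetric])
   moreover have "(1 - 5 * \<rho>) * real n \<le> \<beta> * (1 - \<rho>) * real n"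
   proof (intro mult_right_mono)
    have "(1 - 4 * \<rho>) * (1 - \<rho>) \<le> \<beta> * (1 - \<rho>)" using \<beta> \<rho> by (intro mult_right_mono) auto
    moreover have "(1 - 4 * \<rho>) * (1 - \<rho>) = 1 - 5 * \<rho> + 4 * (\<rho> * \<rho>)" by (simp add: algebra_simps)
    moreover have "0 \<le> \<rho> * \<rho>" by simp
    ultimately show "1 - 5 * \<rho> \<le> \<beta> * (1 - \<rho>)" by linarith
   qed simp
   ultimately have "(1 - 5 * \<rho>) * real n \<le> real (C \<zeta>)" by linarith
   then show "real (n - C \<zeta>) \<le> 5 * \<rho> * real n" using Cn by (simp add: of_nat_diff algebra_simps)
  qed
  \<comment> \<open>At least a proportion \<open>\<rho>\<close> of the tiles with
    \<open>10 * m\<close> cells each offers \<open>10 * \<rho> * \<theta> * n\<close> places, and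
    \<open>\<theta>\<close> is at least one half.\<close>
  have cap: "5 * \<rho> * real n \<le> real (card (Ir \<times> (grid q :: ('d \<Rightarrow> nat) set)))"
  proof -
   have "5 * \<rho> * real n \<le> 10 * \<rho> * (\<theta> * real n)"
   proof -
    have "1 / 2 \<le> \<theta>" using \<theta>2 \<rho> by linarith
    then have "1 / 2 * (10 * \<rho> * real n) \<le> \<theta> * (10 * \<rho> * real n)" using \<rho> by (intro mult_right_mono) auto
    then show ?thesis by (simp add: mult_ac)
   qed
   also have "... = \<rho> * real (?k ^ ?d) * (10 * real m)" using n by (simp add: \<theta>_def)
   also have "... \<le> real R * real q ^ ?d" using R qd \<rho> by (intro mult_mono) auto
   also have "... = real (card (Ir \<times> (grid q :: ('d \<Rightarrow> nat) set)))" using Ir by (simp add: card_cartesian_product card_grid)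
   finally show ?thesis .
  qed
  \<comment> \<open>Lower bound for the Boltzmann factor on the constructed configurations:
    \<open>v\<close> from the blocks with their errors, and \<open>c\<close> for each of at most
    \<open>5 * \<rho> * n\<close> reserve points.\<close>
  define \<phi> where "\<phi> = exp (- (real n / lam) * (v + 4 * \<rho> * \<bar>v\<bar> + \<rho> * lam + 5 * c * \<rho> * lam))"
  have \<beta>y: "\<beta> * y \<le> y + 4 * \<rho> * \<bar>y\<bar>" for y
  proof -
   have "(\<beta> - 1) * y \<le> \<bar>\<beta> - 1\<bar> * \<bar>y\<bar>" unfolding abs_mult[symmetric] by (rule abs_ge_self)
   also have "... \<le> 4 * \<rho> * \<bar>y\<bar>" using \<beta> \<rho> by (intro mult_right_mono) auto
   finally show ?thesis by (simp add: algebra_simps)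
  qed
  have block: "(\<Sum>w\<in>Ib. free_score h ?B (\<zeta> w)) \<le> real n / lam * (y + 4 * \<rho> * \<bar>y\<bar> + \<rho> * lam)"
   if \<zeta>: "\<zeta> \<in> G" and "f h \<in> K" and hy: "(\<integral>om. f h om \<partial>mu) \<le> w * (y + eps)" for \<zeta> h y
  proof -
   have "(\<Sum>w\<in>Ib. free_score h ?B (\<zeta> w)) \<le> NB * ((\<integral>om. f h om \<partial>mu) + w * eps)" using sumK[OF that(1,2)] by simp
   also have "... \<le> NB * (w * (y + eps) + w * eps)" using hy NB0 by (intro mult_left_mono) auto
   also have "... = NB * w * (y + 2 * eps)" by (simp add: algebra_simps)
   also have "... = real n / lam * (\<beta> * y + \<beta> * (\<rho> * lam))" unfolding NBw using lam by (simp add: eps_def field_simps)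
   also have "... \<le> real n / lam * (y + 4 * \<rho> * \<bar>y\<bar> + \<rho> * lam)"
   proof (intro mult_left_mono add_mono \<beta>y)
    have "\<beta> * (\<rho> * lam) \<le> 1 * (\<rho> * lam)" using \<beta> \<rho> lam by (intro mult_right_mono) auto
    then show "\<beta> * (\<rho> * lam) \<le> \<rho> * lam" by simp
   qed (use lam in auto)
   finally show ?thesis .
  qed
  let ?E = "{om \<in> space conf_space. \<forall>j\<in>J. mean_score lam (\<xi> j) n om < a j}"
  let ?En = "{om \<in> space (conf_space :: (real^'d) set measure). num_points om UNIV = of_nat n}"
  \<comment> \<open>The indicator of exactly \<open>n\<close> points is what allows the passage from
    the Poisson to the binomial process.\<close>
  define \<Phi> where "\<Phi> om = indicator ?En om * (indicator ?E om * ennreal (exp (- energy lam V n om)))" for om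
  interpret GB: gibbs lam c n V using lam n V(1) Vb by unfold_locales auto
  have E_m: "?E \<in> sets conf_space" using J \<xi>(1) lam n by (rule measurable_gibbs_event)
  have \<Phi>_m: "\<Phi> \<in> borel_measurable conf_space"
   unfolding \<Phi>_def using E_m GB.H_measurable by measurable
  have conf_lower: "ennreal \<phi> \<le> \<Phi> (BL.config \<zeta> eta)"
   if \<zeta>: "\<zeta> \<in> G" and F: "F \<subseteq> Ir \<times> grid q" "card F = n - C \<zeta>" and eta: "eta \<in> one_each BL.small F" for \<zeta> F eta
  proof -
   have finF: "finite F"
    using F(1) BL.finite_Ir finite_grid by (meson finite_SigmaI finite_subset)
   note lf\<zeta> = lf[OF \<zeta>]
   have cF: "real (card F) \<le> 5 * \<rho> * real n" using cnt[OF \<zeta>] F by simp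
   have "num_points (BL.config \<zeta> eta) UNIV = of_nat (C \<zeta> + card F)"
    unfolding C_def by (rule BL.num_points_config[OF _ finF F(1) eta]) (rule lf\<zeta>)
   moreover have "C \<zeta> + card F = n" using cnt(1)[OF \<zeta>] F(2) by simp
   ultimately have np: "num_points (BL.config \<zeta> eta) UNIV = of_nat n" by metis
   then have "BL.config \<zeta> eta \<in> locally_finite_sets"
    by (intro finite_locally_finite) (auto simp: num_points_def emeasure_count_space split: if_splits)
   moreover have "mean_score lam (\<xi> j) n (BL.config \<zeta> eta) < a j" if j: "j \<in> J" for j
   proof -
    have "mean_score lam (\<xi> j) n (BL.config \<zeta> eta) \<le>
     ((\<Sum>w\<in>Ib. free_score (\<xi> j) ?B (\<zeta> w)) + real (card F) * M ((2 * A + 1) ^ ?d)) / real n"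
     by (rule BL.config_mean_score[OF \<xi>(3,5)[OF j] _ finF F(1) eta Aq]) (rule lf\<zeta>)
    also have "... \<le> (real n / lam * (x j + 4 * \<rho> * \<bar>x j\<bar> + \<rho> * lam) + 5 * \<rho> * real n * Mb) / real n"
    proof (intro divide_right_mono add_mono)
     show "(\<Sum>w\<in>Ib. free_score (\<xi> j) ?B (\<zeta> w)) \<le> real n / lam * (x j + 4 * \<rho> * \<bar>x j\<bar> + \<rho> * lam)"
      using \<xi>E[OF j] j by (intro block[OF \<zeta>]) (auto simp: K_def f_def w_def)
     show "real (card F) * M ((2 * A + 1) ^ ?d) \<le> 5 * \<rho> * real n * Mb"
      using cF \<rho> \<xi>(5)[OF j] by (intro mult_mono') (auto simp: Mb_def cardinality_bounded_fun_def less_imp_le)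
    qed simp
    also have "... = (x j + \<rho> * Y j) / lam" using n lam by (simp add: Y_def field_simps)
    also have "... < a j" using \<rho>Y[OF j] lam by (simp add: field_simps)
    finally show ?thesis .
   qed
   moreover have "energy lam V n (BL.config \<zeta> eta) \<le> real n / lam * (v + 4 * \<rho> * \<bar>v\<bar> + \<rho> * lam + 5 * c * \<rho> * lam)"
   proof -
    have "energy lam V n (BL.config \<zeta> eta) \<le> (\<Sum>w\<in>Ib. free_score V ?B (\<zeta> w)) + real (card F) * c"
     by (rule BL.config_energy[OF V(2) Vb _ finF F(1) eta]) (use lf\<zeta> in auto)
    also have "... \<le> real n / lam * (v + 4 * \<rho> * \<bar>v\<bar> + \<rho> * lam) + 5 * \<rho> * real n * c"
    proof (intro add_mono mult_right_mono cF)
     show "(\<Sum>w\<in>Ib. free_score V ?B (\<zeta> w)) \<le> real n / lam * (v + 4 * \<rho> * \<bar>v\<bar> + \<rho> * lam)"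
      using VE by (intro block[OF \<zeta>]) (auto simp: K_def f_def w_def)
    qed (use c in simp)
    also have "... = real n / lam * (v + 4 * \<rho> * \<bar>v\<bar> + \<rho> * lam + 5 * c * \<rho> * lam)" using lam by (simp add: field_simps)
    finally show ?thesis .
   qed
   ultimately show ?thesis using np by (simp add: \<Phi>_def \<phi>_def)
  qed
  have "ennreal (\<phi> * ((lam * \<sigma>) ^ K' * exp (- lam * measure lborel (BL.W - BL.U))) * measure ?N G) \<le> (\<integral>\<^sup>+om. \<Phi> om \<partial>ppp lam BL.W)"
   unfolding \<sigma>_def
  proof (rule BL.poisson_lower[where Kf="\<lambda>\<zeta>. n - C \<zeta>"])
   show "\<Phi> \<in> borel_measurable conf_space" by (rule \<Phi>_m)
   show "G \<in> sets ?N" using Gs sMN by simp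
   show "0 \<le> \<phi>" by (simp add: \<phi>_def)
   show "lam * (s / (2 * real q)) ^ ?d \<le> 1" using \<sigma>(1) by (simp add: \<sigma>_def)
   show "n - C \<zeta> \<le> card (Ir \<times> (grid q :: ('d \<Rightarrow> nat) set)) \<and> n - C \<zeta> \<le> K'" if "\<zeta> \<in> G" for \<zeta>
    using cnt(2)[OF that] cap unfolding K'_def by (simp add: le_nat_floor)
  qed (rule conf_lower)
  also have "... \<le> (\<integral>\<^sup>+om. \<Phi> om \<partial>binomial_process lam n)"
   unfolding binomial_process_def
   by (rule positive_volume.nn_integral_ppp_le[OF positive_volume_window[OF lam n] \<Phi>_m]) (simp add: \<Phi>_def)
  also have "... \<le> (\<integral>\<^sup>+om. indicator ?E om * ennreal (exp (- energy lam V n om)) \<partial>binomial_process lam n)"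
   unfolding \<Phi>_def by (intro nn_integral_mono) (auto split: split_indicator)
  finally have main: "ennreal (\<phi> * ((lam * \<sigma>) ^ K' * exp (- lam * measure lborel (BL.W - BL.U))) * measure ?N G) \<le> ..." .
  have NBn: "NB * w \<le> real n / lam"
  proof -
   have "\<beta> * (real n / lam) \<le> 1 * (real n / lam)" using \<beta> \<rho> lam by (intro mult_right_mono) auto
   then show ?thesis using NBw by simp
  qed
  \<comment> \<open>Cost of the reserve points: at most \<open>5 * \<rho> * n\<close> of them, each
    at \<open>C1\<close>.\<close>
  have t1: "exp (- (5 * \<rho> * real n * C1)) \<le> (lam * \<sigma>) ^ K'"
  proof -
   have "exp (- (5 * \<rho> * real n * C1)) \<le> exp (- (real K' * C1))"
   proof -
    have "real K' \<le> 5 * \<rho> * real n" unfolding K'_def using \<rho> by (simp add: of_nat_floor)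
    then show ?thesis using C1 by (simp add: mult_right_mono)
   qed
   also have "... = exp (- C1) ^ K'" by (simp add: exp_of_nat_mult[symmetric])
   also have "exp (- C1) = 1 / (10 * 4 ^ ?d)" by (simp add: C1_def exp_minus inverse_eq_divide)
   also have "(1 / (10 * 4 ^ ?d)) ^ K' \<le> (lam * \<sigma>) ^ K'" using \<sigma>(2) by (intro power_mono) auto
   finally show ?thesis .
  qed
  \<comment> \<open>Outside the filled tiles, corridors and reserve tiles have at most a proportion
    \<open>4 * \<rho>\<close> of the volume; this is the void cost there.\<close>
  have t2: "exp (- (real n / lam * (4 * \<rho> * lam))) \<le> exp (- lam * measure lborel (BL.W - BL.U))"
  proof -
   have "measure lborel (BL.W - BL.U) = real n / lam * (1 - \<beta>)"
    unfolding BL.measure_W_minus_U NBw[unfolded NB_def w_def] by (simp only: right_diff_distrib mult_1_right mult.commute[of _ \<beta>])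
   also have "... \<le> real n / lam * (4 * \<rho>)" using \<beta> lam by (intro mult_left_mono) auto
   finally have "lam * measure lborel (BL.W - BL.U) \<le> lam * (real n / lam * (4 * \<rho>))" using lam by (intro mult_left_mono) auto
   moreover have "lam * (real n / lam * (4 * \<rho>)) = real n / lam * (4 * \<rho> * lam)" by (simp add: mult_ac)
   ultimately show ?thesis unfolding exp_le_cancel_iff by linarith
  qed
  \<comment> \<open>Cost of the blocks by change of measure: their total entropy, divided by the
    probability of \<open>G\<close> under the block law. That probability is at least
    \<open>1 - \<rho>\<close>, and \<open>1 / (1 - \<rho>) \<le> 1 + 2 * \<rho>\<close>.\<close>
  have t3: "exp (- (real n / lam * (i + \<rho> * (lam + 1) + 2 * \<rho> * (\<bar>i\<bar> + lam + 1)))) \<le> measure ?N G"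
  proof -
   define Y0 where "Y0 = NB * (w * (i + eps)) + ln 2"
   have Y0: "0 \<le> Y0" unfolding Y0_def using NB0 w wi by (simp add: add_nonneg_nonneg)
   have NBi: "NB * (w * (i + eps)) \<le> real n / lam * (i + eps)"
    using mult_right_mono[OF NBn wi] by (simp add: mult.assoc)
   have Y0le: "Y0 \<le> real n / lam * (i + eps + \<rho>)"
    using NBi elim(3) by (simp add: Y0_def distrib_left)
   have "Y0 / PM.prob G \<le> Y0 / (1 - \<rho>)" using QG \<rho> Y0 by (intro divide_left_mono mult_pos_pos) auto
   also have "... \<le> Y0 * (1 + 2 * \<rho>)"
   proof -
    have "1 \<le> (1 + 2 * \<rho>) * (1 - \<rho>)" using \<rho> by (simp add: algebra_simps)
    then have "Y0 * 1 \<le> Y0 * ((1 + 2 * \<rho>) * (1 - \<rho>))" using Y0 by (intro mult_left_mono) auto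
    then show ?thesis using \<rho> by (simp add: pos_divide_le_eq mult.assoc)
   qed
   also have "... \<le> real n / lam * (i + eps + \<rho>) * (1 + 2 * \<rho>)" using Y0le \<rho> by (intro mult_right_mono) auto
   also have "... = real n / lam * (i + eps + \<rho> + 2 * \<rho> * (i + eps + \<rho>))"
    unfolding mult.assoc by (intro arg_cong2[where f="(*)"] refl) (simp add: algebra_simps)
   also have "... \<le> real n / lam * (i + \<rho> * (lam + 1) + 2 * \<rho> * (\<bar>i\<bar> + lam + 1))"
   proof (intro mult_left_mono)
    have e: "eps \<le> \<rho> * lam" using \<rho> lam by (simp add: eps_def)
    have "\<rho> * lam \<le> 1 * lam" using \<rho> lam by (intro mult_right_mono) auto
    then have "2 * \<rho> * (i + eps + \<rho>) \<le> 2 * \<rho> * (\<bar>i\<bar> + lam + 1)" using e \<rho> by (intro mult_left_mono) auto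
    then show "i + eps + \<rho> + 2 * \<rho> * (i + eps + \<rho>) \<le> i + \<rho> * (lam + 1) + 2 * \<rho> * (\<bar>i\<bar> + lam + 1)"
     using e by (simp add: distrib_left)
   qed (use lam in simp)
   finally show ?thesis using nuG by (smt (verit) Y0_def exp_le_cancel_iff minus_divide_left)
  qed
  have "exp (- (real n / lam) * (i + v + \<delta>)) \<le> exp (- (real n / lam) * (i + v + \<rho> * Ctot))"
  proof -
   have "real n / lam * (i + v + \<rho> * Ctot) \<le> real n / lam * (i + v + \<delta>)" using \<rho>C lam by (intro mult_left_mono) auto
   then show ?thesis by simp
  qed
  also have "... = \<phi> * (exp (- (5 * \<rho> * real n * C1)) * exp (- (real n / lam * (4 * \<rho> * lam)))) *
   exp (- (real n / lam * (i + \<rho> * (lam + 1) + 2 * \<rho> * (\<bar>i\<bar> + lam + 1))))"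
   unfolding \<phi>_def exp_add[symmetric] Ctot_def using lam by (intro arg_cong[where f=exp]) (simp add: field_simps)
  also have "... \<le> \<phi> * ((lam * \<sigma>) ^ K' * exp (- lam * measure lborel (BL.W - BL.U))) * measure ?N G"
   using t1 t2 t3 by (intro mult_mono) (auto simp: \<phi>_def intro!: mult_nonneg_nonneg order_trans[OF _ t1])
  finally show ?case using main by (meson ennreal_leI order_trans)
 qed
qed

section \<open>From the weighted event to the normalised probability\<close>

context stationary_process
begin

lemma specific_entropy_nonneg:
 assumes lam: "0 < lam"
 shows "0 \<le> specific_entropy lam P"
proof (rule LIMSEQ_le_const[OF entropy_density_seq_tendsto[OF lam]], intro exI allI impI)
 fix n :: nat assume "1 \<le> n"
 then show "0 \<le> entropy_density_seq lam P n"
  unfolding entropy_density_seq_def using relative_entropy_restriction_nonneg[OF lam, of n] by simp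
qed

text \<open>Makes \<open>palm_integral P V\<close> a real number and excludes the value minus
  infinity for the scores, whose finiteness from above will follow from the constraint with
  \<open>a j\<close>.\<close>

lemma palm_integral_bounds:
 assumes lam: "0 < lam" and mass: "palm_integral P (\<lambda>_. 1) = ereal lam"
  and h: "h \<in> borel_measurable conf_space" and lb: "\<And>om. om \<in> locally_finite_sets \<Longrightarrow> c0 \<le> h om"
 shows palm_integral_lower: "ereal (c0 * lam) \<le> palm_integral P h"
  and palm_integral_upper: "(\<And>om. om \<in> locally_finite_sets \<Longrightarrow> h om \<le> c1) \<Longrightarrow> palm_integral P h < \<infinity>"
proof -
 let ?Q = "palm_measure P" and ?N = "\<integral>\<^sup>+om. ennreal (h om - c0) \<partial>palm_measure P"
 have hm: "h \<in> borel_measurable ?Q" using h by (simp add: measurable_cong_sets[OF sets_palm_measure refl])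
 have eq: "palm_integral P h = enn2ereal ?N + ereal (c0 * lam)"
  using ext_integral_shift[OF finite_palm[OF lam zero_less_one mass] hm, of c0] lb
   measure_palm[OF lam zero_less_one mass]
  by (simp add: palm_integral_def space_palm_measure)
 show "ereal (c0 * lam) \<le> palm_integral P h"
  unfolding eq using add_right_mono[OF enn2ereal_nonneg[of ?N], of "ereal (c0 * lam)"] by simp
 show "palm_integral P h < \<infinity>" if ub: "\<And>om. om \<in> locally_finite_sets \<Longrightarrow> h om \<le> c1"
 proof -
  have "?N \<le> (\<integral>\<^sup>+om. ennreal (c1 - c0) \<partial>?Q)"
   using ub by (intro nn_integral_mono ennreal_leI) (simp add: space_palm_measure)
  also have "... < \<infinity>" by (simp add: emeasure_palm[OF lam zero_less_one mass] ennreal_mult_less_top)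
  finally obtain y where "0 \<le> y" "?N = ennreal y" by (cases ?N) auto
  then show ?thesis unfolding eq by (simp add: enn2ereal_ennreal)
 qed
qed

end

text \<open>Division by the partition function: the weighted event costs \<open>i + v\<close> per
  unit volume, and the normalisation gives back at least \<open>\<alpha>\<close>, each up to
  \<open>\<delta> / 2\<close>.\<close>

lemma (in score_model) gibbs_event_log_lower:
 assumes a: "\<And>j. j \<in> J \<Longrightarrow> x j < lam * a j"
  and \<delta>: "0 < \<delta>"
  and \<alpha>: "\<forall>\<^sub>F n in sequentially. \<alpha> \<le> - ln (partition_fun lam V n) / (real n / lam) + \<delta> / 2"
 shows "\<forall>\<^sub>F n in sequentially. ereal (\<alpha> - (i + v) - \<delta>) \<le>
  ereal (1 / measure lborel (window lam n :: (real ^ 'd) set)) *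
   ext_log (measure (binomial_gibbs lam V n)
    {om \<in> space conf_space. \<forall>j\<in>J. mean_score lam (\<xi> j) n om < a j})"
proof -
 have \<delta>2: "0 < \<delta> / 2" using \<delta> by simp
 have Vb: "\<And>om. om \<in> locally_finite_sets \<Longrightarrow> \<bar>V om\<bar> \<le> c" using V(3) by (auto simp: bounded_fun_def)
 have "\<forall>\<^sub>F n in sequentially. ennreal (exp (- (real n / lam) * (i + v + \<delta> / 2))) \<le>
  (\<integral>\<^sup>+om. indicator {om \<in> space conf_space. \<forall>j\<in>J. mean_score lam (\<xi> j) n om < a j} om * ennreal (exp (- energy lam V n om))
   \<partial>binomial_process lam n)"
  using gibbs_event_lower[OF a \<delta>2] .
 then show ?thesis using \<alpha> eventually_gt_at_top[of "0::nat"]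
 proof eventually_elim
  case (elim n)
  let ?E = "{om \<in> space (conf_space :: (real^'d) set measure). \<forall>j\<in>J. mean_score lam (\<xi> j) n om < a j}"
  interpret GB: gibbs lam c n V using lam elim(3) V(1) Vb by unfold_locales auto
  let ?N = "real n / lam" and ?p = "GB.G.prob ?E"
  have N: "0 < ?N" using lam elim(3) by simp
  have E [measurable]: "?E \<in> sets conf_space" using J \<xi>(1) lam elim(3) by (rule measurable_gibbs_event)
  have "ennreal (1 / GB.Z * exp (- ?N * (i + v + \<delta> / 2))) = ennreal (1 / GB.Z) * ennreal (exp (- ?N * (i + v + \<delta> / 2)))"
   using GB.Z_pos by (intro ennreal_mult) auto
  also have "... \<le> ennreal (1 / GB.Z) * (\<integral>\<^sup>+om. indicator ?E om * ennreal (exp (- GB.H om)) \<partial>GB.\<beta>)"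
   using elim(1) by (intro mult_left_mono) auto
  also have "... = (\<integral>\<^sup>+om. ennreal (1 / GB.Z) * (indicator ?E om * ennreal (exp (- GB.H om))) \<partial>GB.\<beta>)"
   by (rule nn_integral_cmult[symmetric]) measurable
  also have "... = (\<integral>\<^sup>+om. ennreal (exp (- GB.H om) / GB.Z) * indicator ?E om \<partial>GB.\<beta>)"
   using GB.Z_pos by (intro nn_integral_cong) (auto simp: ennreal_mult'[symmetric] split: split_indicator)
  also have "... = (\<integral>\<^sup>+om. indicator ?E om \<partial>GB.G)"
   by (rule GB.nn_integral_G[symmetric]) measurable
  also have "... = ennreal ?p"
   using E by (subst nn_integral_indicator) (simp_all add: GB.sets_G GB.G.emeasure_eq_measure)
  finally have p: "1 / GB.Z * exp (- ?N * (i + v + \<delta> / 2)) \<le> ?p" by simp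
  have p0: "0 < 1 / GB.Z * exp (- ?N * (i + v + \<delta> / 2))" using GB.Z_pos by simp
  have "- ln GB.Z - ?N * (i + v + \<delta> / 2) = ln (1 / GB.Z * exp (- ?N * (i + v + \<delta> / 2)))"
   using GB.Z_pos by (simp add: ln_mult ln_div)
  also have "... \<le> ln ?p" using p p0 by (intro ln_mono) auto
  finally have "(- ln GB.Z - ?N * (i + v + \<delta> / 2)) / ?N \<le> ln ?p / ?N" using N by (intro divide_right_mono) auto
  moreover have "(- ln GB.Z - ?N * (i + v + \<delta> / 2)) / ?N = - ln GB.Z / ?N - (i + v + \<delta> / 2)"
   by (simp only: diff_divide_distrib nonzero_mult_div_cancel_left[OF less_imp_neq[OF N, symmetric]])
  ultimately have "\<alpha> - (i + v) - \<delta> \<le> ln ?p / ?N" using elim(2) by linarith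
  then show ?case
   using p p0 by (simp add: measure_window[OF lam] ext_log_def mult.commute)
 qed
qed

theorem corollary2p10:
  fixes V :: "(real ^ 'd::finite) set \<Rightarrow> real"
    and \<xi> :: "nat \<Rightarrow> (real ^ 'd) set \<Rightarrow> real"
    and a :: "nat \<Rightarrow> real" and M :: "nat \<Rightarrow> real"
    and lam r c c' :: real and J :: nat
  assumes "2 \<le> CARD('d)" and "0 < lam" and "0 < r"
    and "V \<in> borel_measurable conf_space"
    and "local_fun r V"
    and "bounded_fun c V"
    and "\<And>j. j \<in> {1..J} \<Longrightarrow> \<xi> j \<in> borel_measurable conf_space"
    and "\<And>j. j \<in> {1..J} \<Longrightarrow> bounded_below_fun c' (\<xi> j)"
    and "\<And>j. j \<in> {1..J} \<Longrightarrow> local_fun r (\<xi> j)"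
    and "\<And>j. j \<in> {1..J} \<Longrightarrow> increasing_fun (\<xi> j)"
    and "\<And>j. j \<in> {1..J} \<Longrightarrow> cardinality_bounded_fun M (\<xi> j)"
  defines "A \<equiv> Inf {specific_entropy lam P + palm_integral P V | P.
      P \<in> stationary_processes \<and> palm_integral P (\<lambda>_. 1) = ereal lam}"
  shows "liminf (\<lambda>n. ereal (1 / measure lborel (window lam n :: (real ^ 'd) set)) *
            ext_log (measure (binomial_gibbs lam V n)
              {\<omega> \<in> space conf_space. \<forall>j \<in> {1..J}. mean_score lam (\<xi> j) n \<omega> < a j}))
         \<ge> - Inf {specific_entropy lam P + palm_integral P V | P.
               P \<in> stationary_processes \<and> palm_integral P (\<lambda>_. 1) = ereal lam \<and>
               (\<forall>j \<in> {1..J}. palm_integral P (\<xi> j) < ereal (lam * a j))} + A"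
proof -
 let ?F = "\<lambda>n. ereal (1 / measure lborel (window lam n :: (real ^ 'd) set)) *
  ext_log (measure (binomial_gibbs lam V n) {om \<in> space conf_space. \<forall>j \<in> {1..J}. mean_score lam (\<xi> j) n om < a j})"
 let ?S = "{specific_entropy lam P + palm_integral P V | P.
  P \<in> stationary_processes \<and> palm_integral P (\<lambda>_. 1) = ereal lam \<and> (\<forall>j \<in> {1..J}. palm_integral P (\<xi> j) < ereal (lam * a j))}"
 note lam = \<open>0 < lam\<close> and r = \<open>0 < r\<close> and V = assms(4-6) and \<xi> = assms(7-11)
 have Vb: "\<And>om. om \<in> locally_finite_sets \<Longrightarrow> - c \<le> V om" "\<And>om. om \<in> locally_finite_sets \<Longrightarrow> V om \<le> c"
  using V(3) by (auto simp: bounded_fun_def abs_le_iff)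
 have upper: "\<forall>\<^sub>F n in sequentially. A \<le> ereal (- ln (partition_fun lam V n) / (real n / lam) + \<delta>)" if "0 < \<delta>" for \<delta>
  unfolding A_def using lam r V that by (rule partition_fun_upper)
 have fin: "0 \<le> specific_entropy lam P \<and> ereal (- c * lam) \<le> palm_integral P V \<and> palm_integral P V < \<infinity>"
  if P: "P \<in> stationary_processes" "palm_integral P (\<lambda>_. 1) = ereal lam" for P
 proof -
  interpret stationary_process P by unfold_locales (rule P(1))
  show ?thesis
   using specific_entropy_nonneg[OF lam] palm_integral_lower[OF lam P(2) V(1), of "- c"]
    palm_integral_upper[OF lam P(2) V(1), of "- c" c] Vb by blast
 qed
 \<comment> \<open>The upper bound on the partition function contains an admissible tiling, so the
   infimum is not over the empty set. Below, entropies are nonnegative and \<open>V\<close> is at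
   least \<open>- c\<close>.\<close>
 have "A < \<infinity>"
  using eventually_happens'[OF sequentially_bot upper[OF zero_less_one]] by (auto simp: less_top[symmetric] top_ereal_def)
 moreover have "ereal (- c * lam) \<le> A"
  unfolding A_def
 proof (rule Inf_greatest, clarify)
  fix P :: "(real^'d) set measure" assume P: "P \<in> stationary_processes" "palm_integral P (\<lambda>_. 1) = ereal lam"
  show "ereal (- c * lam) \<le> specific_entropy lam P + palm_integral P V"
   using fin[OF P] add_mono[of 0 "specific_entropy lam P" "ereal (- c * lam)" "palm_integral P V"] by simp
 qed
 ultimately obtain \<alpha> where \<alpha>: "A = ereal \<alpha>" by (cases A) auto
 \<comment> \<open>With the finite \<open>A\<close> moved across, it suffices to treat every
   admissible process separately; an empty constraint set is covered as well.\<close>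
 have "A - liminf ?F \<le> Inf ?S"
 proof (rule Inf_greatest, clarify)
  fix P :: "(real^'d) set measure"
  assume P: "P \<in> stationary_processes" "palm_integral P (\<lambda>_. 1) = ereal lam"
   and less: "\<forall>j\<in>{1..J}. palm_integral P (\<xi> j) < ereal (lam * a j)"
  interpret stationary_process P by unfold_locales (rule P(1))
  obtain v where v: "palm_integral P V = ereal v" using fin[OF P] by (cases "palm_integral P V") auto
  show "A - liminf ?F \<le> specific_entropy lam P + palm_integral P V"
  \<comment> \<open>A process of infinite specific entropy gives infinity on the right, so only
    finite entropy calls for the block construction.\<close>
  proof (cases "specific_entropy lam P")
   case (real i)
   have "\<exists>y. palm_integral P (\<xi> j) = ereal y" if j: "j \<in> {1..J}" for j
   proof -
    have "ereal (c' * lam) \<le> palm_integral P (\<xi> j)"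
     using \<xi>(2)[OF j] by (intro palm_integral_lower[OF lam P(2) \<xi>(1)[OF j]]) (simp add: bounded_below_fun_def)
    then show ?thesis using bspec[OF less j] by (cases "palm_integral P (\<xi> j)") auto
   qed
   then obtain x where x: "\<And>j. j \<in> {1..J} \<Longrightarrow> palm_integral P (\<xi> j) = ereal (x j)" by metis
   then have xa: "\<And>j. j \<in> {1..J} \<Longrightarrow> x j < lam * a j" using less by force
   interpret score_model P lam r c c' i v M "{1..J}" x V \<xi>
    using lam r P(2) real V v \<xi> x by unfold_locales auto
   have "ereal (\<alpha> - (i + v)) \<le> liminf ?F"
   proof (rule ereal_le_epsilon2)
    fix \<delta> :: real assume \<delta>: "0 < \<delta>"
    have "\<forall>\<^sub>F n in sequentially. \<alpha> \<le> - ln (partition_fun lam V n) / (real n / lam) + \<delta> / 2"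
     using upper[of "\<delta> / 2"] \<delta> by (simp add: \<alpha>)
    then have "\<forall>\<^sub>F n in sequentially. ereal (\<alpha> - (i + v) - \<delta>) \<le> ?F n"
     by (intro gibbs_event_log_lower xa \<delta>)
    then have "ereal (\<alpha> - (i + v) - \<delta>) \<le> liminf ?F" by (rule Liminf_bounded)
    then have "ereal (\<alpha> - (i + v) - \<delta>) + ereal \<delta> \<le> liminf ?F + ereal \<delta>" by (rule add_right_mono)
    then show "ereal (\<alpha> - (i + v)) \<le> liminf ?F + ereal \<delta>" by simp
   qed
   then show ?thesis unfolding real v \<alpha> by (cases "liminf ?F") auto
  next
   case MInf
   then show ?thesis using specific_entropy_nonneg[OF lam] by simp
  qed (simp add: v)
 qed
 then show "- Inf ?S + A \<le> liminf ?F"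
  unfolding \<alpha> by (cases "Inf ?S"; cases "liminf ?F") auto
qed

end
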